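(* Assume that for every $g\in L^2(\Omega)$ the problem $-A:D^2 v=g$ in $\Omega$, $v=0$ on $\partial\Omega$, has a unique solution $v\in V$. Let $f\in L^2(\Omega)$, let $u$ be the solution with right-hand side $f$, $\boldsymbol\sigma=\nabla u$, and assume $u\in H^{3}(\Omega)$. Let $(u_h,\boldsymbol\sigma_h)\in S_{1,0}\times S_1^d$ be the $L^2$-LSFEM solution, i.e. the minimizer of $\mathcal{J}_0(\cdot,\cdot;f)$ over $S_{1,0}\times S_1^d$. Then there exists a constant $C>0$ independent of the mesh size $h$ such that $$|||(u-u_h,\boldsymbol\sigma-\boldsymbol\sigma_h)|||_0\le C\,h\,\|u\|_{3}.$$
   Context: Setting: $d\in\{2,3\}$, $\Omega\subset\mathbb{R}^d$ is a bounded open polytope, $A=(a_{ij})\in L^\infty(\Omega)^{d\times d}$ (possibly degenerate). $A:B=\sum_{i,j}a_{ij}b_{ij}$; $D^2v$ is the Hessian; $A:\nabla\boldsymbol\tau=\sum_{i,j}a_{ij}\,\partial_j\tau_i$. $\|\cdot\|_{s}$ is the $H^s(\Omega)$ norm. $V=\{v\in H^1_0(\Omega): A:D^2v\in L^2(\Omega)\}$. Mesh: $\mathcal{T}=\{K\}$ ranges over a shape-regular family of simplicial triangulations of $\Omega$ (not necessarily quasi-uniform), $h_K=\operatorname{diam}K$, $h=\max_K h_K$. "Independent of $h$" means uniform over the family. $S_1=\{v\in H^1(\Omega): v|_K\in P_1(K)\ \forall K\in\mathcal{T}\}$, $S_{1,0}=S_1\cap H^1_0(\Omega)$. $$\mathcal{J}_0(v,\boldsymbol\tau;f)=\|f+A:\nabla\boldsymbol\tau\|_0^2+\|\boldsymbol\tau-\nabla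 v\|_0^2,\qquad |||(v,\boldsymbol\tau)|||_0^2=\|A:\nabla\boldsymbol\tau\|_0^2+\|\boldsymbol\tau-\nabla v\|_0^2 .$$ *)

theory Defs
  imports "HOL-Analysis.Analysis" "HOL-Library.Multiset"
begin

text \<open>
  The space dimension is \<open>d = CARD('n)\<close>. Elements of Lebesgue and Sobolev spaces are represented
  by functions on the whole type \<open>real ^ 'n\<close>, of which only the values almost everywhere in the
  domain \<open>\<Omega>\<close> matter.
\<close>

section \<open>Lebesgue spaces\<close>

definition L2 :: "(real ^ 'n) set \<Rightarrow> (real ^ 'n \<Rightarrow> real) set" where
  "L2 \<Omega> = {f. f \<in> borel_measurable (lebesgue_on \<Omega>) \<and>
              integrable (lebesgue_on \<Omega>) (\<lambda>x. (f x)\<^sup>2)}"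

definition L2_norm_on :: "(real ^ 'n) set \<Rightarrow> (real ^ 'n \<Rightarrow> 'b::euclidean_space) \<Rightarrow> real" where
  "L2_norm_on \<Omega> f = sqrt (LINT x|lebesgue_on \<Omega>. (norm (f x))\<^sup>2)"

definition Linf_matrix :: "(real ^ 'n) set \<Rightarrow> (real ^ 'n \<Rightarrow> real ^ 'n ^ 'n) set" where
  "Linf_matrix \<Omega> = {A. \<forall>i j. (\<lambda>x. A x $ i $ j) \<in> borel_measurable (lebesgue_on \<Omega>) \<and>
                          (\<exists>b. AE x in lebesgue_on \<Omega>. \<bar>A x $ i $ j\<bar> \<le> b)}"

definition locally_integrable :: "(real ^ 'n) set \<Rightarrow> (real ^ 'n \<Rightarrow> real) \<Rightarrow> bool" where
  "locally_integrable \<Omega> f \<longleftrightarrow>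
     (\<forall>K. compact K \<and> K \<subseteq> \<Omega> \<longrightarrow> integrable (lebesgue_on K) f)"

section \<open>Weak derivatives and Sobolev spaces\<close>

definition partial_deriv :: "'n::finite \<Rightarrow> (real ^ 'n \<Rightarrow> real) \<Rightarrow> real ^ 'n \<Rightarrow> real" where
  "partial_deriv i f x = frechet_derivative f (at x) (axis i 1)"

definition smooth :: "(real ^ 'n \<Rightarrow> real) \<Rightarrow> bool" where
  "smooth f \<longleftrightarrow> (\<forall>is. foldr partial_deriv is f differentiable_on UNIV)"

definition test_functions :: "(real ^ 'n) set \<Rightarrow> (real ^ 'n \<Rightarrow> real) set" where
  "test_functions \<Omega> =
     {\<phi>. smooth \<phi> \<and> (\<exists>K. compact K \<and> K \<subseteq> \<Omega> \<and> (\<forall>x. x \<notin> K \<longrightarrow> \<phi> x = 0))}"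

text \<open>
  A multi-index is a multiset \<open>\<alpha>\<close> of coordinate indices, with \<open>|\<alpha>| = size \<alpha>\<close>; for instance
  \<open>{#i, j#}\<close> stands for \<open>\<partial>\<^sub>i \<partial>\<^sub>j\<close>. The lists \<open>is\<close> below are its enumerations, which all give the
  same classical derivative of a smooth function.
\<close>

definition has_weak_deriv ::
  "(real ^ 'n) set \<Rightarrow> 'n::finite multiset \<Rightarrow> (real ^ 'n \<Rightarrow> real) \<Rightarrow> (real ^ 'n \<Rightarrow> real) \<Rightarrow> bool" where
  "has_weak_deriv \<Omega> \<alpha> v w \<longleftrightarrow>
     locally_integrable \<Omega> v \<and> locally_integrable \<Omega> w \<and>
     (\<forall>\<phi> \<in> test_functions \<Omega>. \<forall>is. mset is = \<alpha> \<longrightarrow>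
        (LINT x|lebesgue_on \<Omega>. v x * foldr partial_deriv is \<phi> x)
          = (-1) ^ size \<alpha> * (LINT x|lebesgue_on \<Omega>. w x * \<phi> x))"

text \<open>
  A chosen representative of the weak derivative, which is unique up to null sets if it exists.
\<close>

definition weak_deriv ::
  "(real ^ 'n) set \<Rightarrow> 'n::finite multiset \<Rightarrow> (real ^ 'n \<Rightarrow> real) \<Rightarrow> real ^ 'n \<Rightarrow> real" where
  "weak_deriv \<Omega> \<alpha> v = (SOME w. has_weak_deriv \<Omega> \<alpha> v w)"

definition weak_grad ::
  "(real ^ 'n) set \<Rightarrow> (real ^ 'n \<Rightarrow> real) \<Rightarrow> real ^ 'n \<Rightarrow> real ^ 'n" where
  "weak_grad \<Omega> v x = (\<chi> i. weak_deriv \<Omega> {#i#} v x)"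

definition weak_jacobian ::
  "(real ^ 'n) set \<Rightarrow> (real ^ 'n \<Rightarrow> real ^ 'n) \<Rightarrow> real ^ 'n \<Rightarrow> real ^ 'n ^ 'n" where
  "weak_jacobian \<Omega> \<tau> x = (\<chi> i j. weak_deriv \<Omega> {#j#} (\<lambda>y. \<tau> y $ i) x)"

definition weak_hessian ::
  "(real ^ 'n) set \<Rightarrow> (real ^ 'n \<Rightarrow> real) \<Rightarrow> real ^ 'n \<Rightarrow> real ^ 'n ^ 'n" where
  "weak_hessian \<Omega> v x = (\<chi> i j. weak_deriv \<Omega> {#i, j#} v x)"

definition Hk :: "nat \<Rightarrow> (real ^ 'n) set \<Rightarrow> (real ^ 'n \<Rightarrow> real) set" where
  "Hk k \<Omega> = {v. v \<in> L2 \<Omega> \<and>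
                (\<forall>\<alpha>. size \<alpha> \<le> k \<longrightarrow> (\<exists>w \<in> L2 \<Omega>. has_weak_deriv \<Omega> \<alpha> v w))}"

definition Hk_norm :: "nat \<Rightarrow> (real ^ 'n) set \<Rightarrow> (real ^ 'n \<Rightarrow> real) \<Rightarrow> real" where
  "Hk_norm k \<Omega> v =
     sqrt (\<Sum>\<alpha> | size \<alpha> \<le> k. (L2_norm_on \<Omega> (weak_deriv \<Omega> \<alpha> v))\<^sup>2)"

definition H1_0 :: "(real ^ 'n) set \<Rightarrow> (real ^ 'n \<Rightarrow> real) set" where
  "H1_0 \<Omega> = {v \<in> Hk 1 \<Omega>. \<forall>e>0. \<exists>\<phi> \<in> test_functions \<Omega>. Hk_norm 1 \<Omega> (\<lambda>x. v x - \<phi> x) < e}"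

section \<open>The problem in nondivergence form\<close>

definition contract :: "real ^ 'n ^ 'n \<Rightarrow> real ^ 'n ^ 'n \<Rightarrow> real" (infix "\<Zcolon>" 70) where
  "A \<Zcolon> B = (\<Sum>i\<in>UNIV. \<Sum>j\<in>UNIV. A $ i $ j * B $ i $ j)"

text \<open>
  As the coefficients are merely bounded, \<open>A : D\<^sup>2v\<close> is a pointwise product, and so the second weak
  derivatives of \<open>v\<close> have to be locally integrable functions. They need not be square integrable.
\<close>

definition V_space ::
  "(real ^ 'n) set \<Rightarrow> (real ^ 'n \<Rightarrow> real ^ 'n ^ 'n) \<Rightarrow> (real ^ 'n \<Rightarrow> real) set" where
  "V_space \<Omega> A = {v \<in> H1_0 \<Omega>. (\<forall>i j. \<exists>w. has_weak_deriv \<Omega> {#i, j#} v w) \<and>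
                              (\<lambda>x. A x \<Zcolon> weak_hessian \<Omega> v x) \<in> L2 \<Omega>}"

text \<open>The boundary condition is contained in \<open>V_space\<close>.\<close>

definition is_solution ::
  "(real ^ 'n) set \<Rightarrow> (real ^ 'n \<Rightarrow> real ^ 'n ^ 'n) \<Rightarrow> (real ^ 'n \<Rightarrow> real) \<Rightarrow>
     (real ^ 'n \<Rightarrow> real) \<Rightarrow> bool" where
  "is_solution \<Omega> A g v \<longleftrightarrow>
     v \<in> V_space \<Omega> A \<and> (AE x in lebesgue_on \<Omega>. - (A x \<Zcolon> weak_hessian \<Omega> v x) = g x)"

definition uniquely_solvable ::
  "(real ^ 'n) set \<Rightarrow> (real ^ 'n \<Rightarrow> real ^ 'n ^ 'n) \<Rightarrow> bool" where
  "uniquely_solvable \<Omega> A \<longleftrightarrow>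
     (\<forall>g \<in> L2 \<Omega>. (\<exists>v. is_solution \<Omega> A g v) \<and>
        (\<forall>v w. is_solution \<Omega> A g v \<and> is_solution \<Omega> A g w \<longrightarrow>
           (AE x in lebesgue_on \<Omega>. v x = w x)))"

section \<open>Meshes and finite element spaces\<close>

text \<open>
  Polytopal domains need not be convex (in contrast to the closed \<^const>\<open>polytope\<close>s of the library).
  The condition \<open>interior (closure \<Omega>) = \<Omega>\<close> excludes slits.
\<close>

definition open_polytope :: "(real ^ 'n) set \<Rightarrow> bool" where
  "open_polytope \<Omega> \<longleftrightarrow>
     \<Omega> \<noteq> {} \<and> open \<Omega> \<and> bounded \<Omega> \<and> interior (closure \<Omega>) = \<Omega> \<and>
     (\<exists>\<P>. finite \<P> \<and> (\<forall>P\<in>\<P>. polytope P) \<and> closure \<Omega> = \<Union>\<P>)"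

definition simplicial_mesh :: "(real ^ 'n) set \<Rightarrow> (real ^ 'n) set set \<Rightarrow> bool" where
  "simplicial_mesh \<Omega> \<T> \<longleftrightarrow>
     triangulation \<T> \<and> (\<forall>K\<in>\<T>. int CARD('n) simplex K) \<and> \<Union>\<T> = closure \<Omega>"

definition mesh_size :: "(real ^ 'n) set set \<Rightarrow> real" where
  "mesh_size \<T> = Max (diameter ` \<T>)"

text \<open>The supremum of the diameters of the balls contained in \<open>K\<close>.\<close>

definition insphere_diameter :: "(real ^ 'n) set \<Rightarrow> real" where
  "insphere_diameter K = Sup {2 * r | x r. 0 \<le> r \<and> ball x r \<subseteq> K}"

definition shape_regular :: "(real ^ 'n) set set set \<Rightarrow> bool" where
  "shape_regular \<F> \<longleftrightarrow>
     (\<exists>\<gamma>>0. \<forall>\<T>\<in>\<F>. \<forall>K\<in>\<T>. diameter K \<le> \<gamma> * insphere_diameter K)"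

definition S1 :: "(real ^ 'n) set \<Rightarrow> (real ^ 'n) set set \<Rightarrow> (real ^ 'n \<Rightarrow> real) set" where
  "S1 \<Omega> \<T> = {v \<in> Hk 1 \<Omega>. \<forall>K\<in>\<T>. \<exists>c b. AE x in lebesgue_on K. v x = c + b \<bullet> x}"

definition S1_0 :: "(real ^ 'n) set \<Rightarrow> (real ^ 'n) set set \<Rightarrow> (real ^ 'n \<Rightarrow> real) set" where
  "S1_0 \<Omega> \<T> = S1 \<Omega> \<T> \<inter> H1_0 \<Omega>"

definition S1_vec :: "(real ^ 'n) set \<Rightarrow> (real ^ 'n) set set \<Rightarrow> (real ^ 'n \<Rightarrow> real ^ 'n) set" where
  "S1_vec \<Omega> \<T> = {\<tau>. \<forall>i. (\<lambda>x. \<tau> x $ i) \<in> S1 \<Omega> \<T>}"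

section \<open>The least-squares method\<close>

definition J0 ::
  "(real ^ 'n) set \<Rightarrow> (real ^ 'n \<Rightarrow> real ^ 'n ^ 'n) \<Rightarrow> (real ^ 'n \<Rightarrow> real) \<Rightarrow>
     (real ^ 'n \<Rightarrow> real) \<Rightarrow> (real ^ 'n \<Rightarrow> real ^ 'n) \<Rightarrow> real" where
  "J0 \<Omega> A f v \<tau> =
     (L2_norm_on \<Omega> (\<lambda>x. f x + A x \<Zcolon> weak_jacobian \<Omega> \<tau> x))\<^sup>2 +
     (L2_norm_on \<Omega> (\<lambda>x. \<tau> x - weak_grad \<Omega> v x))\<^sup>2"

definition triple_norm0 ::
  "(real ^ 'n) set \<Rightarrow> (real ^ 'n \<Rightarrow> real ^ 'n ^ 'n) \<Rightarrow>
     (real ^ 'n \<Rightarrow> real) \<Rightarrow> (real ^ 'n \<Rightarrow> real ^ 'n) \<Rightarrow> real" where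
  "triple_norm0 \<Omega> A v \<tau> =
     sqrt ((L2_norm_on \<Omega> (\<lambda>x. A x \<Zcolon> weak_jacobian \<Omega> \<tau> x))\<^sup>2 +
           (L2_norm_on \<Omega> (\<lambda>x. \<tau> x - weak_grad \<Omega> v x))\<^sup>2)"

definition L2_LSFEM_solution ::
  "(real ^ 'n) set \<Rightarrow> (real ^ 'n \<Rightarrow> real ^ 'n ^ 'n) \<Rightarrow> (real ^ 'n) set set \<Rightarrow>
     (real ^ 'n \<Rightarrow> real) \<Rightarrow> (real ^ 'n \<Rightarrow> real) \<Rightarrow> (real ^ 'n \<Rightarrow> real ^ 'n) \<Rightarrow> bool" where
  "L2_LSFEM_solution \<Omega> A \<T> f u\<^sub>h \<sigma>\<^sub>h \<longleftrightarrow>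
     is_arg_min (\<lambda>(v, \<tau>). J0 \<Omega> A f v \<tau>) (\<lambda>p. p \<in> S1_0 \<Omega> \<T> \<times> S1_vec \<Omega> \<T>) (u\<^sub>h, \<sigma>\<^sub>h)"

end

theory Submission
  imports Defs "HOL-Computational_Algebra.Polynomial"
begin

text \<open>
  Minimality bounds the error by \<open>J0\<close> at the nodal interpolants of \<open>u\<close> and of each \<open>\<partial>\<^sub>i u\<close>, because
  the squared error equals \<open>J0\<close> at the discrete solution. On a simplex \<open>K\<close>, a function \<open>v\<close> in \<open>H\<^sup>2\<close>
  is mollified along dilations towards an interior cube, and Taylor's formula shows that \<open>v\<close> has a
  continuous representative on \<open>K\<close> for which
  \<open>v(a) - v + \<nabla>v \<bullet> (x - a)\<close> is of size \<open>diam(K)\<^sup>2\<close> times the second derivatives in \<open>L\<^sup>2(K)\<close>. Barycentric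
  averaging over the vertices \<open>a\<close> bounds the interpolation error, and a ball contained in \<open>K\<close> turns
  this into a bound for the gradient. Since the interpolants are glued only along points of \<open>\<Omega>\<close>, one
  needs that a face meeting \<open>\<Omega>\<close> has its relative interior in \<open>\<Omega>\<close>. For the boundary condition, \<open>\<nabla>u\<close> is
  bounded, so the extension of \<open>u\<close> by zero is Lipschitz; hence \<open>u\<close> and its interpolant vanish on
  the boundary, and a truncation near zero followed by mollification puts the interpolant into
  \<open>H\<^sup>1\<^sub>0\<close>.
\<close>

section \<open>Smooth functions and test functions\<close>

text \<open>The rate is first order because grad u is only in H^2: the gradients of the interpolants
  of its components converge to D^2 u with one power of h, and this is where three derivatives of u
  are spent.

  Weak derivatives are known only inside a simplex, whereas values are wanted at its vertices.
  Taylor's formula is therefore applied to the mollification kernel, whose derivatives fall on v by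
  the definition of weak derivatives. All constants stay explicit, so that among the data of the
  mesh only the shape-regularity constant enters them.

  A domain that equals the interior of its closure may still touch itself at a vertex or an edge.
  The components of grad u carry no boundary condition and may have different limits there, so
  continuity of the interpolants can be claimed only inside the domain.

  The boundary condition is given as membership in a closure of test functions. It is converted into
  pointwise values for u, and back into such a membership for the interpolant.\<close>

lemma partial_deriv_eqI:
  assumes "(f has_derivative f') (at x)"
  shows "partial_deriv i f x = f' (axis i 1)"
  using frechet_derivative_at[OF assms] by (simp add: partial_deriv_def)

text \<open>The definition of \<open>smooth\<close> speaks of all iterated partial derivatives. A
  class of differentiable functions that is closed under single partial derivatives contains all
  these iterates, so exhibiting such a class replaces computing them.\<close>

lemma smooth_coinduct:
  assumes "f \<in> C"
    and "\<And>g. g \<in> C \<Longrightarrow> g differentiable_on UNIV"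
    and "\<And>g i. g \<in> C \<Longrightarrow> partial_deriv i g \<in> C"
  shows "smooth f"
proof -
  have "foldr partial_deriv is f \<in> C" for "is"
    by (induction "is") (auto intro: assms)
  then show ?thesis
    unfolding smooth_def using assms(2) by blast
qed

lemma smooth_differentiable: "smooth f \<Longrightarrow> f differentiable (at x)"
  unfolding smooth_def differentiable_on_def by (metis foldr.simps(1) UNIV_I id_apply)

lemma smooth_foldr: "smooth f \<Longrightarrow> smooth (foldr partial_deriv is f)"
  unfolding smooth_def by (metis foldr_append)

lemma smooth_partial_deriv: "smooth f \<Longrightarrow> smooth (partial_deriv i f)"
  using smooth_foldr[of f "[i]"] by simp

lemma smooth_continuous: "smooth f \<Longrightarrow> continuous_on S f"
  by (meson continuous_at_imp_continuous_on differentiable_imp_continuous_within smooth_differentiable)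

lemma smooth_borel: "smooth f \<Longrightarrow> f \<in> borel_measurable borel"
  by (simp add: borel_measurable_continuous_onI smooth_continuous)

lemma sum_axis: "(\<Sum>j\<in>UNIV. axis i (c::real) $ j * g j) = c * g i"
proof -
  have "(\<Sum>j\<in>UNIV. axis i c $ j * g j) = (\<Sum>j\<in>UNIV. if j = i then c * g j else 0)"
    by (rule sum.cong) (auto simp: axis_def)
  then show ?thesis by simp
qed

lemma scaleR_axis: "c *\<^sub>R axis i (1::real) = axis i c"
  by (simp add: vec_eq_iff axis_def)

lemma has_derivative_partial:
  fixes f :: "real ^ 'n \<Rightarrow> real"
  assumes "f differentiable (at x)"
  shows "(f has_derivative (\<lambda>h. \<Sum>i\<in>UNIV. h $ i * partial_deriv i f x)) (at x)"
proof -
  from assms obtain f' where f': "(f has_derivative f') (at x)"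
    unfolding differentiable_def by blast
  interpret bounded_linear f' using f' by (rule has_derivative_bounded_linear)
  have "f' h = (\<Sum>i\<in>UNIV. h $ i * partial_deriv i f x)" for h
  proof -
    have "f' h = f' (\<Sum>i\<in>UNIV. h $ i *\<^sub>R axis i 1)"
      by (metis basis_expansion scalar_mult_eq_scaleR)
    then show ?thesis
      by (simp add: sum scaleR partial_deriv_eqI[OF f'])
  qed
  then have "f' = (\<lambda>h. \<Sum>i\<in>UNIV. h $ i * partial_deriv i f x)" by blast
  with f' show ?thesis by simp
qed

lemmas smooth_has_derivative = has_derivative_partial[OF smooth_differentiable]

lemma smooth_line_derivative:
  fixes f :: "real ^ 'n \<Rightarrow> real"
  assumes f: "smooth f" and g: "(g has_vector_derivative g') (at t)"
  shows "((\<lambda>t. f (g t)) has_real_derivative (\<Sum>i\<in>UNIV. g' $ i * partial_deriv i f (g t))) (at t)"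
proof -
  have "((\<lambda>t. f (g t)) has_derivative (\<lambda>h. \<Sum>i\<in>UNIV. (h *\<^sub>R g') $ i * partial_deriv i f (g t))) (at t)"
    using has_derivative_compose[OF g[unfolded has_vector_derivative_def] smooth_has_derivative[OF f]] by simp
  moreover have "(\<lambda>h. \<Sum>i\<in>UNIV. (h *\<^sub>R g') $ i * partial_deriv i f (g t))
      = (*) (\<Sum>i\<in>UNIV. g' $ i * partial_deriv i f (g t))"
    by (rule ext) (simp add: sum_distrib_left sum_distrib_right ac_simps)
  ultimately show ?thesis
    by (simp only: has_field_derivative_def)
qed

lemma partial_deriv_line:
  fixes f :: "real ^ 'n \<Rightarrow> real"
  assumes "smooth f"
  shows "((\<lambda>t. f (x + t *\<^sub>R axis i 1)) has_real_derivative partial_deriv i f (x + t *\<^sub>R axis i 1)) (at t)"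
proof -
  have "((\<lambda>t. x + t *\<^sub>R axis i (1::real)) has_vector_derivative (axis i 1)) (at t)"
    by (auto intro!: derivative_eq_intros)
  from smooth_line_derivative[OF assms this] show ?thesis
    by (simp add: sum_axis)
qed

text \<open>A partial derivative of a product is a sum of products, so products alone are not closed
  under differentiation. The generated ring is, and it serves as the class in
  \<open>smooth_coinduct\<close>.\<close>

inductive_set smooth_ring :: "(real ^ 'n \<Rightarrow> real) set" where
  base: "smooth f \<Longrightarrow> f \<in> smooth_ring"
| const: "(\<lambda>x. c) \<in> smooth_ring"
| add: "f \<in> smooth_ring \<Longrightarrow> g \<in> smooth_ring \<Longrightarrow> (\<lambda>x. f x + g x) \<in> smooth_ring"
| mult: "f \<in> smooth_ring \<Longrightarrow> g \<in> smooth_ring \<Longrightarrow> (\<lambda>x. f x * g x) \<in> smooth_ring"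

lemma smooth_ring_differentiable:
  "f \<in> smooth_ring \<Longrightarrow> f differentiable (at x) \<and> partial_deriv i f \<in> smooth_ring"
proof (induction arbitrary: x rule: smooth_ring.induct)
  case (base f)
  then show ?case
    by (auto intro: smooth_ring.base smooth_differentiable smooth_partial_deriv)
next
  case (const c)
  have "partial_deriv i (\<lambda>x. c) = (\<lambda>x. 0)"
    by (rule ext) (rule partial_deriv_eqI, rule has_derivative_const)
  then show ?case by (auto intro: smooth_ring.const)
next
  case (add f g)
  have "partial_deriv i (\<lambda>x. f x + g x) = (\<lambda>x. partial_deriv i f x + partial_deriv i g x)"
  proof
    fix x
    have "(f has_derivative frechet_derivative f (at x)) (at x)"
      "(g has_derivative frechet_derivative g (at x)) (at x)"
      using add.IH frechet_derivative_works by blast+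
    from partial_deriv_eqI[OF has_derivative_add[OF this]]
    show "partial_deriv i (\<lambda>x. f x + g x) x = partial_deriv i f x + partial_deriv i g x"
      by (simp add: partial_deriv_def)
  qed
  then show ?case using add by (auto intro: smooth_ring.add)
next
  case (mult f g)
  have "partial_deriv i (\<lambda>x. f x * g x) = (\<lambda>x. f x * partial_deriv i g x + partial_deriv i f x * g x)"
  proof
    fix x
    have "(f has_derivative frechet_derivative f (at x)) (at x)"
      "(g has_derivative frechet_derivative g (at x)) (at x)"
      using mult.IH frechet_derivative_works by blast+
    from partial_deriv_eqI[OF has_derivative_mult[OF this]]
    show "partial_deriv i (\<lambda>x. f x * g x) x = f x * partial_deriv i g x + partial_deriv i f x * g x"
      by (simp add: partial_deriv_def)
  qed
  then show ?case
    using mult by (auto intro!: smooth_ring.add intro: smooth_ring.mult)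
qed

lemma smooth_ring_smooth: "f \<in> smooth_ring \<Longrightarrow> smooth f"
  by (rule smooth_coinduct[of _ smooth_ring])
    (use smooth_ring_differentiable in \<open>auto simp: differentiable_on_def\<close>)

lemma smooth_const: "smooth (\<lambda>x. c)"
  and smooth_add: "smooth f \<Longrightarrow> smooth g \<Longrightarrow> smooth (\<lambda>x. f x + g x)"
  and smooth_mult: "smooth f \<Longrightarrow> smooth g \<Longrightarrow> smooth (\<lambda>x. f x * g x)"
  using smooth_ring_smooth[OF smooth_ring.const]
    smooth_ring_smooth[OF smooth_ring.add[OF smooth_ring.base smooth_ring.base]]
    smooth_ring_smooth[OF smooth_ring.mult[OF smooth_ring.base smooth_ring.base]] by blast+

lemma smooth_prod: "(\<And>i. i \<in> I \<Longrightarrow> smooth (f i)) \<Longrightarrow> smooth (\<lambda>x. \<Prod>i\<in>I. f i x)"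
  by (induction I rule: infinite_finite_induct) (simp_all add: smooth_const smooth_mult)

lemma partial_deriv_mult:
  fixes f g :: "real ^ 'n \<Rightarrow> real"
  assumes "smooth f" "smooth g"
  shows "partial_deriv i (\<lambda>x. f x * g x) x = f x * partial_deriv i g x + partial_deriv i f x * g x"
proof -
  have "(f has_derivative frechet_derivative f (at x)) (at x)"
    "(g has_derivative frechet_derivative g (at x)) (at x)"
    using assms smooth_differentiable frechet_derivative_works by blast+
  from partial_deriv_eqI[OF has_derivative_mult[OF this]]
  show ?thesis by (simp add: partial_deriv_def)
qed

lemma partial_deriv_affine:
  fixes g :: "real ^ 'n \<Rightarrow> real"
  assumes "smooth g"
  shows "((\<lambda>x. d * g (c *\<^sub>R x + p)) has_derivative
      (\<lambda>h. d * (\<Sum>i\<in>UNIV. (c *\<^sub>R h) $ i * partial_deriv i g (c *\<^sub>R x + p)))) (at x)"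
    and "partial_deriv i (\<lambda>x. d * g (c *\<^sub>R x + p)) x = d * c * partial_deriv i g (c *\<^sub>R x + p)"
proof -
  have "((\<lambda>x. c *\<^sub>R x + p) has_derivative (\<lambda>h. c *\<^sub>R h)) (at x)"
    by (auto intro!: derivative_eq_intros)
  from has_derivative_mult_right[OF has_derivative_compose[OF this smooth_has_derivative[OF assms]], of d]
  show *: "((\<lambda>x. d * g (c *\<^sub>R x + p)) has_derivative
      (\<lambda>h. d * (\<Sum>i\<in>UNIV. (c *\<^sub>R h) $ i * partial_deriv i g (c *\<^sub>R x + p)))) (at x)" by simp
  show "partial_deriv i (\<lambda>x. d * g (c *\<^sub>R x + p)) x = d * c * partial_deriv i g (c *\<^sub>R x + p)"
    unfolding partial_deriv_eqI[OF *]
    by (simp only: scaleR_axis sum_axis mult.assoc)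
qed

lemma smooth_affine:
  fixes g :: "real ^ 'n \<Rightarrow> real"
  assumes "smooth g"
  shows "smooth (\<lambda>x. d * g (c *\<^sub>R x + p))"
\<comment> \<open>The outer factor \<open>d\<close> varies over the class, because each
  differentiation multiplies it by \<open>c\<close>.\<close>
proof (rule smooth_coinduct[of _ "{\<lambda>x. d * g (c *\<^sub>R x + p) | d g. smooth g}"])
  show "(\<lambda>x. d * g (c *\<^sub>R x + p)) \<in> {\<lambda>x. d * g (c *\<^sub>R x + p) |d g. smooth g}"
    using assms by blast
next
  fix f :: "real ^ 'n \<Rightarrow> real" assume "f \<in> {\<lambda>x. d * g (c *\<^sub>R x + p) | d g. smooth g}"
  then obtain d g where g: "smooth g" and f: "f = (\<lambda>x. d * g (c *\<^sub>R x + p))" by blast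
  show "f differentiable_on UNIV"
    unfolding f differentiable_on_def using partial_deriv_affine(1)[OF g]
    by (meson differentiableI differentiable_at_withinI)
  fix i
  have "partial_deriv i f = (\<lambda>x. (d * c) * partial_deriv i g (c *\<^sub>R x + p))"
    unfolding f by (rule ext) (rule partial_deriv_affine(2)[OF g])
  then show "partial_deriv i f \<in> {\<lambda>x. d * g (c *\<^sub>R x + p) | d g. smooth g}"
    using smooth_partial_deriv[OF g] by blast
qed

section \<open>Smooth functions that are flat at the origin\<close>

definition flat :: "real poly \<Rightarrow> real \<Rightarrow> real" where
  "flat P t = (if t > 0 then poly P (1 / t) * exp (- (1 / t)) else 0)"

lemma poly_times_exp_tendsto_0: "((\<lambda>s::real. poly P s * exp (- s)) \<longlongrightarrow> 0) at_top"
proof -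
  have "((\<lambda>s. \<Sum>i\<le>degree P. coeff P i * (s ^ i / exp s)) \<longlongrightarrow> (\<Sum>i\<le>degree P. coeff P i * 0)) at_top"
    by (intro tendsto_intros tendsto_power_div_exp_0)
  then show ?thesis
    by (simp add: poly_altdef sum_divide_distrib exp_minus divide_inverse sum_distrib_right mult.assoc)
qed

text \<open>With s = 1/t, differentiating P(s) exp(-s) in t gives s^2 (P - P')(s) exp(-s), so the
  polynomial parameter keeps the family closed under derivatives. At the origin the right difference
  quotient is s P(s) exp(-s), which decays as s grows.\<close>

lemma flat_has_derivative:
  "(flat P has_real_derivative flat ([:0, 0, 1:] * (P - pderiv P)) t) (at t)"
proof -
  consider "t > 0" | "t < 0" | "t = 0" by linarith
  then show ?thesis
  proof cases
    case 1
    have inv: "((\<lambda>t. 1 / t) has_real_derivative - (1 / t\<^sup>2)) (at t)"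
      using 1 DERIV_inverse[of t] by (simp add: inverse_eq_divide power2_eq_square numeral_2_eq_2)
    have "((\<lambda>t. poly P (1 / t)) has_real_derivative poly (pderiv P) (1 / t) * (- (1 / t\<^sup>2))) (at t)"
      by (rule DERIV_chain2[OF poly_DERIV inv])
    moreover have "((\<lambda>t. exp (- (1 / t))) has_real_derivative exp (- (1 / t)) * (1 / t\<^sup>2)) (at t)"
      using DERIV_chain2[OF DERIV_exp DERIV_minus[OF inv]] by simp
    ultimately have "((\<lambda>t. poly P (1 / t) * exp (- (1 / t))) has_real_derivative
        (poly (pderiv P) (1 / t) * (- (1 / t\<^sup>2))) * exp (- (1 / t)) + exp (- (1 / t)) * (1 / t\<^sup>2) * poly P (1 / t)) (at t)"
      by (rule DERIV_mult)
    then have "(flat P has_real_derivative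
        (poly (pderiv P) (1 / t) * (- (1 / t\<^sup>2))) * exp (- (1 / t)) + exp (- (1 / t)) * (1 / t\<^sup>2) * poly P (1 / t)) (at t)"
      by (rule has_field_derivative_transform_within_open[of _ _ _ "{0<..}"])
        (use 1 in \<open>auto simp: flat_def\<close>)
    then show ?thesis using 1
      by (simp add: flat_def algebra_simps power2_eq_square)
  next
    case 2
    have "((\<lambda>x. 0::real) has_real_derivative 0) (at t)" by simp
    then have "(flat P has_real_derivative 0) (at t)"
      by (rule has_field_derivative_transform_within_open[of _ _ _ "{..<0}"])
        (use 2 in \<open>auto simp: flat_def\<close>)
    then show ?thesis using 2 by (simp add: flat_def)
  next
    case 3
    have "((\<lambda>s::real. poly ([:0, 1:] * P) s * exp (- s)) \<longlongrightarrow> 0) at_top"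
      by (rule poly_times_exp_tendsto_0)
    then have "((\<lambda>h. poly ([:0, 1:] * P) (inverse h) * exp (- (inverse h))) \<longlongrightarrow> 0) (at_right 0)"
      by (rule filterlim_compose[OF _ filterlim_inverse_at_top_right])
    then have "((\<lambda>h. flat P h / h) \<longlongrightarrow> 0) (at_right 0)"
      by (rule Lim_transform_eventually)
        (auto simp: eventually_at_filter flat_def field_simps intro!: always_eventually)
    moreover have "((\<lambda>h. flat P h / h) \<longlongrightarrow> 0) (at_left 0)"
      by (rule Lim_transform_eventually[OF tendsto_const])
        (auto simp: eventually_at_filter flat_def intro!: always_eventually)
    ultimately have "((\<lambda>h. flat P h / h) \<longlongrightarrow> 0) (at 0)"
      by (simp add: filterlim_split_at)
    then show ?thesis
      using 3 by (simp add: DERIV_def flat_def)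
  qed
qed

lemma smooth_flat:
  fixes i :: "'n::finite"
  shows "smooth (\<lambda>x::real ^ 'n. flat P (a * x $ i + b))"
proof (rule smooth_coinduct[of _ "{\<lambda>x::real ^ 'n. c * flat P (a * x $ i + b) | c P. True}"])
  show "(\<lambda>x::real ^ 'n. flat P (a * x $ i + b)) \<in> {\<lambda>x. c * flat P (a * x $ i + b) |c P. True}"
    by (auto intro!: exI[of _ 1] exI[of _ P])
next
  fix f :: "real ^ 'n \<Rightarrow> real" assume "f \<in> {\<lambda>x. c * flat P (a * x $ i + b) | c P. True}"
  then obtain c P where f: "f = (\<lambda>x. c * flat P (a * x $ i + b))" by blast
  let ?Q = "[:0, 0, 1:] * (P - pderiv P)"
  have d: "(f has_derivative (\<lambda>h. c * (flat ?Q (a * x $ i + b) * (a * h $ i)))) (at x)" for x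
  proof -
    have "((\<lambda>x. a * x $ i + b) has_derivative (\<lambda>h. a * h $ i)) (at x)"
      using has_derivative_add[OF has_derivative_mult_right[OF
          bounded_linear_imp_has_derivative[OF bounded_linear_vec_nth[of i]], of a] has_derivative_const[of b]]
      by simp
    from has_derivative_mult_right[OF has_derivative_compose[OF this flat_has_derivative[unfolded has_field_derivative_def]], of c P]
    show ?thesis unfolding f by simp
  qed
  show "f differentiable_on UNIV"
    unfolding differentiable_on_def using d by (meson differentiableI differentiable_at_withinI)
  fix j
  have "partial_deriv j f = (\<lambda>x. (c * a * axis j 1 $ i) * flat ?Q (a * x $ i + b))"
    using partial_deriv_eqI[OF d] by (auto simp: algebra_simps)
  then show "partial_deriv j f \<in> {\<lambda>x. c * flat P (a * x $ i + b) | c P. True}" by blast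
qed

section \<open>Test functions\<close>

lemma test_functions_smooth: "\<phi> \<in> test_functions \<Omega> \<Longrightarrow> smooth \<phi>"
  by (simp add: test_functions_def)

lemma partial_deriv_zero_outside:
  fixes \<phi> :: "real ^ 'n \<Rightarrow> real"
  assumes "closed K" "\<And>x. x \<notin> K \<Longrightarrow> \<phi> x = 0" "x \<notin> K"
  shows "partial_deriv i \<phi> x = 0"
proof -
  have "((\<lambda>x. 0) has_derivative (\<lambda>h. 0)) (at x)" by simp
  then have "(\<phi> has_derivative (\<lambda>h. 0)) (at x)"
    by (rule has_derivative_transform_within_open[of _ _ _ _ "- K"])
      (use assms in auto)
  then show ?thesis by (rule partial_deriv_eqI)
qed

lemma test_functions_partial_deriv:
  assumes "\<phi> \<in> test_functions \<Omega>"
  shows "partial_deriv i \<phi> \<in> test_functions \<Omega>"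
proof -
  obtain K where K: "compact K" "K \<subseteq> \<Omega>" "\<And>x. x \<notin> K \<Longrightarrow> \<phi> x = 0"
    using assms unfolding test_functions_def by blast
  have "\<forall>x. x \<notin> K \<longrightarrow> partial_deriv i \<phi> x = 0"
    using partial_deriv_zero_outside[OF compact_imp_closed[OF K(1)], of \<phi>] K(3) by blast
  then show ?thesis
    using K smooth_partial_deriv[OF test_functions_smooth[OF assms]]
    unfolding test_functions_def by blast
qed

lemma test_functions_foldr:
  "\<phi> \<in> test_functions \<Omega> \<Longrightarrow> foldr partial_deriv is \<phi> \<in> test_functions \<Omega>"
  by (induction "is") (auto intro: test_functions_partial_deriv)

lemma test_functions_support:
  assumes "\<phi> \<in> test_functions \<Omega>"
  obtains K where "compact K" "K \<subseteq> \<Omega>" "\<And>x. x \<notin> K \<Longrightarrow> \<phi> x = 0"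
  using assms unfolding test_functions_def by blast

lemma test_functionsI:
  "smooth \<phi> \<Longrightarrow> compact K \<Longrightarrow> K \<subseteq> \<Omega> \<Longrightarrow> (\<And>x. x \<notin> K \<Longrightarrow> \<phi> x = 0) \<Longrightarrow> \<phi> \<in> test_functions \<Omega>"
  unfolding test_functions_def by blast

lemma test_functions_bounded:
  assumes "\<phi> \<in> test_functions \<Omega>"
  obtains B where "B \<ge> 0" "\<And>x. \<bar>\<phi> x\<bar> \<le> B"
proof -
  obtain K where K: "compact K" "\<And>x. x \<notin> K \<Longrightarrow> \<phi> x = 0"
    using test_functions_support[OF assms] by metis
  have "bounded (\<phi> ` K)"
    using K(1) smooth_continuous[OF test_functions_smooth[OF assms]]
    by (simp add: compact_imp_bounded compact_continuous_image)
  then obtain B where B: "\<forall>x\<in>K. \<bar>\<phi> x\<bar> \<le> B" by (auto simp: bounded_iff)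
  have "\<bar>\<phi> x\<bar> \<le> max B 0" for x
    using B K(2) by (cases "x \<in> K") force+
  then show ?thesis using that[of "max B 0"] by auto
qed

section \<open>Integration by parts and weak derivatives\<close>

lemma lborel_integral_translate:
  fixes F :: "'a::euclidean_space \<Rightarrow> real"
  assumes "F \<in> borel_measurable borel"
  shows "(LINT x|lborel. F (x + c)) = (LINT x|lborel. F x)"
proof -
  have "(LINT x|lborel. F x) = integral\<^sup>L (distr lborel borel ((+) c)) F"
    by (simp add: lborel_distr_plus)
  also have "\<dots> = (LINT x|lborel. F (c + x))"
    using assms by (subst integral_distr) simp_all
  finally show ?thesis by (simp add: add.commute)
qed

lemma integrable_bounded_support:
  fixes F :: "'a::euclidean_space \<Rightarrow> real"
  assumes "F \<in> borel_measurable borel" "bounded L" "\<And>x. x \<notin> L \<Longrightarrow> F x = 0" "\<And>x. \<bar>F x\<bar> \<le> B"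
  shows "integrable lborel F"
proof -
  obtain R where R: "L \<subseteq> ball 0 R" using bounded_subset_ballD[OF assms(2), of 0] by auto
  have "emeasure lborel (ball (0::'a) R) < \<infinity>" by (rule emeasure_lborel_ball_finite)
  moreover have "x \<notin> ball 0 R \<Longrightarrow> F x = 0" for x using R assms(3) by blast
  ultimately show ?thesis
    using assms(1,4) by (intro integrableI_bounded_set[of "ball 0 R" _ _ B]) simp_all
qed

text \<open>Difference quotients in the direction \<open>e\<close> have integral zero by translation
  invariance. The Lipschitz bound dominates them by \<open>M\<close> on a fixed ball, so dominated
  convergence passes the vanishing integral on to the derivative. As the derivative is required only
  almost everywhere, piecewise affine functions are covered.\<close>

lemma integral_directional_derivative_eq_0:
  fixes F F' :: "'a::euclidean_space \<Rightarrow> real"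
  assumes F: "F \<in> borel_measurable borel" and L: "bounded L" "\<And>x. x \<notin> L \<Longrightarrow> F x = 0"
    and e: "norm e = 1"
    and lip: "\<And>x t. \<bar>F (x + t *\<^sub>R e) - F x\<bar> \<le> M * \<bar>t\<bar>"
    and F': "F' \<in> borel_measurable borel"
    and der: "AE x in lborel. ((\<lambda>t. F (x + t *\<^sub>R e)) has_real_derivative F' x) (at 0)"
  shows "integrable lborel F'" "(LINT x|lborel. F' x) = 0"
proof -
  obtain R where R: "L \<subseteq> ball 0 R" "R > 0"
    using bounded_subset_ballD[OF L(1), of 0] by auto
  have M: "M \<ge> 0" using lip[of 0 1] by simp
  \<comment> \<open>A step of length 2R + 1 from a point of the ball leaves the support, so the
    Lipschitz bound also bounds \<open>F\<close> itself.\<close>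
  have bd: "\<bar>F x\<bar> \<le> M * (2 * R + 1)" for x
  proof (cases "x \<in> L")
    case True
    have "norm ((2 * R + 1) *\<^sub>R e) = 2 * R + 1" using e R(2) by simp
    moreover have "norm x < R" using True R by auto
    ultimately have "norm (x + (2 * R + 1) *\<^sub>R e) > R"
      using R(2) norm_diff_ineq[of "(2 * R + 1) *\<^sub>R e" x] by (simp add: add.commute)
    then have "x + (2 * R + 1) *\<^sub>R e \<notin> L" using R by auto
    then show ?thesis using lip[of x "2 * R + 1"] L(2) R(2) by simp
  next
    case False
    then show ?thesis using L(2) M R(2) by simp
  qed
  have intF: "integrable lborel F"
    by (rule integrable_bounded_support[OF F L bd])
  define D where "D k x = (F (x + (1 / real (Suc k)) *\<^sub>R e) - F x) * real (Suc k)" for k x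
  have Fm: "(\<lambda>x. F (x + c)) \<in> borel_measurable borel" for c
    using F by measurable
  have intFc: "integrable lborel (\<lambda>x. F (x + c))" for c
  proof (rule integrable_bounded_support[OF Fm])
    show "bounded ((\<lambda>x. x - c) ` L)" using L(1) by (rule bounded_translation_minus)
    show "F (x + c) = 0" if "x \<notin> (\<lambda>x. x - c) ` L" for x
      using L(2)[of "x + c"] that by (metis add_diff_cancel_right' image_eqI)
    show "\<bar>F (x + c)\<bar> \<le> M * (2 * R + 1)" for x by (rule bd)
  qed
  have Dm: "D k \<in> borel_measurable lborel" for k
    unfolding D_def using F Fm by simp
  let ?w = "\<lambda>x. M * indicator (ball (0::'a) (R + 1)) x :: real"
  have w: "integrable lborel ?w"
  proof -
    have "emeasure lborel (ball (0::'a) (R + 1)) < \<infinity>" by (rule emeasure_lborel_ball_finite)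
    then show ?thesis by (intro integrable_mult_right integrable_real_indicator) simp
  qed
  have seq: "filterlim (\<lambda>k. 1 / real (Suc k)) (at 0) sequentially"
    by (rule filterlim_atI) (use LIMSEQ_Suc[OF lim_1_over_n] in auto)
  have lim: "AE x in lborel. (\<lambda>k. D k x) \<longlonglongrightarrow> F' x"
    using der
  proof eventually_elim
    case (elim x)
    then have "((\<lambda>h. (F (x + h *\<^sub>R e) - F x) / h) \<longlongrightarrow> F' x) (at 0)"
      by (simp add: DERIV_def)
    from filterlim_compose[OF this seq] show ?case
      by (simp add: D_def)
  qed
  have "norm (D k x) \<le> ?w x" for k x
  proof (cases "x \<in> ball 0 (R + 1)")
    case True
    have "\<bar>F (x + (1 / real (Suc k)) *\<^sub>R e) - F x\<bar> * real (Suc k) \<le> (M * \<bar>1 / real (Suc k)\<bar>) * real (Suc k)"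
      by (intro mult_right_mono lip) auto
    then show ?thesis using True by (simp add: D_def abs_mult)
  next
    case False
    have "norm ((1 / real (Suc k)) *\<^sub>R e) \<le> 1" using e by simp
    then have "norm (x + (1 / real (Suc k)) *\<^sub>R e) \<ge> R"
      using False norm_diff_ineq[of x "(1 / real (Suc k)) *\<^sub>R e"] by (simp only: mem_ball dist_0_norm not_less)
    then have "x + (1 / real (Suc k)) *\<^sub>R e \<notin> L" "x \<notin> L" using R False by auto
    then show ?thesis using L(2) M by (simp add: D_def)
  qed
  then have dom: "AE x in lborel. norm (D k x) \<le> ?w x" for k by simp
  have "(LINT x|lborel. D k x) = 0" for k
  proof -
    have "(LINT x|lborel. D k x) = (LINT x|lborel. F (x + (1 / real (Suc k)) *\<^sub>R e) - F x) * real (Suc k)"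
      unfolding D_def by simp
    also have "\<dots> = 0"
      using lborel_integral_translate[OF F] intF intFc by (subst Bochner_Integration.integral_diff) auto
    finally show ?thesis .
  qed
  moreover have "(\<lambda>k. LINT x|lborel. D k x) \<longlonglongrightarrow> (LINT x|lborel. F' x)"
    by (rule integral_dominated_convergence[OF _ Dm w lim dom]) (use F' in simp)
  ultimately show "(LINT x|lborel. F' x) = 0"
    using LIMSEQ_unique[OF _ tendsto_const] by auto
  show "integrable lborel F'"
    by (rule integrable_dominated_convergence[OF _ Dm w lim dom]) (use F' in simp)
qed

lemma test_functions_lipschitz:
  assumes "\<phi> \<in> test_functions \<Omega>"
  obtains M where "\<And>x t. \<bar>\<phi> (x + t *\<^sub>R axis i 1) - \<phi> x\<bar> \<le> M * \<bar>t\<bar>"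
proof -
  obtain B where B: "B \<ge> 0" "\<And>x. \<bar>partial_deriv i \<phi> x\<bar> \<le> B"
    using test_functions_bounded[OF test_functions_partial_deriv[OF assms]] by metis
  have "\<bar>\<phi> (x + t *\<^sub>R axis i 1) - \<phi> x\<bar> \<le> B * \<bar>t\<bar>" for x t
    using field_differentiable_bound[of UNIV "\<lambda>t. \<phi> (x + t *\<^sub>R axis i 1)" "\<lambda>t. partial_deriv i \<phi> (x + t *\<^sub>R axis i 1)" B t 0]
      partial_deriv_line[OF test_functions_smooth[OF assms]] B by simp
  then show ?thesis by (rule that)
qed

lemma test_functions_mult:
  assumes "\<phi> \<in> test_functions \<Omega>" "smooth \<psi>"
  shows "(\<lambda>x. \<phi> x * \<psi> x) \<in> test_functions \<Omega>"
proof -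
  obtain K where K: "compact K" "K \<subseteq> \<Omega>" "\<And>x. x \<notin> K \<Longrightarrow> \<phi> x = 0"
    using test_functions_support[OF assms(1)] by metis
  show ?thesis
    by (rule test_functionsI[OF smooth_mult[OF test_functions_smooth[OF assms(1)] assms(2)] K(1,2)])
      (simp add: K(3))
qed

lemma test_functions_integrable:
  assumes "\<phi> \<in> test_functions \<Omega>"
  shows "integrable lborel \<phi>"
proof -
  obtain K where K: "compact K" "\<And>x. x \<notin> K \<Longrightarrow> \<phi> x = 0"
    using test_functions_support[OF assms] by metis
  obtain B where B: "\<And>x. \<bar>\<phi> x\<bar> \<le> B" using test_functions_bounded[OF assms] by metis
  show ?thesis
    by (rule integrable_bounded_support[where L = K, OF _ _ _ B])
      (use K in \<open>auto simp: compact_imp_bounded intro: smooth_borel test_functions_smooth[OF assms]\<close>)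
qed

lemma integral_by_parts:
  fixes \<phi> :: "real ^ 'n \<Rightarrow> real"
  assumes \<phi>: "\<phi> \<in> test_functions \<Omega>" and \<psi>: "smooth \<psi>"
  shows "(LINT x|lborel. \<phi> x * partial_deriv i \<psi> x) = - (LINT x|lborel. partial_deriv i \<phi> x * \<psi> x)"
proof -
  let ?F = "\<lambda>x. \<phi> x * \<psi> x"
  have F: "?F \<in> test_functions \<Omega>" by (rule test_functions_mult[OF assms])
  note sF = test_functions_smooth[OF F]
  obtain K where K: "compact K" "\<And>x. x \<notin> K \<Longrightarrow> ?F x = 0"
    using test_functions_support[OF F] by metis
  obtain M where M: "\<And>x t. \<bar>?F (x + t *\<^sub>R axis i 1) - ?F x\<bar> \<le> M * \<bar>t\<bar>"
    using test_functions_lipschitz[OF F] by blast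
  have "AE x in lborel. ((\<lambda>t. ?F (x + t *\<^sub>R axis i 1)) has_real_derivative partial_deriv i ?F x) (at 0)"
    using partial_deriv_line[OF sF, of _ i 0] by simp
  from integral_directional_derivative_eq_0(2)[OF smooth_borel[OF sF] compact_imp_bounded[OF K(1)] K(2) _ M
      smooth_borel[OF smooth_partial_deriv[OF sF]] this]
  have "(LINT x|lborel. partial_deriv i ?F x) = 0" by (simp add: norm_axis_1)
  moreover have "(LINT x|lborel. partial_deriv i ?F x)
    = (LINT x|lborel. \<phi> x * partial_deriv i \<psi> x) + (LINT x|lborel. partial_deriv i \<phi> x * \<psi> x)"
    unfolding partial_deriv_mult[OF test_functions_smooth[OF \<phi>] \<psi>]
    by (rule Bochner_Integration.integral_add[OF
        test_functions_integrable[OF test_functions_mult[OF \<phi> smooth_partial_deriv[OF \<psi>]]]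
        test_functions_integrable[OF test_functions_mult[OF test_functions_partial_deriv[OF \<phi>] \<psi>]]])
  ultimately show ?thesis by simp
qed

text \<open>
  Representatives are Borel and vanish off \<open>\<Omega>\<close>, so that all integrals can be taken over \<^const>\<open>lborel\<close>.
\<close>

definition zero_rep :: "(real ^ 'n) set \<Rightarrow> (real ^ 'n \<Rightarrow> real) \<Rightarrow> (real ^ 'n \<Rightarrow> real) \<Rightarrow> bool" where
  "zero_rep \<Omega> f g \<longleftrightarrow> g \<in> borel_measurable borel \<and> (\<forall>x. x \<notin> \<Omega> \<longrightarrow> g x = 0) \<and>
     (AE x in lborel. x \<in> \<Omega> \<longrightarrow> f x = g x)"

lemma AE_lebesgue_on:
  "\<Omega> \<in> sets borel \<Longrightarrow> (AE x in lebesgue_on \<Omega>. P x) \<longleftrightarrow> (AE x in lborel. x \<in> \<Omega> \<longrightarrow> P x)"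
  by (subst AE_restrict_space_iff) (auto simp: AE_completion_iff)

lemma zero_rep_exists:
  assumes "f \<in> borel_measurable (lebesgue_on \<Omega>)" "\<Omega> \<in> sets borel"
  obtains g where "zero_rep \<Omega> f g"
proof -
  have "(\<lambda>x. indicator \<Omega> x *\<^sub>R f x) \<in> borel_measurable lebesgue"
    using assms by (subst (asm) borel_measurable_restrict_space_iff) auto
  from completion_ex_borel_measurable_real[OF this] obtain h where
    h: "h \<in> borel_measurable lborel" "AE x in lborel. indicator \<Omega> x *\<^sub>R f x = h x" by blast
  have "zero_rep \<Omega> f (\<lambda>x. indicator \<Omega> x * h x)"
    unfolding zero_rep_def
  proof (intro conjI)
    show "(\<lambda>x. indicator \<Omega> x * h x) \<in> borel_measurable borel" using h(1) assms(2) by simp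
    show "AE x in lborel. x \<in> \<Omega> \<longrightarrow> f x = indicator \<Omega> x * h x"
      using h(2) by eventually_elim auto
  qed auto
  then show ?thesis by (rule that)
qed

lemma zero_rep_indicator:
  assumes "zero_rep \<Omega> f g"
  shows "AE x in lebesgue. indicator \<Omega> x *\<^sub>R f x = g x"
proof -
  have z: "AE x in lborel. x \<in> \<Omega> \<longrightarrow> f x = g x" "\<And>x. x \<notin> \<Omega> \<Longrightarrow> g x = 0"
    using assms by (auto simp: zero_rep_def)
  from z(1) have "AE x in lborel. indicator \<Omega> x *\<^sub>R f x = g x"
    by eventually_elim (use z(2) in \<open>auto simp: indicator_def\<close>)
  then show ?thesis by (rule AE_completion)
qed

lemma zero_rep_measurable:
  assumes "zero_rep \<Omega> f g" "\<Omega> \<in> sets borel"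
  shows "(\<lambda>x. indicator \<Omega> x *\<^sub>R f x) \<in> borel_measurable lebesgue"
    "f \<in> borel_measurable (lebesgue_on \<Omega>)"
proof -
  have "g \<in> borel_measurable lebesgue" using assms(1) unfolding zero_rep_def
    by (auto intro: measurable_completion)
  then show *: "(\<lambda>x. indicator \<Omega> x *\<^sub>R f x) \<in> borel_measurable lebesgue"
    by (rule borel_measurable_AE) (use zero_rep_indicator[OF assms(1)] in \<open>simp add: eq_commute\<close>)
  then show "f \<in> borel_measurable (lebesgue_on \<Omega>)"
    using assms(2) by (subst borel_measurable_restrict_space_iff) auto
qed

lemma zero_rep_integral:
  assumes "zero_rep \<Omega> f g" "\<Omega> \<in> sets borel"
  shows "integrable (lebesgue_on \<Omega>) f \<longleftrightarrow> integrable lborel g"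
    and "(LINT x|lebesgue_on \<Omega>. f x) = (LINT x|lborel. g x)"
proof -
  have g: "g \<in> borel_measurable lborel" "g \<in> borel_measurable lebesgue" using assms(1) unfolding zero_rep_def
    by (auto intro: measurable_completion)
  have "integrable (lebesgue_on \<Omega>) f \<longleftrightarrow> integrable lebesgue (\<lambda>x. indicator \<Omega> x *\<^sub>R f x)"
    using assms(2) by (intro integrable_restrict_space) auto
  also have "\<dots> \<longleftrightarrow> integrable lebesgue g"
    by (rule integrable_cong_AE[OF zero_rep_measurable(1)[OF assms] g(2) zero_rep_indicator[OF assms(1)]])
  also have "\<dots> \<longleftrightarrow> integrable lborel g" by (rule integrable_completion[OF g(1)])
  finally show "integrable (lebesgue_on \<Omega>) f \<longleftrightarrow> integrable lborel g" .
  have "(LINT x|lebesgue_on \<Omega>. f x) = (LINT x|lebesgue. indicator \<Omega> x *\<^sub>R f x)"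
    using assms(2) by (intro integral_restrict_space) auto
  also have "\<dots> = (LINT x|lebesgue. g x)"
    by (rule integral_cong_AE[OF zero_rep_measurable(1)[OF assms] g(2) zero_rep_indicator[OF assms(1)]])
  also have "\<dots> = (LINT x|lborel. g x)" by (rule integral_completion[OF g(1)])
  finally show "(LINT x|lebesgue_on \<Omega>. f x) = (LINT x|lborel. g x)" .
qed

lemma zero_rep_mult:
  assumes "zero_rep \<Omega> f g" "\<phi> \<in> borel_measurable borel"
  shows "zero_rep \<Omega> (\<lambda>x. f x * \<phi> x) (\<lambda>x. g x * \<phi> x)"
  using assms unfolding zero_rep_def by auto

lemma zero_rep_mult2:
  assumes "zero_rep \<Omega> f g" "zero_rep \<Omega> f' g'"
  shows "zero_rep \<Omega> (\<lambda>x. f x * f' x) (\<lambda>x. g x * g' x)"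
  using assms unfolding zero_rep_def by auto

lemma zero_rep_square:
  assumes "zero_rep \<Omega> f g"
  shows "zero_rep \<Omega> (\<lambda>x. (f x)\<^sup>2) (\<lambda>x. (g x)\<^sup>2)"
  using assms unfolding zero_rep_def by auto

lemma zero_rep_diff:
  assumes "zero_rep \<Omega> f g" "zero_rep \<Omega> f' g'"
  shows "zero_rep \<Omega> (\<lambda>x. f x - f' x) (\<lambda>x. g x - g' x)"
  using assms unfolding zero_rep_def by auto

lemma zero_rep_sum:
  assumes "\<And>i. i \<in> I \<Longrightarrow> zero_rep \<Omega> (f i) (g i)" "finite I"
  shows "zero_rep \<Omega> (\<lambda>x. \<Sum>i\<in>I. f i x) (\<lambda>x. \<Sum>i\<in>I. g i x)"
proof -
  have "AE x in lborel. \<forall>i\<in>I. x \<in> \<Omega> \<longrightarrow> f i x = g i x"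
    using assms by (intro AE_finite_allI) (auto simp: zero_rep_def)
  then have "AE x in lborel. x \<in> \<Omega> \<longrightarrow> (\<Sum>i\<in>I. f i x) = (\<Sum>i\<in>I. g i x)"
    by eventually_elim auto
  then show ?thesis
    using assms(1) unfolding zero_rep_def by (auto intro!: borel_measurable_sum sum.neutral)
qed

text \<open>Boxes form an intersection-stable generator of the Borel sets, so the vanishing of the
  integral spreads to all Borel sets. Complements require the integral over the whole space, which
  is a limit over growing boxes.\<close>

lemma AE_eq_0_if_box_integrals_eq_0:
  fixes g :: "'a::euclidean_space \<Rightarrow> real"
  assumes g: "integrable lborel g" and box: "\<And>a b. (LINT x:box a b|lborel. g x) = 0"
  shows "AE x in lborel. g x = 0"
proof (rule sigma_finite_measure.density_zero[OF sigma_finite_lborel g])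
  have total: "(LINT x|lborel. g x) = 0"
  proof -
    let ?B = "\<lambda>k. box (- real k *\<^sub>R One) (real k *\<^sub>R One :: 'a)"
    have "(\<lambda>k. LINT x|lborel. indicator (?B k) x *\<^sub>R g x) \<longlonglongrightarrow> (LINT x|lborel. g x)"
    proof (rule integral_dominated_convergence)
      show "integrable lborel (\<lambda>x. \<bar>g x\<bar>)" using g by simp
      show "AE x in lborel. (\<lambda>k. indicator (?B k) x *\<^sub>R g x) \<longlonglongrightarrow> g x"
      proof (rule AE_I2)
        fix x :: 'a
        obtain k0 where k0: "norm x < real k0" using reals_Archimedean2 by blast
        have "x \<in> ?B k" if "k \<ge> k0" for k
        proof -
          have "\<bar>x \<bullet> i\<bar> < real k" if "i \<in> Basis" for i
            using Basis_le_norm[OF that, of x] k0 \<open>k \<ge> k0\<close> by linarith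
          then show ?thesis by (force simp: mem_box abs_less_iff)
        qed
        then have "eventually (\<lambda>k. indicator (?B k) x *\<^sub>R g x = g x) sequentially"
          unfolding eventually_sequentially by (intro exI[of _ k0]) simp
        then show "(\<lambda>k. indicator (?B k) x *\<^sub>R g x) \<longlonglongrightarrow> g x" by (rule tendsto_eventually)
      qed
      show "AE x in lborel. norm (indicator (?B k) x *\<^sub>R g x) \<le> \<bar>g x\<bar>" for k
        by (rule AE_I2) (auto simp: indicator_def)
    qed (use g in auto)
    then show ?thesis
      using box by (simp add: set_lebesgue_integral_def LIMSEQ_const_iff)
  qed
  have si: "set_integrable lborel A g" if "A \<in> sets borel" for A
    unfolding set_integrable_def using integrable_mult_indicator[OF _ g, of A] that by simp
  fix A :: "'a set" assume "A \<in> sets lborel"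
  have sb: "sigma_sets UNIV (range (\<lambda>(a, b). box a b)) = sets (borel :: 'a measure)"
    by (simp add: borel_eq_box)
  with \<open>A \<in> sets lborel\<close> have A: "A \<in> sigma_sets UNIV (range (\<lambda>(a, b). box a b))" by simp
  have stable: "Int_stable (range (\<lambda>(a, b :: 'a). box a b))"
  proof (rule Int_stableI)
    fix A B :: "'a set" assume "A \<in> range (\<lambda>(a, b). box a b)" "B \<in> range (\<lambda>(a, b). box a b)"
    then obtain a b c d where AB: "A = box a b" "B = box c d" by auto
    have "\<exists>p q. A \<inter> B = box p q" unfolding AB by (intro exI) (rule box_Int_box)
    then obtain p q where "A \<inter> B = box p q" by blast
    then show "A \<inter> B \<in> range (\<lambda>(a, b). box a b)" by (intro range_eqI[of _ _ "(p, q)"]) simp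
  qed
  have sub: "range (\<lambda>(a, b :: 'a). box a b) \<subseteq> Pow UNIV" by simp
  from stable sub A show "(LINT x:A|lborel. g x) = 0"
  proof (induction rule: sigma_sets_induct_disjoint)
    case (basic A)
    then show ?case using box by auto
  next
    case empty
    show ?case by (simp add: set_lebesgue_integral_def)
  next
    case (compl A)
    have "(LINT x:A \<union> (UNIV - A)|lborel. g x) = (LINT x:A|lborel. g x) + (LINT x:UNIV - A|lborel. g x)"
      using compl(1) by (intro set_integral_Un si) (auto simp: sb)
    moreover have "A \<union> (UNIV - A) = UNIV" by auto
    ultimately show ?case using compl total by (simp add: set_lebesgue_integral_def)
  next
    case (union A)
    have "(LINT x:(\<Union>i. A i)|lborel. g x) = (\<Sum>i. LINT x:A i|lborel. g x)"
      using union(1,2) by (intro lebesgue_integral_countable_add si)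
        (auto simp: sb disjoint_family_on_def intro!: sets.countable_UN)
    then show ?case using union(3) by simp
  qed
qed

section \<open>Bump functions and uniqueness of weak derivatives\<close>

definition bump :: "real \<Rightarrow> real ^ 'n \<Rightarrow> real ^ 'n \<Rightarrow> real ^ 'n \<Rightarrow> real" where
  "bump c a b x = (\<Prod>i\<in>UNIV. flat 1 (c * (x $ i - a $ i)) * flat 1 (c * (b $ i - x $ i)))"

lemma flat_1: "flat 1 t = (if t > 0 then exp (- (1 / t)) else 0)"
  by (simp add: flat_def)

lemma flat_1_bounds: "0 \<le> flat 1 t" "flat 1 t \<le> 1"
  by (auto simp: flat_1)

lemma bump_bounds: "0 \<le> bump c a b x" "bump c a b x \<le> 1"
  unfolding bump_def
  by (auto intro!: prod_nonneg prod_le_1 mult_nonneg_nonneg mult_le_one flat_1_bounds)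

lemma smooth_bump: "smooth (bump c a b)"
proof -
  have "smooth (\<lambda>x. flat 1 (c * x $ i + (- c * a $ i)) * flat 1 ((- c) * x $ i + c * b $ i))" for i
    by (intro smooth_mult smooth_flat)
  then have "smooth (\<lambda>x. \<Prod>i\<in>UNIV. flat 1 (c * x $ i + (- c * a $ i)) * flat 1 ((- c) * x $ i + c * b $ i))"
    by (intro smooth_prod)
  moreover have "bump c a b = (\<lambda>x. \<Prod>i\<in>UNIV. flat 1 (c * x $ i + (- c * a $ i)) * flat 1 ((- c) * x $ i + c * b $ i))"
    unfolding bump_def by (rule ext) (simp add: algebra_simps)
  ultimately show ?thesis by simp
qed

lemma bump_outside:
  assumes "x \<notin> box a b" "c > 0"
  shows "bump c a b x = 0"
proof -
  obtain i where "\<not> (a $ i < x $ i \<and> x $ i < b $ i)" using assms(1) by (auto simp: mem_box_cart)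
  then have "flat 1 (c * (x $ i - a $ i)) * flat 1 (c * (b $ i - x $ i)) = 0"
    using assms(2) by (auto simp: flat_1 zero_less_mult_iff)
  then show ?thesis unfolding bump_def by (intro prod_zero) auto
qed

lemma bump_pos: "x \<in> box a b \<Longrightarrow> c > 0 \<Longrightarrow> bump c a b x > 0"
  unfolding bump_def by (intro prod_pos) (auto simp: flat_1 mem_box_cart)

lemma bump_test_function:
  assumes "c > 0" "cbox a b \<subseteq> \<Omega>"
  shows "bump c a b \<in> test_functions \<Omega>"
proof (rule test_functionsI[OF smooth_bump compact_cbox assms(2)])
  fix x assume "x \<notin> cbox a b"
  then have "x \<notin> box a b" using box_subset_cbox by blast
  then show "bump c a b x = 0" by (rule bump_outside[OF _ assms(1)])
qed

text \<open>Inside the box each factor has the form exp(-1/(ct)) with t > 0, so a growing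
  \<open>c\<close> steepens the profile. Integrals over boxes thereby become limits of integrals
  against test functions.\<close>

lemma bump_tendsto_indicator: "(\<lambda>k. bump (real (Suc k)) a b x) \<longlonglongrightarrow> indicator (box a b) x"
proof (cases "x \<in> box a b")
  case True
  have "(\<lambda>k. flat 1 (real (Suc k) * t)) \<longlonglongrightarrow> 1" if "t > 0" for t
  proof -
    have "(\<lambda>k. - (1 / t * (1 / real (Suc k)))) \<longlonglongrightarrow> - (1 / t * 0)"
      using LIMSEQ_Suc[OF lim_1_over_n] by (intro tendsto_intros) auto
    then have "(\<lambda>k. exp (- (1 / t * (1 / real (Suc k))))) \<longlonglongrightarrow> exp (- (1 / t * 0))"
      by (intro tendsto_exp)
    then show ?thesis using that by (simp add: flat_1 mult.commute)
  qed
  then have "(\<lambda>k. bump (real (Suc k)) a b x) \<longlonglongrightarrow> (\<Prod>i\<in>(UNIV::'a set). 1 * 1)"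
    unfolding bump_def using True by (intro tendsto_prod tendsto_mult) (auto simp: mem_box_cart)
  then show ?thesis using True by simp
next
  case False
  then show ?thesis by (simp add: bump_outside)
qed

text \<open>Weak derivatives are only locally integrable. The support of the test function permits
  passing to a compact set, on which the other factor has an integrable representative.\<close>

lemma integral_localize:
  fixes w \<phi> :: "real ^ 'n \<Rightarrow> real"
  assumes "C \<subseteq> \<Omega>" "C \<in> sets borel" "\<Omega> \<in> sets borel" "\<And>x. x \<notin> C \<Longrightarrow> \<phi> x = 0"
  shows "(LINT x|lebesgue_on \<Omega>. w x * \<phi> x) = (LINT x|lebesgue_on C. w x * \<phi> x)"
proof -
  have "(LINT x|lebesgue_on \<Omega>. w x * \<phi> x) = (LINT x|lebesgue. indicator \<Omega> x *\<^sub>R (w x * \<phi> x))"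
    using assms(3) by (intro integral_restrict_space) auto
  also have "(\<lambda>x. indicator \<Omega> x *\<^sub>R (w x * \<phi> x)) = (\<lambda>x. indicator C x *\<^sub>R (w x * \<phi> x))"
    using assms(1,4) by (auto simp: indicator_def fun_eq_iff)
  also have "(LINT x|lebesgue. indicator C x *\<^sub>R (w x * \<phi> x)) = (LINT x|lebesgue_on C. w x * \<phi> x)"
    using assms(2) by (intro integral_restrict_space[symmetric]) auto
  finally show ?thesis .
qed

lemma integral_localize_zero_rep:
  assumes "zero_rep C w g" "C \<subseteq> \<Omega>" "C \<in> sets borel" "\<Omega> \<in> sets borel" "\<And>x. x \<notin> C \<Longrightarrow> \<phi> x = 0" "\<phi> \<in> borel_measurable borel"
  shows "(LINT x|lebesgue_on \<Omega>. w x * \<phi> x) = (LINT x|lborel. g x * \<phi> x)"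
  by (rule trans[OF integral_localize[of C \<Omega> \<phi> w, OF assms(2-5)] zero_rep_integral(2)[OF zero_rep_mult[OF assms(1,6)] assms(3)]])

lemma has_weak_derivD:
  assumes "has_weak_deriv \<Omega> \<alpha> v w" "\<phi> \<in> test_functions \<Omega>" "mset is = \<alpha>"
  shows "(LINT x|lebesgue_on \<Omega>. v x * foldr partial_deriv is \<phi> x)
          = (-1) ^ size \<alpha> * (LINT x|lebesgue_on \<Omega>. w x * \<phi> x)"
  using assms unfolding has_weak_deriv_def by blast

lemma integrable_mult_bounded:
  fixes g \<phi> :: "'a::euclidean_space \<Rightarrow> real"
  assumes "integrable lborel g" "\<phi> \<in> borel_measurable borel" "\<And>x. \<bar>\<phi> x\<bar> \<le> B"
  shows "integrable lborel (\<lambda>x. g x * \<phi> x)"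
proof (rule Bochner_Integration.integrable_bound)
  show "integrable lborel (\<lambda>x. B * g x)" using assms(1) by simp
  show "AE x in lborel. norm (g x * \<phi> x) \<le> norm (B * g x)"
  proof (rule AE_I2)
    fix x
    have "\<bar>\<phi> x\<bar> * \<bar>g x\<bar> \<le> \<bar>B\<bar> * \<bar>g x\<bar>"
      using assms(3)[of x] by (intro mult_right_mono) auto
    then show "norm (g x * \<phi> x) \<le> norm (B * g x)" by (simp add: abs_mult mult.commute)
  qed
qed (use assms in simp)

text \<open>The fundamental lemma of the calculus of variations. Testing with bumps that converge to
  indicators shows that both candidates have the same integral over every box inside a closed box
  contained in \<Omega>; countably many such closed boxes exhaust \<Omega>.\<close>

lemma has_weak_deriv_unique:
  fixes \<Omega> :: "(real ^ 'n) set"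
  assumes "open \<Omega>" and w1: "has_weak_deriv \<Omega> \<alpha> v w1" and w2: "has_weak_deriv \<Omega> \<alpha> v w2"
  shows "AE x in lebesgue_on \<Omega>. w1 x = w2 x"
proof -
  have \<Omega>: "\<Omega> \<in> sets borel" using assms(1) by simp
  have loc: "AE x in lborel. x \<in> cbox p q \<longrightarrow> w1 x = w2 x" if pq: "cbox p q \<subseteq> \<Omega>" for p q
  proof -
    have C: "cbox p q \<in> sets borel" by simp
    have i1: "integrable (lebesgue_on (cbox p q)) w1" and i2: "integrable (lebesgue_on (cbox p q)) w2"
      using w1 w2 pq unfolding has_weak_deriv_def locally_integrable_def by auto
    obtain g1 where g1: "zero_rep (cbox p q) w1 g1"
      using zero_rep_exists[OF _ C] i1 by (metis borel_measurable_integrable)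
    obtain g2 where g2: "zero_rep (cbox p q) w2 g2"
      using zero_rep_exists[OF _ C] i2 by (metis borel_measurable_integrable)
    have ig: "integrable lborel g1" "integrable lborel g2"
      using zero_rep_integral(1)[OF g1 C] zero_rep_integral(1)[OF g2 C] i1 i2 by auto
    define g where "g x = g1 x - g2 x" for x
    have g: "integrable lborel g" unfolding g_def using ig by simp
    have box0: "(LINT x:box a b|lborel. g x) = 0" if ab: "cbox a b \<subseteq> cbox p q" for a b
    proof -
      have zero: "(LINT x|lborel. bump (real (Suc k)) a b x *\<^sub>R g x) = 0" for k
      proof -
        let ?\<phi> = "bump (real (Suc k)) a b"
        have \<phi>: "?\<phi> \<in> test_functions \<Omega>" using ab pq by (intro bump_test_function) auto
        have out: "?\<phi> x = 0" if "x \<notin> cbox p q" for x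
        proof (rule bump_outside)
          show "x \<notin> box a b" using that ab box_subset_cbox by blast
        qed simp
        obtain "is" where "is": "mset is = \<alpha>" using ex_mset by blast
        have "(- 1) ^ size \<alpha> * (LINT x|lebesgue_on \<Omega>. w1 x * ?\<phi> x) = (- 1) ^ size \<alpha> * (LINT x|lebesgue_on \<Omega>. w2 x * ?\<phi> x)"
          by (rule trans[OF has_weak_derivD[OF w1 \<phi> "is", symmetric] has_weak_derivD[OF w2 \<phi> "is"]])
        then have "(LINT x|lebesgue_on \<Omega>. w1 x * ?\<phi> x) = (LINT x|lebesgue_on \<Omega>. w2 x * ?\<phi> x)" by simp
        moreover have "(LINT x|lebesgue_on \<Omega>. w1 x * ?\<phi> x) = (LINT x|lborel. g1 x * ?\<phi> x)"
          by (rule integral_localize_zero_rep[OF g1 pq C \<Omega> out smooth_borel[OF smooth_bump]])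
        moreover have "(LINT x|lebesgue_on \<Omega>. w2 x * ?\<phi> x) = (LINT x|lborel. g2 x * ?\<phi> x)"
          by (rule integral_localize_zero_rep[OF g2 pq C \<Omega> out smooth_borel[OF smooth_bump]])
        ultimately have "(LINT x|lborel. g1 x * ?\<phi> x) = (LINT x|lborel. g2 x * ?\<phi> x)" by simp
        moreover have "integrable lborel (\<lambda>x. g1 x * ?\<phi> x)" "integrable lborel (\<lambda>x. g2 x * ?\<phi> x)"
          using bump_bounds[of "real (Suc k)" a b]
          by (intro integrable_mult_bounded[of _ _ 1] ig smooth_borel[OF smooth_bump]; simp add: abs_le_iff order_trans[of _ 0 1])+
        ultimately have "(LINT x|lborel. g1 x * ?\<phi> x - g2 x * ?\<phi> x) = 0"
          by (subst Bochner_Integration.integral_diff) auto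
        then show ?thesis
          by (simp add: g_def left_diff_distrib mult.commute[of "bump _ _ _ _"])
      qed
      have "(\<lambda>k. LINT x|lborel. bump (real (Suc k)) a b x *\<^sub>R g x) \<longlonglongrightarrow> (LINT x|lborel. indicator (box a b) x *\<^sub>R g x)"
      proof (rule integral_dominated_convergence)
        show "integrable lborel (\<lambda>x. \<bar>g x\<bar>)" using g by simp
        show "AE x in lborel. (\<lambda>k. bump (real (Suc k)) a b x *\<^sub>R g x) \<longlonglongrightarrow> indicator (box a b) x *\<^sub>R g x"
          by (intro AE_I2 tendsto_scaleR bump_tendsto_indicator tendsto_const)
        show "AE x in lborel. norm (bump (real (Suc k)) a b x *\<^sub>R g x) \<le> \<bar>g x\<bar>" for k
          using bump_bounds[of "real (Suc k)" a b] by (intro AE_I2) (simp add: abs_mult mult_left_le_one_le)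
      qed (use borel_measurable_integrable[OF g] smooth_borel[OF smooth_bump] in \<open>auto intro!: borel_measurable_times\<close>)
      then show ?thesis
        using zero by (simp add: set_lebesgue_integral_def LIMSEQ_const_iff)
    qed
    have "AE x in lborel. indicator (box p q) x *\<^sub>R g x = 0"
    proof (rule AE_eq_0_if_box_integrals_eq_0)
      show "integrable lborel (\<lambda>x. indicator (box p q) x *\<^sub>R g x)"
        using integrable_mult_indicator[OF _ g] by simp
      fix a b
      obtain c d where cd: "box a b \<inter> box p q = box c d" by (rule that[OF box_Int_box])
      have "(LINT x:box a b|lborel. indicator (box p q) x *\<^sub>R g x) = (LINT x:box c d|lborel. g x)"
        unfolding set_lebesgue_integral_def cd[symmetric] by (simp add: indicator_inter_arith mult.assoc)
      also have "\<dots> = 0"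
      proof (cases "box c d = {}")
        case True
        then show ?thesis by (simp add: set_lebesgue_integral_def)
      next
        case False
        have "closure (box c d) \<subseteq> closure (box p q)" using cd by (intro closure_mono) auto
        moreover have "closure (box p q) \<subseteq> cbox p q" by (rule closure_minimal[OF box_subset_cbox closed_cbox])
        ultimately show ?thesis using box0[of c d] False by auto
      qed
      finally show "(LINT x:box a b|lborel. indicator (box p q) x *\<^sub>R g x) = 0" .
    qed
    moreover have "AE x in lborel. x \<notin> cbox p q - box p q"
    proof -
      have "cbox p q - box p q \<in> null_sets lebesgue"
        using negligible_frontier_interval negligible_iff_null_sets by blast
      then have "cbox p q - box p q \<in> null_sets lborel"
        by (subst (asm) null_sets_completion_iff) auto
      then show ?thesis by (rule AE_not_in)
    qed
    moreover have "AE x in lborel. x \<in> cbox p q \<longrightarrow> w1 x = g1 x" "AE x in lborel. x \<in> cbox p q \<longrightarrow> w2 x = g2 x"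
      using g1 g2 by (auto simp: zero_rep_def)
    ultimately show ?thesis
      by eventually_elim (auto simp: g_def)
  qed
  obtain \<D> where \<D>: "countable \<D>" "\<And>X. X \<in> \<D> \<Longrightarrow> X \<subseteq> \<Omega> \<and> (\<exists>a b. X = cbox a b)" "\<Union>\<D> = \<Omega>"
    using open_countable_Union_open_cbox[OF assms(1)] by (metis Pow_iff subsetD)
  have "AE x in lborel. \<forall>X\<in>\<D>. x \<in> X \<longrightarrow> w1 x = w2 x"
    using \<D>(1)
  proof (rule AE_ball_countable'[rotated])
    fix X assume "X \<in> \<D>"
    then show "AE x in lborel. x \<in> X \<longrightarrow> w1 x = w2 x" using \<D>(2)[of X] loc by blast
  qed
  then have "AE x in lborel. x \<in> \<Omega> \<longrightarrow> w1 x = w2 x"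
    by eventually_elim (use \<D>(3) in blast)
  then show ?thesis using AE_lebesgue_on[OF \<Omega>] by blast
qed

lemma weak_deriv_AE_eq:
  assumes "open \<Omega>" "has_weak_deriv \<Omega> \<alpha> v w"
  shows "has_weak_deriv \<Omega> \<alpha> v (weak_deriv \<Omega> \<alpha> v)" "AE x in lebesgue_on \<Omega>. weak_deriv \<Omega> \<alpha> v x = w x"
proof -
  show "has_weak_deriv \<Omega> \<alpha> v (weak_deriv \<Omega> \<alpha> v)"
    unfolding weak_deriv_def by (rule someI[of "has_weak_deriv \<Omega> \<alpha> v", OF assms(2)])
  then show "AE x in lebesgue_on \<Omega>. weak_deriv \<Omega> \<alpha> v x = w x"
    by (rule has_weak_deriv_unique[OF assms(1) _ assms(2)])
qed

section \<open>Square integrable functions and mollification\<close>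

text \<open>The values are extended, so that estimates can be chained before integrability is known;
  finiteness then expresses square integrability.\<close>

definition sqn :: "('a::euclidean_space \<Rightarrow> real) \<Rightarrow> ennreal" where
  "sqn g = (\<integral>\<^sup>+x. ennreal ((g x)\<^sup>2) \<partial>lborel)"

text \<open>The bound (a + b)^2 \<le> 2a^2 + 2b^2 takes the place of the triangle inequality from
  here on, which accounts for many factors 2 in later constants.\<close>

lemma sqn_add:
  assumes [measurable]: "f \<in> borel_measurable borel" "g \<in> borel_measurable borel"
  shows "sqn (\<lambda>x. f x + g x) \<le> 2 * sqn f + 2 * sqn g"
proof -
  have "sqn (\<lambda>x. f x + g x) \<le> (\<integral>\<^sup>+x. 2 * ennreal ((f x)\<^sup>2) + 2 * ennreal ((g x)\<^sup>2) \<partial>lborel)"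
    unfolding sqn_def
  proof (rule nn_integral_mono)
    fix x
    have "0 \<le> (f x - g x)\<^sup>2" by simp
    then have "(f x + g x)\<^sup>2 \<le> 2 * (f x)\<^sup>2 + 2 * (g x)\<^sup>2"
      unfolding power2_sum power2_diff by linarith
    then have "ennreal ((f x + g x)\<^sup>2) \<le> ennreal (2 * (f x)\<^sup>2 + 2 * (g x)\<^sup>2)" by (rule ennreal_leI)
    then show "ennreal ((f x + g x)\<^sup>2) \<le> 2 * ennreal ((f x)\<^sup>2) + 2 * ennreal ((g x)\<^sup>2)"
      by (simp add: ennreal_plus ennreal_mult)
  qed
  also have "\<dots> = 2 * sqn f + 2 * sqn g"
    unfolding sqn_def by (subst nn_integral_add) (auto simp: nn_integral_cmult)
  finally show ?thesis .
qed

lemma sqn_minus_commute: "sqn (\<lambda>x. f x - g x) = sqn (\<lambda>x. g x - f x)"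
  unfolding sqn_def by (simp add: power2_commute)

lemma sqn_diff:
  assumes [measurable]: "f \<in> borel_measurable borel" "g \<in> borel_measurable borel"
  shows "sqn (\<lambda>x. f x - g x) \<le> 2 * sqn f + 2 * sqn g"
  using sqn_add[of f "\<lambda>x. - g x"] by (simp add: sqn_def)

lemma sqn_mono: "(\<And>x. \<bar>f x\<bar> \<le> \<bar>g x\<bar>) \<Longrightarrow> sqn f \<le> sqn g"
  unfolding sqn_def by (intro nn_integral_mono ennreal_leI) (simp add: abs_le_square_iff)

lemma sqn_cmult: "g \<in> borel_measurable borel \<Longrightarrow> sqn (\<lambda>x. c * g x) = ennreal (c\<^sup>2) * sqn g"
  unfolding sqn_def by (subst nn_integral_cmult[symmetric]) (auto simp: power_mult_distrib ennreal_mult)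

lemma nn_integral_lborel_affine:
  fixes f :: "'a::euclidean_space \<Rightarrow> ennreal"
  assumes [measurable]: "f \<in> borel_measurable borel" and c: "c \<noteq> 0"
  shows "(\<integral>\<^sup>+x. f x \<partial>lborel) = ennreal (\<bar>c\<bar> ^ DIM('a)) * (\<integral>\<^sup>+x. f (t + c *\<^sub>R x) \<partial>lborel)"
  by (subst lborel_affine[OF c, of t])
    (simp add: nn_integral_density nn_integral_distr nn_integral_cmult)

lemma square_integral_dominated:
  fixes F :: "nat \<Rightarrow> 'a::euclidean_space \<Rightarrow> real"
  assumes [measurable]: "\<And>k. F k \<in> borel_measurable borel" "w \<in> borel_measurable borel"
    and w: "sqn w < \<infinity>" and bd: "\<And>k x. \<bar>F k x\<bar> \<le> \<bar>w x\<bar>"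
    and lim: "AE x in lborel. (\<lambda>k. F k x) \<longlonglongrightarrow> 0"
  shows "(\<lambda>k. sqn (F k)) \<longlonglongrightarrow> 0"
proof -
  have "(\<lambda>k. \<integral>\<^sup>+x. ennreal ((F k x)\<^sup>2) \<partial>lborel) \<longlonglongrightarrow> (\<integral>\<^sup>+x. ennreal 0 \<partial>(lborel :: 'a measure))"
  proof (rule nn_integral_dominated_convergence)
    show "AE x in lborel. ennreal ((F k x)\<^sup>2) \<le> ennreal ((w x)\<^sup>2)" for k
      using bd by (intro AE_I2 ennreal_leI) (simp add: abs_le_square_iff)
    show "(\<integral>\<^sup>+x. ennreal ((w x)\<^sup>2) \<partial>lborel) < \<infinity>" using w by (simp add: sqn_def)
    show "AE x in lborel. (\<lambda>k. ennreal ((F k x)\<^sup>2)) \<longlonglongrightarrow> ennreal 0"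
      using lim
    proof eventually_elim
      case (elim x)
      then have "(\<lambda>k. (F k x)\<^sup>2) \<longlonglongrightarrow> 0\<^sup>2" by (intro tendsto_intros)
      then show ?case by (intro tendsto_ennrealI) simp
    qed
  qed auto
  then show ?thesis by (simp add: sqn_def)
qed

section \<open>Density of continuous functions with bounded support in L^2\<close>

lemma approx_continuous_indicator:
  fixes A :: "'a::euclidean_space set"
  assumes A: "A \<in> sets borel" "bounded A" and e: "e > 0"
  obtains h where "continuous_on UNIV h" "bounded {x. h x \<noteq> (0::real)}"
    "sqn (\<lambda>x. indicator A x - h x) < ennreal e"
proof -
  have AL: "A \<in> sets lebesgue" using A(1) by simp
  obtain R where R: "A \<subseteq> ball 0 R" using bounded_subset_ballD[OF A(2), of 0] by auto
  obtain T where T: "open T" "A \<subseteq> T" "emeasure lebesgue (T - A) < ennreal (e / 2)"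
    using sets_lebesgue_outer_open[OF AL half_gt_zero[OF e]] by metis
  obtain S where S: "closed S" "S \<subseteq> A" "emeasure lebesgue (A - S) < ennreal (e / 2)"
    using sets_lebesgue_inner_closed[OF AL half_gt_zero[OF e]] by metis
  \<comment> \<open>Intersecting with a ball gives the Urysohn function bounded support. It differs
    from the indicator only on \<open>T - A\<close> and \<open>A - S\<close>, and there by at most
    one.\<close>
  define T' where "T' = T \<inter> ball 0 R"
  have T': "open T'" "A \<subseteq> T'" using T R by (auto simp: T'_def)
  have "closed (- T')" "S \<inter> - T' = {}" using S T' by auto
  then obtain f :: "'a \<Rightarrow> real" where f: "continuous_on UNIV f" "\<And>x. f x \<in> closed_segment 1 0"
    "\<And>x. x \<in> S \<Longrightarrow> f x = 1" "\<And>x. x \<in> - T' \<Longrightarrow> f x = 0"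
    using Urysohn[OF S(1), of "- T'" 1 0] by metis
  have "x \<in> ball 0 R" if "f x \<noteq> 0" for x
    using f(4)[of x] that by (auto simp: T'_def)
  then have "{x. f x \<noteq> 0} \<subseteq> ball 0 R" by blast
  then have "bounded {x. f x \<noteq> 0}"
    by (rule bounded_subset[OF bounded_ball])
  moreover have "sqn (\<lambda>x. indicator A x - f x) < ennreal e"
  proof -
    have f01: "0 \<le> f x" "f x \<le> 1" for x using f(2)[of x] by (auto simp: closed_segment_eq_real_ivl)
    have "sqn (\<lambda>x. indicator A x - f x) \<le> (\<integral>\<^sup>+x. indicator (T - A) x + indicator (A - S) x \<partial>lborel)"
      unfolding sqn_def
    proof (rule nn_integral_mono)
      fix x :: 'a
      consider "x \<in> S" | "x \<in> A - S" | "x \<in> T - A" | "x \<notin> T" using S(2) T(2) by blast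
      then show "ennreal ((indicator A x - f x)\<^sup>2) \<le> indicator (T - A) x + indicator (A - S) x"
      proof cases
        case 1
        then show ?thesis using f(3) S(2) by (auto simp: indicator_def)
      next
        case 2
        have "(1 - f x)\<^sup>2 \<le> 1" using f01[of x] by (intro power_le_one) auto
        then show ?thesis using 2 T(2) by (auto simp: indicator_def)
      next
        case 3
        have "(f x)\<^sup>2 \<le> 1" using f01[of x] by (intro power_le_one) auto
        then show ?thesis using 3 by (auto simp: indicator_def)
      next
        case 4
        then have "f x = 0" "x \<notin> A" using f(4) T(2) by (auto simp: T'_def)
        then show ?thesis by simp
      qed
    qed
    also have "\<dots> = emeasure lborel (T - A) + emeasure lborel (A - S)"
    proof -
      have "T - A \<in> sets lborel" "A - S \<in> sets lborel" using A(1) S(1) T(1) by auto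
      then show ?thesis by (simp add: nn_integral_add)
    qed
    also have "\<dots> = emeasure lebesgue (T - A) + emeasure lebesgue (A - S)"
      using A(1) S(1) T(1) by (simp add: emeasure_completion)
    also have "\<dots> < ennreal (e / 2) + ennreal (e / 2)"
      by (rule add_strict_mono[OF T(3) S(3)])
    also have "\<dots> = ennreal e" using e by (simp flip: ennreal_plus)
    finally show ?thesis .
  qed
  ultimately show ?thesis using that f(1) by blast
qed

definition L2_approximable :: "('a::euclidean_space \<Rightarrow> real) \<Rightarrow> bool" where
  "L2_approximable g \<longleftrightarrow> (\<forall>e>0. \<exists>h. continuous_on UNIV h \<and> bounded {x. h x \<noteq> 0} \<and> sqn (\<lambda>x. g x - h x) < ennreal e)"

lemma L2_approximable_limit:
  fixes g :: "'a::euclidean_space \<Rightarrow> real"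
  assumes g[measurable]: "g \<in> borel_measurable borel"
    and U: "\<And>i::nat. U i \<in> borel_measurable borel" "\<And>i. L2_approximable (U i)"
    and lim: "(\<lambda>i. sqn (\<lambda>x. g x - U i x)) \<longlonglongrightarrow> 0"
  shows "L2_approximable g"
  unfolding L2_approximable_def
proof (intro allI impI)
  fix e :: real assume e: "e > 0"
  have "eventually (\<lambda>i. sqn (\<lambda>x. g x - U i x) < ennreal (e / 4)) sequentially"
    using lim e by (intro order_tendstoD(2)) auto
  then obtain i where i: "sqn (\<lambda>x. g x - U i x) < ennreal (e / 4)"
    by (auto simp: eventually_sequentially)
  have "e / 4 > 0" using e by simp
  then obtain h where h: "continuous_on UNIV h" "bounded {x. h x \<noteq> 0}" "sqn (\<lambda>x. U i x - h x) < ennreal (e / 4)"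
    using U(2)[of i] unfolding L2_approximable_def by blast
  have [measurable]: "h \<in> borel_measurable borel" "U i \<in> borel_measurable borel"
    using h(1) U(1) by (auto intro: borel_measurable_continuous_onI)
  have "sqn (\<lambda>x. g x - h x) = sqn (\<lambda>x. (g x - U i x) + (U i x - h x))" by simp
  also have "\<dots> \<le> 2 * sqn (\<lambda>x. g x - U i x) + 2 * sqn (\<lambda>x. U i x - h x)"
    by (rule sqn_add) auto
  also have "\<dots> < ennreal (e / 2) + ennreal (e / 2)"
  proof (rule add_strict_mono)
    have "2 * ennreal (e / 4) = ennreal (e / 2)" using e by (subst ennreal_numeral[symmetric], subst ennreal_mult[symmetric]) auto
    then show "2 * sqn (\<lambda>x. g x - U i x) < ennreal (e / 2)" "2 * sqn (\<lambda>x. U i x - h x) < ennreal (e / 2)"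
      using i h(3) ennreal_mult_strict_left_mono[of _ "ennreal (e / 4)" 2] by auto
  qed
  also have "\<dots> = ennreal e" using e by (simp flip: ennreal_plus)
  finally show "\<exists>h. continuous_on UNIV h \<and> bounded {x. h x \<noteq> 0} \<and> sqn (\<lambda>x. g x - h x) < ennreal e"
    using h by blast
qed

lemma L2_approximable_add:
  fixes f g :: "'a::euclidean_space \<Rightarrow> real"
  assumes [measurable]: "f \<in> borel_measurable borel" "g \<in> borel_measurable borel"
    and f: "L2_approximable f" and g: "L2_approximable g"
  shows "L2_approximable (\<lambda>x. c * f x + d * g x)"
  unfolding L2_approximable_def
proof (intro allI impI)
  fix e :: real assume e: "e > 0"
  define M where "M = 1 + c\<^sup>2 + d\<^sup>2"
  have M: "M > 0" "c\<^sup>2 \<le> M" "d\<^sup>2 \<le> M" by (auto simp: M_def add_pos_nonneg)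
  have e': "e / (4 * M) > 0" using e M by simp
  then obtain h where h: "continuous_on UNIV h" "bounded {x. h x \<noteq> 0}" "sqn (\<lambda>x. f x - h x) < ennreal (e / (4 * M))"
    using f unfolding L2_approximable_def by blast
  from e' obtain k where k: "continuous_on UNIV k" "bounded {x. k x \<noteq> 0}" "sqn (\<lambda>x. g x - k x) < ennreal (e / (4 * M))"
    using g unfolding L2_approximable_def by blast
  have [measurable]: "h \<in> borel_measurable borel" "k \<in> borel_measurable borel"
    using h(1) k(1) by (auto intro: borel_measurable_continuous_onI)
  have "sqn (\<lambda>x. (c * f x + d * g x) - (c * h x + d * k x)) = sqn (\<lambda>x. c * (f x - h x) + d * (g x - k x))"
    by (simp add: algebra_simps)
  also have "\<dots> \<le> 2 * sqn (\<lambda>x. c * (f x - h x)) + 2 * sqn (\<lambda>x. d * (g x - k x))"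
    by (rule sqn_add) auto
  also have "\<dots> = 2 * (ennreal (c\<^sup>2) * sqn (\<lambda>x. f x - h x)) + 2 * (ennreal (d\<^sup>2) * sqn (\<lambda>x. g x - k x))"
    by (simp add: sqn_cmult)
  also have "\<dots> \<le> 2 * (ennreal M * sqn (\<lambda>x. f x - h x)) + 2 * (ennreal M * sqn (\<lambda>x. g x - k x))"
    using M by (intro add_mono mult_left_mono mult_right_mono ennreal_leI) auto
  also have "\<dots> < ennreal (e / 2) + ennreal (e / 2)"
  proof (rule add_strict_mono)
    have "2 * (ennreal M * s) < ennreal (e / 2)" if "s < ennreal (e / (4 * M))" for s
    proof -
      have "2 * (ennreal M * s) = ennreal (2 * M) * s" using M by (simp add: ennreal_mult mult.assoc)
      also have "\<dots> < ennreal (2 * M) * ennreal (e / (4 * M))"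
        using M that by (intro ennreal_mult_strict_left_mono) auto
      also have "\<dots> = ennreal (e / 2)" using M e by (subst ennreal_mult[symmetric]) auto
      finally show ?thesis .
    qed
    then show "2 * (ennreal M * sqn (\<lambda>x. f x - h x)) < ennreal (e / 2)"
      "2 * (ennreal M * sqn (\<lambda>x. g x - k x)) < ennreal (e / 2)" using h(3) k(3) by auto
  qed
  also have "\<dots> = ennreal e" using e by (simp flip: ennreal_plus)
  finally have s: "sqn (\<lambda>x. (c * f x + d * g x) - (c * h x + d * k x)) < ennreal e" .
  have c: "continuous_on UNIV (\<lambda>x. c * h x + d * k x)" using h(1) k(1) by (intro continuous_intros)
  have b: "bounded {x. c * h x + d * k x \<noteq> 0}"
    by (rule bounded_subset[of "{x. h x \<noteq> 0} \<union> {x. k x \<noteq> 0}"]) (use h(2) k(2) in auto)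
  show "\<exists>h. continuous_on UNIV h \<and> bounded {x. h x \<noteq> 0} \<and> sqn (\<lambda>x. (c * f x + d * g x) - h x) < ennreal e"
    using s c b by blast
qed

text \<open>Induction over nonnegative measurable functions, starting from indicators. The fixed
  ball keeps the sets of the base case bounded, and finiteness is inherited because summands and
  increasing approximants are dominated by the function that they build.\<close>

lemma L2_approximable_nonneg_bounded_support:
  fixes u :: "'a::euclidean_space \<Rightarrow> real"
  assumes "u \<in> borel_measurable borel" "\<And>x. 0 \<le> u x"
  shows "sqn u < \<infinity> \<Longrightarrow> (\<And>x. x \<notin> ball 0 R \<Longrightarrow> u x = 0) \<Longrightarrow> L2_approximable u"
  using assms
proof (induction rule: borel_measurable_induct_real)
  case (set A)
  have "x \<in> ball 0 R" if "x \<in> A" for x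
    using set(3)[of x] that by (cases "x \<in> ball 0 R") auto
  then have "A \<subseteq> ball 0 R" by blast
  then have "bounded A" by (rule bounded_subset[OF bounded_ball])
  then show ?case
    unfolding L2_approximable_def using approx_continuous_indicator[of A] set(1) by (metis sets_lborel)
next
  case (mult u c)
  show ?case
  proof (cases "c = 0")
    case True
    have "sqn (\<lambda>x::'a. 0 - 0) < ennreal e" if "e > 0" for e using that by (simp add: sqn_def)
    then show ?thesis unfolding L2_approximable_def using True
      by (auto intro!: exI[of _ "\<lambda>x. 0"])
  next
    case False
    have "sqn u = ennreal ((1 / c)\<^sup>2) * sqn (\<lambda>x. c * u x)"
      using False sqn_cmult[of "\<lambda>x. c * u x" "1 / c"] mult(2) by simp
    then have "sqn u < \<infinity>" using mult(5) by (simp add: ennreal_mult_less_top)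
    moreover have "u x = 0" if "x \<notin> ball 0 R" for x using mult(6)[OF that] False by simp
    ultimately have "L2_approximable u" using mult(4) by blast
    from L2_approximable_add[OF _ _ this this, of c 0] mult(2) show ?thesis by simp
  qed
next
  case (add u v)
  have "u x = 0" "v x = 0" if "x \<notin> ball 0 R" for x
    using add(2)[of x] add(4)[of x] add(9)[OF that] by simp_all
  moreover have "sqn u \<le> sqn (\<lambda>x. v x + u x)" "sqn v \<le> sqn (\<lambda>x. v x + u x)"
    using add(2,4) by (auto intro!: sqn_mono)
  then have "sqn u < \<infinity>" "sqn v < \<infinity>" using add(8) by (auto intro: le_less_trans)
  ultimately have "L2_approximable u" "L2_approximable v" using add(6,7) by auto
  from L2_approximable_add[OF _ _ this(2,1), of 1 1] add(1,3) show ?case by simp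
next
  case (seq U)
  have le: "U i x \<le> u x" for i x
  proof (rule incseq_le)
    show "incseq (\<lambda>i. U i x)" using seq(3) by (simp add: incseq_def le_fun_def)
    show "(\<lambda>i. U i x) \<longlonglongrightarrow> u x" using seq(4) by simp
  qed
  have um: "u \<in> borel_measurable borel"
    by (rule borel_measurable_LIMSEQ_real[of _ U]) (use seq(1,4) in auto)
  have "L2_approximable (U i)" for i
  proof (rule seq(5))
    have "sqn (U i) \<le> sqn u" by (rule sqn_mono) (use seq(2) le in \<open>simp add: order_trans[OF seq(2) le]\<close>)
    then show "sqn (U i) < \<infinity>" using seq(6) by (rule le_less_trans)
    show "U i x = 0" if "x \<notin> ball 0 R" for x
      using seq(2)[of i x] le[of i x] seq(7)[OF that] by simp
  qed
  moreover have "(\<lambda>i. sqn (\<lambda>x. u x - U i x)) \<longlonglongrightarrow> 0"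
  proof (rule square_integral_dominated[of _ u])
    show "\<bar>u x - U k x\<bar> \<le> \<bar>u x\<bar>" for k x using seq(2)[of k x] le[of k x] by simp
    have "(\<lambda>k. u x - U k x) \<longlonglongrightarrow> u x - u x" for x using seq(4)[of x] by (intro tendsto_intros) auto
    then show "AE x in lborel. (\<lambda>k. u x - U k x) \<longlonglongrightarrow> 0" by simp
  qed (use um seq(1,6) in auto)
  ultimately show ?case
    using L2_approximable_limit[of u U] um seq(1) by simp
qed

lemma L2_approximable_if_square_integrable:
  fixes g :: "'a::euclidean_space \<Rightarrow> real"
  assumes g[measurable]: "g \<in> borel_measurable borel" and fin: "sqn g < \<infinity>"
  shows "L2_approximable g"
proof (rule L2_approximable_limit[OF g])
  \<comment> \<open>Cutting off outside a ball and splitting into positive and negative parts leads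
    back to the nonnegative case with bounded support.\<close>
  let ?p = "\<lambda>k x. indicator (ball 0 (real k)) x * max 0 (g x)"
  let ?n = "\<lambda>k x. indicator (ball 0 (real k)) x * max 0 (- g x)"
  let ?U = "\<lambda>k x. 1 * ?p k x + (- 1) * ?n k x"
  have m: "?p k \<in> borel_measurable borel" "?n k \<in> borel_measurable borel" for k
    by (auto intro!: borel_measurable_times borel_measurable_indicator borel_measurable_max)
  then show "?U k \<in> borel_measurable borel" for k
    by (rule borel_measurable_add[OF borel_measurable_times[OF borel_measurable_const]
          borel_measurable_times[OF borel_measurable_const]])
  show "L2_approximable (?U k)" for k
  proof (rule L2_approximable_add[OF m])
    have "sqn (?p k) \<le> sqn g" "sqn (?n k) \<le> sqn g"
      by (auto intro!: sqn_mono simp: indicator_def)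
    then have "sqn (?p k) < \<infinity>" "sqn (?n k) < \<infinity>" using fin by (auto intro: le_less_trans)
    then show "L2_approximable (?p k)" "L2_approximable (?n k)"
      by (auto intro!: L2_approximable_nonneg_bounded_support[OF m(1), of _ "real k"]
          L2_approximable_nonneg_bounded_support[OF m(2), of _ "real k"])
  qed
  have U: "?U k x = indicator (ball 0 (real k)) x * g x" for k x by (auto simp: indicator_def)
  have Um: "?U k \<in> borel_measurable borel" for k by fact
  show "(\<lambda>k. sqn (\<lambda>x. g x - ?U k x)) \<longlonglongrightarrow> 0"
  proof (rule square_integral_dominated[OF _ g fin])
    show "\<bar>g x - ?U k x\<bar> \<le> \<bar>g x\<bar>" for k x unfolding U by (auto simp: indicator_def)
    show "AE x in lborel. (\<lambda>k. g x - ?U k x) \<longlonglongrightarrow> 0"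
    proof (rule AE_I2)
      fix x :: 'a
      obtain k0 where k0: "norm x < real k0" using reals_Archimedean2 by blast
      then have "\<forall>k\<ge>k0. g x - ?U k x = 0" unfolding U by (auto simp: indicator_def)
      then show "(\<lambda>k. g x - ?U k x) \<longlonglongrightarrow> 0"
        by (intro tendsto_eventually) (auto simp: eventually_sequentially)
    qed
    show "(\<lambda>x. g x - ?U k x) \<in> borel_measurable borel" for k
      by (rule borel_measurable_diff[OF g Um])
  qed
qed

text \<open>A nonempty open set is not null. Instances with a contradictory \<open>P\<close> later
  show that a set has positive measure or is dense.\<close>

lemma AE_open_ex:
  fixes U :: "'a::euclidean_space set"
  assumes "open U" "U \<noteq> {}" "AE x in lborel. x \<in> U \<longrightarrow> P x"
  shows "\<exists>x\<in>U. P x"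
proof (rule ccontr)
  assume *: "\<not> (\<exists>x\<in>U. P x)"
  from assms(3) have "AE x in lborel. x \<notin> U"
    by eventually_elim (use * in blast)
  then have "U \<in> null_sets lborel"
    using assms(1) by (subst (asm) AE_iff_null_sets[symmetric]) auto
  then have "negligible U"
    unfolding negligible_iff_null_sets by (rule null_sets_completionI)
  then show False using open_not_negligible assms by blast
qed

lemma AE_eq_continuous_on_open:
  fixes f g :: "'a::euclidean_space \<Rightarrow> real"
  assumes "open U" "continuous_on U f" "continuous_on U g" "AE x in lborel. x \<in> U \<longrightarrow> f x = g x" "x \<in> U"
  shows "f x = g x"
proof (rule ccontr)
  assume ne: "f x \<noteq> g x"
  let ?W = "U \<inter> (\<lambda>x. f x - g x) -` (- {0})"
  have "open ?W"
    by (intro continuous_open_preimage continuous_intros assms)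
  moreover have "?W \<noteq> {}" using assms(5) ne by auto
  moreover have "AE x in lborel. x \<in> ?W \<longrightarrow> f x = g x"
    using assms(4) by eventually_elim auto
  ultimately show False using AE_open_ex[of ?W "\<lambda>x. f x = g x"] by auto
qed

lemma lborel_integral_affine:
  fixes f :: "'a::euclidean_space \<Rightarrow> real"
  assumes f: "f \<in> borel_measurable borel" and c: "c \<noteq> 0"
  shows "(LINT x|lborel. f x) = \<bar>c\<bar> ^ DIM('a) * (LINT x|lborel. f (t + c *\<^sub>R x))"
proof -
  have "(LINT x|lborel. f x) = integral\<^sup>L (density (distr lborel borel (\<lambda>x. t + c *\<^sub>R x)) (\<lambda>_. \<bar>c\<bar> ^ DIM('a))) f"
    using lborel_affine[OF c, of t] by simp
  also have "\<dots> = (LINT x|distr lborel borel (\<lambda>x. t + c *\<^sub>R x). \<bar>c\<bar> ^ DIM('a) *\<^sub>R f x)"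
    using f by (intro integral_density) auto
  also have "\<dots> = (LINT x|lborel. \<bar>c\<bar> ^ DIM('a) *\<^sub>R f (t + c *\<^sub>R x))"
    using f by (intro integral_distr) auto
  finally show ?thesis by simp
qed

lemma sqn_finite_iff:
  assumes "g \<in> borel_measurable borel"
  shows "sqn g < \<infinity> \<longleftrightarrow> integrable lborel (\<lambda>x. (g x)\<^sup>2)"
  using assms unfolding sqn_def by (simp add: integrable_iff_bounded)

lemma sqn_eq_integral:
  assumes "integrable lborel (\<lambda>x. (g x)\<^sup>2)"
  shows "sqn g = ennreal (LINT x|lborel. (g x)\<^sup>2)"
  unfolding sqn_def by (rule nn_integral_eq_integral[OF assms]) simp

lemma integrable_mult_square_integrable:
  assumes [measurable]: "f \<in> borel_measurable borel" "g \<in> borel_measurable borel"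
    and "sqn f < \<infinity>" "sqn g < \<infinity>"
  shows "integrable lborel (\<lambda>x. f x * g x)"
proof (rule Bochner_Integration.integrable_bound)
  show "integrable lborel (\<lambda>x. (f x)\<^sup>2 + (g x)\<^sup>2)"
    using assms(3,4) unfolding sqn_finite_iff[OF assms(1)] sqn_finite_iff[OF assms(2)]
    by (rule Bochner_Integration.integrable_add)
  show "AE x in lborel. norm (f x * g x) \<le> norm ((f x)\<^sup>2 + (g x)\<^sup>2)"
  proof (rule AE_I2)
    fix x
    have "0 \<le> (\<bar>f x\<bar> - \<bar>g x\<bar>)\<^sup>2" by simp
    then have "2 * (\<bar>f x\<bar> * \<bar>g x\<bar>) \<le> (f x)\<^sup>2 + (g x)\<^sup>2" unfolding power2_diff by simp
    moreover have "0 \<le> \<bar>f x\<bar> * \<bar>g x\<bar>" by simp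
    ultimately have "\<bar>f x\<bar> * \<bar>g x\<bar> \<le> (f x)\<^sup>2 + (g x)\<^sup>2" by linarith
    then show "norm (f x * g x) \<le> norm ((f x)\<^sup>2 + (g x)\<^sup>2)" by (simp add: abs_mult)
  qed
qed measurable

lemma sqn_affine_finite:
  fixes g :: "'a::euclidean_space \<Rightarrow> real"
  assumes g: "g \<in> borel_measurable borel" "sqn g < \<infinity>" and c: "c \<noteq> 0"
  shows "sqn (\<lambda>x. g (t + c *\<^sub>R x)) < \<infinity>"
proof -
  have "sqn g = ennreal (\<bar>c\<bar> ^ DIM('a)) * sqn (\<lambda>x. g (t + c *\<^sub>R x))"
    unfolding sqn_def using nn_integral_lborel_affine[of "\<lambda>x. ennreal ((g x)\<^sup>2)" c t] g(1) c by simp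
  then show ?thesis using g(2) c by (auto simp: ennreal_mult_less_top)
qed

section \<open>The mollifier and its convergence in L^2\<close>

abbreviation lower :: "real ^ 'n" where "lower \<equiv> (\<chi> i. - 1)"
abbreviation upper :: "real ^ 'n" where "upper \<equiv> (\<chi> i. 1)"

definition eta :: "real ^ 'n \<Rightarrow> real" where
  "eta x = bump 1 lower upper x / (LINT y|lborel. bump 1 lower upper (y :: real ^ 'n))"

lemma integral_bump_pos: "(LINT y|lborel. bump 1 lower upper (y :: real ^ 'n)) > 0"
proof -
  have t: "bump 1 lower upper \<in> test_functions (UNIV :: (real ^ 'n) set)" by (intro bump_test_function) auto
  have i: "integrable lborel (bump 1 lower (upper :: real ^ 'n))" by (rule test_functions_integrable[OF t])
  have "(LINT y|lborel. bump 1 lower upper (y :: real ^ 'n)) \<noteq> 0"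
  proof
    assume "(LINT y|lborel. bump 1 lower upper (y :: real ^ 'n)) = 0"
    then have "AE y in lborel. bump 1 lower upper (y :: real ^ 'n) = 0"
      using integral_nonneg_eq_0_iff_AE[OF i AE_I2[OF bump_bounds(1)]] by blast
    then have *: "AE y in lborel. (y :: real ^ 'n) \<in> box lower upper \<longrightarrow> bump 1 lower upper y = 0" by auto
    have "(0 :: real ^ 'n) \<in> box lower upper" by (simp add: mem_box_cart)
    then have "box lower (upper :: real ^ 'n) \<noteq> {}" by blast
    then have "\<exists>y\<in>box lower (upper :: real ^ 'n). bump 1 lower upper y = 0"
      by (rule AE_open_ex[OF open_box _ *])
    then obtain y :: "real ^ 'n" where "y \<in> box lower upper" "bump 1 lower upper y = 0" by blast
    then show False using bump_pos[of y lower upper 1] by simp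
  qed
  moreover have "(LINT y|lborel. bump 1 lower upper (y :: real ^ 'n)) \<ge> 0"
    by (intro integral_nonneg_AE AE_I2 bump_bounds)
  ultimately show ?thesis by linarith
qed

lemma smooth_eta: "smooth (eta :: real ^ 'n \<Rightarrow> real)"
proof -
  have "smooth (\<lambda>x :: real ^ 'n. (1 / (LINT y|lborel. bump 1 lower upper (y :: real ^ 'n))) * bump 1 lower upper (1 *\<^sub>R x + 0))"
    by (intro smooth_affine smooth_bump)
  then show ?thesis unfolding eta_def[abs_def] by simp
qed

lemma eta_outside: "x \<notin> cbox lower upper \<Longrightarrow> eta x = 0"
  using box_subset_cbox[of lower upper] bump_outside[of x lower upper 1] by (auto simp: eta_def)

lemma eta_nonneg: "eta x \<ge> 0"
  unfolding eta_def by (intro divide_nonneg_pos bump_bounds integral_bump_pos)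

lemma abs_eta[simp]: "\<bar>eta x\<bar> = eta x"
  by (simp add: eta_nonneg)

lemma eta_test_function: "eta \<in> test_functions UNIV"
  by (rule test_functionsI[OF smooth_eta compact_cbox[of lower upper]]) (auto simp: eta_outside)

lemma integrable_eta: "integrable lborel eta"
  by (rule test_functions_integrable[OF eta_test_function])

lemma integral_eta: "(LINT y|lborel. eta (y :: real ^ 'n)) = 1"
proof -
  have "(LINT y|lborel. eta (y :: real ^ 'n)) = (LINT y|lborel. bump 1 lower upper (y :: real ^ 'n)) / (LINT y|lborel. bump 1 lower upper (y :: real ^ 'n))"
    unfolding eta_def by (rule integral_divide_zero)
  then show ?thesis using integral_bump_pos[where 'n = 'n] by simp
qed

lemma nn_integral_eta: "(\<integral>\<^sup>+y. ennreal (eta (y :: real ^ 'n)) \<partial>lborel) = 1"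
  by (subst nn_integral_eq_integral[OF integrable_eta AE_I2[OF eta_nonneg]]) (simp add: integral_eta)

lemma borel_eta[measurable]: "eta \<in> borel_measurable borel"
  by (rule smooth_borel[OF smooth_eta])

lemma sqn_test_function_finite: "\<phi> \<in> test_functions \<Omega> \<Longrightarrow> sqn \<phi> < \<infinity>"
  using test_functions_integrable[OF test_functions_mult[OF _ test_functions_smooth]]
  by (subst sqn_finite_iff[OF smooth_borel[OF test_functions_smooth]]) (auto simp: power2_eq_square)

text \<open>
  The dilation by \<open>a\<close> and the translation by \<open>b\<close> move the averaging cube into the interior of a convex
  set, so that no extension of \<open>g\<close> is needed near its boundary.
\<close>

definition mollify :: "real \<Rightarrow> real ^ 'n \<Rightarrow> real \<Rightarrow> (real ^ 'n \<Rightarrow> real) \<Rightarrow> real ^ 'n \<Rightarrow> real" where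
  "mollify a b r g x = (LINT y|lborel. g (a *\<^sub>R x + b + r *\<^sub>R y) * eta y)"

lemma mollify_measurable:
  fixes g :: "real ^ 'n \<Rightarrow> real"
  assumes [measurable]: "g \<in> borel_measurable borel"
  shows "mollify a b r g \<in> borel_measurable borel"
proof -
  have "(\<lambda>x. LINT y|lborel. g (a *\<^sub>R x + b + r *\<^sub>R y) * eta y) \<in> borel_measurable lborel"
    by (rule lborel.borel_measurable_lebesgue_integral) measurable
  then show ?thesis unfolding mollify_def[abs_def] by simp
qed

lemma mollify_integrable:
  fixes g :: "real ^ 'n \<Rightarrow> real"
  assumes g[measurable]: "g \<in> borel_measurable borel" "sqn g < \<infinity>" and r: "r \<noteq> 0"
  shows "integrable lborel (\<lambda>y. g (c + r *\<^sub>R y) * eta y)"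
  by (rule integrable_mult_square_integrable)
    (use sqn_affine_finite[OF g r] sqn_test_function_finite[OF eta_test_function] in \<open>measurable\<close>)

lemma mollify_diff:
  assumes "g \<in> borel_measurable borel" "sqn g < \<infinity>" "h \<in> borel_measurable borel" "sqn h < \<infinity>" "r \<noteq> 0"
  shows "mollify a b r (\<lambda>x. g x - h x) x = mollify a b r g x - mollify a b r h x"
  unfolding mollify_def
  by (subst Bochner_Integration.integral_diff[symmetric])
    (auto intro!: mollify_integrable assms simp: left_diff_distrib)

text \<open>Jensen's inequality for the probability density \<open>eta\<close>. It follows from
  Cauchy-Schwarz after splitting the weight into two factors \<open>sqrt (eta y)\<close>, one of
  which is left with total mass one.\<close>

lemma mollify_square_le:
  fixes g :: "real ^ 'n \<Rightarrow> real"
  assumes g[measurable]: "g \<in> borel_measurable borel" "sqn g < \<infinity>" and r: "r \<noteq> 0"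
  shows "ennreal ((mollify a b r g x)\<^sup>2) \<le> (\<integral>\<^sup>+y. ennreal ((g (a *\<^sub>R x + b + r *\<^sub>R y))\<^sup>2) * ennreal (eta y) \<partial>lborel)"
proof -
  let ?G = "\<lambda>y. g (a *\<^sub>R x + b + r *\<^sub>R y)"
  have [measurable]: "?G \<in> borel_measurable borel" by measurable
  have "ennreal \<bar>mollify a b r g x\<bar> \<le> (\<integral>\<^sup>+y. ennreal \<bar>?G y * eta y\<bar> \<partial>lborel)"
    using integral_norm_bound_ennreal[OF mollify_integrable[OF g r, of "a *\<^sub>R x + b"]]
    by (simp add: mollify_def)
  also have "\<dots> = (\<integral>\<^sup>+y. ennreal (\<bar>?G y\<bar> * sqrt (eta y)) * ennreal (sqrt (eta y)) \<partial>lborel)"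
    by (intro nn_integral_cong) (simp add: ennreal_mult[symmetric] eta_nonneg abs_mult mult.assoc)
  finally have "(ennreal \<bar>mollify a b r g x\<bar>)\<^sup>2 \<le> (\<integral>\<^sup>+y. ennreal (\<bar>?G y\<bar> * sqrt (eta y)) * ennreal (sqrt (eta y)) \<partial>lborel)\<^sup>2"
    by (rule power_mono) simp
  also have "\<dots> \<le> (\<integral>\<^sup>+y. (ennreal (\<bar>?G y\<bar> * sqrt (eta y)))\<^sup>2 \<partial>lborel) * (\<integral>\<^sup>+y. (ennreal (sqrt (eta y)))\<^sup>2 \<partial>(lborel :: (real ^ 'n) measure))"
    by (rule Cauchy_Schwarz_nn_integral) measurable
  also have "(\<integral>\<^sup>+y. (ennreal (sqrt (eta y)))\<^sup>2 \<partial>(lborel :: (real ^ 'n) measure)) = (\<integral>\<^sup>+y. ennreal (eta y) \<partial>(lborel :: (real ^ 'n) measure))"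
    by (intro nn_integral_cong) (simp add: ennreal_power eta_nonneg)
  also have "\<dots> = 1"
    by (rule nn_integral_eta)
  also have "(\<integral>\<^sup>+y. (ennreal (\<bar>?G y\<bar> * sqrt (eta y)))\<^sup>2 \<partial>lborel) = (\<integral>\<^sup>+y. ennreal ((?G y)\<^sup>2) * ennreal (eta y) \<partial>lborel)"
    by (intro nn_integral_cong)
      (simp add: ennreal_power ennreal_mult[symmetric] eta_nonneg power_mult_distrib)
  finally show ?thesis by (simp add: ennreal_power)
qed

text \<open>After Fubini, each dilation x \<mapsto> ax contributes the factor a^(-d) to the
  integral, and a \<ge> 1/2 bounds it by 2^d. Translations contribute nothing, and
  \<open>eta\<close> has mass one.\<close>

lemma mollify_sqn_le:
  fixes g :: "real ^ 'n \<Rightarrow> real"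
  assumes g[measurable]: "g \<in> borel_measurable borel" "sqn g < \<infinity>" and r: "r \<noteq> 0" and a: "1 / 2 \<le> a"
  shows "sqn (mollify a b r g) \<le> ennreal (2 ^ CARD('n)) * sqn g"
proof -
  have a0: "a \<noteq> 0" using a by auto
  have "sqn (mollify a b r g) \<le> (\<integral>\<^sup>+x. (\<integral>\<^sup>+y. ennreal ((g (a *\<^sub>R x + b + r *\<^sub>R y))\<^sup>2) * ennreal (eta y) \<partial>lborel) \<partial>lborel)"
    unfolding sqn_def by (intro nn_integral_mono mollify_square_le g r)
  also have "\<dots> = (\<integral>\<^sup>+y. (\<integral>\<^sup>+x. ennreal ((g (a *\<^sub>R x + b + r *\<^sub>R y))\<^sup>2) * ennreal (eta y) \<partial>lborel) \<partial>lborel)"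
    by (rule lborel_pair.Fubini'[symmetric]) measurable
  also have "\<dots> = (\<integral>\<^sup>+y. (\<integral>\<^sup>+x. ennreal ((g (b + r *\<^sub>R y + a *\<^sub>R x))\<^sup>2) \<partial>lborel) * ennreal (eta y) \<partial>lborel)"
  proof (rule nn_integral_cong)
    fix y :: "real ^ 'n"
    have "(\<lambda>x. ennreal ((g (a *\<^sub>R x + b + r *\<^sub>R y))\<^sup>2)) \<in> borel_measurable lborel" by measurable
    from nn_integral_multc[OF this, of "ennreal (eta y)"]
    show "(\<integral>\<^sup>+x. ennreal ((g (a *\<^sub>R x + b + r *\<^sub>R y))\<^sup>2) * ennreal (eta y) \<partial>lborel)
      = (\<integral>\<^sup>+x. ennreal ((g (b + r *\<^sub>R y + a *\<^sub>R x))\<^sup>2) \<partial>lborel) * ennreal (eta y)"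
      by (simp add: ac_simps)
  qed
  finally have "ennreal (\<bar>a\<bar> ^ CARD('n)) * sqn (mollify a b r g)
    \<le> ennreal (\<bar>a\<bar> ^ CARD('n)) * (\<integral>\<^sup>+y. (\<integral>\<^sup>+x. ennreal ((g (b + r *\<^sub>R y + a *\<^sub>R x))\<^sup>2) \<partial>lborel) * ennreal (eta y) \<partial>lborel)"
    by (rule mult_left_mono) simp
  also have "\<dots> = (\<integral>\<^sup>+y. (ennreal (\<bar>a\<bar> ^ CARD('n)) * (\<integral>\<^sup>+x. ennreal ((g (b + r *\<^sub>R y + a *\<^sub>R x))\<^sup>2) \<partial>lborel)) * ennreal (eta y) \<partial>lborel)"
    by (subst nn_integral_cmult[symmetric]) (measurable, simp add: mult.assoc)
  also have "\<dots> = (\<integral>\<^sup>+y. sqn g * ennreal (eta y) \<partial>(lborel :: (real ^ 'n) measure))"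
  proof (rule nn_integral_cong)
    fix y :: "real ^ 'n"
    show "(ennreal (\<bar>a\<bar> ^ CARD('n)) * (\<integral>\<^sup>+x. ennreal ((g (b + r *\<^sub>R y + a *\<^sub>R x))\<^sup>2) \<partial>lborel)) * ennreal (eta y) = sqn g * ennreal (eta y)"
      using nn_integral_lborel_affine[of "\<lambda>x. ennreal ((g x)\<^sup>2)" a "b + r *\<^sub>R y"] a0 by (simp add: sqn_def)
  qed
  also have "\<dots> = sqn g"
    by (subst nn_integral_cmult) (auto simp: nn_integral_eta)
  finally have *: "ennreal (\<bar>a\<bar> ^ CARD('n)) * sqn (mollify a b r g) \<le> sqn g" .
  have "1 \<le> (2 * a) ^ CARD('n)" using a by (intro one_le_power) simp
  then have "1 \<le> ennreal (2 ^ CARD('n) * \<bar>a\<bar> ^ CARD('n))" using a by (simp add: power_mult_distrib)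
  then have "1 * sqn (mollify a b r g) \<le> ennreal (2 ^ CARD('n) * \<bar>a\<bar> ^ CARD('n)) * sqn (mollify a b r g)"
    by (rule mult_right_mono) simp
  also have "\<dots> = ennreal (2 ^ CARD('n)) * (ennreal (\<bar>a\<bar> ^ CARD('n)) * sqn (mollify a b r g))"
    by (simp add: ennreal_mult mult.assoc)
  also have "\<dots> \<le> ennreal (2 ^ CARD('n)) * sqn g"
    by (rule mult_left_mono[OF *]) simp
  finally show ?thesis by simp
qed

lemma mollify_tendsto_continuous:
  fixes h :: "real ^ 'n \<Rightarrow> real"
  assumes h: "continuous_on UNIV h" "\<And>x. \<bar>h x\<bar> \<le> C"
    and a: "a \<longlonglongrightarrow> 1" and b: "b \<longlonglongrightarrow> 0" and r: "r \<longlonglongrightarrow> 0"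
  shows "(\<lambda>k. mollify (a k) (b k) (r k) h x) \<longlonglongrightarrow> h x"
proof -
  have [measurable]: "h \<in> borel_measurable borel" using h(1) by (rule borel_measurable_continuous_onI)
  have C: "C \<ge> 0" using h(2)[of 0] by simp
  have "(\<lambda>k. LINT y|lborel. h (a k *\<^sub>R x + b k + r k *\<^sub>R y) * eta y) \<longlonglongrightarrow> (LINT (y :: real ^ 'n)|lborel. h x * eta y)"
  proof (rule integral_dominated_convergence)
    show "integrable lborel (\<lambda>y :: real ^ 'n. C * eta y)" by (intro integrable_mult_right integrable_eta)
    show "AE y in lborel. (\<lambda>k. h (a k *\<^sub>R x + b k + r k *\<^sub>R y) * eta y) \<longlonglongrightarrow> h x * eta y"
    proof (intro AE_I2 tendsto_mult tendsto_const)
      fix y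
      have "(\<lambda>k. a k *\<^sub>R x + b k + r k *\<^sub>R y) \<longlonglongrightarrow> 1 *\<^sub>R x + 0 + 0 *\<^sub>R y"
        by (intro tendsto_intros a b r)
      then have "(\<lambda>k. a k *\<^sub>R x + b k + r k *\<^sub>R y) \<longlonglongrightarrow> x" by simp
      moreover have "isCont h x" using h(1) by (simp add: continuous_on_eq_continuous_at)
      ultimately show "(\<lambda>k. h (a k *\<^sub>R x + b k + r k *\<^sub>R y)) \<longlonglongrightarrow> h x"
        using isCont_tendsto_compose by blast
    qed
    show "AE y in lborel. norm (h (a k *\<^sub>R x + b k + r k *\<^sub>R y) * eta y) \<le> C * eta y" for k
      using mult_right_mono[OF h(2) eta_nonneg] by (intro AE_I2) (simp add: abs_mult)
  qed measurable
  then show ?thesis by (simp add: mollify_def integral_eta)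
qed

lemma mollify_bounded:
  fixes h :: "real ^ 'n \<Rightarrow> real"
  assumes [measurable]: "h \<in> borel_measurable borel" and h: "\<And>x. \<bar>h x\<bar> \<le> C"
  shows "\<bar>mollify a b r h x\<bar> \<le> C"
proof -
  have C: "C \<ge> 0" using h[of 0] by simp
  have i: "integrable lborel (\<lambda>y :: real ^ 'n. C * eta y)" by (intro integrable_mult_right integrable_eta)
  have le: "\<bar>h (a *\<^sub>R x + b + r *\<^sub>R y) * eta y\<bar> \<le> C * eta y" for y
    using mult_right_mono[OF h eta_nonneg] by (simp add: abs_mult)
  have i2: "integrable lborel (\<lambda>y. h (a *\<^sub>R x + b + r *\<^sub>R y) * eta y)"
    by (rule Bochner_Integration.integrable_bound[OF i])
      (use le in \<open>measurable, auto intro!: AE_I2 order_trans[OF le]\<close>)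
  have "\<bar>mollify a b r h x\<bar> \<le> (LINT y|lborel. \<bar>h (a *\<^sub>R x + b + r *\<^sub>R y) * eta y\<bar>)"
    unfolding mollify_def by (rule integral_abs_bound)
  also have "\<dots> \<le> (LINT (y :: real ^ 'n)|lborel. C * eta y)"
    by (intro integral_mono integrable_abs i2 i le)
  also have "\<dots> = C" by (simp add: integral_eta)
  finally show ?thesis .
qed

lemma ennreal_tendsto_0I:
  fixes f :: "'a \<Rightarrow> ennreal"
  assumes "\<And>e::real. e > 0 \<Longrightarrow> eventually (\<lambda>k. f k < ennreal e) F"
  shows "(f \<longlongrightarrow> 0) F"
proof (rule order_tendstoI)
  fix u :: ennreal assume "0 < u"
  then obtain v where v: "0 < v" "v < u" using dense by blast
  then have "v < top" using less_trans top.not_eq_extremum by blast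
  then obtain e where e: "v = ennreal e" "e \<ge> 0" by (cases v) auto
  then have "e > 0" using v(1) by (simp add: order_less_le)
  from assms[OF this] show "eventually (\<lambda>k. f k < u) F"
    by eventually_elim (use v(2) e in auto)
qed auto

text \<open>A density argument: \<open>g\<close> is replaced by a continuous \<open>h\<close> of
  bounded support. The bound \<open>mollify_sqn_le\<close> controls the mollified difference
  uniformly in the index, and for \<open>h\<close> the pointwise convergence is dominated.\<close>

lemma mollify_tendsto_L2:
  fixes g :: "real ^ 'n \<Rightarrow> real"
  assumes g[measurable]: "g \<in> borel_measurable borel" "sqn g < \<infinity>"
    and a: "a \<longlonglongrightarrow> 1" "\<And>k. 1 / 2 \<le> a k" and b: "b \<longlonglongrightarrow> 0" and r: "r \<longlonglongrightarrow> 0" "\<And>k. r k \<noteq> 0"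
  shows "(\<lambda>k. sqn (\<lambda>x. mollify (a k) (b k) (r k) g x - g x)) \<longlonglongrightarrow> 0"
proof (rule ennreal_tendsto_0I)
  fix e :: real assume e: "e > 0"
  define D where "D = (2::real) ^ CARD('n)"
  have D: "D \<ge> 1" by (simp add: D_def)
  \<comment> \<open>The contributions below stay under 2Dd + 8d, which this choice makes equal to
    \<open>e\<close>.\<close>
  define d where "d = e / (2 * D + 8)"
  have d: "d > 0" using e D by (simp add: d_def)
  obtain h where h: "continuous_on UNIV h" "bounded {x. h x \<noteq> 0}" "sqn (\<lambda>x. g x - h x) < ennreal d"
    using L2_approximable_if_square_integrable[OF g] d unfolding L2_approximable_def by blast
  have [measurable]: "h \<in> borel_measurable borel" using h(1) by (rule borel_measurable_continuous_onI)
  obtain R where R: "{x. h x \<noteq> 0} \<subseteq> ball 0 R" using bounded_subset_ballD[OF h(2), of 0] by auto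
  have R0: "h x = 0" if "norm x \<ge> R" for x using R that by (force simp: subset_iff)
  have "compact (h ` cball 0 R)"
    by (intro compact_continuous_image compact_cball) (rule continuous_on_subset[OF h(1)], simp)
  then obtain C0 where C0: "\<forall>y\<in>h ` cball 0 R. norm y \<le> C0" using compact_imp_bounded bounded_iff by blast
  define C where "C = max C0 0"
  have C: "\<bar>h x\<bar> \<le> C" for x
  proof (cases "norm x \<le> R")
    case True
    then have "norm (h x) \<le> C0" using C0 by simp
    then show ?thesis by (simp add: C_def)
  next
    case False
    then show ?thesis using R0[of x] by (simp add: C_def)
  qed
  have sh: "sqn h < \<infinity>"
  proof -
    have "integrable lborel (\<lambda>x. (h x)\<^sup>2)"
    proof (rule integrable_bounded_support)
      show "\<bar>(h x)\<^sup>2\<bar> \<le> C\<^sup>2" for x using C[of x] by (simp add: abs_le_square_iff[symmetric])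
    qed (use h(2) in auto)
    then show ?thesis by (subst sqn_finite_iff) auto
  qed
  obtain B where B: "\<And>k. norm (b k) \<le> B"
    using convergent_imp_Bseq[of b] b unfolding Bseq_def convergent_def by blast
  obtain Q where Q: "\<And>k. norm (r k) \<le> Q"
    using convergent_imp_Bseq[of r] r(1) unfolding Bseq_def convergent_def by blast
  have Q0: "Q \<ge> 0" using Q[of 0] by simp
  obtain N where N: "\<And>y. y \<in> cbox lower (upper :: real ^ 'n) \<Longrightarrow> norm y \<le> N"
    using bounded_cbox[of lower "upper :: real ^ 'n"] unfolding bounded_iff by blast
  have N0: "N \<ge> 0" using N[of 0] by (simp add: mem_box_cart)
  have tri: "norm u \<le> norm (u + v + w) + norm v + norm w" for u v w :: "real ^ 'n" by norm
  \<comment> \<open>The dilation shrinks a norm to no less than half, while the shift and the kernel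
    displace by at most B + QN. Beyond this radius \<open>h\<close> and all its mollifications
    vanish.\<close>
  define R' where "R' = max R (2 * (R + B + Q * N))"
  have far: "mollify (a k) (b k) (r k) h x - h x = 0" if x: "norm x > R'" for k x
  proof -
    have "h (a k *\<^sub>R x + b k + r k *\<^sub>R y) * eta y = 0" for y
    proof (cases "y \<in> cbox lower upper")
      case True
      have "norm (r k *\<^sub>R y) \<le> Q * N" using Q[of k] N[OF True] Q0 by (simp add: mult_mono)
      moreover have "norm (a k *\<^sub>R x) \<ge> norm x / 2" using a(2)[of k] mult_right_mono[OF a(2)[of k], of "norm x"] by simp
      moreover have "norm x / 2 > R + B + Q * N" using x by (simp add: R'_def)
      moreover have "norm (a k *\<^sub>R x) \<le> norm (a k *\<^sub>R x + b k + r k *\<^sub>R y) + norm (b k) + norm (r k *\<^sub>R y)"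
        by (rule tri)
      ultimately have "norm (a k *\<^sub>R x + b k + r k *\<^sub>R y) \<ge> R" using B[of k] by linarith
      then show ?thesis using R0 by simp
    next
      case False
      then show ?thesis by (simp add: eta_outside)
    qed
    then have "(\<lambda>y. h (a k *\<^sub>R x + b k + r k *\<^sub>R y) * eta y) = (\<lambda>y. 0)" by (rule ext)
    then have "mollify (a k) (b k) (r k) h x = 0" unfolding mollify_def by (simp only: integral_zero)
    moreover have "h x = 0" using x R0[of x] by (simp add: R'_def)
    ultimately show ?thesis by simp
  qed
  have "(\<lambda>k. sqn (\<lambda>x. mollify (a k) (b k) (r k) h x - h x)) \<longlonglongrightarrow> 0"
  proof (rule square_integral_dominated)
    let ?w = "\<lambda>x :: real ^ 'n. 2 * C * indicator (cball 0 R') x :: real"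
    show wm: "?w \<in> borel_measurable borel"
      by (intro borel_measurable_times borel_measurable_const borel_measurable_indicator) simp
    have "integrable lborel (\<lambda>x. (?w x)\<^sup>2)"
      by (rule integrable_bounded_support[of _ "cball 0 R'" "(2 * C)\<^sup>2"])
        (auto simp: indicator_def intro: borel_measurable_power wm)
    then show "sqn ?w < \<infinity>" by (subst sqn_finite_iff[OF wm])
    show "\<bar>mollify (a k) (b k) (r k) h x - h x\<bar> \<le> \<bar>?w x\<bar>" for k x
    proof (cases "norm x > R'")
      case True
      then show ?thesis using far by simp
    next
      case False
      have "h \<in> borel_measurable borel" by measurable
      from mollify_bounded[OF this C, of "a k" "b k" "r k" x] C[of x]
      have "\<bar>mollify (a k) (b k) (r k) h x - h x\<bar> \<le> 2 * C" "C \<ge> 0" by linarith+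
      then show ?thesis using False by (simp add: indicator_def)
    qed
    show "AE x in lborel. (\<lambda>k. mollify (a k) (b k) (r k) h x - h x) \<longlonglongrightarrow> 0"
      by (intro AE_I2 LIM_zero mollify_tendsto_continuous[OF h(1) C a(1) b r(1)])
    show "(\<lambda>x. mollify (a k) (b k) (r k) h x - h x) \<in> borel_measurable borel" for k
      using borel_measurable_continuous_onI[OF h(1)] by (intro borel_measurable_diff mollify_measurable)
  qed
  then have "eventually (\<lambda>k. sqn (\<lambda>x. mollify (a k) (b k) (r k) h x - h x) < ennreal d) sequentially"
    using d by (intro order_tendstoD(2)) auto
  then show "eventually (\<lambda>k. sqn (\<lambda>x. mollify (a k) (b k) (r k) g x - g x) < ennreal e) sequentially"
  proof eventually_elim
    case (elim k)
    let ?T = "mollify (a k) (b k) (r k)"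
    have dm[measurable]: "(\<lambda>x. g x - h x) \<in> borel_measurable borel" by measurable
    have ds: "sqn (\<lambda>x. g x - h x) < \<infinity>" using h(3) by (rule less_trans) simp
    have hm: "h \<in> borel_measurable borel" by measurable
    have Tm[measurable]: "?T g \<in> borel_measurable borel" "?T h \<in> borel_measurable borel" "?T (\<lambda>x. g x - h x) \<in> borel_measurable borel"
      by (rule mollify_measurable; fact)+
    have "sqn (\<lambda>x. ?T g x - g x) = sqn (\<lambda>x. ?T (\<lambda>x. g x - h x) x + (?T h x - g x))"
      using mollify_diff[OF g hm sh r(2), of "a k" "b k"] by simp
    also have "\<dots> \<le> 2 * sqn (?T (\<lambda>x. g x - h x)) + 2 * sqn (\<lambda>x. ?T h x - g x)"
      by (rule sqn_add) measurable
    also have "sqn (\<lambda>x. ?T h x - g x) = sqn (\<lambda>x. (?T h x - h x) + (h x - g x))" by simp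
    also have "\<dots> \<le> 2 * sqn (\<lambda>x. ?T h x - h x) + 2 * sqn (\<lambda>x. h x - g x)"
      by (rule sqn_add) measurable
    also have "sqn (\<lambda>x. h x - g x) = sqn (\<lambda>x. g x - h x)" by (rule sqn_minus_commute)
    finally have "sqn (\<lambda>x. ?T g x - g x) \<le> 2 * sqn (?T (\<lambda>x. g x - h x)) + 2 * (2 * sqn (\<lambda>x. ?T h x - h x) + 2 * sqn (\<lambda>x. g x - h x))"
      by (simp add: add_mono mult_left_mono)
    also have "\<dots> \<le> 2 * (ennreal D * sqn (\<lambda>x. g x - h x)) + 2 * (2 * sqn (\<lambda>x. ?T h x - h x) + 2 * sqn (\<lambda>x. g x - h x))"
      unfolding D_def by (intro add_mono mult_left_mono mollify_sqn_le dm ds r(2) a(2)) auto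
    also have "\<dots> \<le> 2 * (ennreal D * ennreal d) + 2 * (2 * sqn (\<lambda>x. ?T h x - h x) + 2 * ennreal d)"
      using h(3) by (intro add_mono mult_left_mono) auto
    also have "\<dots> < ennreal (2 * D * d) + ennreal (8 * d)"
    proof -
      obtain s where s: "sqn (\<lambda>x. ?T h x - h x) = ennreal s" "s \<ge> 0" "s < d"
        using elim d by (cases "sqn (\<lambda>x. ?T h x - h x)") (auto simp: ennreal_less_iff)
      have "2 * (ennreal D * ennreal d) + 2 * (2 * ennreal s + 2 * ennreal d) = ennreal (2 * (D * d) + 2 * (2 * s + 2 * d))"
        using D d s(2) by (simp add: ennreal_plus ennreal_mult)
      also have "\<dots> < ennreal (2 * D * d + 8 * d)"
      proof (rule ennreal_lessI)
        have "D * d > 0" using D d by simp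
        then show "0 < 2 * D * d + 8 * d" using d by linarith
        show "2 * (D * d) + 2 * (2 * s + 2 * d) < 2 * D * d + 8 * d" using s(3) by (simp add: algebra_simps)
      qed
      also have "\<dots> = ennreal (2 * D * d) + ennreal (8 * d)" using D d by (intro ennreal_plus) auto
      finally show ?thesis unfolding s(1) .
    qed
    also have "\<dots> = ennreal e"
    proof -
      have "2 * D + 8 \<noteq> 0" using D by linarith
      then have "(2 * D + 8) * d = e" by (simp add: d_def)
      then have "2 * D * d + 8 * d = e" by (simp only: distrib_right)
      then show ?thesis using D d by (simp flip: ennreal_plus)
    qed
    finally show ?case .
  qed
qed

section \<open>Mollification as integration against a test function\<close>

definition kern :: "real ^ 'n \<Rightarrow> real \<Rightarrow> real ^ 'n \<Rightarrow> real" where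
  "kern b r w = (1 / r ^ CARD('n)) * eta ((1 / r) *\<^sub>R w + (- (1 / r)) *\<^sub>R b)"

lemma smooth_kern: "smooth (kern b r)"
  unfolding kern_def[abs_def] by (rule smooth_affine[OF smooth_eta])

text \<open>Substituting z = ax + b + ry moves \<open>x\<close> from the argument of
  \<open>g\<close> into a smooth kernel. Weak derivatives of \<open>g\<close> can then be reached by
  differentiating the kernel.\<close>

lemma mollify_kernel:
  fixes g :: "real ^ 'n \<Rightarrow> real"
  assumes g[measurable]: "g \<in> borel_measurable borel" and r: "r > 0"
  shows "mollify a b r g x = (LINT z|lborel. g z * kern b r (z - a *\<^sub>R x))"
proof -
  have [measurable]: "kern b r \<in> borel_measurable borel" by (rule smooth_borel[OF smooth_kern])
  have "(LINT z|lborel. g z * kern b r (z - a *\<^sub>R x))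
      = \<bar>r\<bar> ^ DIM(real ^ 'n) * (LINT y|lborel. g (a *\<^sub>R x + b + r *\<^sub>R y) * kern b r (a *\<^sub>R x + b + r *\<^sub>R y - a *\<^sub>R x))"
    using r by (intro lborel_integral_affine) auto
  also have "\<dots> = r ^ CARD('n) * (LINT y|lborel. g (a *\<^sub>R x + b + r *\<^sub>R y) * ((1 / r ^ CARD('n)) * eta y))"
  proof -
    have "kern b r (a *\<^sub>R x + b + r *\<^sub>R y - a *\<^sub>R x) = (1 / r ^ CARD('n)) * eta y" for y
    proof -
      have "(1 / r) *\<^sub>R (a *\<^sub>R x + b + r *\<^sub>R y - a *\<^sub>R x) + (- (1 / r)) *\<^sub>R b = y"
        using r by (simp add: algebra_simps)
      then show ?thesis unfolding kern_def by simp
    qed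
    then show ?thesis using r by simp
  qed
  also have "\<dots> = mollify a b r g x"
    using r by (simp add: mollify_def mult.left_commute)
  finally show ?thesis by simp
qed

lemma kern_test_function:
  fixes b q :: "real ^ 'n"
  assumes r: "r > 0" and \<Omega>: "\<And>y. y \<in> cbox lower upper \<Longrightarrow> q + b + r *\<^sub>R y \<in> \<Omega>"
  shows "(\<lambda>z. kern b r (z - q)) \<in> test_functions \<Omega>"
proof (rule test_functionsI[of _ "(\<lambda>y. q + b + r *\<^sub>R y) ` cbox lower upper"])
  have "smooth (\<lambda>z. 1 * kern b r (1 *\<^sub>R z + (- q)))" by (rule smooth_affine[OF smooth_kern])
  then show "smooth (\<lambda>z. kern b r (z - q))" by simp
  show "compact ((\<lambda>y. q + b + r *\<^sub>R y) ` cbox lower upper)"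
    by (intro compact_continuous_image continuous_intros compact_cbox)
  show "(\<lambda>y. q + b + r *\<^sub>R y) ` cbox lower upper \<subseteq> \<Omega>" using \<Omega> by blast
  fix z assume z: "z \<notin> (\<lambda>y. q + b + r *\<^sub>R y) ` cbox lower upper"
  let ?y = "(1 / r) *\<^sub>R (z - q) + (- (1 / r)) *\<^sub>R b"
  have "z = q + b + r *\<^sub>R ?y" using r by (simp add: algebra_simps)
  then have "?y \<notin> cbox lower upper" using z by blast
  then have "eta ?y = 0" by (rule eta_outside)
  then show "kern b r (z - q) = 0" by (simp only: kern_def mult_zero_right)
qed

lemma kern_test_UNIV: "r > 0 \<Longrightarrow> kern b r \<in> test_functions UNIV"
  using kern_test_function[of r 0 b UNIV] by simp

lemma partial_deriv_translate:
  assumes "smooth g"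
  shows "partial_deriv i (\<lambda>z. g (z - q)) = (\<lambda>z. partial_deriv i g (z - q))"
  using partial_deriv_affine(2)[OF assms, of i 1 1 "- q"] by (simp add: fun_eq_iff)

text \<open>
  Taylor's formula with the substitution \<open>t = s\<^sup>2\<close> in the integral remainder: then the weight \<open>s\<^sup>6\<close>
  of the squared remainder absorbs the factor \<open>s\<^sup>-\<^sup>2\<^sup>d\<close> of the dilation by \<open>s\<^sup>2\<close> for \<open>d \<le> 3\<close>.
\<close>

lemma taylor_smooth_line:
  fixes \<kappa> :: "real ^ 'n \<Rightarrow> real"
  assumes \<kappa>: "smooth \<kappa>"
  shows "(LINT s|lborel. 2 * s ^ 3 * (\<Sum>i\<in>UNIV. \<Sum>j\<in>UNIV. Q $ i * Q $ j * partial_deriv i (partial_deriv j \<kappa>) (P + s\<^sup>2 *\<^sub>R Q)) * indicator {0..1} s)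
    = (\<Sum>i\<in>UNIV. Q $ i * partial_deriv i \<kappa> (P + Q)) - \<kappa> (P + Q) + \<kappa> P"
proof -
  let ?g = "\<lambda>s::real. P + s\<^sup>2 *\<^sub>R Q"
  \<comment> \<open>With \<phi>(t) = \<kappa>(P + tQ) this is t \<phi>'(t) - \<phi>(t) at t = s^2.
    The first-order terms cancel on differentiation, so its derivative in s is 2 s^3
    \<phi>''(s^2).\<close>
  let ?F = "\<lambda>s. s\<^sup>2 * (\<Sum>j\<in>UNIV. Q $ j * partial_deriv j \<kappa> (?g s)) - \<kappa> (?g s)"
  let ?f = "\<lambda>s. 2 * s ^ 3 * (\<Sum>i\<in>UNIV. \<Sum>j\<in>UNIV. Q $ i * Q $ j * partial_deriv i (partial_deriv j \<kappa>) (?g s))"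
  have g: "(?g has_vector_derivative (2 * s) *\<^sub>R Q) (at s)" for s
    by (auto intro!: derivative_eq_intros simp: has_vector_derivative_def)
  have line: "((\<lambda>s. \<psi> (?g s)) has_real_derivative 2 * s * (\<Sum>i\<in>UNIV. Q $ i * partial_deriv i \<psi> (?g s))) (at s)"
    if "smooth \<psi>" for \<psi> s
    using smooth_line_derivative[OF that g] by (simp add: sum_distrib_left mult.assoc)
  have F: "(?F has_real_derivative ?f s) (at s)" for s
  proof -
    have "((\<lambda>s. \<Sum>j\<in>UNIV. Q $ j * partial_deriv j \<kappa> (?g s)) has_real_derivative
        (\<Sum>j\<in>UNIV. Q $ j * (2 * s * (\<Sum>i\<in>UNIV. Q $ i * partial_deriv i (partial_deriv j \<kappa>) (?g s))))) (at s)"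
      by (intro DERIV_sum DERIV_cmult line smooth_partial_deriv \<kappa>)
    moreover have "((\<lambda>s::real. s\<^sup>2) has_real_derivative 2 * s) (at s)"
      by (auto intro!: derivative_eq_intros)
    ultimately have "(?F has_real_derivative
        2 * s * (\<Sum>j\<in>UNIV. Q $ j * partial_deriv j \<kappa> (?g s))
        + (\<Sum>j\<in>UNIV. Q $ j * (2 * s * (\<Sum>i\<in>UNIV. Q $ i * partial_deriv i (partial_deriv j \<kappa>) (?g s)))) * s\<^sup>2
        - 2 * s * (\<Sum>i\<in>UNIV. Q $ i * partial_deriv i \<kappa> (?g s))) (at s)"
      by (intro DERIV_diff DERIV_mult line \<kappa>)
    moreover have "(\<Sum>j\<in>UNIV. Q $ j * (2 * s * (\<Sum>i\<in>UNIV. Q $ i * partial_deriv i (partial_deriv j \<kappa>) (?g s)))) * s\<^sup>2 = ?f s"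
    proof -
      have "(\<Sum>i\<in>UNIV. \<Sum>j\<in>UNIV. Q $ i * Q $ j * partial_deriv i (partial_deriv j \<kappa>) (?g s))
          = (\<Sum>j\<in>UNIV. \<Sum>i\<in>UNIV. Q $ i * Q $ j * partial_deriv i (partial_deriv j \<kappa>) (?g s))"
        by (rule sum.swap)
      then show ?thesis
        by (simp add: sum_distrib_left sum_distrib_right power2_eq_square power3_eq_cube ac_simps)
    qed
    ultimately show ?thesis by simp
  qed
  have "isCont ?f s" for s
  proof -
    have "continuous_on UNIV (\<lambda>s. \<psi> (?g s))" if "smooth \<psi>" for \<psi>
      by (rule continuous_on_compose2[OF smooth_continuous[OF that, of UNIV]]) (auto intro!: continuous_intros)
    then have "continuous_on UNIV (\<lambda>s. partial_deriv i (partial_deriv j \<kappa>) (?g s))" for i j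
      by (simp add: smooth_partial_deriv \<kappa>)
    then have "continuous_on UNIV ?f" by (intro continuous_intros)
    then show ?thesis by (simp add: continuous_on_eq_continuous_at)
  qed
  from integral_FTC_Icc_real[of 0 1 ?F ?f, OF _ F this]
  show ?thesis by simp
qed

lemma integrable_unit_interval:
  fixes f :: "real \<Rightarrow> real"
  assumes [measurable]: "f \<in> borel_measurable borel" and f: "\<And>s. \<bar>f s\<bar> \<le> B"
  shows "integrable lborel (\<lambda>s. 2 * s ^ 3 * f s * indicator {0..1} s)"
proof (rule integrable_bounded_support)
  show "bounded {0..1::real}" by simp
  have B: "B \<ge> 0" using f[of 0] by simp
  show "\<bar>2 * s ^ 3 * f s * indicator {0..1} s\<bar> \<le> 2 * B" for s
  proof (cases "s \<in> {0..1}")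
    case True
    then have "\<bar>s ^ 3\<bar> \<le> 1" by (simp add: power_le_one)
    then have "\<bar>s ^ 3\<bar> * \<bar>f s\<bar> \<le> 1 * B" using f by (intro mult_mono) auto
    then show ?thesis using True by (simp add: abs_mult)
  next
    case False
    then show ?thesis using B by simp
  qed
qed auto

text \<open>Each derivative of the kernel in its Taylor expansion is shifted onto \<open>v\<close>
  by the weak identities. For this the translated kernels have to be test functions in \<Omega>
  along the whole segment, which is the hypothesis \<open>test\<close>. The kernel is displaced by
  \<alpha> times the displacement of the point, hence the powers of \<alpha>.\<close>

lemma mollified_taylor:
  fixes v :: "real ^ 'n \<Rightarrow> real"
  assumes v[measurable]: "v \<in> borel_measurable borel" "integrable lborel v"
    and v1: "\<And>i. v1 i \<in> borel_measurable borel" and v2: "\<And>i j. v2 i j \<in> borel_measurable borel"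
    and r: "r > 0"
    and test: "\<And>s. s \<in> {0..1} \<Longrightarrow> (\<lambda>z. kern b r (z - \<alpha> *\<^sub>R (a + s\<^sup>2 *\<^sub>R (x - a)))) \<in> test_functions \<Omega>"
    and w1: "\<And>\<phi> i. \<phi> \<in> test_functions \<Omega> \<Longrightarrow> (LINT z|lborel. v z * partial_deriv i \<phi> z) = - (LINT z|lborel. v1 i z * \<phi> z)"
    and w2: "\<And>\<phi> i j. \<phi> \<in> test_functions \<Omega> \<Longrightarrow> (LINT z|lborel. v z * partial_deriv i (partial_deriv j \<phi>) z) = (LINT z|lborel. v2 i j z * \<phi> z)"
  shows "mollify \<alpha> b r v a = mollify \<alpha> b r v x - \<alpha> * (\<Sum>i\<in>UNIV. (x - a) $ i * mollify \<alpha> b r (v1 i) x)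
    + \<alpha>\<^sup>2 * (\<Sum>i\<in>UNIV. \<Sum>j\<in>UNIV. (x - a) $ i * (x - a) $ j *
        (LINT s|lborel. 2 * s ^ 3 * mollify \<alpha> b r (v2 i j) (a + s\<^sup>2 *\<^sub>R (x - a)) * indicator {0..1} s))"
proof -
  let ?\<kappa> = "kern b r"
  let ?d = "x - a"
  let ?\<gamma> = "\<lambda>s. a + s\<^sup>2 *\<^sub>R (x - a)"
  let ?D = "\<lambda>i j. partial_deriv i (partial_deriv j ?\<kappa>)"
  let ?J = "\<lambda>i j z. LINT s|lborel. 2 * s ^ 3 * ?D i j (z - \<alpha> *\<^sub>R ?\<gamma> s) * indicator {0..1} s"
  have sm: "smooth (partial_deriv i ?\<kappa>)" "smooth (?D i j)" for i j
    by (auto intro: smooth_partial_deriv smooth_kern)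
  have D[measurable]: "?D i j \<in> borel_measurable borel" "partial_deriv i ?\<kappa> \<in> borel_measurable borel" "?\<kappa> \<in> borel_measurable borel" for i j
    by (auto intro: smooth_borel sm smooth_kern)
  have td: "?D i j \<in> test_functions UNIV" "partial_deriv i ?\<kappa> \<in> test_functions UNIV" for i j
    by (intro test_functions_partial_deriv kern_test_UNIV r)+
  have bd: "\<exists>B. \<forall>w. \<bar>\<psi> w\<bar> \<le> B" if "\<psi> \<in> test_functions UNIV" for \<psi> :: "real ^ 'n \<Rightarrow> real"
    using test_functions_bounded[OF that] by metis
  have int: "integrable lborel (\<lambda>z. v z * \<psi> (z - q))" if t: "\<psi> \<in> test_functions UNIV" for \<psi> q
  proof -
    obtain B where B: "\<forall>w. \<bar>\<psi> w\<bar> \<le> B" using bd[OF t] by blast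
    have [measurable]: "\<psi> \<in> borel_measurable borel" using t by (intro smooth_borel test_functions_smooth)
    show ?thesis by (rule integrable_mult_bounded[OF v(2), of _ B]) (use B in auto)
  qed
  \<comment> \<open>Fubini exchanges the integral along the segment with the one over space. The
    second derivatives of the kernel are bounded, so integrability of \<open>v\<close> makes the
    product integrable.\<close>
  have intJ: "integrable lborel (\<lambda>z. v z * ?J i j z)"
    and fub: "(LINT z|lborel. v z * ?J i j z) = (LINT s|lborel. 2 * s ^ 3 * (LINT z|lborel. v z * ?D i j (z - \<alpha> *\<^sub>R ?\<gamma> s)) * indicator {0..1} s)" for i j
  proof -
    obtain B where B: "\<forall>w. \<bar>?D i j w\<bar> \<le> B" using bd[OF td(1)] by blast
    let ?h = "\<lambda>z s. 2 * s ^ 3 * ?D i j (z - \<alpha> *\<^sub>R ?\<gamma> s) * indicator {0..1} s"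
    have hs: "integrable lborel (?h z)" for z
      by (rule integrable_unit_interval[of _ B]) (use B in auto)
    have hb: "(LINT s|lborel. \<bar>?h z s\<bar>) \<le> 2 * B" for z
    proof -
      have "(LINT s|lborel. \<bar>?h z s\<bar>) \<le> (LINT s|lborel. 2 * B * indicator {0..1::real} s)"
      proof (rule integral_mono)
        show "integrable lborel (\<lambda>s. \<bar>?h z s\<bar>)" using hs by (rule integrable_abs)
        show "\<bar>?h z s\<bar> \<le> 2 * B * indicator {0..1} s" for s
        proof (cases "s \<in> {0..1}")
          case True
          then have "\<bar>s ^ 3\<bar> \<le> 1" by (simp add: power_le_one)
          then have "\<bar>s ^ 3\<bar> * \<bar>?D i j (z - \<alpha> *\<^sub>R ?\<gamma> s)\<bar> \<le> 1 * B" using B by (intro mult_mono) auto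
          then show ?thesis using True by (simp add: abs_mult)
        qed simp
      qed (auto intro!: integrable_mult_right integrable_real_indicator)
      then show ?thesis by simp
    qed
    have meas: "(\<lambda>z. LINT s|lborel. \<bar>?h z s\<bar>) \<in> borel_measurable borel" "?J i j \<in> borel_measurable borel"
    proof -
      have "(\<lambda>z. LINT s|lborel. \<bar>?h z s\<bar>) \<in> borel_measurable lborel" "?J i j \<in> borel_measurable lborel"
        by (rule lborel.borel_measurable_lebesgue_integral, measurable)+
      then show "(\<lambda>z. LINT s|lborel. \<bar>?h z s\<bar>) \<in> borel_measurable borel" "?J i j \<in> borel_measurable borel" by simp_all
    qed
    have nn: "(LINT s|lborel. \<bar>?h z s\<bar>) \<ge> 0" for z by (rule integral_nonneg_AE) simp
    have "\<bar>?J i j z\<bar> \<le> 2 * B" for z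
      using integral_abs_bound[of lborel "?h z"] hb[of z] by linarith
    then show "integrable lborel (\<lambda>z. v z * ?J i j z)"
      by (rule integrable_mult_bounded[OF v(2) meas(2)])
    have "integrable (lborel \<Otimes>\<^sub>M lborel) (case_prod (\<lambda>z s. v z * ?h z s))"
    proof (rule lborel_pair.Fubini_integrable)
      show "case_prod (\<lambda>z s. v z * ?h z s) \<in> borel_measurable (lborel \<Otimes>\<^sub>M lborel)" by measurable
      have "integrable lborel (\<lambda>z. \<bar>v z\<bar> * (LINT s|lborel. \<bar>?h z s\<bar>))"
        by (rule integrable_mult_bounded[OF _ meas(1), of _ "2 * B"]) (use v(2) hb nn in auto)
      then show "integrable lborel (\<lambda>z. LINT s|lborel. norm (case (z, s) of (z, s) \<Rightarrow> v z * ?h z s))"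
        by (simp add: abs_mult[of "v _"])
      show "AE z in lborel. integrable lborel (\<lambda>s. case (z, s) of (z, s) \<Rightarrow> v z * ?h z s)"
        using hs by (intro AE_I2) simp
    qed
    from lborel_pair.Fubini_integral[OF this]
    have "(LINT z|lborel. LINT s|lborel. v z * ?h z s) = (LINT s|lborel. LINT z|lborel. v z * ?h z s)" by simp
    moreover have "(LINT z|lborel. LINT s|lborel. v z * ?h z s) = (LINT z|lborel. v z * ?J i j z)" by simp
    moreover have "(LINT z|lborel. v z * ?h z s) = 2 * s ^ 3 * (LINT z|lborel. v z * ?D i j (z - \<alpha> *\<^sub>R ?\<gamma> s)) * indicator {0..1} s" for s
    proof -
      have "(\<lambda>z. v z * ?h z s) = (\<lambda>z. (2 * s ^ 3 * indicator {0..1} s) * (v z * ?D i j (z - \<alpha> *\<^sub>R ?\<gamma> s)))"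
        by (simp add: fun_eq_iff)
      then show ?thesis by simp
    qed
    ultimately show "(LINT z|lborel. v z * ?J i j z) = (LINT s|lborel. 2 * s ^ 3 * (LINT z|lborel. v z * ?D i j (z - \<alpha> *\<^sub>R ?\<gamma> s)) * indicator {0..1} s)"
      by simp
  qed
  \<comment> \<open>Base point z - \<alpha>a and increment -\<alpha>(x - a), so the expansion ends
    at z - \<alpha>x. The two signs in the second-order term cancel.\<close>
  have point: "?\<kappa> (z - \<alpha> *\<^sub>R a) = ?\<kappa> (z - \<alpha> *\<^sub>R x) + \<alpha> * (\<Sum>i\<in>UNIV. ?d $ i * partial_deriv i ?\<kappa> (z - \<alpha> *\<^sub>R x))
      + \<alpha>\<^sup>2 * (\<Sum>i\<in>UNIV. \<Sum>j\<in>UNIV. ?d $ i * ?d $ j * ?J i j z)" for z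
  proof -
    let ?Q = "- \<alpha> *\<^sub>R ?d"
    have PQ: "z - \<alpha> *\<^sub>R a + ?Q = z - \<alpha> *\<^sub>R x" by (simp add: algebra_simps)
    have Ps: "z - \<alpha> *\<^sub>R a + s\<^sup>2 *\<^sub>R ?Q = z - \<alpha> *\<^sub>R ?\<gamma> s" for s by (simp add: algebra_simps)
    have ints: "integrable lborel (\<lambda>s. 2 * s ^ 3 * ?D i j (z - \<alpha> *\<^sub>R ?\<gamma> s) * indicator {0..1} s)" for i j
    proof -
      obtain B where B: "\<forall>w. \<bar>?D i j w\<bar> \<le> B" using bd[OF td(1)] by blast
      show ?thesis by (rule integrable_unit_interval[of _ B]) (use B in auto)
    qed
    have "(LINT s|lborel. 2 * s ^ 3 * (\<Sum>i\<in>UNIV. \<Sum>j\<in>UNIV. ?Q $ i * ?Q $ j * ?D i j (z - \<alpha> *\<^sub>R ?\<gamma> s)) * indicator {0..1} s)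
        = (LINT s|lborel. (\<Sum>i\<in>UNIV. \<Sum>j\<in>UNIV. (\<alpha>\<^sup>2 * (?d $ i * ?d $ j)) * (2 * s ^ 3 * ?D i j (z - \<alpha> *\<^sub>R ?\<gamma> s) * indicator {0..1} s)))"
      by (intro Bochner_Integration.integral_cong refl)
        (simp add: sum_distrib_left sum_distrib_right power2_eq_square ac_simps del: of_bool_eq_iff)
    also have "\<dots> = (\<Sum>i\<in>UNIV. \<Sum>j\<in>UNIV. (\<alpha>\<^sup>2 * (?d $ i * ?d $ j)) * ?J i j z)"
      by (subst Bochner_Integration.integral_sum, intro Bochner_Integration.integrable_sum integrable_mult_right ints,
          intro sum.cong refl, subst Bochner_Integration.integral_sum, intro integrable_mult_right ints,
          intro sum.cong refl integral_mult_right_zero)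
    also have "\<dots> = \<alpha>\<^sup>2 * (\<Sum>i\<in>UNIV. \<Sum>j\<in>UNIV. ?d $ i * ?d $ j * ?J i j z)"
      by (simp only: sum_distrib_left mult.assoc)
    finally have A: "(LINT s|lborel. 2 * s ^ 3 * (\<Sum>i\<in>UNIV. \<Sum>j\<in>UNIV. ?Q $ i * ?Q $ j * ?D i j (z - \<alpha> *\<^sub>R ?\<gamma> s)) * indicator {0..1} s)
        = \<alpha>\<^sup>2 * (\<Sum>i\<in>UNIV. \<Sum>j\<in>UNIV. ?d $ i * ?d $ j * ?J i j z)" .
    have C: "(\<Sum>i\<in>UNIV. ?Q $ i * partial_deriv i ?\<kappa> (z - \<alpha> *\<^sub>R x)) = - (\<alpha> * (\<Sum>i\<in>UNIV. ?d $ i * partial_deriv i ?\<kappa> (z - \<alpha> *\<^sub>R x)))"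
      by (simp add: sum_distrib_left sum_negf[symmetric] mult.assoc)
    show ?thesis
      using taylor_smooth_line[OF smooth_kern, of ?Q b r "z - \<alpha> *\<^sub>R a"]
      unfolding PQ Ps A C by linarith
  qed
  have t1: "(\<lambda>z. ?\<kappa> (z - \<alpha> *\<^sub>R x)) \<in> test_functions \<Omega>" using test[of 1] by simp
  have e1: "(LINT z|lborel. v z * ?\<kappa> (z - \<alpha> *\<^sub>R x)) = mollify \<alpha> b r v x" by (rule mollify_kernel[OF v(1) r, symmetric])
  have e2: "(LINT z|lborel. v z * partial_deriv i ?\<kappa> (z - \<alpha> *\<^sub>R x)) = - mollify \<alpha> b r (v1 i) x" for i
    using w1[OF t1, of i] by (simp add: partial_deriv_translate[OF smooth_kern] mollify_kernel[OF v1 r])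
  have e3: "(LINT z|lborel. v z * ?J i j z) = (LINT s|lborel. 2 * s ^ 3 * mollify \<alpha> b r (v2 i j) (?\<gamma> s) * indicator {0..1} s)" for i j
    unfolding fub
  proof (intro Bochner_Integration.integral_cong refl)
    fix s :: real
    show "2 * s ^ 3 * (LINT z|lborel. v z * ?D i j (z - \<alpha> *\<^sub>R ?\<gamma> s)) * indicator {0..1} s
        = 2 * s ^ 3 * mollify \<alpha> b r (v2 i j) (?\<gamma> s) * indicator {0..1} s"
    proof (cases "s \<in> {0..1}")
      case True
      have "(LINT z|lborel. v z * ?D i j (z - \<alpha> *\<^sub>R ?\<gamma> s)) = mollify \<alpha> b r (v2 i j) (?\<gamma> s)"
        using w2[OF test[OF True], of i j]
        by (simp only: partial_deriv_translate[OF smooth_kern] partial_deriv_translate[OF sm(1)] mollify_kernel[OF v2 r])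
      then show ?thesis by simp
    qed simp
  qed
  have "mollify \<alpha> b r v a = (LINT z|lborel. v z * ?\<kappa> (z - \<alpha> *\<^sub>R a))" by (rule mollify_kernel[OF v(1) r])
  also have "\<dots> = (LINT z|lborel. v z * ?\<kappa> (z - \<alpha> *\<^sub>R x)
      + (\<Sum>i\<in>UNIV. (\<alpha> * ?d $ i) * (v z * partial_deriv i ?\<kappa> (z - \<alpha> *\<^sub>R x)))
      + (\<Sum>i\<in>UNIV. \<Sum>j\<in>UNIV. (\<alpha>\<^sup>2 * (?d $ i * ?d $ j)) * (v z * ?J i j z)))"
    by (intro Bochner_Integration.integral_cong refl, subst point)
      (simp add: distrib_left sum_distrib_left ac_simps)
  also have "\<dots> = (LINT z|lborel. v z * ?\<kappa> (z - \<alpha> *\<^sub>R x))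
      + (\<Sum>i\<in>UNIV. (\<alpha> * ?d $ i) * (LINT z|lborel. v z * partial_deriv i ?\<kappa> (z - \<alpha> *\<^sub>R x)))
      + (\<Sum>i\<in>UNIV. \<Sum>j\<in>UNIV. (\<alpha>\<^sup>2 * (?d $ i * ?d $ j)) * (LINT z|lborel. v z * ?J i j z))"
  proof -
    have i1: "integrable lborel (\<lambda>z. v z * ?\<kappa> (z - \<alpha> *\<^sub>R x))" by (rule int[OF kern_test_UNIV[OF r]])
    have i2: "integrable lborel (\<lambda>z. (\<alpha> * ?d $ i) * (v z * partial_deriv i ?\<kappa> (z - \<alpha> *\<^sub>R x)))" for i
      by (intro integrable_mult_right int td)
    have i3: "integrable lborel (\<lambda>z. (\<alpha>\<^sup>2 * (?d $ i * ?d $ j)) * (v z * ?J i j z))" for i j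
      by (intro integrable_mult_right intJ)
    show ?thesis
      by (simp only: Bochner_Integration.integral_add Bochner_Integration.integral_sum integral_mult_right_zero
          Bochner_Integration.integrable_add Bochner_Integration.integrable_sum i1 i2 i3)
  qed
  finally show ?thesis
    unfolding e1 e2 e3 by (simp add: sum_distrib_left sum_negf mult.assoc)
qed

lemma CS_real:
  fixes f :: "'i \<Rightarrow> real"
  shows "(\<Sum>i\<in>I. f i)\<^sup>2 \<le> real (card I) * (\<Sum>i\<in>I. (f i)\<^sup>2)"
  using sum_squared_le_sum_of_squares[of f I] by (simp add: mult.commute)

lemma sqn_indicator_le: "sqn (\<lambda>x. indicator S x * g x) \<le> sqn g"
  by (rule sqn_mono) (auto simp: indicator_def)

lemma sqn_indicator_const:
  "S \<in> sets borel \<Longrightarrow> sqn (\<lambda>x. indicator S x * c) = ennreal (c\<^sup>2) * emeasure lborel S"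
  unfolding sqn_def
  by (subst nn_integral_cmult_indicator[symmetric])
    (auto intro!: nn_integral_cong simp: indicator_def)

lemma sqn_sum_le:
  fixes f :: "'i \<Rightarrow> 'a::euclidean_space \<Rightarrow> real"
  assumes "finite I" "\<And>i. i \<in> I \<Longrightarrow> f i \<in> borel_measurable borel"
    and bd: "\<And>x. \<bar>g x\<bar> \<le> H * (\<Sum>i\<in>I. \<bar>f i x\<bar>)" and H: "H \<ge> 0"
  shows "sqn g \<le> ennreal (H\<^sup>2 * card I) * (\<Sum>i\<in>I. sqn (f i))"
proof -
  have "sqn g \<le> (\<integral>\<^sup>+x. ennreal (H\<^sup>2 * card I) * (\<Sum>i\<in>I. ennreal ((f i x)\<^sup>2)) \<partial>lborel)"
    unfolding sqn_def
  proof (rule nn_integral_mono)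
    fix x
    have "(g x)\<^sup>2 \<le> (H * (\<Sum>i\<in>I. \<bar>f i x\<bar>))\<^sup>2"
      using bd[of x] H by (intro abs_le_square_iff[THEN iffD1]) (simp add: sum_nonneg)
    also have "\<dots> = H\<^sup>2 * (\<Sum>i\<in>I. \<bar>f i x\<bar>)\<^sup>2" by (rule power_mult_distrib)
    also have "\<dots> \<le> H\<^sup>2 * (real (card I) * (\<Sum>i\<in>I. \<bar>f i x\<bar>\<^sup>2))"
      by (intro mult_left_mono CS_real) simp
    finally have "ennreal ((g x)\<^sup>2) \<le> ennreal ((H\<^sup>2 * card I) * (\<Sum>i\<in>I. (f i x)\<^sup>2))"
      by (intro ennreal_leI) (simp add: mult.assoc)
    also have "\<dots> = ennreal (H\<^sup>2 * card I) * (\<Sum>i\<in>I. ennreal ((f i x)\<^sup>2))"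
      by (simp add: ennreal_mult sum_nonneg sum_ennreal)
    finally show "ennreal ((g x)\<^sup>2) \<le> ennreal (H\<^sup>2 * card I) * (\<Sum>i\<in>I. ennreal ((f i x)\<^sup>2))" .
  qed
  also have "\<dots> = ennreal (H\<^sup>2 * card I) * (\<Sum>i\<in>I. sqn (f i))"
  proof -
    have m: "(\<lambda>x. ennreal ((f i x)\<^sup>2)) \<in> borel_measurable lborel" if "i \<in> I" for i
      using assms(2)[OF that] by simp
    show ?thesis
      unfolding sqn_def
      by (subst nn_integral_cmult, rule borel_measurable_sum, erule m, subst nn_integral_sum, erule m, rule refl)
  qed
  finally show ?thesis .
qed

section \<open>Continuous representatives\<close>

text \<open>The integral of t q(a + t(x - a)) over the unit interval, as in Taylor's integral
  remainder, after the substitution t = s^2.\<close>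

definition line_avg :: "real ^ 'n \<Rightarrow> (real ^ 'n \<Rightarrow> real) \<Rightarrow> real ^ 'n \<Rightarrow> real" where
  "line_avg a q x = (LINT s|lborel. 2 * s ^ 3 * q (a + s\<^sup>2 *\<^sub>R (x - a)) * indicator {0..1} s)"

lemma line_avg_measurable:
  fixes q :: "real ^ 'n \<Rightarrow> real"
  assumes [measurable]: "q \<in> borel_measurable borel"
  shows "line_avg a q \<in> borel_measurable borel"
proof -
  have "line_avg a q \<in> borel_measurable lborel"
    unfolding line_avg_def[abs_def]
    by (rule lborel.borel_measurable_lebesgue_integral) measurable
  then show ?thesis by simp
qed

text \<open>Cauchy-Schwarz in s and Fubini reduce the claim to dilations towards \<open>a\<close>.
  These map the convex set into itself and cost s^(-2d) in the integral. Without the substitution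
  the same argument would leave the integral of t^(2 - d), which diverges for d = 3.\<close>

lemma line_avg_sqn_le:
  fixes q :: "real ^ 'n \<Rightarrow> real"
  assumes q[measurable]: "q \<in> borel_measurable borel" and S[measurable]: "S \<in> sets borel" and cS: "convex S" and a: "a \<in> S"
    and d: "CARD('n) \<le> 3"
  shows "sqn (\<lambda>x. indicator S x * line_avg a q x) \<le> 4 * sqn (\<lambda>x. indicator S x * q x)"
proof -
  let ?h = "\<lambda>x s. 2 * s ^ 3 * q (a + s\<^sup>2 *\<^sub>R (x - a)) * indicator {0..1::real} s"
  let ?N = "sqn (\<lambda>x. indicator S x * q x)"
  have p: "ennreal ((line_avg a q x)\<^sup>2) \<le> (\<integral>\<^sup>+s. ennreal ((?h x s)\<^sup>2) \<partial>lborel)" for x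
  proof -
    have "ennreal \<bar>line_avg a q x\<bar> \<le> (\<integral>\<^sup>+s. ennreal \<bar>?h x s\<bar> \<partial>lborel)"
    proof (cases "integrable lborel (?h x)")
      case True
      from integral_norm_bound_ennreal[OF this] show ?thesis by (simp add: line_avg_def)
    next
      case False
      then show ?thesis by (simp add: line_avg_def not_integrable_integral_eq)
    qed
    also have "\<dots> = (\<integral>\<^sup>+s. ennreal \<bar>?h x s\<bar> * indicator {0..1} s \<partial>lborel)"
      by (intro nn_integral_cong) (auto simp: indicator_def)
    finally have "(ennreal \<bar>line_avg a q x\<bar>)\<^sup>2 \<le> (\<integral>\<^sup>+s. ennreal \<bar>?h x s\<bar> * indicator {0..1} s \<partial>lborel)\<^sup>2"
      by (rule power_mono) simp
    also have "\<dots> \<le> (\<integral>\<^sup>+s. (ennreal \<bar>?h x s\<bar>)\<^sup>2 \<partial>lborel) * (\<integral>\<^sup>+s. (indicator {0..1::real} s)\<^sup>2 \<partial>lborel)"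
      by (rule Cauchy_Schwarz_nn_integral) measurable
    also have "(\<integral>\<^sup>+s. (indicator {0..1::real} s :: ennreal)\<^sup>2 \<partial>lborel) = (\<integral>\<^sup>+s. indicator {0..1::real} s \<partial>lborel)"
      by (intro nn_integral_cong) (auto simp: indicator_def)
    also have "\<dots> = 1" by (subst nn_integral_indicator) auto
    finally show ?thesis by (simp add: ennreal_power)
  qed
  have "sqn (\<lambda>x. indicator S x * line_avg a q x) \<le> (\<integral>\<^sup>+x. (\<integral>\<^sup>+s. ennreal ((?h x s)\<^sup>2) * indicator S x \<partial>lborel) \<partial>lborel)"
    unfolding sqn_def
  proof (rule nn_integral_mono)
    fix x
    show "ennreal ((indicator S x * line_avg a q x)\<^sup>2) \<le> (\<integral>\<^sup>+s. ennreal ((?h x s)\<^sup>2) * indicator S x \<partial>lborel)"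
      using p[of x] by (cases "x \<in> S") auto
  qed
  also have "\<dots> = (\<integral>\<^sup>+s. (\<integral>\<^sup>+x. ennreal ((?h x s)\<^sup>2) * indicator S x \<partial>lborel) \<partial>lborel)"
    by (rule lborel_pair.Fubini'[symmetric]) measurable
  also have "\<dots> \<le> (\<integral>\<^sup>+s. 4 * ?N * indicator {0..1::real} s \<partial>lborel)"
  proof (rule nn_integral_mono)
    fix s :: real
    show "(\<integral>\<^sup>+x. ennreal ((?h x s)\<^sup>2) * indicator S x \<partial>lborel) \<le> 4 * ?N * indicator {0..1} s"
    proof (cases "s \<in> {0..1} \<and> s \<noteq> 0")
      case False
      then have h0: "?h x s = 0" for x by (auto simp: indicator_def)
      show ?thesis by (simp only: h0) simp
    next
      case True
      then have s: "0 < s" "s \<le> 1" by auto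
      let ?f = "\<lambda>y. ennreal ((indicator S y * q y)\<^sup>2)"
      have "(\<integral>\<^sup>+x. ennreal ((?h x s)\<^sup>2) * indicator S x \<partial>lborel)
          \<le> (\<integral>\<^sup>+x. 4 * ennreal (s ^ 6) * ?f ((a - s\<^sup>2 *\<^sub>R a) + s\<^sup>2 *\<^sub>R x) \<partial>lborel)"
      proof (rule nn_integral_mono)
        fix x
        have eq: "(a - s\<^sup>2 *\<^sub>R a) + s\<^sup>2 *\<^sub>R x = a + s\<^sup>2 *\<^sub>R (x - a)" by (simp add: algebra_simps)
        show "ennreal ((?h x s)\<^sup>2) * indicator S x \<le> 4 * ennreal (s ^ 6) * ?f ((a - s\<^sup>2 *\<^sub>R a) + s\<^sup>2 *\<^sub>R x)"
        proof (cases "x \<in> S")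
          case True
          have "(1 - s\<^sup>2) *\<^sub>R a + s\<^sup>2 *\<^sub>R x \<in> S"
            using s by (intro convexD_alt[OF cS a True]) (auto simp: power_le_one)
          then have "a + s\<^sup>2 *\<^sub>R (x - a) \<in> S" by (simp add: algebra_simps)
          moreover have "(?h x s)\<^sup>2 = 4 * s ^ 6 * (q (a + s\<^sup>2 *\<^sub>R (x - a)))\<^sup>2"
            using s by (simp add: power_mult_distrib flip: power_mult)
          ultimately show ?thesis
            unfolding eq using True s by (simp add: ennreal_mult)
        qed simp
      qed
      also have "\<dots> = 4 * (ennreal (s ^ 6) * (\<integral>\<^sup>+x. ?f ((a - s\<^sup>2 *\<^sub>R a) + s\<^sup>2 *\<^sub>R x) \<partial>lborel))"
        by (subst nn_integral_cmult) (auto simp: mult.assoc)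
      also have "\<dots> \<le> 4 * (ennreal (\<bar>s\<^sup>2\<bar> ^ DIM(real ^ 'n)) * (\<integral>\<^sup>+x. ?f ((a - s\<^sup>2 *\<^sub>R a) + s\<^sup>2 *\<^sub>R x) \<partial>lborel))"
      proof (intro mult_left_mono mult_right_mono ennreal_leI)
        \<comment> \<open>This is the only use of d \<le> 3 in the estimate: the weight has to
          absorb the Jacobian of the dilation by s^2.\<close>
        have "s ^ 6 \<le> s ^ (2 * CARD('n))" using s d by (intro power_decreasing) auto
        then show "s ^ 6 \<le> \<bar>s\<^sup>2\<bar> ^ DIM(real ^ 'n)" by (simp add: power_mult)
      qed auto
      also have "\<dots> = 4 * ?N"
        using nn_integral_lborel_affine[of ?f "s\<^sup>2" "a - s\<^sup>2 *\<^sub>R a"] s by (simp add: sqn_def)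
      finally show ?thesis using s by simp
    qed
  qed
  also have "\<dots> = 4 * ?N"
    by (subst nn_integral_cmult_indicator) auto
  finally show ?thesis .
qed

lemma line_avg_diff:
  fixes q q' :: "real ^ 'n \<Rightarrow> real"
  assumes [measurable]: "q \<in> borel_measurable borel" "q' \<in> borel_measurable borel"
    and "\<And>x. \<bar>q x\<bar> \<le> B" "\<And>x. \<bar>q' x\<bar> \<le> B'"
  shows "line_avg a (\<lambda>x. q x - q' x) x = line_avg a q x - line_avg a q' x"
proof -
  have i: "integrable lborel (\<lambda>s. 2 * s ^ 3 * q (a + s\<^sup>2 *\<^sub>R (x - a)) * indicator {0..1} s)"
    by (rule integrable_unit_interval[of _ B]) (use assms in auto)
  have i': "integrable lborel (\<lambda>s. 2 * s ^ 3 * q' (a + s\<^sup>2 *\<^sub>R (x - a)) * indicator {0..1} s)"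
    by (rule integrable_unit_interval[of _ B']) (use assms in auto)
  show ?thesis
    unfolding line_avg_def
    by (subst Bochner_Integration.integral_diff[OF i i', symmetric])
      (simp add: left_diff_distrib right_diff_distrib)
qed

lemma line_avg_cmult: "line_avg a (\<lambda>x. c * q x) x = c * line_avg a q x"
proof -
  have "(\<lambda>s. 2 * s ^ 3 * (c * q (a + s\<^sup>2 *\<^sub>R (x - a))) * indicator {0..1} s)
      = (\<lambda>s. c * (2 * s ^ 3 * q (a + s\<^sup>2 *\<^sub>R (x - a)) * indicator {0..1} s))"
    by (simp add: fun_eq_iff)
  then show ?thesis unfolding line_avg_def by simp
qed

text \<open>For smooth v with gradient p and second derivatives q, the value v(a) is v(x) plus this
  expression. It is linear in \<open>p\<close> and in bounded \<open>q\<close>, so the difference of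
  two approximations is again of this form.\<close>

definition taylor_remainder ::
  "real ^ 'n \<Rightarrow> ('n \<Rightarrow> real ^ 'n \<Rightarrow> real) \<Rightarrow> ('n \<Rightarrow> 'n \<Rightarrow> real ^ 'n \<Rightarrow> real) \<Rightarrow> real ^ 'n \<Rightarrow> real" where
  "taylor_remainder a p q x = (\<Sum>i\<in>UNIV. \<Sum>j\<in>UNIV. (x - a) $ i * (x - a) $ j * line_avg a (q i j) x)
     - (\<Sum>i\<in>UNIV. (x - a) $ i * p i x)"

lemma abs_component_le_diameter:
  fixes S :: "(real ^ 'n) set"
  assumes "bounded S" "x \<in> S" "a \<in> S"
  shows "\<bar>(x - a) $ i\<bar> \<le> diameter S"
  using component_le_norm_cart[of "x - a" i] diameter_bounded_bound[OF assms] by (simp add: dist_norm)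

text \<open>Only this part of the Taylor formula survives when the mollification is removed, so its
  fourth power of the diameter determines the order of the interpolation error.\<close>

lemma second_order_sqn_le:
  fixes q :: "'n \<Rightarrow> 'n \<Rightarrow> real ^ 'n \<Rightarrow> real"
  assumes S: "compact S" "convex S" "a \<in> S" and d: "CARD('n) \<le> 3"
    and q: "\<And>i j. q i j \<in> borel_measurable borel"
  shows "sqn (\<lambda>x. indicator S x * (\<Sum>i\<in>UNIV. \<Sum>j\<in>UNIV. (x - a) $ i * (x - a) $ j * line_avg a (q i j) x))
    \<le> ennreal (4 * (diameter S)^4 * (CARD('n))\<^sup>2) * (\<Sum>i\<in>UNIV. \<Sum>j\<in>UNIV. sqn (\<lambda>x. indicator S x * q i j x))"
proof -
  let ?h = "diameter S"
  have Sb: "S \<in> sets borel" using S(1) by (simp add: compact_imp_closed)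
  have bS: "bounded S" using S(1) by (rule compact_imp_bounded)
  have h0: "?h \<ge> 0" using diameter_ge_0[OF bS] .
  have "sqn (\<lambda>x. indicator S x * (\<Sum>i\<in>UNIV. \<Sum>j\<in>UNIV. (x - a) $ i * (x - a) $ j * line_avg a (q i j) x))
      \<le> ennreal ((?h\<^sup>2)\<^sup>2 * card (UNIV :: ('n \<times> 'n) set)) * (\<Sum>(i,j)\<in>UNIV. sqn (\<lambda>x. indicator S x * line_avg a (q i j) x))"
  proof (rule order_trans[OF sqn_sum_le[of "UNIV :: ('n \<times> 'n) set" "\<lambda>(i, j) x. indicator S x * line_avg a (q i j) x" _ "?h\<^sup>2"]])
    fix ij :: "'n \<times> 'n"
    show "(case ij of (i, j) \<Rightarrow> \<lambda>x. indicator S x * line_avg a (q i j) x) \<in> borel_measurable borel"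
      using Sb line_avg_measurable[OF q] by (cases ij) (auto intro!: borel_measurable_times)
  next
    fix x
    show "\<bar>indicator S x * (\<Sum>i\<in>UNIV. \<Sum>j\<in>UNIV. (x - a) $ i * (x - a) $ j * line_avg a (q i j) x)\<bar>
        \<le> ?h\<^sup>2 * (\<Sum>ij\<in>UNIV. \<bar>(case ij of (i, j) \<Rightarrow> \<lambda>x. indicator S x * line_avg a (q i j) x) x\<bar>)"
    proof (cases "x \<in> S")
      case True
      have "\<bar>\<Sum>i\<in>UNIV. \<Sum>j\<in>UNIV. (x - a) $ i * (x - a) $ j * line_avg a (q i j) x\<bar>
          \<le> (\<Sum>i\<in>UNIV. \<Sum>j\<in>UNIV. \<bar>(x - a) $ i * (x - a) $ j * line_avg a (q i j) x\<bar>)"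
        by (intro order_trans[OF sum_abs] sum_mono sum_abs)
      also have "\<dots> \<le> (\<Sum>i\<in>UNIV. \<Sum>j\<in>UNIV. ?h\<^sup>2 * \<bar>line_avg a (q i j) x\<bar>)"
      proof (intro sum_mono)
        fix i j :: 'n
        have "\<bar>(x - a) $ i\<bar> * \<bar>(x - a) $ j\<bar> \<le> ?h * ?h"
          using h0 by (intro mult_mono abs_component_le_diameter[OF bS True S(3)]) auto
        then show "\<bar>(x - a) $ i * (x - a) $ j * line_avg a (q i j) x\<bar> \<le> ?h\<^sup>2 * \<bar>line_avg a (q i j) x\<bar>"
          unfolding abs_mult power2_eq_square by (rule mult_right_mono) simp
      qed
      also have "\<dots> = ?h\<^sup>2 * (\<Sum>(i,j)\<in>UNIV. \<bar>line_avg a (q i j) x\<bar>)"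
        by (simp add: sum_distrib_left sum.cartesian_product case_prod_beta flip: UNIV_Times_UNIV)
      finally show ?thesis using True by (simp add: case_prod_beta)
    qed (simp add: case_prod_beta)
  qed (auto simp: case_prod_beta)
  also have "\<dots> \<le> ennreal ((?h\<^sup>2)\<^sup>2 * card (UNIV :: ('n \<times> 'n) set)) * (\<Sum>(i,j)\<in>UNIV. 4 * sqn (\<lambda>x. indicator S x * q i j x))"
    by (intro mult_left_mono sum_mono) (auto intro!: line_avg_sqn_le q Sb S d)
  also have "\<dots> = ennreal (4 * ?h^4 * (CARD('n))\<^sup>2) * (\<Sum>i\<in>UNIV. \<Sum>j\<in>UNIV. sqn (\<lambda>x. indicator S x * q i j x))"
  proof -
    have "(\<Sum>(i,j)\<in>UNIV. 4 * sqn (\<lambda>x. indicator S x * q i j x)) = 4 * (\<Sum>i\<in>UNIV. \<Sum>j\<in>UNIV. sqn (\<lambda>x. indicator S x * q i j x))"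
      by (simp add: sum_distrib_left sum.cartesian_product case_prod_beta flip: UNIV_Times_UNIV)
    moreover have "ennreal ((?h\<^sup>2)\<^sup>2 * card (UNIV :: ('n \<times> 'n) set)) * 4 = ennreal (4 * ?h^4 * (CARD('n))\<^sup>2)"
    proof -
      have "(?h\<^sup>2)\<^sup>2 * real (card (UNIV :: ('n \<times> 'n) set)) * 4 = 4 * ?h^4 * (CARD('n))\<^sup>2"
        by (simp add: power2_eq_square flip: power_mult) (simp add: power4_eq_xxxx)
      then show ?thesis using h0 by (simp flip: ennreal_numeral ennreal_mult)
    qed
    ultimately show ?thesis by (simp add: mult.assoc[symmetric])
  qed
  finally show ?thesis .
qed

text \<open>A crude constant. It multiplies only quantities that tend to zero and is absent from the
  final bounds.\<close>

definition taylor_const :: "(real ^ 'n) set \<Rightarrow> real" where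
  "taylor_const S = 2 + 4 * ((diameter S)\<^sup>2 * CARD('n)) + 4 * (4 * (diameter S)^4 * (CARD('n))\<^sup>2)"

lemma taylor_combination_sqn_le:
  fixes S :: "(real ^ 'n) set" and q :: "'n \<Rightarrow> 'n \<Rightarrow> real ^ 'n \<Rightarrow> real"
  assumes S: "compact S" "convex S" and d: "CARD('n) \<le> 3"
    and a: "a \<in> S" and U[measurable]: "U \<in> borel_measurable borel" and p[measurable]: "\<And>i. p i \<in> borel_measurable borel"
    and q: "\<And>i j. q i j \<in> borel_measurable borel"
  shows "sqn (\<lambda>x. indicator S x * (U x + taylor_remainder a p q x))
        \<le> ennreal (taylor_const S) * (sqn (\<lambda>x. indicator S x * U x) + (\<Sum>i\<in>UNIV. sqn (\<lambda>x. indicator S x * p i x))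
          + (\<Sum>i\<in>UNIV. \<Sum>j\<in>UNIV. sqn (\<lambda>x. indicator S x * q i j x)))" (is "_ \<le> _ * (?su + ?sp + ?sq)")
proof -
  let ?h = "diameter S"
  have Sb[measurable]: "S \<in> sets borel" using S(1) by (simp add: compact_imp_closed)
  have bS: "bounded S" using S(1) by (rule compact_imp_bounded)
  have h0: "?h \<ge> 0" using diameter_ge_0[OF bS] .
  define M1 where "M1 = ?h\<^sup>2 * CARD('n)"
  define M2 where "M2 = 4 * ?h^4 * (CARD('n))\<^sup>2"
  have M: "taylor_const S = 2 + 4 * M1 + 4 * M2" by (simp add: taylor_const_def M1_def M2_def)
  have M12: "M1 \<ge> 0" "M2 \<ge> 0" using h0 by (auto simp: M1_def M2_def)
    let ?P = "\<lambda>x. \<Sum>i\<in>UNIV. (x - a) $ i * p i x"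
    let ?Q = "\<lambda>x. \<Sum>i\<in>UNIV. \<Sum>j\<in>UNIV. (x - a) $ i * (x - a) $ j * line_avg a (q i j) x"
    have [measurable]: "(\<lambda>x. (x - a) $ i) \<in> borel_measurable borel" for i
      by (intro borel_measurable_continuous_onI continuous_intros)
    have [measurable]: "line_avg a (q i j) \<in> borel_measurable borel" for i j by (rule line_avg_measurable[OF q])
    have "?P \<in> borel_measurable borel" "?Q \<in> borel_measurable borel" by measurable
    then have m: "(\<lambda>x. indicator S x * U x) \<in> borel_measurable borel" "(\<lambda>x. indicator S x * ?P x) \<in> borel_measurable borel"
      "(\<lambda>x. indicator S x * ?Q x) \<in> borel_measurable borel"
      using Sb U by (auto intro!: borel_measurable_times)
    have sP: "sqn (\<lambda>x. indicator S x * ?P x) \<le> ennreal M1 * ?sp"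
      unfolding M1_def
    proof (rule sqn_sum_le)
      show "\<bar>indicator S x * ?P x\<bar> \<le> ?h * (\<Sum>i\<in>UNIV. \<bar>indicator S x * p i x\<bar>)" for x
      proof (cases "x \<in> S")
        case True
        have "\<bar>?P x\<bar> \<le> (\<Sum>i\<in>UNIV. \<bar>(x - a) $ i * p i x\<bar>)" by (rule sum_abs)
        also have "\<dots> \<le> (\<Sum>i\<in>UNIV. ?h * \<bar>p i x\<bar>)"
          unfolding abs_mult by (intro sum_mono mult_right_mono abs_component_le_diameter[OF bS True a]) simp
        finally show ?thesis using True by (simp add: sum_distrib_left)
      qed simp
    qed (use h0 in auto)
    have sQ: "sqn (\<lambda>x. indicator S x * ?Q x) \<le> ennreal M2 * ?sq"
      unfolding M2_def by (rule second_order_sqn_le[OF S a d q])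
    have "sqn (\<lambda>x. indicator S x * (U x + taylor_remainder a p q x))
        = sqn (\<lambda>x. indicator S x * U x + (indicator S x * ?Q x - indicator S x * ?P x))"
      by (simp add: taylor_remainder_def algebra_simps)
    also have "\<dots> \<le> 2 * ?su + 2 * sqn (\<lambda>x. indicator S x * ?Q x - indicator S x * ?P x)"
      by (intro sqn_add borel_measurable_diff m)
    also have "\<dots> \<le> 2 * ?su + 2 * (2 * sqn (\<lambda>x. indicator S x * ?Q x) + 2 * sqn (\<lambda>x. indicator S x * ?P x))"
      by (intro add_left_mono mult_left_mono sqn_diff m) simp
    also have "\<dots> \<le> 2 * ?su + 2 * (2 * (ennreal M2 * ?sq) + 2 * (ennreal M1 * ?sp))"
      by (intro add_left_mono mult_left_mono add_mono sP sQ) auto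
    also have "\<dots> = 2 * ?su + ennreal (4 * M1) * ?sp + ennreal (4 * M2) * ?sq"
      using M12 by (simp add: ennreal_mult distrib_left mult.assoc[symmetric] add_ac)
    also have "\<dots> \<le> ennreal (taylor_const S) * ?su + ennreal (taylor_const S) * ?sp + ennreal (taylor_const S) * ?sq"
      using M12 by (intro add_mono mult_right_mono) (auto simp: M simp flip: ennreal_numeral intro!: ennreal_leI)
    also have "\<dots> = ennreal (taylor_const S) * (?su + ?sp + ?sq)" by (simp add: distrib_left)
    finally show ?thesis .
qed

section \<open>Smooth approximation on a compact convex set\<close>

lemma mollify_continuous:
  fixes v :: "real ^ 'n \<Rightarrow> real"
  assumes v[measurable]: "v \<in> borel_measurable borel" "integrable lborel v" and r: "r > 0"
  shows "continuous_on UNIV (mollify a b r v)"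
    and "\<exists>B. \<forall>x. \<bar>mollify a b r v x\<bar> \<le> B"
proof -
  have [measurable]: "kern b r \<in> borel_measurable borel" by (rule smooth_borel[OF smooth_kern])
  obtain B where B: "B \<ge> 0" "\<And>w. \<bar>kern b r w\<bar> \<le> B" using test_functions_bounded[OF kern_test_UNIV[OF r]] by metis
  have K: "continuous_on UNIV (kern b r)" by (rule smooth_continuous[OF smooth_kern])
  have le: "\<bar>v z * kern b r (z - a *\<^sub>R x)\<bar> \<le> B * \<bar>v z\<bar>" for z x
    using mult_right_mono[OF B(2), of "\<bar>v z\<bar>"] by (simp add: abs_mult mult.commute)
  have i: "integrable lborel (\<lambda>z. B * \<bar>v z\<bar>)" using v(2) by simp
  have "isCont (mollify a b r v) x" for x
    unfolding continuous_at_sequentially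
  proof (intro allI impI)
    fix X assume X: "X \<longlonglongrightarrow> x"
    have "(\<lambda>n. LINT z|lborel. v z * kern b r (z - a *\<^sub>R X n)) \<longlonglongrightarrow> (LINT z|lborel. v z * kern b r (z - a *\<^sub>R x))"
    proof (rule integral_dominated_convergence[OF _ _ i])
      show "AE z in lborel. (\<lambda>n. v z * kern b r (z - a *\<^sub>R X n)) \<longlonglongrightarrow> v z * kern b r (z - a *\<^sub>R x)"
      proof (intro AE_I2 tendsto_mult tendsto_const)
        fix z
        have "(\<lambda>n. z - a *\<^sub>R X n) \<longlonglongrightarrow> z - a *\<^sub>R x" by (intro tendsto_intros X)
        moreover have "isCont (kern b r) (z - a *\<^sub>R x)" using K by (simp add: continuous_on_eq_continuous_at)
        ultimately show "(\<lambda>n. kern b r (z - a *\<^sub>R X n)) \<longlonglongrightarrow> kern b r (z - a *\<^sub>R x)"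
          by (rule isCont_tendsto_compose[rotated])
      qed
      show "AE z in lborel. norm (v z * kern b r (z - a *\<^sub>R X n)) \<le> B * \<bar>v z\<bar>" for n
        using le by (intro AE_I2) simp
    qed measurable
    then show "(mollify a b r v \<circ> X) \<longlonglongrightarrow> mollify a b r v x"
      by (simp add: mollify_kernel[OF v(1) r] comp_def)
  qed
  then show "continuous_on UNIV (mollify a b r v)" by (simp add: continuous_at_imp_continuous_on)
  have "\<bar>mollify a b r v x\<bar> \<le> (LINT z|lborel. B * \<bar>v z\<bar>)" for x
  proof -
    have "\<bar>LINT z|lborel. v z * kern b r (z - a *\<^sub>R x)\<bar> \<le> (LINT z|lborel. \<bar>v z * kern b r (z - a *\<^sub>R x)\<bar>)"
      by (rule integral_abs_bound)
    also have "\<dots> \<le> (LINT z|lborel. B * \<bar>v z\<bar>)"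
      by (rule integral_mono'[OF i le]) (use B in auto)
    finally show ?thesis by (simp add: mollify_kernel[OF v(1) r])
  qed
  then show "\<exists>B. \<forall>x. \<bar>mollify a b r v x\<bar> \<le> B" by blast
qed

text \<open>By the chain rule, first and second derivatives of a function dilated by \<alpha> carry
  the factors \<alpha> and \<alpha>^2. These tend to one and do not disturb the limit.\<close>

lemma sqn_scaled_tendsto:
  fixes F :: "nat \<Rightarrow> 'a::euclidean_space \<Rightarrow> real"
  assumes m: "\<And>k. F k \<in> borel_measurable borel" "g \<in> borel_measurable borel" and g: "sqn g < \<infinity>"
    and lim: "(\<lambda>k. sqn (\<lambda>x. F k x - g x)) \<longlonglongrightarrow> 0" and c: "c \<longlonglongrightarrow> 1" "\<And>k. \<bar>c k\<bar> \<le> 1"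
  shows "(\<lambda>k. sqn (\<lambda>x. c k * F k x - g x)) \<longlonglongrightarrow> 0"
proof (rule tendsto_sandwich[OF always_eventually always_eventually tendsto_const])
  show "\<forall>k. 0 \<le> sqn (\<lambda>x. c k * F k x - g x)" by simp
  show "\<forall>k. sqn (\<lambda>x. c k * F k x - g x) \<le> 2 * sqn (\<lambda>x. F k x - g x) + 2 * (ennreal ((c k - 1)\<^sup>2) * sqn g)"
  proof
    fix k
    have "sqn (\<lambda>x. c k * F k x - g x) = sqn (\<lambda>x. c k * (F k x - g x) + (c k - 1) * g x)"
      by (simp add: algebra_simps)
    also have "\<dots> \<le> 2 * sqn (\<lambda>x. c k * (F k x - g x)) + 2 * sqn (\<lambda>x. (c k - 1) * g x)"
      by (rule sqn_add) (use m in auto)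
    also have "sqn (\<lambda>x. (c k - 1) * g x) = ennreal ((c k - 1)\<^sup>2) * sqn g" by (rule sqn_cmult[OF m(2)])
    also have "sqn (\<lambda>x. c k * (F k x - g x)) \<le> sqn (\<lambda>x. F k x - g x)"
      by (rule sqn_mono) (use c(2) in \<open>simp add: abs_mult mult_left_le_one_le\<close>)
    finally show "sqn (\<lambda>x. c k * F k x - g x) \<le> 2 * sqn (\<lambda>x. F k x - g x) + 2 * (ennreal ((c k - 1)\<^sup>2) * sqn g)"
      by (simp add: add_right_mono mult_left_mono)
  qed
  have "(\<lambda>k. ennreal ((c k - 1)\<^sup>2)) \<longlonglongrightarrow> ennreal ((1 - 1)\<^sup>2)" by (intro tendsto_intros c)
  then have "(\<lambda>k. sqn g * ennreal ((c k - 1)\<^sup>2)) \<longlonglongrightarrow> sqn g * ennreal ((1 - 1)\<^sup>2)"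
    using g by (intro ennreal_tendsto_cmult) auto
  then have "(\<lambda>k. ennreal ((c k - 1)\<^sup>2) * sqn g) \<longlonglongrightarrow> 0 * sqn g"
    by (simp add: mult.commute)
  then have "(\<lambda>k. 2 * sqn (\<lambda>x. F k x - g x) + 2 * (ennreal ((c k - 1)\<^sup>2) * sqn g)) \<longlonglongrightarrow> 2 * 0 + 2 * (0 * sqn g)"
    by (intro tendsto_add ennreal_tendsto_cmult lim) auto
  then show "(\<lambda>k. 2 * sqn (\<lambda>x. F k x - g x) + 2 * (ennreal ((c k - 1)\<^sup>2) * sqn g)) \<longlonglongrightarrow> 0" by simp
qed

lemma sqn_AE_eq:
  assumes "f \<in> borel_measurable borel" "sqn f = 0"
  shows "AE x in lborel. f x = 0"
proof -
  have "AE x in lborel. ennreal ((f x)\<^sup>2) = 0"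
    using assms unfolding sqn_def by (subst (asm) nn_integral_0_iff_AE) auto
  then show ?thesis by eventually_elim (simp add: ennreal_eq_0_iff)
qed

text \<open>The averaged points (1 - e)x + e(c + \<rho>y) are convex combinations of a point of
  \<open>S\<close> with a point of an interior cube, hence interior. So the kernels belonging to
  points of \<open>S\<close>, boundary points included, are test functions in the interior, and the
  Taylor formula holds up to the boundary.\<close>

lemma mollify_approximation:
  fixes v :: "real ^ 'n \<Rightarrow> real"
  assumes S: "compact S" "convex S" and int: "interior S \<noteq> {}"
    and v: "v \<in> borel_measurable borel" "sqn v < \<infinity>" "integrable lborel v"
    and v1: "\<And>i. v1 i \<in> borel_measurable borel" "\<And>i. sqn (v1 i) < \<infinity>" "\<And>i. integrable lborel (v1 i)"
    and v2: "\<And>i j. v2 i j \<in> borel_measurable borel" "\<And>i j. sqn (v2 i j) < \<infinity>" "\<And>i j. integrable lborel (v2 i j)"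
    and w1: "\<And>\<phi> i. \<phi> \<in> test_functions (interior S) \<Longrightarrow> (LINT z|lborel. v z * partial_deriv i \<phi> z) = - (LINT z|lborel. v1 i z * \<phi> z)"
    and w2: "\<And>\<phi> i j. \<phi> \<in> test_functions (interior S) \<Longrightarrow> (LINT z|lborel. v z * partial_deriv i (partial_deriv j \<phi>) z) = (LINT z|lborel. v2 i j z * \<phi> z)"
  obtains w p q where
    "\<And>k. continuous_on UNIV (w k)" "\<And>k i. p k i \<in> borel_measurable borel" "\<And>k i j. q k i j \<in> borel_measurable borel"
    "\<And>k i j. \<exists>B. \<forall>x. \<bar>q k i j x\<bar> \<le> B"
    "\<And>k x a. x \<in> S \<Longrightarrow> a \<in> S \<Longrightarrow> w k a = w k x + taylor_remainder a (p k) (q k) x"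
    "(\<lambda>k. sqn (\<lambda>x. w k x - v x)) \<longlonglongrightarrow> 0"
    "\<And>i. (\<lambda>k. sqn (\<lambda>x. p k i x - v1 i x)) \<longlonglongrightarrow> 0"
    "\<And>i j. (\<lambda>k. sqn (\<lambda>x. q k i j x - v2 i j x)) \<longlonglongrightarrow> 0"
    "\<And>k i j. sqn (q k i j) \<le> ennreal (2 ^ CARD('n)) * sqn (v2 i j)"
proof -
  obtain c where c: "c \<in> interior S" using int by blast
  obtain \<delta> where \<delta>: "\<delta> > 0" "ball c \<delta> \<subseteq> interior S" using c open_interior open_contains_ball by blast
  obtain N where N: "\<And>y. y \<in> cbox lower (upper :: real ^ 'n) \<Longrightarrow> norm y \<le> N"
    using bounded_cbox[of lower "upper :: real ^ 'n"] unfolding bounded_iff by blast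
  have N0: "N \<ge> 0" using N[of 0] by (simp add: mem_box_cart)
  \<comment> \<open>Points of the unit cube have norm at most \<open>N\<close>, so this scale places
    the cube around \<open>c\<close> inside the ball of radius \<delta>.\<close>
  define \<rho> where "\<rho> = \<delta> / (N + 1)"
  have \<rho>: "\<rho> > 0" using \<delta> N0 by (simp add: \<rho>_def)
  have cube: "c + \<rho> *\<^sub>R y \<in> interior S" if "y \<in> cbox lower upper" for y
  proof -
    have "norm (\<rho> *\<^sub>R y) \<le> \<rho> * N" using N[OF that] \<rho> by simp
    also have "\<dots> < \<rho> * (N + 1)" using \<rho> by simp
    also have "\<dots> = \<delta>" using N0 by (simp add: \<rho>_def)
    finally have "c + \<rho> *\<^sub>R y \<in> ball c \<delta>" by (simp add: dist_norm)
    then show ?thesis using \<delta>(2) by blast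
  qed
  \<comment> \<open>The offset 2 keeps the dilation factor 1 - e at least 1/2, as
    \<open>mollify_sqn_le\<close> requires.\<close>
  define e where "e k = 1 / (real k + 2)" for k :: nat
  have e: "0 < e k" "e k \<le> 1 / 2" for k by (auto simp: e_def field_simps)
  have e0: "e \<longlonglongrightarrow> 0"
  proof -
    have "(\<lambda>k. 1 / real (k + 2)) \<longlonglongrightarrow> 0" by (rule LIMSEQ_ignore_initial_segment[OF lim_1_over_n])
    then show ?thesis by (simp add: e_def[abs_def] add.commute)
  qed
  define \<alpha> where "\<alpha> k = 1 - e k" for k
  define b where "b k = e k *\<^sub>R c" for k
  define r where "r k = e k * \<rho>" for k
  have \<alpha>: "1 / 2 \<le> \<alpha> k" "\<alpha> k \<le> 1" for k using e[of k] by (auto simp: \<alpha>_def)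
  have r: "r k > 0" for k using e[of k] \<rho> by (simp add: r_def)
  have lims: "\<alpha> \<longlonglongrightarrow> 1" "b \<longlonglongrightarrow> 0" "r \<longlonglongrightarrow> 0"
  proof -
    have "(\<lambda>k. 1 - e k) \<longlonglongrightarrow> 1 - 0" "(\<lambda>k. e k *\<^sub>R c) \<longlonglongrightarrow> 0 *\<^sub>R c" "(\<lambda>k. e k * \<rho>) \<longlonglongrightarrow> 0 * \<rho>"
      by (intro tendsto_intros e0)+
    then show "\<alpha> \<longlonglongrightarrow> 1" "b \<longlonglongrightarrow> 0" "r \<longlonglongrightarrow> 0"
      by (simp_all add: \<alpha>_def[abs_def] b_def[abs_def] r_def[abs_def])
  qed
  have rne: "r k \<noteq> 0" for k using r[of k] by simp
  have test: "(\<lambda>z. kern (b k) (r k) (z - \<alpha> k *\<^sub>R x)) \<in> test_functions (interior S)" if "x \<in> S" for k x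
  proof (rule kern_test_function[OF r])
    fix y :: "real ^ 'n" assume y: "y \<in> cbox lower upper"
    have "x - e k *\<^sub>R (x - (c + \<rho> *\<^sub>R y)) \<in> interior S"
      by (rule mem_interior_convex_shrink[OF S(2) cube[OF y] that]) (use e[of k] in auto)
    moreover have "\<alpha> k *\<^sub>R x + b k + r k *\<^sub>R y = x - e k *\<^sub>R (x - (c + \<rho> *\<^sub>R y))"
      by (simp add: \<alpha>_def b_def r_def algebra_simps)
    ultimately show "\<alpha> k *\<^sub>R x + b k + r k *\<^sub>R y \<in> interior S" by simp
  qed
  define w where "w k = mollify (\<alpha> k) (b k) (r k) v" for k
  define p where "p k i x = \<alpha> k * mollify (\<alpha> k) (b k) (r k) (v1 i) x" for k i x
  define q where "q k i j x = (\<alpha> k)\<^sup>2 * mollify (\<alpha> k) (b k) (r k) (v2 i j) x" for k i j x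
  note mv1 = mollify_measurable[OF v1(1)] and mv2 = mollify_measurable[OF v2(1)]
  have sq\<alpha>: "(\<alpha> k)\<^sup>2 \<le> 1" "\<bar>\<alpha> k\<bar> \<le> 1" "\<bar>(\<alpha> k)\<^sup>2\<bar> \<le> 1" for k
    using \<alpha>[of k] by (auto simp: power_le_one abs_le_iff)
  show thesis
  proof (rule that[of w p q])
    show "continuous_on UNIV (w k)" for k unfolding w_def by (rule mollify_continuous[OF v(1,3) r])
    show "p k i \<in> borel_measurable borel" for k i unfolding p_def[abs_def] using mv1 by simp
    show "q k i j \<in> borel_measurable borel" for k i j unfolding q_def[abs_def] using mv2 by simp
    show "\<exists>B. \<forall>x. \<bar>q k i j x\<bar> \<le> B" for k i j
    proof -
      obtain B where B: "\<forall>x. \<bar>mollify (\<alpha> k) (b k) (r k) (v2 i j) x\<bar> \<le> B"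
        using mollify_continuous(2)[OF v2(1,3) r] by blast
      have "\<bar>q k i j x\<bar> \<le> 1 * B" for x
        unfolding q_def abs_mult using B sq\<alpha>(3)[of k] by (intro mult_mono) auto
      then show ?thesis by blast
    qed
    show "w k a = w k x + taylor_remainder a (p k) (q k) x" if x: "x \<in> S" and a: "a \<in> S" for k x a
    proof -
      have t: "(\<lambda>z. kern (b k) (r k) (z - \<alpha> k *\<^sub>R (a + s\<^sup>2 *\<^sub>R (x - a)))) \<in> test_functions (interior S)"
        if "s \<in> {0..1}" for s
      proof (rule test)
        have "(1 - s\<^sup>2) *\<^sub>R a + s\<^sup>2 *\<^sub>R x \<in> S"
          using that by (intro convexD_alt[OF S(2) a x]) (auto simp: power_le_one)
        then show "a + s\<^sup>2 *\<^sub>R (x - a) \<in> S" by (simp add: algebra_simps)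
      qed
      have "line_avg a (q k i j) x = (\<alpha> k)\<^sup>2 * (LINT s|lborel. 2 * s ^ 3 * mollify (\<alpha> k) (b k) (r k) (v2 i j) (a + s\<^sup>2 *\<^sub>R (x - a)) * indicator {0..1} s)" for i j
        unfolding q_def[abs_def] line_avg_cmult by (simp add: line_avg_def)
      then show ?thesis
        using mollified_taylor[OF v(1,3) v1(1) v2(1) r t w1 w2]
        by (simp add: w_def p_def taylor_remainder_def sum_distrib_left mult.left_commute)
    qed
    show "(\<lambda>k. sqn (\<lambda>x. w k x - v x)) \<longlonglongrightarrow> 0"
      unfolding w_def by (rule mollify_tendsto_L2[OF v(1,2) lims(1) \<alpha>(1) lims(2,3) rne])
    show "(\<lambda>k. sqn (\<lambda>x. p k i x - v1 i x)) \<longlonglongrightarrow> 0" for i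
      unfolding p_def
      by (rule sqn_scaled_tendsto[OF mv1 v1(1,2) mollify_tendsto_L2[OF v1(1,2) lims(1) \<alpha>(1) lims(2,3) rne] lims(1) sq\<alpha>(2)])
    have "(\<lambda>k. (\<alpha> k)\<^sup>2) \<longlonglongrightarrow> 1\<^sup>2" by (intro tendsto_intros lims)
    then have l2: "(\<lambda>k. (\<alpha> k)\<^sup>2) \<longlonglongrightarrow> 1" by simp
    show "(\<lambda>k. sqn (\<lambda>x. q k i j x - v2 i j x)) \<longlonglongrightarrow> 0" for i j
      unfolding q_def
      by (rule sqn_scaled_tendsto[OF mv2 v2(1,2) mollify_tendsto_L2[OF v2(1,2) lims(1) \<alpha>(1) lims(2,3) rne] l2 sq\<alpha>(3)])
    show "sqn (q k i j) \<le> ennreal (2 ^ CARD('n)) * sqn (v2 i j)" for k i j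
    proof -
      have "sqn (q k i j) \<le> sqn (mollify (\<alpha> k) (b k) (r k) (v2 i j))"
        unfolding q_def[abs_def] by (rule sqn_mono) (use sq\<alpha>(3)[of k] in \<open>simp add: abs_mult mult_left_le_one_le\<close>)
      also have "\<dots> \<le> ennreal (2 ^ CARD('n)) * sqn (v2 i j)"
        by (rule mollify_sqn_le[OF v2(1,2) rne \<alpha>(1)])
      finally show ?thesis .
    qed
  qed
qed

lemma sqn_triangle:
  assumes "f \<in> borel_measurable borel" "g \<in> borel_measurable borel" "h \<in> borel_measurable borel"
  shows "sqn (\<lambda>x. f x - g x) \<le> 2 * sqn (\<lambda>x. f x - h x) + 2 * sqn (\<lambda>x. g x - h x)"
  using sqn_diff[of "\<lambda>x. f x - h x" "\<lambda>x. g x - h x"] assms by simp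

lemma taylor_remainder_diff:
  assumes "\<And>i j. q i j \<in> borel_measurable borel" "\<And>i j. q' i j \<in> borel_measurable borel"
    and "\<And>i j. \<exists>B. \<forall>x. \<bar>q i j x\<bar> \<le> B" "\<And>i j. \<exists>B. \<forall>x. \<bar>q' i j x\<bar> \<le> B"
  shows "taylor_remainder a (\<lambda>i x. p i x - p' i x) (\<lambda>i j x. q i j x - q' i j x) x
    = taylor_remainder a p q x - taylor_remainder a p' q' x"
proof -
  have l: "line_avg a (\<lambda>x. q i j x - q' i j x) x = line_avg a (q i j) x - line_avg a (q' i j) x" for i j
  proof -
    obtain B B' where "\<forall>x. \<bar>q i j x\<bar> \<le> B" "\<forall>x. \<bar>q' i j x\<bar> \<le> B'" using assms(3,4) by metis
    then show ?thesis by (intro line_avg_diff[OF assms(1,2)]) auto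
  qed
  show ?thesis
    unfolding taylor_remainder_def l by (simp add: right_diff_distrib sum_subtractf)
qed

lemma taylor_remainder_first_order:
  "taylor_remainder a p (\<lambda>i j x. 0) x = - (\<Sum>i\<in>UNIV. (x - a) $ i * p i x)"
  by (simp add: taylor_remainder_def line_avg_def)

text \<open>The Taylor formula expresses the constant w_k(a) - w_l(a) on \<open>S\<close> by
  functions that are small in L^2. Dividing by the measure of \<open>S\<close> makes the
  approximations uniformly Cauchy. In the error bound only the second-order term persists, for which
  the mollification costs the factor 2^d.\<close>

lemma H2_continuous_rep:
  fixes v :: "real ^ 'n \<Rightarrow> real"
  assumes d: "CARD('n) \<le> 3" and S: "compact S" "convex S" and int: "interior S \<noteq> {}"
    and v: "v \<in> borel_measurable borel" "sqn v < \<infinity>" "integrable lborel v"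
    and v1: "\<And>i. v1 i \<in> borel_measurable borel" "\<And>i. sqn (v1 i) < \<infinity>" "\<And>i. integrable lborel (v1 i)"
    and v2: "\<And>i j. v2 i j \<in> borel_measurable borel" "\<And>i j. sqn (v2 i j) < \<infinity>" "\<And>i j. integrable lborel (v2 i j)"
    and w1: "\<And>\<phi> i. \<phi> \<in> test_functions (interior S) \<Longrightarrow> (LINT z|lborel. v z * partial_deriv i \<phi> z) = - (LINT z|lborel. v1 i z * \<phi> z)"
    and w2: "\<And>\<phi> i j. \<phi> \<in> test_functions (interior S) \<Longrightarrow> (LINT z|lborel. v z * partial_deriv i (partial_deriv j \<phi>) z) = (LINT z|lborel. v2 i j z * \<phi> z)"
  obtains u where "continuous_on S u" "AE x in lborel. x \<in> S \<longrightarrow> u x = v x"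
    "\<And>a. a \<in> S \<Longrightarrow> sqn (\<lambda>x. indicator S x * (u a - v x + (\<Sum>i\<in>UNIV. (x - a) $ i * v1 i x)))
       \<le> ennreal (8 * (diameter S)^4 * (CARD('n))\<^sup>2 * 2 ^ CARD('n)) * (\<Sum>i\<in>UNIV. \<Sum>j\<in>UNIV. sqn (v2 i j))"
proof -
  note A1 = mollify_approximation[where S = S and v = v and ?v1.0 = v1 and ?v2.0 = v2]
  note A2 = A1[OF S int v(1) v(2) v(3)]
  note A3 = A2[OF v1(1) v1(2) v1(3)]
  note A4 = A3[OF v2(1) v2(2) v2(3)]
  show thesis
  proof (rule A4)
    show "(LINT z|lborel. v z * partial_deriv i \<phi> z) = - (LINT z|lborel. v1 i z * \<phi> z)" if "\<phi> \<in> test_functions (interior S)" for \<phi> i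
      using that by (rule w1)
    show "(LINT z|lborel. v z * partial_deriv i (partial_deriv j \<phi>) z) = (LINT z|lborel. v2 i j z * \<phi> z)" if "\<phi> \<in> test_functions (interior S)" for \<phi> i j
      using that by (rule w2)
  next
  fix w p q
  assume wc: "\<And>k. continuous_on UNIV (w k)" and pm: "\<And>k i. p k i \<in> borel_measurable borel"
    and qm: "\<And>k i j. q k i j \<in> borel_measurable borel"
    and qb: "\<And>k i j. \<exists>B. \<forall>x. \<bar>q k i j x\<bar> \<le> B"
    and eq: "\<And>k x a. x \<in> S \<Longrightarrow> a \<in> S \<Longrightarrow> w k a = w k x + taylor_remainder a (p k) (q k) x"
    and wl: "(\<lambda>k. sqn (\<lambda>x. w k x - v x)) \<longlonglongrightarrow> 0"
    and pl: "\<And>i. (\<lambda>k. sqn (\<lambda>x. p k i x - v1 i x)) \<longlonglongrightarrow> 0"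
    and ql: "\<And>i j. (\<lambda>k. sqn (\<lambda>x. q k i j x - v2 i j x)) \<longlonglongrightarrow> 0"
    and qs: "\<And>k i j. sqn (q k i j) \<le> ennreal (2 ^ CARD('n)) * sqn (v2 i j)"
  have wm: "w k \<in> borel_measurable borel" for k by (rule borel_measurable_continuous_onI[OF wc])
  have Sb[measurable]: "S \<in> sets borel" using S(1) by (simp add: compact_imp_closed)
  define M where "M = taylor_const S"
  note M = taylor_combination_sqn_le[OF S d, folded M_def]
  have M0: "M \<ge> 0"
    using diameter_ge_0[OF compact_imp_bounded[OF S(1)]] by (simp add: M_def taylor_const_def)
  define m where "m = measure lborel S"
  have em: "emeasure lborel S = ennreal m"
    using emeasure_bounded_finite[OF compact_imp_bounded[OF S(1)]] unfolding m_def by (intro emeasure_eq_ennreal_measure) simp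
  have m: "m > 0"
  proof (rule ccontr)
    assume "\<not> m > 0"
    then have "m = 0" using measure_nonneg[of lborel S] by (simp add: m_def)
    then have "emeasure lborel S = 0" using em by simp
    then have "AE x in lborel. x \<notin> S" by (intro AE_not_in) (simp add: null_sets_def)
    then have "AE x in lborel. x \<in> interior S \<longrightarrow> False"
      by eventually_elim (use interior_subset[of S] in blast)
    then have "\<exists>x\<in>interior S. False" by (rule AE_open_ex[OF open_interior int])
    then show False by blast
  qed
  define E where "E k = sqn (\<lambda>x. w k x - v x) + (\<Sum>i\<in>UNIV. sqn (\<lambda>x. p k i x - v1 i x))
      + (\<Sum>i\<in>UNIV. \<Sum>j\<in>UNIV. sqn (\<lambda>x. q k i j x - v2 i j x))" for k
  have E: "E \<longlonglongrightarrow> 0"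
  proof -
    have "E \<longlonglongrightarrow> 0 + (\<Sum>i\<in>(UNIV::'n set). 0) + (\<Sum>i\<in>(UNIV::'n set). \<Sum>j\<in>(UNIV::'n set). 0)"
      unfolding E_def[abs_def] by (intro tendsto_add tendsto_sum wl pl ql)
    then show ?thesis by simp
  qed
  have cauchy: "ennreal ((w k a - w l a)\<^sup>2) * ennreal m \<le> ennreal M * (2 * E k + 2 * E l)" if a: "a \<in> S" for k l a
  proof -
    let ?U = "\<lambda>x. w k x - w l x" and ?P = "\<lambda>i x. p k i x - p l i x" and ?Q = "\<lambda>i j x. q k i j x - q l i j x"
    have "ennreal ((w k a - w l a)\<^sup>2) * ennreal m = sqn (\<lambda>x. indicator S x * (w k a - w l a))"
      by (simp add: sqn_indicator_const[OF Sb] em)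
    also have "(\<lambda>x. indicator S x * (w k a - w l a)) = (\<lambda>x. indicator S x * (?U x + taylor_remainder a ?P ?Q x))"
    proof
      fix x
      show "indicator S x * (w k a - w l a) = indicator S x * (?U x + taylor_remainder a ?P ?Q x)"
      proof (cases "x \<in> S")
        case True
        have "taylor_remainder a ?P ?Q x = taylor_remainder a (p k) (q k) x - taylor_remainder a (p l) (q l) x"
          by (rule taylor_remainder_diff[OF qm qm qb qb])
        then show ?thesis using eq[OF True a, of k] eq[OF True a, of l] True by simp
      qed simp
    qed
    also have "sqn \<dots> \<le> ennreal M * (sqn (\<lambda>x. indicator S x * ?U x) + (\<Sum>i\<in>UNIV. sqn (\<lambda>x. indicator S x * ?P i x))
          + (\<Sum>i\<in>UNIV. \<Sum>j\<in>UNIV. sqn (\<lambda>x. indicator S x * ?Q i j x)))"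
      by (rule M[OF a]) (use wm pm qm in \<open>auto intro!: borel_measurable_diff\<close>)
    also have "\<dots> \<le> ennreal M * (sqn ?U + (\<Sum>i\<in>UNIV. sqn (?P i)) + (\<Sum>i\<in>UNIV. \<Sum>j\<in>UNIV. sqn (?Q i j)))"
      by (intro mult_left_mono add_mono sum_mono sqn_indicator_le) auto
    also have "\<dots> \<le> ennreal M * ((2 * sqn (\<lambda>x. w k x - v x) + 2 * sqn (\<lambda>x. w l x - v x))
        + (\<Sum>i\<in>UNIV. 2 * sqn (\<lambda>x. p k i x - v1 i x) + 2 * sqn (\<lambda>x. p l i x - v1 i x))
        + (\<Sum>i\<in>UNIV. \<Sum>j\<in>UNIV. 2 * sqn (\<lambda>x. q k i j x - v2 i j x) + 2 * sqn (\<lambda>x. q l i j x - v2 i j x)))"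
      by (intro mult_left_mono add_mono sum_mono sqn_triangle wm pm qm v(1) v1(1) v2(1)) auto
    also have "\<dots> = ennreal M * (2 * E k + 2 * E l)"
      unfolding E_def by (simp add: sum.distrib distrib_left sum_distrib_left add_ac)
    finally show ?thesis .
  qed
  have "uniformly_Cauchy_on S w"
    unfolding uniformly_Cauchy_on_def
  proof (intro allI impI)
    fix e :: real assume e: "e > 0"
    \<comment> \<open>The estimate below yields 4Mt, which has to stay under e^2 m. Adding one to
      \<open>M\<close> gives the strict inequality and a nonzero denominator.\<close>
    define t where "t = e\<^sup>2 * m / (4 * (M + 1))"
    have t: "t > 0" using e m M0 by (simp add: t_def)
    then have "eventually (\<lambda>k. E k < ennreal t) sequentially" using E by (intro order_tendstoD(2)) auto
    then obtain K where K: "\<And>k. k \<ge> K \<Longrightarrow> E k < ennreal t" by (auto simp: eventually_sequentially)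
    have "dist (w k a) (w l a) < e" if a: "a \<in> S" and kl: "k \<ge> K" "l \<ge> K" for a k l
    proof -
      have "ennreal ((w k a - w l a)\<^sup>2 * m) = ennreal ((w k a - w l a)\<^sup>2) * ennreal m"
        using m by (simp add: ennreal_mult)
      also have "\<dots> \<le> ennreal M * (2 * E k + 2 * E l)" by (rule cauchy[OF a])
      also have "\<dots> \<le> ennreal M * (2 * ennreal t + 2 * ennreal t)"
        using K[OF kl(1)] K[OF kl(2)] by (intro mult_left_mono add_mono) auto
      also have "2 * ennreal t + 2 * ennreal t = ennreal (4 * t)"
      proof -
        have "2 * ennreal t = ennreal (2 * t)" using t by (simp add: ennreal_mult)
        then show ?thesis using t by (simp flip: ennreal_plus)
      qed
      also have "ennreal M * ennreal (4 * t) = ennreal (4 * M * t)"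
        using M0 t by (subst ennreal_mult[symmetric]) (auto simp: ac_simps)
      finally have "(w k a - w l a)\<^sup>2 * m \<le> 4 * M * t" using M0 t by (subst (asm) ennreal_le_iff) auto
      also have "\<dots> < 4 * (M + 1) * t" using t by simp
      also have "\<dots> = e\<^sup>2 * m" using M0 by (simp add: t_def)
      finally have "(w k a - w l a)\<^sup>2 < e\<^sup>2" using m by simp
      then have "\<bar>w k a - w l a\<bar> < e" using e by (metis abs_of_pos power2_abs power2_less_imp_less less_imp_le)
      then show ?thesis by (simp add: dist_real_def)
    qed
    then show "\<exists>K. \<forall>x\<in>S. \<forall>k\<ge>K. \<forall>l\<ge>K. dist (w k x) (w l x) < e" by blast
  qed
  then obtain u where u: "uniform_limit S w u sequentially"
    using Cauchy_uniformly_convergent[of S w] unfolding uniformly_convergent_on_def by blast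
  have uc: "continuous_on S u"
    by (rule uniform_limit_theorem[OF _ u]) (use continuous_on_subset[OF wc] in auto)
  have um: "(\<lambda>x. indicator S x * u x) \<in> borel_measurable borel"
    using borel_measurable_continuous_on_indicator[OF Sb uc] by simp
  have uw: "(\<lambda>k. sqn (\<lambda>x. indicator S x * u x - indicator S x * w k x)) \<longlonglongrightarrow> 0"
  proof (rule ennreal_tendsto_0I)
    fix e :: real assume e: "e > 0"
    define t where "t = sqrt (e / (2 * m))"
    have t: "t > 0" "t\<^sup>2 = e / (2 * m)" using e m by (auto simp: t_def)
    have "eventually (\<lambda>k. \<forall>x\<in>S. dist (w k x) (u x) < t) sequentially"
      using u t(1) by (auto simp: uniform_limit_iff)
    then show "eventually (\<lambda>k. sqn (\<lambda>x. indicator S x * u x - indicator S x * w k x) < ennreal e) sequentially"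
    proof eventually_elim
      case (elim k)
      have "sqn (\<lambda>x. indicator S x * u x - indicator S x * w k x) \<le> sqn (\<lambda>x. indicator S x * t)"
      proof (rule sqn_mono)
        fix x
        show "\<bar>indicator S x * u x - indicator S x * w k x\<bar> \<le> \<bar>indicator S x * t\<bar>"
          using elim t(1) by (cases "x \<in> S") (force simp: dist_real_def abs_minus_commute)+
      qed
      also have "\<dots> = ennreal (t\<^sup>2 * m)" using m by (simp add: sqn_indicator_const[OF Sb] em ennreal_mult)
      also have "\<dots> < ennreal e" using e m by (intro ennreal_lessI) (auto simp: t(2))
      finally show ?case .
    qed
  qed
  have aeq: "AE x in lborel. indicator S x * u x - indicator S x * v x = 0"
  proof (rule sqn_AE_eq)
    show "(\<lambda>x. indicator S x * u x - indicator S x * v x) \<in> borel_measurable borel"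
      using v(1) Sb by (intro borel_measurable_diff um) (auto intro!: borel_measurable_times)
    have lim: "(\<lambda>k. 2 * sqn (\<lambda>x. indicator S x * u x - indicator S x * w k x) + 2 * sqn (\<lambda>x. w k x - v x)) \<longlonglongrightarrow> 2 * 0 + 2 * 0"
      by (intro tendsto_add ennreal_tendsto_cmult uw wl) auto
    have "sqn (\<lambda>x. indicator S x * u x - indicator S x * v x)
        \<le> 2 * sqn (\<lambda>x. indicator S x * u x - indicator S x * w k x) + 2 * sqn (\<lambda>x. w k x - v x)" for k
    proof -
      have "sqn (\<lambda>x. indicator S x * u x - indicator S x * v x)
        \<le> 2 * sqn (\<lambda>x. indicator S x * u x - indicator S x * w k x) + 2 * sqn (\<lambda>x. indicator S x * v x - indicator S x * w k x)"
        using v(1) Sb wm by (intro sqn_triangle um) (auto intro!: borel_measurable_times)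
      also have "sqn (\<lambda>x. indicator S x * v x - indicator S x * w k x) = sqn (\<lambda>x. indicator S x * (w k x - v x))"
        by (subst sqn_minus_commute) (simp add: right_diff_distrib)
      also have "\<dots> \<le> sqn (\<lambda>x. w k x - v x)" by (rule sqn_indicator_le)
      finally show ?thesis by (simp add: add_left_mono mult_left_mono)
    qed
    with lim have "sqn (\<lambda>x. indicator S x * u x - indicator S x * v x) \<le> 0"
      by (intro LIMSEQ_le_const[OF lim[simplified]]) auto
    then show "sqn (\<lambda>x. indicator S x * u x - indicator S x * v x) = 0" by simp
  qed
  show thesis
  proof (rule that[OF uc])
    show "AE x in lborel. x \<in> S \<longrightarrow> u x = v x"
      using aeq by eventually_elim (auto simp: indicator_def)
    fix a assume a: "a \<in> S"
    let ?h = "diameter S"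
    have h0: "?h \<ge> 0" using diameter_ge_0[OF compact_imp_bounded[OF S(1)]] .
    let ?X = "ennreal (4 * ?h^4 * (CARD('n))\<^sup>2) * (ennreal (2 ^ CARD('n)) * (\<Sum>i\<in>UNIV. \<Sum>j\<in>UNIV. sqn (v2 i j)))"
    let ?R = "\<lambda>k. (2 * (ennreal ((u a - w k a)\<^sup>2) * ennreal m) + 2 * sqn (\<lambda>x. w k x - v x))
        + (\<Sum>i\<in>UNIV. sqn (\<lambda>x. p k i x - v1 i x))"
    let ?L = "\<lambda>x. u a - v x + (\<Sum>i\<in>UNIV. (x - a) $ i * v1 i x)"
    have le: "sqn (\<lambda>x. indicator S x * ?L x) \<le> 2 * ?X + 2 * (ennreal M * ?R k)" for k
    proof -
      \<comment> \<open>The function to be estimated is split in two: \<open>?A\<close> is the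
        second-order remainder of the approximation and is bounded uniformly in \<open>k\<close>,
        while \<open>?B\<close> collects the approximation errors and tends to zero.\<close>
      let ?A = "\<lambda>x. \<Sum>i\<in>UNIV. \<Sum>j\<in>UNIV. (x - a) $ i * (x - a) $ j * line_avg a (q k i j) x"
      let ?U = "\<lambda>x. (u a - w k a) + (w k x - v x)"
      let ?P = "\<lambda>i x. p k i x - v1 i x"
      let ?B = "\<lambda>x. ?U x + taylor_remainder a ?P (\<lambda>i j x. 0) x"
      have cm: "(\<lambda>x. (x - a) $ i) \<in> borel_measurable borel" for i
        by (intro borel_measurable_continuous_onI continuous_intros)
      have Am: "(\<lambda>x. indicator S x * ?A x) \<in> borel_measurable borel"
        using Sb line_avg_measurable[OF qm] cm by (intro borel_measurable_times borel_measurable_sum) auto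
      have Um: "?U \<in> borel_measurable borel"
        using wm v(1) by (intro borel_measurable_add borel_measurable_diff) auto
      have Bm: "(\<lambda>x. indicator S x * ?B x) \<in> borel_measurable borel"
        unfolding taylor_remainder_first_order using Sb wm v(1) cm pm v1(1)
        by (intro borel_measurable_times borel_measurable_add borel_measurable_uminus borel_measurable_sum borel_measurable_diff) auto
      have "indicator S x * ?L x = indicator S x * ?A x + indicator S x * ?B x" for x
      proof (cases "x \<in> S")
        case True
        show ?thesis
          using eq[OF True a, of k] True unfolding taylor_remainder_first_order
          by (simp add: taylor_remainder_def right_diff_distrib sum_subtractf)
      qed simp
      then have "sqn (\<lambda>x. indicator S x * ?L x) = sqn (\<lambda>x. indicator S x * ?A x + indicator S x * ?B x)" by simp
      also have "\<dots> \<le> 2 * sqn (\<lambda>x. indicator S x * ?A x) + 2 * sqn (\<lambda>x. indicator S x * ?B x)"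
        by (rule sqn_add[OF Am Bm])
      also have "sqn (\<lambda>x. indicator S x * ?A x) \<le> ennreal (4 * ?h^4 * (CARD('n))\<^sup>2) * (\<Sum>i\<in>UNIV. \<Sum>j\<in>UNIV. sqn (\<lambda>x. indicator S x * q k i j x))"
        by (rule second_order_sqn_le[OF S a d qm])
      also have "\<dots> \<le> ennreal (4 * ?h^4 * (CARD('n))\<^sup>2) * (\<Sum>i\<in>UNIV. \<Sum>j\<in>UNIV. ennreal (2 ^ CARD('n)) * sqn (v2 i j))"
        by (intro mult_left_mono sum_mono order_trans[OF sqn_indicator_le qs]) auto
      also have "\<dots> = ?X" by (simp only: sum_distrib_left)
      also have "sqn (\<lambda>x. indicator S x * ?B x) \<le> ennreal M * (sqn (\<lambda>x. indicator S x * ?U x) + (\<Sum>i\<in>UNIV. sqn (\<lambda>x. indicator S x * ?P i x))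
          + (\<Sum>i\<in>(UNIV::'n set). \<Sum>j\<in>(UNIV::'n set). sqn (\<lambda>x. indicator S x * 0)))"
        by (rule M[OF a Um]) (use pm v1(1) in \<open>auto intro!: borel_measurable_diff\<close>)
      also have "\<dots> \<le> ennreal M * ?R k"
      proof (rule mult_left_mono)
        have "sqn (\<lambda>x. indicator S x * ?U x) = sqn (\<lambda>x. indicator S x * (u a - w k a) + indicator S x * (w k x - v x))"
          by (simp add: distrib_left)
        also have "\<dots> \<le> 2 * sqn (\<lambda>x. indicator S x * (u a - w k a)) + 2 * sqn (\<lambda>x. indicator S x * (w k x - v x))"
          using Sb wm v(1) by (intro sqn_add borel_measurable_times borel_measurable_diff) auto
        also have "\<dots> \<le> 2 * (ennreal ((u a - w k a)\<^sup>2) * ennreal m) + 2 * sqn (\<lambda>x. w k x - v x)"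
          by (intro add_mono mult_left_mono sqn_indicator_le) (auto simp: sqn_indicator_const[OF Sb] em)
        finally have "sqn (\<lambda>x. indicator S x * ?U x) \<le> 2 * (ennreal ((u a - w k a)\<^sup>2) * ennreal m) + 2 * sqn (\<lambda>x. w k x - v x)" .
        moreover have "sqn (\<lambda>x::real ^ 'n. indicator S x * 0) = 0" by (simp add: sqn_def)
        ultimately show "sqn (\<lambda>x. indicator S x * ?U x) + (\<Sum>i\<in>UNIV. sqn (\<lambda>x. indicator S x * ?P i x))
          + (\<Sum>i\<in>(UNIV::'n set). \<Sum>j\<in>(UNIV::'n set). sqn (\<lambda>x::real ^ 'n. indicator S x * 0)) \<le> ?R k"
          by (simp only: sum.neutral_const add_0_right) (intro add_mono sum_mono sqn_indicator_le)
      qed simp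
      finally show ?thesis by (simp add: add_mono mult_left_mono)
    qed
    have Rl: "?R \<longlonglongrightarrow> (2 * (ennreal m * ennreal ((u a - u a)\<^sup>2)) + 2 * 0) + (\<Sum>i\<in>(UNIV::'n set). 0)"
    proof (intro tendsto_add tendsto_sum pl ennreal_tendsto_cmult wl)
      have "(\<lambda>k. w k a) \<longlonglongrightarrow> u a" using tendsto_uniform_limitI[OF u a] .
      then have "(\<lambda>k. ennreal m * ennreal ((u a - w k a)\<^sup>2)) \<longlonglongrightarrow> ennreal m * ennreal ((u a - u a)\<^sup>2)"
        by (intro ennreal_tendsto_cmult tendsto_ennrealI tendsto_intros) auto
      then show "(\<lambda>k. ennreal ((u a - w k a)\<^sup>2) * ennreal m) \<longlonglongrightarrow> ennreal m * ennreal ((u a - u a)\<^sup>2)"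
        by (simp add: mult.commute)
    qed auto
    then have "?R \<longlonglongrightarrow> 0" by simp
    then have "(\<lambda>k. 2 * ?X + 2 * (ennreal M * ?R k)) \<longlonglongrightarrow> 2 * ?X + 2 * (ennreal M * 0)"
      by (intro tendsto_add tendsto_const ennreal_tendsto_cmult) auto
    then have "(\<lambda>k. 2 * ?X + 2 * (ennreal M * ?R k)) \<longlonglongrightarrow> 2 * ?X" by simp
    then have "sqn (\<lambda>x. indicator S x * ?L x) \<le> 2 * ?X"
      using le by (intro LIMSEQ_le_const) auto
    also have "2 * ?X = ennreal (8 * ?h^4 * (CARD('n))\<^sup>2 * 2 ^ CARD('n)) * (\<Sum>i\<in>UNIV. \<Sum>j\<in>UNIV. sqn (v2 i j))"
    proof -
      have "2 * (ennreal (4 * ?h^4 * (CARD('n))\<^sup>2) * ennreal (2 ^ CARD('n))) = ennreal (8 * ?h^4 * (CARD('n))\<^sup>2 * 2 ^ CARD('n))"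
        using h0 by (simp flip: ennreal_numeral ennreal_mult)
      then show ?thesis by (simp only: mult.assoc[symmetric])
    qed
    finally show "sqn (\<lambda>x. indicator S x * ?L x)
       \<le> ennreal (8 * ?h^4 * (CARD('n))\<^sup>2 * 2 ^ CARD('n)) * (\<Sum>i\<in>UNIV. \<Sum>j\<in>UNIV. sqn (v2 i j))" .
  qed
qed
qed

section \<open>Representatives on compact convex subsets of the domain\<close>

definition h2_data :: "(real ^ 'n) set \<Rightarrow> (real ^ 'n \<Rightarrow> real) \<Rightarrow> ('n \<Rightarrow> real ^ 'n \<Rightarrow> real) \<Rightarrow> ('n \<Rightarrow> 'n \<Rightarrow> real ^ 'n \<Rightarrow> real) \<Rightarrow> bool" where
  "h2_data \<Omega> v v1 v2 \<longleftrightarrow>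
     v \<in> borel_measurable borel \<and> sqn v < \<infinity> \<and>
     (\<forall>i. v1 i \<in> borel_measurable borel \<and> sqn (v1 i) < \<infinity>) \<and>
     (\<forall>i j. v2 i j \<in> borel_measurable borel \<and> sqn (v2 i j) < \<infinity>) \<and>
     (\<forall>\<phi>\<in>test_functions \<Omega>. \<forall>i. (LINT z|lborel. v z * partial_deriv i \<phi> z) = - (LINT z|lborel. v1 i z * \<phi> z)) \<and>
     (\<forall>\<phi>\<in>test_functions \<Omega>. \<forall>i j. (LINT z|lborel. v z * partial_deriv i (partial_deriv j \<phi>) z) = (LINT z|lborel. v2 i j z * \<phi> z))"

lemma test_functions_mono: "\<phi> \<in> test_functions U \<Longrightarrow> U \<subseteq> W \<Longrightarrow> \<phi> \<in> test_functions W"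
  unfolding test_functions_def by blast

lemma test_functions_zero: "\<phi> \<in> test_functions U \<Longrightarrow> x \<notin> U \<Longrightarrow> \<phi> x = 0"
  unfolding test_functions_def by blast

lemma sqn_restrict_finite:
  "sqn g < \<infinity> \<Longrightarrow> sqn (\<lambda>x. indicator K x * g x) < \<infinity>"
  by (rule le_less_trans[OF sqn_indicator_le])

lemma integrable_restrict_compact:
  fixes g :: "real ^ 'n \<Rightarrow> real"
  assumes g: "g \<in> borel_measurable borel" "sqn g < \<infinity>" and K: "compact K"
  shows "integrable lborel (\<lambda>x. indicator K x * g x)"
proof -
  have Kb: "K \<in> sets borel" using K by (simp add: compact_imp_closed)
  have "sqn (indicator K :: real ^ 'n \<Rightarrow> real) = emeasure lborel K"
    using sqn_indicator_const[OF Kb, of 1] by simp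
  also have "\<dots> < \<infinity>" using emeasure_bounded_finite[OF compact_imp_bounded[OF K]] by simp
  finally have "sqn (indicator K :: real ^ 'n \<Rightarrow> real) < \<infinity>" .
  then show ?thesis using g Kb by (intro integrable_mult_square_integrable) auto
qed

text \<open>Cutting the data off outside \<open>K\<close> keeps the weak identities for test
  functions in the interior of \<open>K\<close> and makes the data integrable. The bound then sees
  the second derivatives on \<open>K\<close> alone, so it can be summed over a mesh.\<close>

lemma h2_local_rep:
  fixes v :: "real ^ 'n \<Rightarrow> real"
  assumes h: "h2_data \<Omega> v v1 v2" and d: "CARD('n) \<le> 3"
    and K: "compact K" "convex K" "interior K \<noteq> {}" "interior K \<subseteq> \<Omega>"
  shows "\<exists>u. continuous_on K u \<and> (AE x in lborel. x \<in> K \<longrightarrow> u x = v x) \<and>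
    (\<forall>a\<in>K. sqn (\<lambda>x. indicator K x * (u a - v x + (\<Sum>i\<in>UNIV. (x - a) $ i * v1 i x)))
       \<le> ennreal (8 * (diameter K)^4 * (CARD('n))\<^sup>2 * 2 ^ CARD('n)) * (\<Sum>i\<in>UNIV. \<Sum>j\<in>UNIV. sqn (\<lambda>x. indicator K x * v2 i j x)))"
proof -
  have v: "v \<in> borel_measurable borel" "sqn v < \<infinity>" and v1: "\<And>i. v1 i \<in> borel_measurable borel" "\<And>i. sqn (v1 i) < \<infinity>"
    and v2: "\<And>i j. v2 i j \<in> borel_measurable borel" "\<And>i j. sqn (v2 i j) < \<infinity>"
    and w1: "\<And>\<phi> i. \<phi> \<in> test_functions \<Omega> \<Longrightarrow> (LINT z|lborel. v z * partial_deriv i \<phi> z) = - (LINT z|lborel. v1 i z * \<phi> z)"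
    and w2: "\<And>\<phi> i j. \<phi> \<in> test_functions \<Omega> \<Longrightarrow> (LINT z|lborel. v z * partial_deriv i (partial_deriv j \<phi>) z) = (LINT z|lborel. v2 i j z * \<phi> z)"
    using h unfolding h2_data_def by auto
  have Kb: "K \<in> sets borel" using K(1) by (simp add: compact_imp_closed)
  let ?r = "\<lambda>g x. indicator K x * g x :: real"
  have m: "?r g \<in> borel_measurable borel" if "g \<in> borel_measurable borel" for g :: "real ^ 'n \<Rightarrow> real"
    using that Kb by (intro borel_measurable_times) auto
  have drop: "(LINT z|lborel. ?r g z * \<psi> z) = (LINT z|lborel. g z * \<psi> z)"
    if "\<psi> \<in> test_functions (interior K)" for g \<psi> :: "real ^ 'n \<Rightarrow> real"
  proof -
    have "?r g z * \<psi> z = g z * \<psi> z" for z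
      using test_functions_zero[OF that, of z] interior_subset[of K] by (cases "z \<in> K") auto
    then have "(\<lambda>z. ?r g z * \<psi> z) = (\<lambda>z. g z * \<psi> z)" by (rule ext)
    then show ?thesis by (simp only:)
  qed
  show ?thesis
  proof (rule H2_continuous_rep[where S = K and v = "?r v" and ?v1.0 = "\<lambda>i. ?r (v1 i)" and ?v2.0 = "\<lambda>i j. ?r (v2 i j)", OF d K(1) K(2) K(3)])
    fix \<phi> :: "real ^ 'n \<Rightarrow> real" and i j assume \<phi>: "\<phi> \<in> test_functions (interior K)"
    note t = test_functions_partial_deriv[OF \<phi>] test_functions_partial_deriv[OF test_functions_partial_deriv[OF \<phi>]]
    show "(LINT z|lborel. ?r v z * partial_deriv i \<phi> z) = - (LINT z|lborel. ?r (v1 i) z * \<phi> z)"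
      unfolding drop[OF t(1)] drop[OF \<phi>] by (rule w1[OF test_functions_mono[OF \<phi> K(4)]])
    show "(LINT z|lborel. ?r v z * partial_deriv i (partial_deriv j \<phi>) z) = (LINT z|lborel. ?r (v2 i j) z * \<phi> z)"
      unfolding drop[OF t(2)] drop[OF \<phi>] by (rule w2[OF test_functions_mono[OF \<phi> K(4)]])
  next
    fix u assume u: "continuous_on K u" "AE x in lborel. x \<in> K \<longrightarrow> u x = ?r v x"
      and e: "\<And>a. a \<in> K \<Longrightarrow> sqn (\<lambda>x. indicator K x * (u a - ?r v x + (\<Sum>i\<in>UNIV. (x - a) $ i * ?r (v1 i) x)))
       \<le> ennreal (8 * (diameter K)^4 * (CARD('n))\<^sup>2 * 2 ^ CARD('n)) * (\<Sum>i\<in>UNIV. \<Sum>j\<in>UNIV. sqn (?r (v2 i j)))"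
    have "AE x in lborel. x \<in> K \<longrightarrow> u x = v x" using u(2) by eventually_elim auto
    moreover have "(\<lambda>x. indicator K x * (u a - ?r v x + (\<Sum>i\<in>UNIV. (x - a) $ i * ?r (v1 i) x)))
        = (\<lambda>x. indicator K x * (u a - v x + (\<Sum>i\<in>UNIV. (x - a) $ i * v1 i x)))" for a
      by (auto simp: fun_eq_iff indicator_def)
    ultimately show ?thesis using u(1) e by auto
  qed (intro m sqn_restrict_finite integrable_restrict_compact K(1) v v1 v2)+
qed

section \<open>Affine functions on simplices and balls\<close>

lemma affine_interpolation:
  fixes C :: "(real ^ 'n) set" and f :: "real ^ 'n \<Rightarrow> real"
  assumes "\<not> affine_dependent C"
  shows "\<exists>c b. \<forall>z\<in>C. f z = c + b \<bullet> z"
proof (cases "C = {}")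
  case False
  then obtain a where a: "a \<in> C" by blast
  have "independent ((\<lambda>x. - a + x) ` (C - {a}))"
    using assms affine_dependent_iff_dependent2[OF a] by simp
  then have "\<exists>g. linear g \<and> (\<forall>x\<in>(\<lambda>x. - a + x) ` (C - {a}). g x = f (a + x) - f a)"
    by (rule linear_independent_extend)
  then obtain g :: "real ^ 'n \<Rightarrow> real" where g: "linear g" "\<And>z. z \<in> C \<Longrightarrow> z \<noteq> a \<Longrightarrow> g (- a + z) = f (a + (- a + z)) - f a"
    by auto
  have rep: "g x = adjoint g 1 \<bullet> x" for x
    using adjoint_works[OF g(1), of x 1] by (simp add: inner_commute)
  have "f z = (f a - adjoint g 1 \<bullet> a) + adjoint g 1 \<bullet> z" if "z \<in> C" for z
  proof (cases "z = a")
    case False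
    have "g (- a + z) = f z - f a" using g(2)[OF that False] by simp
    then show ?thesis by (simp add: rep inner_diff_right inner_add_right)
  qed simp
  then show ?thesis by blast
qed auto

lemma affine_bound_convex_hull:
  fixes C :: "'a::euclidean_space set"
  assumes "\<And>z. z \<in> C \<Longrightarrow> \<bar>c + b \<bullet> z\<bar> \<le> m" and "y \<in> convex hull C"
  shows "\<bar>c + b \<bullet> y\<bar> \<le> m"
proof -
  have cv: "convex {y. b \<bullet> y \<le> m - c}" "convex {y. b \<bullet> y \<ge> - m - c}"
    by (rule convex_halfspace_le convex_halfspace_ge)+
  have sub: "C \<subseteq> {y. b \<bullet> y \<le> m - c}" "C \<subseteq> {y. b \<bullet> y \<ge> - m - c}"
    using assms(1) by (force simp: abs_le_iff)+
  have "convex hull C \<subseteq> {y. b \<bullet> y \<le> m - c}" "convex hull C \<subseteq> {y. b \<bullet> y \<ge> - m - c}"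
    by (rule hull_minimal[of C _ convex, OF sub(1) cv(1)], rule hull_minimal[of C _ convex, OF sub(2) cv(2)])
  then have "b \<bullet> y \<le> m - c" "b \<bullet> y \<ge> - m - c" using assms(2) by auto
  then show ?thesis by (simp add: abs_le_iff)
qed

lemma affine_gradient_bound:
  fixes b :: "'a::euclidean_space"
  assumes "\<And>y. y \<in> ball x r \<Longrightarrow> \<bar>c + b \<bullet> y\<bar> \<le> m" and r: "r > 0"
  shows "norm b \<le> 2 * m / r"
proof (cases "b = 0")
  case True
  have "m \<ge> 0" using assms(1)[of x] r by simp
  then show ?thesis using True r by simp
next
  case False
  \<comment> \<open>Opposite points at distance r/2 in the direction of \<open>b\<close> lie in the
    open ball, and the two values differ by r times the norm of \<open>b\<close>.\<close>
  let ?e = "(r / (2 * norm b)) *\<^sub>R b"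
  have "norm ?e = r / 2" using False r by simp
  then have "x + ?e \<in> ball x r" "x - ?e \<in> ball x r" using r by (auto simp: dist_norm)
  then have "\<bar>c + b \<bullet> (x + ?e)\<bar> \<le> m" "\<bar>c + b \<bullet> (x - ?e)\<bar> \<le> m" using assms(1) by blast+
  then have "c + (b \<bullet> x + b \<bullet> ?e) \<le> m" "- (c + (b \<bullet> x - b \<bullet> ?e)) \<le> m"
    by (simp_all only: inner_add_right inner_diff_right abs_le_iff)
  then have "2 * (b \<bullet> ?e) \<le> 2 * m" by linarith
  moreover have "b \<bullet> ?e = r / 2 * norm b"
    using False by (simp add: inner_commute power2_norm_eq_inner[symmetric] power2_eq_square)
  ultimately have "r * norm b \<le> 2 * m" by simp
  then show ?thesis using r by (simp add: field_simps)
qed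

lemma continuous_eq_closure:
  fixes f g :: "'a::metric_space \<Rightarrow> 'b::t2_space"
  assumes "continuous_on S f" "continuous_on S g" "U \<subseteq> S" "y \<in> closure U" "y \<in> S" "\<And>x. x \<in> U \<Longrightarrow> f x = g x"
  shows "f y = g y"
proof -
  obtain X where X: "\<And>n::nat. X n \<in> U" "X \<longlonglongrightarrow> y" using assms(4) by (auto simp: closure_sequential)
  have "(\<lambda>n. f (X n)) \<longlonglongrightarrow> f y" "(\<lambda>n. g (X n)) \<longlonglongrightarrow> g y"
    using X(1) assms(3) by (auto intro!: continuous_on_tendsto_compose[OF assms(1) X(2) assms(5)]
        continuous_on_tendsto_compose[OF assms(2) X(2) assms(5)] always_eventually)
  moreover have "(\<lambda>n. f (X n)) = (\<lambda>n. g (X n))" using assms(6) X(1) by auto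
  ultimately show ?thesis using LIMSEQ_unique by metis
qed

section \<open>Meshes and interpolation\<close>

definition verts :: "(real ^ 'n) set \<Rightarrow> (real ^ 'n) set" where
  "verts K = {z. z extreme_point_of K}"

lemma simplex_verts:
  fixes K :: "(real ^ 'n) set"
  assumes "int CARD('n) simplex K"
  shows "finite (verts K)" "\<not> affine_dependent (verts K)" "card (verts K) = CARD('n) + 1" "K = convex hull (verts K)"
    "compact K" "convex K" "interior K \<noteq> {}" "rel_interior K = interior K" "K \<noteq> {}"
proof -
  obtain C where C: "finite C" "\<not> affine_dependent C" "int (card C) = int CARD('n) + 1" "K = convex hull C"
    using assms unfolding simplex by blast
  have "verts K = C"
    unfolding verts_def C(4) using extreme_point_of_convex_hull_affine_independent[OF C(2)] by auto
  then show *: "finite (verts K)" "\<not> affine_dependent (verts K)" "card (verts K) = CARD('n) + 1" "K = convex hull (verts K)"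
    using C by auto
  show "compact K" "convex K" unfolding C(4) using finite_imp_compact_convex_hull[OF C(1)] by auto
  have "affine hull K = UNIV" using aff_dim_simplex[OF assms] aff_dim_eq_full[of K] by simp
  then show ri: "rel_interior K = interior K" by (rule rel_interior_interior)
  show ne: "K \<noteq> {}" using aff_dim_simplex[OF assms] by auto
  show "interior K \<noteq> {}" using ri rel_interior_eq_empty[OF \<open>convex K\<close>] ne by simp
qed

text \<open>The required face is spanned by the vertices at which the barycentric coordinates of
  \<open>x\<close> are positive.\<close>

lemma simplex_face_at:
  fixes K :: "(real ^ 'n) set"
  assumes "int CARD('n) simplex K" "x \<in> K"
  shows "\<exists>c\<subseteq>verts K. (convex hull c) face_of K \<and> x \<in> rel_interior (convex hull c)"
proof -
  note V = simplex_verts[OF assms(1)]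
  have "x \<in> convex hull (verts K)" using V(4) assms(2) by simp
  then obtain u where u: "\<And>z. z \<in> verts K \<Longrightarrow> 0 \<le> u z" "sum u (verts K) = 1" "(\<Sum>z\<in>verts K. u z *\<^sub>R z) = x"
    unfolding convex_hull_finite[OF V(1)] by blast
  let ?c = "{z \<in> verts K. u z > 0}"
  have c: "?c \<subseteq> verts K" by blast
  have zero: "u z = 0" if "z \<in> verts K - ?c" for z
  proof -
    have "0 \<le> u z" "\<not> u z > 0" using u(1)[of z] that by simp_all
    then show ?thesis by linarith
  qed
  have "sum u (verts K) = sum u ?c"
    by (rule sum.mono_neutral_right[OF V(1) c]) (use zero in blast)
  then have "sum u ?c = 1" using u(2) by simp
  moreover have "(\<Sum>z\<in>verts K. u z *\<^sub>R z) = (\<Sum>z\<in>?c. u z *\<^sub>R z)"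
    by (rule sum.mono_neutral_right[OF V(1) c]) (use zero in \<open>simp del: mem_Collect_eq\<close>)
  then have "(\<Sum>z\<in>?c. u z *\<^sub>R z) = x" using u(3) by simp
  moreover have "\<not> affine_dependent ?c" using affine_independent_subset[OF V(2) c] .
  ultimately have "x \<in> rel_interior (convex hull ?c)"
    unfolding rel_interior_convex_hull_explicit[OF \<open>\<not> affine_dependent ?c\<close>]
    by (intro CollectI exI[of _ u]) simp
  moreover have "(convex hull ?c) face_of (convex hull (verts K))"
    using face_of_convex_hull_affine_independent[OF V(2)] c by blast
  then have "(convex hull ?c) face_of K" using V(4) by simp
  ultimately show ?thesis using c by blast
qed

section \<open>Faces of the mesh and the boundary of the domain\<close>

locale mesh =
  fixes \<Omega> :: "(real ^ 'n) set" and \<T> :: "(real ^ 'n) set set"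
  assumes dom: "open_polytope \<Omega>" and tri: "simplicial_mesh \<Omega> \<T>"
begin

lemma open_dom: "open \<Omega>" and bounded_dom: "bounded \<Omega>" and regular_dom: "interior (closure \<Omega>) = \<Omega>"
  using dom by (auto simp: open_polytope_def)

lemma finite_mesh: "finite \<T>"
  and face_to_face: "K \<in> \<T> \<Longrightarrow> K' \<in> \<T> \<Longrightarrow> (K \<inter> K') face_of K"
  and simplices: "K \<in> \<T> \<Longrightarrow> int CARD('n) simplex K"
  and cover: "\<Union>\<T> = closure \<Omega>"
  using tri by (auto simp: simplicial_mesh_def triangulation_def)

lemma interior_simplex_subset: "K \<in> \<T> \<Longrightarrow> interior K \<subseteq> \<Omega>"
  using interior_mono[of K "closure \<Omega>"] cover regular_dom by auto

text \<open>The intersection of the two simplices is a face of \<open>K\<close>, and a face that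
  meets the relative interior of \<open>G\<close> contains all of \<open>G\<close>.\<close>

lemma face_subset:
  assumes "K \<in> \<T>" "K' \<in> \<T>" "G face_of K" "y \<in> rel_interior G" "y \<in> K'"
  shows "G \<subseteq> K'"
proof -
  have "y \<in> G" using assms(4) rel_interior_subset by blast
  moreover have "G \<subseteq> K" using face_of_imp_subset[OF assms(3)] .
  ultimately have "(K \<inter> K') \<inter> rel_interior G \<noteq> {}" using assms(4,5) by blast
  from subset_of_face_of[OF face_to_face[OF assms(1,2)] \<open>G \<subseteq> K\<close> this] show ?thesis by blast
qed

text \<open>
  The map \<open>p \<mapsto> (1 - s) p + s z\<close> with \<open>z \<in> G\<close> preserves every simplex containing \<open>G\<close>, and hence
  carries a neighbourhood of one relatively interior point of \<open>G\<close> to a neighbourhood of another.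
\<close>

lemma rel_interior_face_subset_domain:
  assumes K: "K \<in> \<T>" and G: "G face_of K" and x: "x \<in> rel_interior G" "x \<in> \<Omega>"
  shows "rel_interior G \<subseteq> \<Omega>"
proof
  fix y assume y: "y \<in> rel_interior G"
  have cG: "convex G" using face_of_imp_convex[OF G] simplex_verts(6)[OF simplices[OF K]] by blast
  have xG: "x \<in> G" and yG: "y \<in> G" using x(1) y rel_interior_subset by blast+
  have Gne: "G \<noteq> {}" using xG by blast
  \<comment> \<open>Since \<open>y\<close> is relatively interior, the segment from \<open>x\<close>
    to \<open>y\<close> can be prolonged beyond \<open>y\<close> within \<open>G\<close>. The new
    end is \<open>z\<close>, and a contraction towards \<open>z\<close> carries \<open>x\<close> to
    \<open>y\<close>.\<close>
  have "\<forall>x\<in>G. \<exists>e. e > 1 \<and> (1 - e) *\<^sub>R x + e *\<^sub>R y \<in> G"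
    using y convex_rel_interior_iff[OF cG Gne] by simp
  then obtain e where e: "e > 1" "(1 - e) *\<^sub>R x + e *\<^sub>R y \<in> G" using xG by blast
  define z where "z = (1 - e) *\<^sub>R x + e *\<^sub>R y"
  define s where "s = 1 / e"
  have s: "0 < s" "s < 1" using e(1) by (auto simp: s_def)
  define F where "F p = (1 - s) *\<^sub>R p + s *\<^sub>R z" for p
  have sz: "s *\<^sub>R z = (s - 1) *\<^sub>R x + y"
    using e(1) unfolding z_def s_def by (simp add: scaleR_add_right diff_divide_distrib)
  have Fx: "F x = y" unfolding F_def sz by (simp add: algebra_simps)
  \<comment> \<open>Once the simplices that miss \<open>x\<close> are removed, every simplex met
    near \<open>x\<close> contains \<open>x\<close>, hence all of \<open>G\<close> and in particular
    \<open>z\<close>.\<close>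
  let ?Far = "\<Union>{K'\<in>\<T>. x \<notin> K'}"
  have "closed ?Far" using finite_mesh simplex_verts(5)[OF simplices] by (intro closed_Union) (auto intro: compact_imp_closed)
  moreover have "x \<notin> ?Far" by blast
  ultimately have "open (\<Omega> - ?Far)" "x \<in> \<Omega> - ?Far" using open_dom x(2) by auto
  then obtain \<delta> where \<delta>: "\<delta> > 0" "ball x \<delta> \<subseteq> \<Omega> - ?Far" using open_contains_ball by blast
  have "F p \<in> closure \<Omega>" if p: "p \<in> ball x \<delta>" for p
  proof -
    have "p \<in> closure \<Omega>" "p \<notin> ?Far" using p \<delta>(2) closure_subset by blast+
    then obtain K' where K': "K' \<in> \<T>" "p \<in> K'" "x \<in> K'" using cover by blast
    have "z \<in> K'" using face_subset[OF K K'(1) G x(1) K'(3)] e(2) by (auto simp: z_def)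
    then have "F p \<in> K'"
      unfolding F_def using simplex_verts(6)[OF simplices[OF K'(1)]] K'(2) s by (intro convexD_alt) auto
    then show ?thesis using K'(1) cover by blast
  qed
  then have "F ` ball x \<delta> \<subseteq> closure \<Omega>" by blast
  moreover have "ball y ((1 - s) * \<delta>) \<subseteq> F ` ball x \<delta>"
  proof
    fix p' assume p': "p' \<in> ball y ((1 - s) * \<delta>)"
    let ?p = "x + (1 / (1 - s)) *\<^sub>R (p' - y)"
    have "F ?p = F x + (p' - y)" unfolding F_def using s by (simp add: algebra_simps)
    then have "F ?p = p'" by (simp add: Fx)
    moreover have "?p \<in> ball x \<delta>"
    proof -
      have "norm (p' - y) < (1 - s) * \<delta>" using p' by (simp add: dist_norm norm_minus_commute)
      then have "norm ((1 / (1 - s)) *\<^sub>R (p' - y)) < \<delta>"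
        using s by (simp only: norm_scaleR) (simp add: pos_divide_less_eq mult.commute)
      then show ?thesis by (simp add: dist_norm norm_minus_commute)
    qed
    ultimately show "p' \<in> F ` ball x \<delta>" by (metis imageI)
  qed
  ultimately have "ball y ((1 - s) * \<delta>) \<subseteq> closure \<Omega>" by blast
  then have "y \<in> interior (closure \<Omega>)"
    using s \<delta>(1) by (meson centre_in_ball diff_gt_0_iff_gt interiorI mult_pos_pos open_ball)
  then show "y \<in> \<Omega>" using regular_dom by simp
qed

lemma disjoint_interiors:
  assumes "K \<in> \<T>" "K' \<in> \<T>" "x \<in> interior K" "x \<in> interior K'"
  shows "K = K'"
proof -
  have *: "A \<subseteq> B" if "A \<in> \<T>" "B \<in> \<T>" "x \<in> interior A" "x \<in> interior B" for A B
    using face_subset[OF that(1,2) face_of_refl[OF simplex_verts(6)[OF simplices[OF that(1)]]], of x]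
      that simplex_verts(8)[OF simplices[OF that(1)]] interior_subset by blast
  show ?thesis using *[OF assms] *[OF assms(2,1,4,3)] by blast
qed

text \<open>Two simplices containing \<open>y\<close> need not share an open set, so they cannot be
  compared directly. Each is compared with a representative on a small ball around \<open>y\<close>:
  equality holds in the interior of the simplex near \<open>y\<close> and passes to \<open>y\<close>
  by continuity.\<close>

lemma reps_agree:
  fixes v :: "real ^ 'n \<Rightarrow> real"
  assumes h: "h2_data \<Omega> v v1 v2" and d: "CARD('n) \<le> 3"
    and K: "K \<in> \<T>" "continuous_on K u" "AE x in lborel. x \<in> K \<longrightarrow> u x = v x"
    and K': "K' \<in> \<T>" "continuous_on K' u'" "AE x in lborel. x \<in> K' \<longrightarrow> u' x = v x"
    and y: "y \<in> \<Omega>" "y \<in> K" "y \<in> K'"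
  shows "u y = u' y"
proof -
  obtain \<rho> where \<rho>: "\<rho> > 0" "cball y \<rho> \<subseteq> \<Omega>" using open_dom y(1) open_contains_cball by blast
  have "interior (cball y \<rho>) \<noteq> {}" "interior (cball y \<rho>) \<subseteq> \<Omega>" using \<rho> interior_subset by (auto simp: interior_cball)
  from h2_local_rep[OF h d compact_cball convex_cball this] obtain w where
    w: "continuous_on (cball y \<rho>) w" "AE x in lborel. x \<in> cball y \<rho> \<longrightarrow> w x = v x" by blast
  have "u y = w y" if K: "K \<in> \<T>" "continuous_on K u" "AE x in lborel. x \<in> K \<longrightarrow> u x = v x" and yK: "y \<in> K" for K u
  proof -
    let ?U = "interior K \<inter> ball y \<rho>"
    have sub: "?U \<subseteq> K \<inter> cball y \<rho>" using interior_subset ball_subset_cball by blast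
    have "AE x in lborel. x \<in> ?U \<longrightarrow> u x = w x"
      using K(3) w(2) by eventually_elim (use sub in auto)
    then have eq: "u x = w x" if "x \<in> ?U" for x
      using that sub
      by (intro AE_eq_continuous_on_open[of ?U u w x] continuous_on_subset[OF K(2)] continuous_on_subset[OF w(1)]) auto
    have "y \<in> closure (interior K)"
      using convex_closure_interior[OF simplex_verts(6,7)[OF simplices[OF K(1)]]] yK closure_subset by blast
    then have "y \<in> closure ?U"
      using \<rho>(1) open_Int_closure_subset[of "ball y \<rho>" "interior K"] by (auto simp: Int_commute)
    then show ?thesis
      by (rule continuous_eq_closure[of "K \<inter> cball y \<rho>" u w ?U, rotated 3])
        (use eq sub yK \<rho>(1) continuous_on_subset[OF K(2)] continuous_on_subset[OF w(1)] in auto)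
  qed
  from this[OF K y(2)] this[OF K' y(3)] show ?thesis by simp
qed

text \<open>A vertex of the common face may lie on the boundary of \<Omega>, where
  \<open>reps_agree\<close> says nothing. Agreement holds on the relative interior of the face and
  is carried from there to its vertices by continuity of both representatives.\<close>

lemma interpolants_agree:
  fixes v :: "real ^ 'n \<Rightarrow> real"
  assumes h: "h2_data \<Omega> v v1 v2" and d: "CARD('n) \<le> 3"
    and u: "\<And>K. K \<in> \<T> \<Longrightarrow> continuous_on K (u K)" "\<And>K. K \<in> \<T> \<Longrightarrow> AE x in lborel. x \<in> K \<longrightarrow> u K x = v x"
    and p: "\<And>K z. K \<in> \<T> \<Longrightarrow> z \<in> verts K \<Longrightarrow> u K z = c K + b K \<bullet> z"
    and K: "K \<in> \<T>" "K' \<in> \<T>" and x: "x \<in> \<Omega>" "x \<in> K" "x \<in> K'"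
  shows "c K + b K \<bullet> x = c K' + b K' \<bullet> x"
proof -
  obtain g where g: "g \<subseteq> verts K" "(convex hull g) face_of K" "x \<in> rel_interior (convex hull g)"
    using simplex_face_at[OF simplices[OF K(1)] x(2)] by blast
  let ?G = "convex hull g"
  have GK: "?G \<subseteq> K" using face_of_imp_subset[OF g(2)] .
  have GK': "?G \<subseteq> K'" by (rule face_subset[OF K g(2,3) x(3)])
  have G\<Omega>: "rel_interior ?G \<subseteq> \<Omega>" by (rule rel_interior_face_subset_domain[OF K(1) g(2,3) x(1)])
  \<comment> \<open>Equality is put as a bound by zero, so that
    \<open>affine_bound_convex_hull\<close> extends it from the vertices to the face.\<close>
  have "\<bar>(c K - c K') + (b K - b K') \<bullet> z\<bar> \<le> 0" if z: "z \<in> g" for z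
  proof -
    have zG: "z \<in> ?G" using z by (rule hull_inc)
    have "u K z = u K' z"
    proof (rule continuous_eq_closure[of "?G" _ _ "rel_interior ?G"])
      show "continuous_on ?G (u K)" "continuous_on ?G (u K')"
        using continuous_on_subset[OF u(1)[OF K(1)] GK] continuous_on_subset[OF u(1)[OF K(2)] GK'] by auto
      show "z \<in> closure (rel_interior ?G)"
        using convex_closure_rel_interior[OF convex_convex_hull, of g] zG closure_subset by blast
      show "u K y = u K' y" if "y \<in> rel_interior ?G" for y
        using that G\<Omega> GK GK' rel_interior_subset[of ?G]
        by (intro reps_agree[OF h d K(1) u(1)[OF K(1)] u(2)[OF K(1)] K(2) u(1)[OF K(2)] u(2)[OF K(2)]]) auto
    qed (use zG rel_interior_subset in auto)
    moreover have "z \<in> verts K" using z g(1) by blast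
    moreover have "z \<in> verts K'"
    proof -
      have "z extreme_point_of K" using \<open>z \<in> verts K\<close> by (simp add: verts_def)
      then have "z extreme_point_of (K \<inter> K')" using zG GK GK' by (auto simp: extreme_point_of_def)
      then show ?thesis
        using extreme_point_of_face[OF face_to_face[OF K(2,1)], of z] by (simp add: verts_def Int_commute)
    qed
    ultimately show ?thesis using p K by (simp add: inner_diff_left)
  qed
  then have "\<bar>(c K - c K') + (b K - b K') \<bullet> x\<bar> \<le> 0"
    by (rule affine_bound_convex_hull[OF _ subsetD[OF rel_interior_subset g(3)]])
  then show ?thesis by (simp add: inner_diff_left)
qed

text \<open>The face containing \<open>x\<close> in its relative interior has no vertex in \<Omega>:
  near such a vertex its relative interior would meet \<Omega>, hence lie in \<Omega> together with
  \<open>x\<close>.\<close>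

lemma interpolant_zero_boundary:
  assumes K: "K \<in> \<T>" and p: "\<And>z. z \<in> verts K \<Longrightarrow> z \<notin> \<Omega> \<Longrightarrow> c + b \<bullet> z = 0"
    and x: "x \<in> K" "x \<notin> \<Omega>"
  shows "c + b \<bullet> x = 0"
proof -
  obtain g where g: "g \<subseteq> verts K" "(convex hull g) face_of K" "x \<in> rel_interior (convex hull g)"
    using simplex_face_at[OF simplices[OF K] x(1)] by blast
  let ?G = "convex hull g"
  have "\<bar>c + b \<bullet> z\<bar> \<le> 0" if z: "z \<in> g" for z
  proof -
    have "z \<notin> \<Omega>"
    proof
      assume z\<Omega>: "z \<in> \<Omega>"
      have "z \<in> closure (rel_interior ?G)"
        using convex_closure_rel_interior[OF convex_convex_hull, of g] hull_inc[OF z, of convex] closure_subset by blast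
      then obtain y where y: "y \<in> rel_interior ?G" "y \<in> \<Omega>"
        using open_Int_closure_eq_empty[OF open_dom, of "rel_interior ?G"] z\<Omega> by blast
      from rel_interior_face_subset_domain[OF K g(2) y] g(3) x(2) show False by blast
    qed
    then show ?thesis using p[of z] z g(1) by auto
  qed
  then have "\<bar>c + b \<bullet> x\<bar> \<le> 0"
    by (rule affine_bound_convex_hull[OF _ subsetD[OF rel_interior_subset g(3)]])
  then show ?thesis by simp
qed

end

section \<open>Interpolation error on one simplex\<close>

lemma sqn_mono_AE: "AE x in lborel. \<bar>f x\<bar> \<le> \<bar>g x\<bar> \<Longrightarrow> sqn f \<le> sqn g"
  unfolding sqn_def
  by (rule nn_integral_mono_AE, erule eventually_mono) (rule ennreal_leI, simp add: abs_le_square_iff)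

text \<open>For fixed x and g = grad v(x), the function q \<mapsto> (c - v(x) + g \<bullet> x) + (b
  - g) \<bullet> q is affine and equals the Taylor error at each vertex, so the sum of the vertex
  errors bounds it on \<open>K\<close>. At q = x it is the interpolation error up to sign, and its
  slope, read off on the ball, is the gradient error.\<close>

lemma simplex_interpolation_error:
  fixes v :: "real ^ 'n \<Rightarrow> real"
  assumes K: "int CARD('n) simplex K"
    and v: "v \<in> borel_measurable borel" "\<And>i. v1 i \<in> borel_measurable borel"
    and e: "\<And>a. a \<in> K \<Longrightarrow> sqn (\<lambda>x. indicator K x * (u a - v x + (\<Sum>i\<in>UNIV. (x - a) $ i * v1 i x))) \<le> X"
    and p: "\<And>z. z \<in> verts K \<Longrightarrow> u z = c + b \<bullet> z"
    and r: "r > 0" "ball y r \<subseteq> K"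
  shows "sqn (\<lambda>x. indicator K x * (v x - (c + b \<bullet> x))) \<le> ennreal ((real CARD('n) + 1)\<^sup>2) * X"
    and "sqn (\<lambda>x. indicator K x * (v1 i x - b $ i)) \<le> ennreal ((2 / r)\<^sup>2 * (real CARD('n) + 1)\<^sup>2) * X"
proof -
  note V = simplex_verts[OF K]
  have Kb: "K \<in> sets borel" using V(5) by (simp add: compact_imp_closed)
  let ?e = "\<lambda>z x. indicator K x * (u z - v x + (\<Sum>i\<in>UNIV. (x - z) $ i * v1 i x))"
  have cm: "(\<lambda>x. (x - a) $ i) \<in> borel_measurable borel" for a :: "real ^ 'n" and i
    by (intro borel_measurable_continuous_onI continuous_intros)
  have em: "?e z \<in> borel_measurable borel" for z
    using Kb v cm by (intro borel_measurable_times borel_measurable_add borel_measurable_diff borel_measurable_sum) auto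
  have key: "\<bar>v x - (c + b \<bullet> x)\<bar> \<le> 1 * (\<Sum>z\<in>verts K. \<bar>?e z x\<bar>)"
    "\<bar>v1 i x - b $ i\<bar> \<le> 2 / r * (\<Sum>z\<in>verts K. \<bar>?e z x\<bar>)" if x: "x \<in> K" for x i
  proof -
    define g where "g = (\<chi> i. v1 i x)"
    let ?m = "\<Sum>z\<in>verts K. \<bar>?e z x\<bar>"
    have "\<bar>(c - v x + g \<bullet> x) + (b - g) \<bullet> z\<bar> \<le> ?m" if z: "z \<in> verts K" for z
    proof -
      have "(\<Sum>i\<in>UNIV. (x - z) $ i * v1 i x) = g \<bullet> (x - z)"
        by (simp add: inner_vec_def g_def mult.commute)
      then have "(c - v x + g \<bullet> x) + (b - g) \<bullet> z = ?e z x"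
        using p[OF z] x by (simp add: inner_diff_left inner_diff_right)
      then have "\<bar>(c - v x + g \<bullet> x) + (b - g) \<bullet> z\<bar> = \<bar>?e z x\<bar>" by simp
      also have "\<dots> \<le> ?m" by (rule member_le_sum[OF z _ V(1)]) simp
      finally show ?thesis .
    qed
    then have A: "\<bar>(c - v x + g \<bullet> x) + (b - g) \<bullet> q\<bar> \<le> ?m" if "q \<in> K" for q
      by (rule affine_bound_convex_hull) (use that V(4) in auto)
    have "\<bar>(c - v x + g \<bullet> x) + (b - g) \<bullet> x\<bar> \<le> ?m" by (rule A[OF x])
    then show "\<bar>v x - (c + b \<bullet> x)\<bar> \<le> 1 * ?m" by (simp add: inner_diff_left abs_minus_commute)
    have "norm (b - g) \<le> 2 * ?m / r"
      by (rule affine_gradient_bound[OF A r(1)]) (use r(2) in auto)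
    moreover have "\<bar>(b - g) $ i\<bar> \<le> norm (b - g)" by (rule component_le_norm_cart)
    ultimately show "\<bar>v1 i x - b $ i\<bar> \<le> 2 / r * ?m" by (simp add: g_def abs_minus_commute)
  qed
  have sum: "(\<Sum>z\<in>verts K. sqn (?e z)) \<le> ennreal (real CARD('n) + 1) * X"
  proof -
    have "z \<in> K" if "z \<in> verts K" for z using that by (simp add: verts_def extreme_point_of_def)
    then have "(\<Sum>z\<in>verts K. sqn (?e z)) \<le> (\<Sum>z\<in>verts K. X)" by (intro sum_mono e)
    also have "\<dots> = of_nat (CARD('n) + 1) * X" by (simp add: V(3))
    also have "of_nat (CARD('n) + 1) = ennreal (real CARD('n) + 1)"
      by (subst ennreal_of_nat_eq_real_of_nat) (simp add: add.commute)
    finally show ?thesis .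
  qed
  have fin: "ennreal (H\<^sup>2 * card (verts K)) * (\<Sum>z\<in>verts K. sqn (?e z)) \<le> ennreal (H\<^sup>2 * (real CARD('n) + 1)\<^sup>2) * X" for H :: real
  proof -
    have "ennreal (H\<^sup>2 * card (verts K)) * (\<Sum>z\<in>verts K. sqn (?e z)) \<le> ennreal (H\<^sup>2 * card (verts K)) * (ennreal (real CARD('n) + 1) * X)"
      by (rule mult_left_mono[OF sum]) simp
    also have "\<dots> = ennreal (H\<^sup>2 * card (verts K) * (real CARD('n) + 1)) * X"
      by (subst ennreal_mult) (auto simp: mult.assoc)
    also have "H\<^sup>2 * card (verts K) * (real CARD('n) + 1) = H\<^sup>2 * (real CARD('n) + 1)\<^sup>2"
      by (simp add: V(3) power2_eq_square algebra_simps)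
    finally show ?thesis .
  qed
  have "sqn (\<lambda>x. indicator K x * (v x - (c + b \<bullet> x))) \<le> ennreal ((1::real)\<^sup>2 * card (verts K)) * (\<Sum>z\<in>verts K. sqn (?e z))"
  proof (rule sqn_sum_le[OF V(1) em])
    fix x
    show "\<bar>indicator K x * (v x - (c + b \<bullet> x))\<bar> \<le> 1 * (\<Sum>z\<in>verts K. \<bar>?e z x\<bar>)"
      using key(1)[of x] by (cases "x \<in> K") (auto simp: sum_nonneg)
  qed simp
  from order_trans[OF this fin] show "sqn (\<lambda>x. indicator K x * (v x - (c + b \<bullet> x))) \<le> ennreal ((real CARD('n) + 1)\<^sup>2) * X" by simp
  have "sqn (\<lambda>x. indicator K x * (v1 i x - b $ i)) \<le> ennreal ((2 / r)\<^sup>2 * card (verts K)) * (\<Sum>z\<in>verts K. sqn (?e z))"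
  proof (rule sqn_sum_le[OF V(1) em])
    fix x
    show "\<bar>indicator K x * (v1 i x - b $ i)\<bar> \<le> 2 / r * (\<Sum>z\<in>verts K. \<bar>?e z x\<bar>)"
      using key(2)[of x i] r(1) by (cases "x \<in> K") (auto intro!: sum_nonneg)
  qed (use r in simp)
  from order_trans[OF this fin] show "sqn (\<lambda>x. indicator K x * (v1 i x - b $ i)) \<le> ennreal ((2 / r)\<^sup>2 * (real CARD('n) + 1)\<^sup>2) * X" .
qed

text \<open>The supremum need not be attained, so only half of the guaranteed value diam(K)/\<gamma>
  is used. Passing from diameter to radius gives the other factor 2.\<close>

lemma insphere_ball:
  fixes K :: "(real ^ 'n) set"
  assumes K: "compact K" "interior K \<noteq> {}" and \<gamma>: "\<gamma> > 0" "diameter K \<le> \<gamma> * insphere_diameter K"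
  obtains y r where "r > 0" "ball y r \<subseteq> K" "diameter K \<le> 4 * \<gamma> * r"
proof -
  obtain x where "x \<in> interior K" using K(2) by blast
  then obtain \<delta> where x: "\<delta> > 0" "ball x \<delta> \<subseteq> K"
    unfolding mem_interior by blast
  have "dist x (x + (\<delta> / 2) *\<^sub>R axis undefined 1) \<le> diameter K"
    using x by (intro diameter_bounded_bound compact_imp_bounded K subsetD[OF x(2)]) (auto simp: dist_norm)
  then have dpos: "diameter K > 0" using x(1) by (simp add: dist_norm)
  let ?S = "{2 * r | x r. 0 \<le> r \<and> ball x r \<subseteq> K}"
  have "2 * 0 \<in> ?S" by (auto intro!: exI[of _ 0])
  then have ne: "?S \<noteq> {}" by blast
  have "diameter K / (2 * \<gamma>) < diameter K / \<gamma>" using dpos \<gamma>(1) by (simp add: field_simps)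
  also have "\<dots> \<le> Sup ?S" using \<gamma> by (simp add: insphere_diameter_def field_simps)
  finally obtain t where t: "t \<in> ?S" "diameter K / (2 * \<gamma>) < t" using less_cSupD[OF ne] by blast
  then obtain y r where r: "t = 2 * r" "0 \<le> r" "ball y r \<subseteq> K" by blast
  have "0 < diameter K / (2 * \<gamma>)" using dpos \<gamma>(1) by simp
  then have "r > 0" using t(2) r(1) by linarith
  moreover have "diameter K \<le> 4 * \<gamma> * r" using t(2) r(1) \<gamma>(1) by (simp add: field_simps)
  ultimately show thesis using that r(3) by blast
qed

section \<open>Piecewise affine functions on the mesh\<close>

context mesh
begin

lemma AE_interior: "AE x in lborel. \<forall>K\<in>\<T>. x \<in> K \<longrightarrow> x \<in> interior K"
proof (intro AE_finite_allI finite_mesh)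
  fix K assume K: "K \<in> \<T>"
  have "negligible (frontier K)" by (rule negligible_convex_frontier[OF simplex_verts(6)[OF simplices[OF K]]])
  then have "frontier K \<in> null_sets lborel"
    unfolding negligible_iff_null_sets by (subst (asm) null_sets_completion_iff) auto
  then have "AE x in lborel. x \<notin> frontier K" by (rule AE_not_in)
  then show "AE x in lborel. x \<in> K \<longrightarrow> x \<in> interior K"
    by eventually_elim (use closure_subset[of K] in \<open>auto simp: frontier_def\<close>)
qed

lemma simplex_borel: "K \<in> \<T> \<Longrightarrow> K \<in> sets borel"
  using simplex_verts(5)[OF simplices] by (simp add: compact_imp_closed)

lemma sqn_le_sum:
  assumes g: "g \<in> borel_measurable borel" "\<And>x. x \<notin> \<Omega> \<Longrightarrow> g x = 0"
  shows "sqn g \<le> (\<Sum>K\<in>\<T>. sqn (\<lambda>x. indicator K x * g x))"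
proof -
  have m: "(\<lambda>x. ennreal ((indicator K x * g x)\<^sup>2)) \<in> borel_measurable lborel" if "K \<in> \<T>" for K
    using g(1) simplex_borel[OF that] by simp
  have "sqn g \<le> (\<integral>\<^sup>+x. (\<Sum>K\<in>\<T>. ennreal ((indicator K x * g x)\<^sup>2)) \<partial>lborel)"
    unfolding sqn_def
  proof (rule nn_integral_mono)
    fix x
    show "ennreal ((g x)\<^sup>2) \<le> (\<Sum>K\<in>\<T>. ennreal ((indicator K x * g x)\<^sup>2))"
    proof (cases "x \<in> \<Omega>")
      case True
      then obtain K where K: "K \<in> \<T>" "x \<in> K" using cover closure_subset by blast
      have "ennreal ((g x)\<^sup>2) = ennreal ((indicator K x * g x)\<^sup>2)" using K by simp
      also have "\<dots> \<le> (\<Sum>K\<in>\<T>. ennreal ((indicator K x * g x)\<^sup>2))"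
        by (rule member_le_sum[OF K(1) _ finite_mesh]) simp
      finally show ?thesis .
    qed (simp add: g(2))
  qed
  also have "\<dots> = (\<Sum>K\<in>\<T>. sqn (\<lambda>x. indicator K x * g x))"
    unfolding sqn_def by (rule nn_integral_sum) (rule m)
  finally show ?thesis .
qed

lemma sum_sqn_le:
  assumes g: "g \<in> borel_measurable borel"
  shows "(\<Sum>K\<in>\<T>. sqn (\<lambda>x. indicator K x * g x)) \<le> sqn g"
proof -
  have m: "(\<lambda>x. ennreal ((indicator K x * g x)\<^sup>2)) \<in> borel_measurable lborel" if "K \<in> \<T>" for K
    using g(1) simplex_borel[OF that] by simp
  have "(\<Sum>K\<in>\<T>. sqn (\<lambda>x. indicator K x * g x)) = (\<integral>\<^sup>+x. (\<Sum>K\<in>\<T>. ennreal ((indicator K x * g x)\<^sup>2)) \<partial>lborel)"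
    unfolding sqn_def by (rule nn_integral_sum[symmetric]) (rule m)
  also have "\<dots> \<le> sqn g"
    unfolding sqn_def
  proof (rule nn_integral_mono_AE)
    show "AE x in lborel. (\<Sum>K\<in>\<T>. ennreal ((indicator K x * g x)\<^sup>2)) \<le> ennreal ((g x)\<^sup>2)"
      using AE_interior
    proof eventually_elim
      case (elim x)
      show ?case
      proof (cases "\<exists>K\<in>\<T>. x \<in> K")
        case True
        then obtain K where K: "K \<in> \<T>" "x \<in> K" by blast
        have "x \<notin> K'" if "K' \<in> \<T> - {K}" for K'
          using elim disjoint_interiors[of K K' x] K that by blast
        then have "(\<Sum>K'\<in>\<T>. ennreal ((indicator K' x * g x)\<^sup>2)) = (\<Sum>K'\<in>{K}. ennreal ((indicator K' x * g x)\<^sup>2))"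
          using K by (intro sum.mono_neutral_right finite_mesh) auto
        then show ?thesis using K by simp
      next
        case False
        then have "(\<Sum>K\<in>\<T>. ennreal ((indicator K x * g x)\<^sup>2)) = 0"
          by (intro sum.neutral) simp
        then show ?thesis by simp
      qed
    qed
  qed
  finally show ?thesis .
qed

text \<open>The choice of the simplex is immaterial under the condition \<open>pw_agree\<close> below.\<close>

definition pw :: "((real ^ 'n) set \<Rightarrow> real) \<Rightarrow> ((real ^ 'n) set \<Rightarrow> real ^ 'n) \<Rightarrow> real ^ 'n \<Rightarrow> real" where
  "pw c b x = (if x \<in> \<Omega> then c (SOME K. K \<in> \<T> \<and> x \<in> K) + b (SOME K. K \<in> \<T> \<and> x \<in> K) \<bullet> x else 0)"

text \<open>Interiors of different simplices are disjoint, so at most one summand is nonzero. On the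
  mesh skeleton, a null set, the value is zero; in this form measurability is immediate.\<close>

definition pw_grad :: "((real ^ 'n) set \<Rightarrow> real ^ 'n) \<Rightarrow> 'n \<Rightarrow> real ^ 'n \<Rightarrow> real" where
  "pw_grad b i x = (\<Sum>K\<in>\<T>. indicator (interior K) x * b K $ i)"

definition pw_agree :: "((real ^ 'n) set \<Rightarrow> real) \<Rightarrow> ((real ^ 'n) set \<Rightarrow> real ^ 'n) \<Rightarrow> bool" where
  "pw_agree c b \<longleftrightarrow> (\<forall>K\<in>\<T>. \<forall>K'\<in>\<T>. \<forall>x\<in>\<Omega>. x \<in> K \<and> x \<in> K' \<longrightarrow> c K + b K \<bullet> x = c K' + b K' \<bullet> x)"

lemma pw_eq:
  assumes "pw_agree c b" "K \<in> \<T>" "x \<in> K" "x \<in> \<Omega>"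
  shows "pw c b x = c K + b K \<bullet> x"
proof -
  have "(SOME K. K \<in> \<T> \<and> x \<in> K) \<in> \<T> \<and> x \<in> (SOME K. K \<in> \<T> \<and> x \<in> K)"
    by (rule someI[of "\<lambda>K. K \<in> \<T> \<and> x \<in> K" K]) (use assms in simp)
  moreover have "c K' + b K' \<bullet> x = c K + b K \<bullet> x" if "K' \<in> \<T> \<and> x \<in> K'" for K'
    using assms that unfolding pw_agree_def by blast
  ultimately show ?thesis using assms(4) unfolding pw_def by simp
qed

lemma pw_outside: "x \<notin> \<Omega> \<Longrightarrow> pw c b x = 0"
  by (simp add: pw_def)

lemma pw_grad_eq:
  assumes "K \<in> \<T>" "x \<in> interior K"
  shows "pw_grad b i x = b K $ i"
proof -
  have "x \<notin> interior K'" if "K' \<in> \<T> - {K}" for K' using disjoint_interiors[of K K' x] assms that by blast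
  then have "pw_grad b i x = (\<Sum>K'\<in>{K}. indicator (interior K') x * b K' $ i)"
    unfolding pw_grad_def using assms by (intro sum.mono_neutral_right finite_mesh) auto
  then show ?thesis using assms by simp
qed

lemma pw_grad_outside: "x \<notin> \<Omega> \<Longrightarrow> pw_grad b i x = 0"
  unfolding pw_grad_def using interior_simplex_subset by (intro sum.neutral) (auto simp: indicator_def)

lemma pw_grad_borel: "pw_grad b i \<in> borel_measurable borel"
  unfolding pw_grad_def[abs_def] by (intro borel_measurable_sum borel_measurable_times borel_measurable_indicator borel_measurable_const) auto

definition slope_bound :: "((real ^ 'n) set \<Rightarrow> real ^ 'n) \<Rightarrow> real" where
  "slope_bound b = (\<Sum>K\<in>\<T>. norm (b K))"

lemma slope_bound: "K \<in> \<T> \<Longrightarrow> norm (b K) \<le> slope_bound b" and slope_bound_nonneg: "slope_bound b \<ge> 0"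
  unfolding slope_bound_def by (auto intro!: member_le_sum finite_mesh sum_nonneg)

text \<open>Along a segment the preimages of \<open>Z\<close> and of the simplices are finitely many
  closed sets on which the function is affine or zero, and Lipschitz bounds glue over such a cover.
  \<open>Z\<close> is empty for segments inside \<Omega> and the complement of \<Omega> for the
  extension by zero.\<close>

lemma affine_pieces_lipschitz:
  assumes pieces: "\<And>K x. K \<in> \<T> \<Longrightarrow> x \<in> K \<Longrightarrow> x \<in> closed_segment p q \<Longrightarrow> f x = c K + b K \<bullet> x"
    and rest: "\<And>x. x \<in> closed_segment p q \<Longrightarrow> x \<in> Z \<Longrightarrow> f x = 0" "closed Z"
    and cov: "closed_segment p q \<subseteq> Z \<union> \<Union>\<T>"
  shows "\<bar>f p - f q\<bar> \<le> slope_bound b * norm (p - q)"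
proof -
  let ?l = "\<lambda>t. p + t *\<^sub>R (q - p)"
  let ?U = "\<lambda>K. {0..1} \<inter> ?l -` K"
  have seg: "?l t \<in> closed_segment p q" if "t \<in> {0..1}" for t
    using that by (auto simp: in_segment algebra_simps intro!: exI[of _ t])
  let ?M = "slope_bound b * norm (q - p)"
  have M0: "?M \<ge> 0" using slope_bound_nonneg by simp
  have "?M-lipschitz_on {0..1} (f \<circ> ?l)"
  proof (rule lipschitz_on_closed_Union[of "insert Z \<T>" _ ?U])
    fix K assume K: "K \<in> insert Z \<T>"
    show "closed (?U K)"
      using K rest(2) simplex_verts(5)[OF simplices]
      by (intro continuous_closed_preimage continuous_intros) (auto intro: compact_imp_closed)
    show "?M-lipschitz_on (?U K) (f \<circ> ?l)"
    proof (cases "K \<in> \<T>")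
      case True
      show ?thesis
      proof (rule lipschitz_onI[OF _ M0])
        fix s t assume st: "s \<in> ?U K" "t \<in> ?U K"
        have "f (?l s) = c K + b K \<bullet> ?l s" "f (?l t) = c K + b K \<bullet> ?l t"
          by (rule pieces[OF True]; use seg st in auto)+
        then have "f (?l s) - f (?l t) = b K \<bullet> (?l s - ?l t)"
          by (simp only: inner_diff_right[of _ "?l s"])
        also have "?l s - ?l t = (s - t) *\<^sub>R (q - p)" by (simp add: algebra_simps)
        finally have "\<bar>f (?l s) - f (?l t)\<bar> \<le> norm (b K) * norm ((s - t) *\<^sub>R (q - p))"
          by (simp only: Cauchy_Schwarz_ineq2)
        also have "\<dots> \<le> slope_bound b * norm ((s - t) *\<^sub>R (q - p))"
          by (intro mult_right_mono slope_bound True) simp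
        finally show "dist ((f \<circ> ?l) s) ((f \<circ> ?l) t) \<le> ?M * dist s t"
          by (simp add: dist_real_def ac_simps)
      qed
    next
      case False
      then have "K = Z" using K by blast
      show ?thesis
      proof (rule lipschitz_onI[OF _ M0])
        fix s t assume "s \<in> ?U K" "t \<in> ?U K"
        then have "f (?l s) = 0" "f (?l t) = 0" using rest(1) seg \<open>K = Z\<close> by auto
        then show "dist ((f \<circ> ?l) s) ((f \<circ> ?l) t) \<le> ?M * dist s t" using M0 by simp
      qed
    qed
  next
    show "{0..1} \<subseteq> (\<Union>K\<in>insert Z \<T>. ?U K)"
    proof
      fix t :: real assume t: "t \<in> {0..1}"
      then have "?l t \<in> Z \<union> \<Union>\<T>" using seg cov by blast
      then show "t \<in> (\<Union>K\<in>insert Z \<T>. ?U K)" using t by auto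
    qed
  qed (use finite_mesh M0 in auto)
  from lipschitz_onD[OF this, of 0 1] show ?thesis
    by (simp add: dist_real_def norm_minus_commute)
qed

lemma pw_lipschitz_segment:
  assumes "pw_agree c b" "closed_segment p q \<subseteq> \<Omega>"
  shows "\<bar>pw c b p - pw c b q\<bar> \<le> slope_bound b * norm (p - q)"
proof (rule affine_pieces_lipschitz[where Z = "{}"])
  show "closed_segment p q \<subseteq> {} \<union> \<Union>\<T>" using assms(2) cover closure_subset by blast
qed (use assms pw_eq in auto)

lemma pw_continuous:
  assumes "pw_agree c b"
  shows "continuous_on \<Omega> (pw c b)"
proof -
  have "isCont (pw c b) x" if x: "x \<in> \<Omega>" for x
  proof -
    obtain \<delta> where \<delta>: "\<delta> > 0" "ball x \<delta> \<subseteq> \<Omega>" using open_dom x open_contains_ball by blast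
    have "(slope_bound b)-lipschitz_on (ball x \<delta>) (pw c b)"
    proof (rule lipschitz_onI[OF _ slope_bound_nonneg])
      fix p q assume "p \<in> ball x \<delta>" "q \<in> ball x \<delta>"
      then have "closed_segment p q \<subseteq> ball x \<delta>" by (intro closed_segment_subset convex_ball)
      then show "dist (pw c b p) (pw c b q) \<le> slope_bound b * dist p q"
        using pw_lipschitz_segment[OF assms, of p q] \<delta>(2) by (auto simp: dist_real_def dist_norm)
    qed
    then have "continuous_on (ball x \<delta>) (pw c b)" by (rule lipschitz_on_continuous_on)
    then show ?thesis using \<delta>(1) by (simp add: continuous_on_eq_continuous_at)
  qed
  then show ?thesis by (simp add: continuous_at_imp_continuous_on)
qed

lemma pw_borel:
  assumes "pw_agree c b"
  shows "pw c b \<in> borel_measurable borel"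
proof -
  have "(\<lambda>x. indicator \<Omega> x *\<^sub>R pw c b x) \<in> borel_measurable borel"
    using open_dom by (intro borel_measurable_continuous_on_indicator pw_continuous[OF assms]) auto
  moreover have "(\<lambda>x. indicator \<Omega> x *\<^sub>R pw c b x) = pw c b"
    by (auto simp: fun_eq_iff indicator_def pw_def)
  ultimately show ?thesis by simp
qed

lemma pw_bounded:
  assumes "pw_agree c b"
  obtains B where "B \<ge> 0" "\<And>x. \<bar>pw c b x\<bar> \<le> B"
proof -
  obtain R where R: "\<And>x. x \<in> \<Omega> \<Longrightarrow> norm x \<le> R" using bounded_dom bounded_iff by blast
  let ?B = "(\<Sum>K\<in>\<T>. \<bar>c K\<bar>) + slope_bound b * \<bar>R\<bar>"
  have B0: "?B \<ge> 0" using slope_bound_nonneg by (intro add_nonneg_nonneg sum_nonneg mult_nonneg_nonneg) auto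
  have "\<bar>pw c b x\<bar> \<le> ?B" for x
  proof (cases "x \<in> \<Omega>")
    case True
    then obtain K where K: "K \<in> \<T>" "x \<in> K" using cover closure_subset by blast
    have "\<bar>b K \<bullet> x\<bar> \<le> norm (b K) * norm x" by (rule Cauchy_Schwarz_ineq2)
    also have "\<dots> \<le> slope_bound b * \<bar>R\<bar>"
      using slope_bound[OF K(1)] slope_bound_nonneg R[OF True] by (intro mult_mono) auto
    finally have "\<bar>b K \<bullet> x\<bar> \<le> slope_bound b * \<bar>R\<bar>" .
    moreover have "\<bar>c K\<bar> \<le> (\<Sum>K\<in>\<T>. \<bar>c K\<bar>)" by (rule member_le_sum[OF K(1) _ finite_mesh]) simp
    ultimately show ?thesis using pw_eq[OF assms K True] by linarith
  next
    case False
    then show ?thesis using B0 by (simp add: pw_outside)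
  qed
  with B0 show thesis by (rule that)
qed

lemma pw_line_derivative:
  assumes "pw_agree c b" "K \<in> \<T>" "x \<in> interior K"
  shows "((\<lambda>t. pw c b (x + t *\<^sub>R axis i 1)) has_real_derivative pw_grad b i x) (at 0)"
proof -
  have d: "((\<lambda>t. c K + b K \<bullet> (x + t *\<^sub>R axis i 1)) has_real_derivative b K \<bullet> axis i 1) (at 0)"
    unfolding inner_add_right inner_scaleR_right by (auto intro!: derivative_eq_intros)
  have o: "open ((\<lambda>t. x + t *\<^sub>R axis i (1::real)) -` interior K)"
    by (intro open_vimage continuous_intros) auto
  have "((\<lambda>t. pw c b (x + t *\<^sub>R axis i 1)) has_real_derivative b K \<bullet> axis i 1) (at 0)"
  proof (rule has_field_derivative_transform_within_open[OF d o])
    show "0 \<in> (\<lambda>t. x + t *\<^sub>R axis i (1::real)) -` interior K" using assms(3) by simp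
    show "c K + b K \<bullet> (x + t *\<^sub>R axis i 1) = pw c b (x + t *\<^sub>R axis i 1)"
      if "t \<in> (\<lambda>t. x + t *\<^sub>R axis i (1::real)) -` interior K" for t
      using that interior_subset[of K] interior_simplex_subset[OF assms(2)] by (intro pw_eq[OF assms(1,2), symmetric]) auto
  qed
  then show ?thesis
    using pw_grad_eq[OF assms(2,3)] by (simp add: inner_axis)
qed

lemma pw_grad_bound: "\<bar>pw_grad b i x\<bar> \<le> slope_bound b"
proof -
  have "\<bar>pw_grad b i x\<bar> \<le> (\<Sum>K\<in>\<T>. \<bar>indicator (interior K) x * b K $ i\<bar>)" unfolding pw_grad_def by (rule sum_abs)
  also have "\<dots> \<le> slope_bound b" unfolding slope_bound_def
    by (intro sum_mono) (auto simp: indicator_def component_le_norm_cart)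
  finally show ?thesis .
qed

text \<open>The function may jump across the boundary of \<Omega>, so its Lipschitz bound is
  available only on segments inside \<Omega>. The product with \<phi> is nevertheless Lipschitz
  along the axis: short segments that touch the support stay in \<Omega>, and for long ones
  boundedness is enough.\<close>

lemma pw_weak_derivative:
  assumes ag: "pw_agree c b" and \<phi>: "\<phi> \<in> test_functions \<Omega>"
  shows "(LINT x|lborel. pw c b x * partial_deriv i \<phi> x) = - (LINT x|lborel. pw_grad b i x * \<phi> x)"
proof -
  let ?v = "pw c b" and ?e = "axis i (1::real) :: real ^ 'n"
  obtain L where L: "compact L" "L \<subseteq> \<Omega>" "\<And>x. x \<notin> L \<Longrightarrow> \<phi> x = 0" using test_functions_support[OF \<phi>] by metis
  obtain B where B: "B \<ge> 0" "\<And>x. \<bar>?v x\<bar> \<le> B" using pw_bounded[OF ag] by metis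
  obtain P where P: "P \<ge> 0" "\<And>x. \<bar>\<phi> x\<bar> \<le> P" using test_functions_bounded[OF \<phi>] by metis
  obtain Q where Q: "\<And>x t. \<bar>\<phi> (x + t *\<^sub>R ?e) - \<phi> x\<bar> \<le> Q * \<bar>t\<bar>" using test_functions_lipschitz[OF \<phi>] by metis
  have Q0: "Q \<ge> 0" using Q[of 0 1] by simp
  obtain \<delta> where \<delta>: "\<delta> > 0" "(\<Union>x\<in>L. cball x \<delta>) \<subseteq> \<Omega>"
    using compact_subset_open_imp_cball_epsilon_subset[OF L(1) open_dom L(2)] by metis
  note sm = test_functions_smooth[OF \<phi>]
  let ?F = "\<lambda>x. ?v x * \<phi> x"
  let ?F' = "\<lambda>x. pw_grad b i x * \<phi> x + partial_deriv i \<phi> x * ?v x"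
  \<comment> \<open>The first two terms come from the product rule on short segments, the last one
    from steps longer than \<delta>.\<close>
  define M where "M = slope_bound b * P + B * Q + 2 * (B * P) / \<delta>"
  have lip: "\<bar>?F (x + t *\<^sub>R ?e) - ?F x\<bar> \<le> M * \<bar>t\<bar>" for x t
  proof (cases "\<bar>t\<bar> \<le> \<delta>")
    case False
    have a: "\<bar>?F y\<bar> \<le> B * P" for y using mult_mono[OF B(2) P(2)] B P by (simp add: abs_mult)
    have "\<bar>?F (x + t *\<^sub>R ?e) - ?F x\<bar> \<le> 2 * (B * P)" using a[of x] a[of "x + t *\<^sub>R ?e"] by linarith
    also have "\<dots> = 2 * (B * P) / \<delta> * \<delta>" using \<delta> by simp
    also have "\<dots> \<le> 2 * (B * P) / \<delta> * \<bar>t\<bar>" using False \<delta> B P by (intro mult_left_mono) auto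
    also have "\<dots> \<le> M * \<bar>t\<bar>" unfolding M_def
      using B P Q0 slope_bound_nonneg by (intro mult_right_mono) auto
    finally show ?thesis .
  next
    case True
    show ?thesis
    proof (cases "x \<in> L \<or> x + t *\<^sub>R ?e \<in> L")
      case False
      then have "?F (x + t *\<^sub>R ?e) - ?F x = 0" using L(3) by simp
      then show ?thesis using B P Q0 slope_bound_nonneg \<delta> by (simp add: M_def)
    next
      case TL: True
      have "closed_segment x (x + t *\<^sub>R ?e) \<subseteq> \<Omega>"
      proof -
        obtain y where y: "y \<in> L" "x \<in> cball y \<delta>" "x + t *\<^sub>R ?e \<in> cball y \<delta>"
        proof (cases "x \<in> L")
          case True
          then show ?thesis using that[of x] \<open>\<bar>t\<bar> \<le> \<delta>\<close> \<delta>(1) by (simp add: dist_norm)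
        next
          case False
          then show ?thesis using that[of "x + t *\<^sub>R ?e"] TL \<open>\<bar>t\<bar> \<le> \<delta>\<close> \<delta>(1) by (simp add: dist_norm)
        qed
        then have "closed_segment x (x + t *\<^sub>R ?e) \<subseteq> cball y \<delta>" by (intro closed_segment_subset convex_cball)
        then show ?thesis using y(1) \<delta>(2) by blast
      qed
      from pw_lipschitz_segment[OF ag this]
      have v: "\<bar>?v (x + t *\<^sub>R ?e) - ?v x\<bar> \<le> slope_bound b * \<bar>t\<bar>" by (simp add: abs_minus_commute)
      have "?F (x + t *\<^sub>R ?e) - ?F x = (?v (x + t *\<^sub>R ?e) - ?v x) * \<phi> (x + t *\<^sub>R ?e) + ?v x * (\<phi> (x + t *\<^sub>R ?e) - \<phi> x)"
        by (simp add: algebra_simps)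
      also have "\<bar>\<dots>\<bar> \<le> \<bar>?v (x + t *\<^sub>R ?e) - ?v x\<bar> * \<bar>\<phi> (x + t *\<^sub>R ?e)\<bar> + \<bar>?v x\<bar> * \<bar>\<phi> (x + t *\<^sub>R ?e) - \<phi> x\<bar>"
        by (simp add: abs_mult[symmetric])
      also have "\<dots> \<le> (slope_bound b * \<bar>t\<bar>) * P + B * (Q * \<bar>t\<bar>)"
        by (intro add_mono mult_mono v P(2) B Q) (use slope_bound_nonneg in auto)
      also have "\<dots> = (slope_bound b * P + B * Q) * \<bar>t\<bar>" by (simp add: algebra_simps)
      also have "\<dots> \<le> M * \<bar>t\<bar>" unfolding M_def using B P \<delta> by (intro mult_right_mono) auto
      finally show ?thesis .
    qed
  qed
  have der: "AE x in lborel. ((\<lambda>t. ?F (x + t *\<^sub>R ?e)) has_real_derivative ?F' x) (at 0)"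
    using AE_interior
  proof eventually_elim
    case (elim x)
    show ?case
    proof (cases "x \<in> \<Omega>")
      case True
      then obtain K where K: "K \<in> \<T>" "x \<in> K" using cover closure_subset by blast
      have d1: "((\<lambda>t. ?v (x + t *\<^sub>R ?e)) has_real_derivative pw_grad b i x) (at 0)"
        using elim K by (intro pw_line_derivative[OF ag K(1)]) auto
      have d2: "((\<lambda>t. \<phi> (x + t *\<^sub>R ?e)) has_real_derivative partial_deriv i \<phi> x) (at 0)"
        using partial_deriv_line[OF sm, of x i 0] by simp
      from DERIV_mult[OF d1 d2] show ?thesis by simp
    next
      case False
      then have xL: "x \<notin> L" using L(2) by blast
      have "((\<lambda>t. 0::real) has_real_derivative 0) (at (0::real))" by simp
      moreover have "open ((\<lambda>t. x + t *\<^sub>R ?e) -` (- L))"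
        using L(1) by (intro open_vimage continuous_intros) (auto simp: compact_imp_closed)
      ultimately have "((\<lambda>t. ?F (x + t *\<^sub>R ?e)) has_real_derivative 0) (at 0)"
        by (rule has_field_derivative_transform_within_open) (use xL L(3) in auto)
      then show ?thesis using False by (simp add: pw_outside pw_grad_outside)
    qed
  qed
  have bm: "?v \<in> borel_measurable borel" "\<phi> \<in> borel_measurable borel" "partial_deriv i \<phi> \<in> borel_measurable borel" "pw_grad b i \<in> borel_measurable borel"
    using pw_borel[OF ag] smooth_borel[OF sm] smooth_borel[OF smooth_partial_deriv[OF sm]] pw_grad_borel by auto
  have "(LINT x|lborel. ?F' x) = 0"
  proof (rule integral_directional_derivative_eq_0(2)[where F = ?F and L = L and e = ?e and M = M])
    show "?F \<in> borel_measurable borel" using bm by (intro borel_measurable_times)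
    show "?F' \<in> borel_measurable borel"
      by (rule borel_measurable_add[OF borel_measurable_times[OF bm(4,2)] borel_measurable_times[OF bm(3,1)]])
  qed (use L lip der in \<open>auto simp: compact_imp_bounded\<close>)
  moreover have "integrable lborel (\<lambda>x. pw_grad b i x * \<phi> x)"
  proof (rule integrable_bounded_support[of _ L])
    show "\<bar>pw_grad b i x * \<phi> x\<bar> \<le> slope_bound b * P" for x
      unfolding abs_mult using P slope_bound_nonneg by (intro mult_mono pw_grad_bound) auto
  qed (use bm L in \<open>auto simp: compact_imp_bounded intro!: borel_measurable_times\<close>)
  moreover have "integrable lborel (\<lambda>x. partial_deriv i \<phi> x * ?v x)"
    by (rule integrable_mult_bounded[OF test_functions_integrable[OF test_functions_partial_deriv[OF \<phi>]] bm(1) B(2)])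
  ultimately show ?thesis
    by (simp add: Bochner_Integration.integral_add mult.commute)
qed

end

section \<open>Smooth convolutions and Lipschitz representatives\<close>

lemma test_functions_lipschitz_norm:
  fixes \<kappa> :: "real ^ 'n \<Rightarrow> real"
  assumes \<kappa>: "\<kappa> \<in> test_functions \<Omega>"
  obtains L where "L \<ge> 0" "\<And>p q. \<bar>\<kappa> p - \<kappa> q\<bar> \<le> L * norm (p - q)"
proof -
  note sm = test_functions_smooth[OF \<kappa>]
  have "\<exists>B\<ge>0. \<forall>x. \<bar>partial_deriv i \<kappa> x\<bar> \<le> B" for i
    using test_functions_bounded[OF test_functions_partial_deriv[OF \<kappa>]] by metis
  then obtain B where B: "\<And>i. B i \<ge> 0" "\<And>i x. \<bar>partial_deriv i \<kappa> x\<bar> \<le> B i" by metis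
  let ?L = "\<Sum>i\<in>UNIV. B i"
  have "\<bar>\<kappa> p - \<kappa> q\<bar> \<le> ?L * norm (p - q)" for p q
  proof -
    let ?g = "\<lambda>t. q + t *\<^sub>R (p - q)"
    have g: "(?g has_vector_derivative (p - q)) (at t)" for t
      by (auto intro!: derivative_eq_intros)
    have "norm ((\<lambda>t. \<kappa> (?g t)) 1 - (\<lambda>t. \<kappa> (?g t)) 0) \<le> (?L * norm (p - q)) * norm (1 - 0 :: real)"
    proof (rule field_differentiable_bound[of UNIV _ "\<lambda>t. \<Sum>i\<in>UNIV. (p - q) $ i * partial_deriv i \<kappa> (?g t)"])
      show "((\<lambda>t. \<kappa> (?g t)) has_real_derivative (\<Sum>i\<in>UNIV. (p - q) $ i * partial_deriv i \<kappa> (?g t))) (at t within UNIV)" for t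
        using smooth_line_derivative[OF sm g] by simp
      show "norm (\<Sum>i\<in>UNIV. (p - q) $ i * partial_deriv i \<kappa> (?g t)) \<le> ?L * norm (p - q)" for t
      proof -
        have "norm (\<Sum>i\<in>UNIV. (p - q) $ i * partial_deriv i \<kappa> (?g t)) \<le> (\<Sum>i\<in>UNIV. norm (p - q) * B i)"
          unfolding real_norm_def
          by (rule order_trans[OF sum_abs sum_mono]) (simp only: abs_mult, intro mult_mono component_le_norm_cart B, auto)
        then show ?thesis by (simp only: sum_distrib_right mult.commute[of "norm (p - q)"])
      qed
    qed auto
    then show ?thesis by simp
  qed
  moreover have "?L \<ge> 0" using B(1) by (simp add: sum_nonneg)
  ultimately show thesis using that by blast
qed

text \<open>The normalised linearisation error \<open>?E\<close> of the kernel is bounded uniformly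
  and tends to zero pointwise, so dominated convergence against a multiple of the absolute value of
  \<open>v\<close> applies. The minus sign arises because \<open>x\<close> enters the kernel as z -
  x.\<close>

lemma convolution_has_derivative:
  fixes v \<kappa> :: "real ^ 'n \<Rightarrow> real"
  assumes v[measurable]: "v \<in> borel_measurable borel" "integrable lborel v" and \<kappa>: "\<kappa> \<in> test_functions UNIV"
  shows "((\<lambda>x. LINT z|lborel. v z * \<kappa> (z - x)) has_derivative
    (\<lambda>h. \<Sum>i\<in>UNIV. h $ i * - (LINT z|lborel. v z * partial_deriv i \<kappa> (z - x)))) (at x)"
proof -
  note sm = test_functions_smooth[OF \<kappa>]
  have bm[measurable]: "\<kappa> \<in> borel_measurable borel" "partial_deriv i \<kappa> \<in> borel_measurable borel" for i
    using smooth_borel[OF sm] smooth_borel[OF smooth_partial_deriv[OF sm]] by auto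
  have int: "integrable lborel (\<lambda>z. v z * \<psi> (z - y))" if t: "\<psi> \<in> test_functions UNIV" for \<psi> :: "real ^ 'n \<Rightarrow> real" and y
  proof -
    obtain B where B: "\<And>w. \<bar>\<psi> w\<bar> \<le> B" using test_functions_bounded[OF t] by metis
    have [measurable]: "\<psi> \<in> borel_measurable borel" using smooth_borel[OF test_functions_smooth[OF t]] .
    show ?thesis by (rule integrable_mult_bounded[OF v(2) _ B]) measurable
  qed
  note i1 = int[OF \<kappa>] and i2 = int[OF test_functions_partial_deriv[OF \<kappa>]]
  obtain L where L: "L \<ge> 0" "\<And>p q. \<bar>\<kappa> p - \<kappa> q\<bar> \<le> L * norm (p - q)" using test_functions_lipschitz_norm[OF \<kappa>] by metis
  have "\<exists>B\<ge>0. \<forall>x. \<bar>partial_deriv i \<kappa> x\<bar> \<le> B" for i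
    using test_functions_bounded[OF test_functions_partial_deriv[OF \<kappa>]] by metis
  then obtain B where B: "\<And>i. B i \<ge> 0" "\<And>i x. \<bar>partial_deriv i \<kappa> x\<bar> \<le> B i" by metis
  let ?C = "L + (\<Sum>i\<in>UNIV. B i)"
  let ?G = "\<lambda>x. LINT z|lborel. v z * \<kappa> (z - x)"
  let ?D = "\<lambda>h. \<Sum>i\<in>UNIV. h $ i * - (LINT z|lborel. v z * partial_deriv i \<kappa> (z - x))"
  let ?E = "\<lambda>h z. (\<kappa> (z - (x + h)) - \<kappa> (z - x) + (\<Sum>i\<in>UNIV. h $ i * partial_deriv i \<kappa> (z - x))) / norm h"
  have bl: "bounded_linear ?D"
    by (intro bounded_linear_sum bounded_linear_mult_left[THEN bounded_linear_compose] bounded_linear_vec_nth)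
  have Eb: "\<bar>?E h z\<bar> \<le> ?C" for h z
  proof (cases "h = 0")
    case True
    then show ?thesis using L B by (simp add: sum_nonneg)
  next
    case False
    have a: "\<bar>\<Sum>i\<in>UNIV. h $ i * partial_deriv i \<kappa> (z - x)\<bar> \<le> (\<Sum>i\<in>UNIV. norm h * B i)"
      by (rule order_trans[OF sum_abs sum_mono]) (simp only: abs_mult, intro mult_mono component_le_norm_cart B, auto)
    have b: "\<bar>\<kappa> (z - (x + h)) - \<kappa> (z - x)\<bar> \<le> L * norm h"
      using L(2)[of "z - (x + h)" "z - x"] by simp
    have "\<bar>\<kappa> (z - (x + h)) - \<kappa> (z - x) + (\<Sum>i\<in>UNIV. h $ i * partial_deriv i \<kappa> (z - x))\<bar> \<le> L * norm h + norm h * (\<Sum>i\<in>UNIV. B i)"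
      using a b unfolding sum_distrib_left[symmetric] by linarith
    then have "\<bar>\<kappa> (z - (x + h)) - \<kappa> (z - x) + (\<Sum>i\<in>UNIV. h $ i * partial_deriv i \<kappa> (z - x))\<bar> \<le> ?C * norm h"
      by (simp only: distrib_right mult.commute[of "norm h"])
    then show ?thesis using False by (simp add: abs_divide pos_divide_le_eq)
  qed
  have eq: "norm (?G (x + h) - ?G x - ?D h) / norm h = \<bar>LINT z|lborel. v z * ?E h z\<bar>" for h
  proof -
    have "(\<lambda>z. v z * ?E h z) = (\<lambda>z. (v z * \<kappa> (z - (x + h)) - v z * \<kappa> (z - x) + (\<Sum>i\<in>UNIV. h $ i * (v z * partial_deriv i \<kappa> (z - x)))) / norm h)"
      by (rule ext) (simp add: distrib_left right_diff_distrib sum_distrib_left mult.left_commute)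
    then have I: "(LINT z|lborel. v z * ?E h z) = (?G (x + h) - ?G x + (\<Sum>i\<in>UNIV. h $ i * (LINT z|lborel. v z * partial_deriv i \<kappa> (z - x)))) / norm h"
      by (simp add: i1 i2)
    have D: "?D h = - (\<Sum>i\<in>UNIV. h $ i * (LINT z|lborel. v z * partial_deriv i \<kappa> (z - x)))"
      by (simp add: sum_negf)
    show ?thesis unfolding I D by (simp only: abs_divide real_norm_def abs_norm_cancel diff_minus_eq_add)
  qed
  have "((\<lambda>h. LINT z|lborel. v z * ?E h z) \<longlongrightarrow> 0) (at 0)"
    unfolding tendsto_at_iff_sequentially
  proof (intro allI impI)
    fix X :: "nat \<Rightarrow> real ^ 'n" assume X: "\<forall>i. X i \<in> UNIV - {0}" "X \<longlonglongrightarrow> 0"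
    have "(\<lambda>n. LINT z|lborel. v z * ?E (X n) z) \<longlonglongrightarrow> (LINT z|lborel. v z * 0)"
    proof (rule integral_dominated_convergence)
      show "integrable lborel (\<lambda>z. ?C * \<bar>v z\<bar>)" using v(2) by simp
      show "AE z in lborel. norm (v z * ?E (X n) z) \<le> ?C * \<bar>v z\<bar>" for n
        using mult_right_mono[OF Eb, of "\<bar>v _\<bar>"] by (intro AE_I2) (simp only: real_norm_def abs_mult mult.commute abs_ge_zero)
      show "AE z in lborel. (\<lambda>n. v z * ?E (X n) z) \<longlonglongrightarrow> v z * 0"
      proof (intro AE_I2 tendsto_mult tendsto_const)
        fix z
        have "((\<lambda>h. norm (\<kappa> (z - x + h) - \<kappa> (z - x) - (\<Sum>i\<in>UNIV. h $ i * partial_deriv i \<kappa> (z - x))) / norm h) \<longlongrightarrow> 0) (at 0)"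
          using smooth_has_derivative[OF sm, of "z - x"] unfolding has_derivative_at by blast
        moreover have "filterlim (\<lambda>n. - X n) (at 0) sequentially"
          using tendsto_minus[OF X(2)] X(1) by (intro filterlim_atI) auto
        ultimately have "(\<lambda>n. norm (\<kappa> (z - x + - X n) - \<kappa> (z - x) - (\<Sum>i\<in>UNIV. (- X n) $ i * partial_deriv i \<kappa> (z - x))) / norm (- X n)) \<longlonglongrightarrow> 0"
          by (rule filterlim_compose)
        moreover have "norm (\<kappa> (z - x + - h) - \<kappa> (z - x) - (\<Sum>i\<in>UNIV. (- h) $ i * partial_deriv i \<kappa> (z - x))) / norm (- h) = \<bar>?E h z\<bar>" for h
        proof -
          have "z - x + - h = z - (x + h)" by simp
          then show ?thesis
            by (simp only: vector_uminus_component mult_minus_left sum_negf norm_minus_cancel diff_minus_eq_add real_norm_def abs_divide abs_norm_cancel)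
        qed
        ultimately have "(\<lambda>n. \<bar>?E (X n) z\<bar>) \<longlonglongrightarrow> 0" by (simp only:)
        then show "(\<lambda>n. ?E (X n) z) \<longlonglongrightarrow> 0" by (rule tendsto_rabs_zero_cancel)
      qed
    qed measurable
    then show "((\<lambda>h. LINT z|lborel. v z * ?E h z) \<circ> X) \<longlonglongrightarrow> 0" by (simp add: comp_def)
  qed
  then have "((\<lambda>h. norm (?G (x + h) - ?G x - ?D h) / norm h) \<longlongrightarrow> 0) (at 0)"
    unfolding eq by (rule tendsto_rabs_zero)
  then show ?thesis using bl unfolding has_derivative_at by blast
qed

text \<open>Differentiation moves to the kernel with a change of sign. Hence the convolutions of
  \<open>v\<close> with all test functions, up to constant factors, form a class closed under
  partial derivatives.\<close>

lemma smooth_convolution: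
  fixes v \<kappa> :: "real ^ 'n \<Rightarrow> real"
  assumes v: "v \<in> borel_measurable borel" "integrable lborel v" and \<kappa>: "\<kappa> \<in> test_functions UNIV"
  shows "smooth (\<lambda>x. LINT z|lborel. v z * \<kappa> (z - x))"
    and "partial_deriv i (\<lambda>x. LINT z|lborel. v z * \<kappa> (z - x)) x = - (LINT z|lborel. v z * partial_deriv i \<kappa> (z - x))"
proof -
  have pd: "partial_deriv i (\<lambda>x. LINT z|lborel. v z * \<kappa> (z - x)) x = - (LINT z|lborel. v z * partial_deriv i \<kappa> (z - x))"
    if \<kappa>: "\<kappa> \<in> test_functions UNIV" for \<kappa> i x
    unfolding partial_deriv_eqI[OF convolution_has_derivative[OF v \<kappa>]] by (simp only: sum_axis mult_1)
  from pd[OF \<kappa>] show "partial_deriv i (\<lambda>x. LINT z|lborel. v z * \<kappa> (z - x)) x = - (LINT z|lborel. v z * partial_deriv i \<kappa> (z - x))" .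
  let ?C = "{\<lambda>x. c * (LINT z|lborel. v z * \<kappa> (z - x)) | c \<kappa>. \<kappa> \<in> test_functions UNIV}"
  show "smooth (\<lambda>x. LINT z|lborel. v z * \<kappa> (z - x))"
  proof (rule smooth_coinduct[of _ ?C])
    show "(\<lambda>x. LINT z|lborel. v z * \<kappa> (z - x)) \<in> ?C"
      using \<kappa> by (intro CollectI exI[of _ 1] exI[of _ \<kappa>]) simp
  next
    fix g assume "g \<in> ?C"
    then obtain c \<psi> where \<psi>: "\<psi> \<in> test_functions UNIV" and g: "g = (\<lambda>x. c * (LINT z|lborel. v z * \<psi> (z - x)))" by blast
    have d: "(g has_derivative (\<lambda>h. c * (\<Sum>i\<in>UNIV. h $ i * - (LINT z|lborel. v z * partial_deriv i \<psi> (z - x))))) (at x)" for x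
      unfolding g by (rule has_derivative_mult_right[OF convolution_has_derivative[OF v \<psi>]])
    show "g differentiable_on UNIV"
      unfolding differentiable_on_def using d by (meson differentiableI differentiable_at_withinI)
    fix i
    have "partial_deriv i g = (\<lambda>x. (- c) * (LINT z|lborel. v z * partial_deriv i \<psi> (z - x)))"
    proof
      fix x
      have "partial_deriv i g x = c * (1 * - (LINT z|lborel. v z * partial_deriv i \<psi> (z - x)))"
        unfolding partial_deriv_eqI[OF d] by (simp only: sum_axis)
      then show "partial_deriv i g x = (- c) * (LINT z|lborel. v z * partial_deriv i \<psi> (z - x))" by simp
    qed
    then show "partial_deriv i g \<in> ?C" using test_functions_partial_deriv[OF \<psi>, of i] by blast
  qed
qed

lemma mollify_smooth:
  fixes v :: "real ^ 'n \<Rightarrow> real"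
  assumes v: "v \<in> borel_measurable borel" "integrable lborel v" and r: "r > 0"
  shows "smooth (mollify 1 0 r v)"
    and "v1 \<in> borel_measurable borel \<Longrightarrow> (\<And>\<phi>. \<phi> \<in> test_functions UNIV \<Longrightarrow> (LINT z|lborel. v z * partial_deriv i \<phi> z) = - (LINT z|lborel. v1 z * \<phi> z))
      \<Longrightarrow> partial_deriv i (mollify 1 0 r v) x = mollify 1 0 r v1 x"
proof -
  note k = kern_test_UNIV[OF r, of "0 :: real ^ 'n"]
  have eq: "mollify 1 0 r v = (\<lambda>x. LINT z|lborel. v z * kern 0 r (z - x))"
    by (rule ext) (simp add: mollify_kernel[OF v(1) r])
  show "smooth (mollify 1 0 r v)" unfolding eq by (rule smooth_convolution(1)[OF v k])
  assume v1: "v1 \<in> borel_measurable borel"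
    and w: "\<And>\<phi>. \<phi> \<in> test_functions UNIV \<Longrightarrow> (LINT z|lborel. v z * partial_deriv i \<phi> z) = - (LINT z|lborel. v1 z * \<phi> z)"
  have "(\<lambda>z. kern 0 r (z - x)) \<in> test_functions UNIV" using kern_test_function[OF r, of x 0 UNIV] by simp
  from w[OF this] show "partial_deriv i (mollify 1 0 r v) x = mollify 1 0 r v1 x"
    unfolding eq smooth_convolution(2)[OF v k] by (simp add: partial_deriv_translate[OF smooth_kern] mollify_kernel[OF v1 r])
qed

lemma mollify_bounded_AE:
  fixes g :: "real ^ 'n \<Rightarrow> real"
  assumes g[measurable]: "g \<in> borel_measurable borel" and bd: "AE x in lborel. \<bar>g x\<bar> \<le> M" and r: "r > 0"
  shows "\<bar>mollify a b r g x\<bar> \<le> M"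
proof -
  \<comment> \<open>Clipping changes \<open>g\<close> only on a null set, which the integral
    ignores, and yields a bound at every point.\<close>
  let ?h = "\<lambda>x. max (- M) (min M (g x))"
  have hm: "?h \<in> borel_measurable borel" by measurable
  have M: "M \<ge> 0"
  proof -
    have "\<exists>x\<in>UNIV. \<bar>g x\<bar> \<le> M" by (rule AE_open_ex) (use bd in auto)
    then show ?thesis by force
  qed
  have [measurable]: "kern b r \<in> borel_measurable borel" by (rule smooth_borel[OF smooth_kern])
  have "mollify a b r g x = mollify a b r ?h x"
    unfolding mollify_kernel[OF g r] mollify_kernel[OF hm r]
  proof (rule integral_cong_AE)
    show "AE z in lborel. g z * kern b r (z - a *\<^sub>R x) = ?h z * kern b r (z - a *\<^sub>R x)"
      using bd by eventually_elim (auto simp: abs_le_iff max_def min_def)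
  qed measurable
  moreover have "\<bar>mollify a b r ?h x\<bar> \<le> M"
    by (rule mollify_bounded[OF hm]) (use M in \<open>auto simp: abs_le_iff max_def min_def\<close>)
  ultimately show ?thesis by simp
qed

text \<open>Mollifications have gradients bounded by \<open>M\<close> in each component, hence a
  common Lipschitz constant. A subsequence converges almost everywhere, which makes \<open>v\<close>
  Lipschitz on a set of full measure. Such a set is dense, and the function extends to its
  closure.\<close>

lemma lipschitz_representative:
  fixes v :: "real ^ 'n \<Rightarrow> real"
  assumes v: "v \<in> borel_measurable borel" "sqn v < \<infinity>" "integrable lborel v"
    and v1: "\<And>i. v1 i \<in> borel_measurable borel" "\<And>i. AE x in lborel. \<bar>v1 i x\<bar> \<le> M"
    and w: "\<And>\<phi> i. \<phi> \<in> test_functions UNIV \<Longrightarrow> (LINT z|lborel. v z * partial_deriv i \<phi> z) = - (LINT z|lborel. v1 i z * \<phi> z)"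
  shows "\<exists>U. continuous_on UNIV U \<and> (AE x in lborel. U x = v x)"
proof -
  define r where "r k = 1 / real (Suc k)" for k
  have r: "r k > 0" "r k \<noteq> 0" for k by (auto simp: r_def)
  have rl: "r \<longlonglongrightarrow> 0" unfolding r_def using LIMSEQ_Suc[OF lim_1_over_n] by simp
  define wk where "wk k = mollify 1 0 (r k) v" for k
  have wm: "wk k \<in> borel_measurable borel" for k unfolding wk_def by (rule mollify_measurable[OF v(1)])
  let ?L = "real CARD('n) * M"
  have lip: "\<bar>wk k p - wk k q\<bar> \<le> ?L * norm (p - q)" for k p q
  proof -
    let ?g = "\<lambda>t. q + t *\<^sub>R (p - q)"
    have g: "(?g has_vector_derivative (p - q)) (at t)" for t
      by (auto intro!: derivative_eq_intros)
    have sm: "smooth (wk k)" unfolding wk_def by (rule mollify_smooth(1)[OF v(1,3) r(1)])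
    have pd: "\<bar>partial_deriv i (wk k) x\<bar> \<le> M" for i x
    proof -
      have "partial_deriv i (wk k) x = mollify 1 0 (r k) (v1 i) x"
        unfolding wk_def by (rule mollify_smooth(2)[OF v(1,3) r(1) v1(1)]) (rule w)
      then show ?thesis using mollify_bounded_AE[OF v1(1) v1(2) r(1)] by simp
    qed
    have "norm ((\<lambda>t. wk k (?g t)) 1 - (\<lambda>t. wk k (?g t)) 0) \<le> (?L * norm (p - q)) * norm (1 - 0 :: real)"
    proof (rule field_differentiable_bound[of UNIV _ "\<lambda>t. \<Sum>i\<in>UNIV. (p - q) $ i * partial_deriv i (wk k) (?g t)"])
      show "((\<lambda>t. wk k (?g t)) has_real_derivative (\<Sum>i\<in>UNIV. (p - q) $ i * partial_deriv i (wk k) (?g t))) (at t within UNIV)" for t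
        using smooth_line_derivative[OF sm g] by simp
      show "norm (\<Sum>i\<in>UNIV. (p - q) $ i * partial_deriv i (wk k) (?g t)) \<le> ?L * norm (p - q)" for t
      proof -
        have "norm (\<Sum>i\<in>UNIV. (p - q) $ i * partial_deriv i (wk k) (?g t)) \<le> (\<Sum>i\<in>(UNIV::'n set). norm (p - q) * M)"
          unfolding real_norm_def
          by (rule order_trans[OF sum_abs sum_mono]) (simp only: abs_mult, intro mult_mono component_le_norm_cart pd, auto)
        then show ?thesis by (simp add: ac_simps)
      qed
    qed auto
    then show ?thesis by simp
  qed
  have lim: "(\<lambda>k. sqn (\<lambda>x. wk k x - v x)) \<longlonglongrightarrow> 0"
    unfolding wk_def by (rule mollify_tendsto_L2[OF v(1,2) tendsto_const _ tendsto_const rl r(2)]) simp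
  have fin: "sqn (\<lambda>x. wk k x - v x) < \<infinity>" for k
  proof -
    have "sqn (wk k) \<le> ennreal (2 ^ CARD('n)) * sqn v" unfolding wk_def by (rule mollify_sqn_le[OF v(1,2) r(2)]) simp
    also have "\<dots> < \<infinity>" using v(2) by (simp add: ennreal_mult_less_top)
    finally have "2 * sqn (wk k) + 2 * sqn v < \<infinity>" using v(2) by (simp add: ennreal_mult_less_top)
    with sqn_diff[OF wm v(1)] show ?thesis by (rule le_less_trans)
  qed
  have dm: "(\<lambda>x. wk k x - v x) \<in> borel_measurable borel" for k using wm v(1) by (rule borel_measurable_diff)
  have ik: "integrable lborel (\<lambda>x. (wk k x - v x)\<^sup>2)" for k
    using fin[of k] unfolding sqn_finite_iff[OF dm] .
  \<comment> \<open>Convergence of \<open>sqn\<close> to zero is L^1 convergence of the squares,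
    which provides the almost everywhere convergent subsequence.\<close>
  have "(\<lambda>k. enn2real (sqn (\<lambda>x. wk k x - v x))) \<longlonglongrightarrow> enn2real 0"
    using lim by (intro tendsto_enn2real) auto
  then have "(\<lambda>k. LINT x|lborel. norm ((wk k x - v x)\<^sup>2)) \<longlonglongrightarrow> 0"
    by (simp add: sqn_eq_integral[OF ik] integral_nonneg_AE)
  then have "\<exists>\<rho>::nat \<Rightarrow> nat. strict_mono \<rho> \<and> (AE x in lborel. (\<lambda>k. (wk (\<rho> k) x - v x)\<^sup>2) \<longlonglongrightarrow> 0)"
    by (rule tendsto_L1_AE_subseq[of lborel "\<lambda>k x. (wk k x - v x)\<^sup>2", OF ik])
  then obtain \<rho> :: "nat \<Rightarrow> nat" where \<rho>: "strict_mono \<rho> \<and> (AE x in lborel. (\<lambda>k. (wk (\<rho> k) x - v x)\<^sup>2) \<longlonglongrightarrow> 0)" ..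
  define E where "E = {x. (\<lambda>k. (wk (\<rho> k) x - v x)\<^sup>2) \<longlonglongrightarrow> 0}"
  have conv: "(\<lambda>k. wk (\<rho> k) x) \<longlonglongrightarrow> v x" if "x \<in> E" for x
  proof -
    have "(\<lambda>k. sqrt ((wk (\<rho> k) x - v x)\<^sup>2)) \<longlonglongrightarrow> sqrt 0"
      using that unfolding E_def by (intro tendsto_real_sqrt) simp
    then have "(\<lambda>k. \<bar>wk (\<rho> k) x - v x\<bar>) \<longlonglongrightarrow> 0" by simp
    then have "(\<lambda>k. wk (\<rho> k) x - v x) \<longlonglongrightarrow> 0" by (rule tendsto_rabs_zero_cancel)
    then show ?thesis by (rule LIM_zero_cancel)
  qed
  have M0: "M \<ge> 0"
  proof -
    have "\<exists>x\<in>UNIV. \<bar>v1 undefined x\<bar> \<le> M" by (rule AE_open_ex) (use v1(2) in auto)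
    then show ?thesis by force
  qed
  have "?L-lipschitz_on E v"
  proof (rule lipschitz_onI)
    fix p q assume "p \<in> E" "q \<in> E"
    then have "(\<lambda>k. \<bar>wk (\<rho> k) p - wk (\<rho> k) q\<bar>) \<longlonglongrightarrow> \<bar>v p - v q\<bar>" by (intro tendsto_intros conv)
    then have "\<bar>v p - v q\<bar> \<le> ?L * norm (p - q)" by (rule LIMSEQ_le_const2) (use lip in auto)
    then show "dist (v p) (v q) \<le> ?L * dist p q" by (simp add: dist_real_def dist_norm)
  qed (use M0 in simp)
  then obtain U where U: "?L-lipschitz_on (closure E) U" "\<forall>x\<in>E. U x = v x" using lipschitz_extend_closure by blast
  have AE: "AE x in lborel. x \<in> E" using \<rho> unfolding E_def by simp
  have "closure E = UNIV"
  proof (rule ccontr)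
    assume "closure E \<noteq> UNIV"
    then have ne: "- closure E \<noteq> {}" by blast
    have "AE x in lborel. x \<in> - closure E \<longrightarrow> False"
      using AE by eventually_elim (use closure_subset[of E] in blast)
    then have "\<exists>x\<in>- closure E. False" by (rule AE_open_ex[OF open_Compl[OF closed_closure] ne])
    then show False by blast
  qed
  then have "continuous_on UNIV U" using lipschitz_on_continuous_on[OF U(1)] by simp
  moreover have "AE x in lborel. U x = v x" using AE by eventually_elim (use U(2) in blast)
  ultimately show ?thesis by blast
qed

section \<open>Boundary values\<close>

text \<open>
  A continuously differentiable truncation that vanishes on \<open>[-\<epsilon>, \<epsilon>]\<close>, so that composing it with
  a continuous function vanishing off \<open>\<Omega>\<close> yields compact support in \<open>\<Omega>\<close>.
\<close>

definition shrink :: "real \<Rightarrow> real \<Rightarrow> real" where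
  "shrink \<epsilon> t = (if \<bar>t\<bar> \<le> \<epsilon> then 0 else t - 2 * \<epsilon> * sgn t + \<epsilon>\<^sup>2 / t)"

definition shrink' :: "real \<Rightarrow> real \<Rightarrow> real" where
  "shrink' \<epsilon> t = (if \<bar>t\<bar> \<le> \<epsilon> then 0 else 1 - \<epsilon>\<^sup>2 / t\<^sup>2)"

lemma shrink'_bounds: "\<epsilon> > 0 \<Longrightarrow> 0 \<le> shrink' \<epsilon> t \<and> shrink' \<epsilon> t \<le> 1"
proof -
  assume e: "\<epsilon> > 0"
  have "\<epsilon>\<^sup>2 / t\<^sup>2 \<le> 1" if "\<bar>t\<bar> > \<epsilon>"
  proof -
    have "\<epsilon>\<^sup>2 \<le> t\<^sup>2" using that e by (simp add: abs_le_square_iff[symmetric])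
    moreover have "t\<^sup>2 > 0" using that e by auto
    ultimately show ?thesis by simp
  qed
  then show ?thesis by (auto simp: shrink'_def)
qed

text \<open>Written with complete squares, the outer branches visibly vanish to second order at
  \<epsilon> and -\<epsilon>. This is what makes the truncation differentiable at its two
  corners.\<close>

lemma shrink_eq: "\<epsilon> > 0 \<Longrightarrow> shrink \<epsilon> t = (if t \<ge> \<epsilon> then (t - \<epsilon>)\<^sup>2 / t else if t \<le> - \<epsilon> then (t + \<epsilon>)\<^sup>2 / t else 0)"
  by (cases "t = \<epsilon>"; cases "t = - \<epsilon>") (auto simp: shrink_def power2_eq_square field_simps abs_if sgn_if)

lemma shrink_deriv:
  assumes e: "\<epsilon> > 0"
  shows "(shrink \<epsilon> has_real_derivative shrink' \<epsilon> t) (at t)"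
proof -
  have pos: "((\<lambda>t. (t - a)\<^sup>2 / t) has_real_derivative 1 - a\<^sup>2 / t\<^sup>2) (at t)" if "t \<noteq> 0" for a t :: real
    using that by (auto intro!: derivative_eq_intros simp: field_simps power2_eq_square)
  \<comment> \<open>Both corners are treated at once, with \<sigma> = 1 or \<sigma> = -1. The
    quadratic bound h^2/\<epsilon> makes the difference quotient at most |h|/\<epsilon>.\<close>
  have corner: "(shrink \<epsilon> has_real_derivative shrink' \<epsilon> (\<sigma> * \<epsilon>)) (at (\<sigma> * \<epsilon>))" if \<sigma>: "\<bar>\<sigma>\<bar> = 1" for \<sigma>
  proof -
    have z: "shrink \<epsilon> (\<sigma> * \<epsilon>) = 0" "shrink' \<epsilon> (\<sigma> * \<epsilon>) = 0" using \<sigma> e by (auto simp: shrink_def shrink'_def abs_mult)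
    have "((\<lambda>h. (shrink \<epsilon> (\<sigma> * \<epsilon> + h) - shrink \<epsilon> (\<sigma> * \<epsilon>)) / h) \<longlongrightarrow> 0) (at 0)"
    proof (rule Lim_null_comparison)
      have bd: "\<bar>shrink \<epsilon> (\<sigma> * \<epsilon> + h)\<bar> \<le> h\<^sup>2 / \<epsilon>" if h: "\<bar>h\<bar> < \<epsilon>" for h
      proof (cases "\<bar>\<sigma> * \<epsilon> + h\<bar> \<le> \<epsilon>")
        case True
        then show ?thesis using e by (simp add: shrink_def)
      next
        case False
        have "\<sigma> = 1 \<or> \<sigma> = - 1" using \<sigma> by linarith
        then have "\<bar>shrink \<epsilon> (\<sigma> * \<epsilon> + h)\<bar> = h\<^sup>2 / \<bar>\<sigma> * \<epsilon> + h\<bar>"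
          using False e h by (auto simp: shrink_eq[OF e] abs_divide)
        also have "\<dots> \<le> h\<^sup>2 / \<epsilon>" using False e by (intro divide_left_mono) auto
        finally show ?thesis .
      qed
      have "eventually (\<lambda>h::real. \<bar>h\<bar> < \<epsilon> \<and> h \<noteq> 0) (at 0)"
        using e by (auto simp: eventually_at intro!: exI[of _ \<epsilon>])
      then show "eventually (\<lambda>h. norm ((shrink \<epsilon> (\<sigma> * \<epsilon> + h) - shrink \<epsilon> (\<sigma> * \<epsilon>)) / h) \<le> \<bar>h\<bar> / \<epsilon>) (at 0)"
      proof eventually_elim
        case (elim h)
        have "norm ((shrink \<epsilon> (\<sigma> * \<epsilon> + h) - shrink \<epsilon> (\<sigma> * \<epsilon>)) / h) \<le> (h\<^sup>2 / \<epsilon>) / \<bar>h\<bar>"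
          unfolding z(1) diff_zero real_norm_def abs_divide using bd[of h] elim by (intro divide_right_mono) auto
        also have "\<dots> = \<bar>h\<bar> / \<epsilon>" using elim by (simp add: power2_eq_square abs_if)
        finally show ?case .
      qed
      show "((\<lambda>h. \<bar>h\<bar> / \<epsilon>) \<longlongrightarrow> 0) (at (0::real))"
        using e by (auto intro!: tendsto_eq_intros)
    qed
    then show ?thesis unfolding DERIV_def z(2) .
  qed
  consider "t > \<epsilon>" | "t < - \<epsilon>" | "\<bar>t\<bar> < \<epsilon>" | "t = \<epsilon>" | "t = - \<epsilon>" by linarith
  then show ?thesis
  proof cases
    case 1
    have "(shrink \<epsilon> has_real_derivative 1 - \<epsilon>\<^sup>2 / t\<^sup>2) (at t)"
      by (rule has_field_derivative_transform_within_open[OF pos[of t \<epsilon>], of "{\<epsilon><..}"]) (use 1 e in \<open>auto simp: shrink_eq\<close>)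
    then show ?thesis using 1 e by (simp add: shrink'_def)
  next
    case 2
    have "(shrink \<epsilon> has_real_derivative 1 - (- \<epsilon>)\<^sup>2 / t\<^sup>2) (at t)"
      by (rule has_field_derivative_transform_within_open[OF pos[of t "- \<epsilon>"], of "{..<- \<epsilon>}"]) (use 2 e in \<open>auto simp: shrink_eq\<close>)
    then show ?thesis using 2 e by (simp add: shrink'_def)
  next
    case 3
    have "(shrink \<epsilon> has_real_derivative 0) (at t)"
      by (rule has_field_derivative_transform_within_open[OF DERIV_const[of 0], of "{- \<epsilon><..<\<epsilon>}"]) (use 3 e in \<open>auto simp: shrink_eq\<close>)
    then show ?thesis using 3 e by (simp add: shrink'_def)
  next
    case 4
    then show ?thesis using corner[of 1] by simp
  next
    case 5
    then show ?thesis using corner[of "- 1"] by simp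
  qed
qed

lemma shrink_lipschitz:
  assumes e: "\<epsilon> > 0"
  shows "\<bar>shrink \<epsilon> s - shrink \<epsilon> t\<bar> \<le> \<bar>s - t\<bar>"
proof -
  have "norm (shrink \<epsilon> s - shrink \<epsilon> t) \<le> 1 * norm (s - t)"
  proof (rule differentiable_bound[of UNIV "shrink \<epsilon>" "\<lambda>u h. shrink' \<epsilon> u * h"])
    show "(shrink \<epsilon> has_derivative (\<lambda>h. shrink' \<epsilon> u * h)) (at u within UNIV)" for u
      using shrink_deriv[OF e, of u] by (simp add: has_field_derivative_def)
    show "onorm (\<lambda>h. shrink' \<epsilon> u * h) \<le> 1" for u
      using shrink'_bounds[OF e, of u] by (intro onorm_le) (auto simp: abs_mult intro!: mult_left_le_one_le)
  qed auto
  then show ?thesis by simp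
qed

lemma shrink_bounds:
  assumes e: "\<epsilon> > 0"
  shows "\<bar>t - shrink \<epsilon> t\<bar> \<le> \<bar>t\<bar>" "\<bar>t - shrink \<epsilon> t\<bar> \<le> 2 * \<epsilon>" "\<bar>shrink \<epsilon> t\<bar> \<le> \<bar>t\<bar>" "\<bar>t\<bar> < \<epsilon> \<Longrightarrow> shrink \<epsilon> t = 0"
proof -
  have pos: "0 \<le> s - (s - \<epsilon>)\<^sup>2 / s" "s - (s - \<epsilon>)\<^sup>2 / s \<le> s" "s - (s - \<epsilon>)\<^sup>2 / s \<le> 2 * \<epsilon>" "0 \<le> (s - \<epsilon>)\<^sup>2 / s" if "s \<ge> \<epsilon>" for s :: real
  proof -
    have s: "s > 0" using that e by linarith
    have eq: "s - (s - \<epsilon>)\<^sup>2 / s = (2 * \<epsilon> * s - \<epsilon>\<^sup>2) / s" using s by (simp add: field_simps power2_eq_square)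
    have "\<epsilon>\<^sup>2 \<le> \<epsilon> * s" using that e by (simp add: power2_eq_square)
    moreover have "0 \<le> \<epsilon> * s" using e s by simp
    ultimately show "0 \<le> s - (s - \<epsilon>)\<^sup>2 / s" unfolding eq using s by (intro divide_nonneg_pos) (simp_all add: mult.assoc)
    show "s - (s - \<epsilon>)\<^sup>2 / s \<le> 2 * \<epsilon>" unfolding eq using s e by (simp add: pos_divide_le_eq)
    show "0 \<le> (s - \<epsilon>)\<^sup>2 / s" using s by simp
    then show "s - (s - \<epsilon>)\<^sup>2 / s \<le> s" by simp
  qed
  have neg: "(t + \<epsilon>)\<^sup>2 / t = - ((- t - \<epsilon>)\<^sup>2 / (- t))"
    by (simp add: power2_eq_square algebra_simps)
  show "\<bar>t - shrink \<epsilon> t\<bar> \<le> \<bar>t\<bar>" "\<bar>t - shrink \<epsilon> t\<bar> \<le> 2 * \<epsilon>" "\<bar>shrink \<epsilon> t\<bar> \<le> \<bar>t\<bar>" "\<bar>t\<bar> < \<epsilon> \<Longrightarrow> shrink \<epsilon> t = 0"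
    using pos[of t] pos[of "- t"] e unfolding shrink_eq[OF e] neg by (auto split: if_splits)
qed

lemma shrink_tendsto: "(\<lambda>k. shrink (1 / real (Suc k)) t) \<longlonglongrightarrow> t"
proof -
  have "(\<lambda>k. 2 * (1 / real (Suc k))) \<longlonglongrightarrow> 2 * 0"
    by (intro tendsto_mult tendsto_const) (use LIMSEQ_inverse_real_of_nat in \<open>simp add: inverse_eq_divide\<close>)
  then have l: "(\<lambda>k. 2 * (1 / real (Suc k))) \<longlonglongrightarrow> 0" by simp
  have "(\<lambda>k. shrink (1 / real (Suc k)) t - t) \<longlonglongrightarrow> 0"
  proof (rule Lim_null_comparison[OF always_eventually l], rule allI)
    fix k
    show "norm (shrink (1 / real (Suc k)) t - t) \<le> 2 * (1 / real (Suc k))"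
      using shrink_bounds(2)[of "1 / real (Suc k)" t] by (simp add: abs_minus_commute)
  qed
  then show ?thesis by (rule LIM_zero_cancel)
qed

lemma shrink'_tendsto:
  assumes "t \<noteq> 0"
  shows "(\<lambda>k. shrink' (1 / real (Suc k)) t) \<longlonglongrightarrow> 1"
proof -
  have l: "(\<lambda>k. 1 / real (Suc k)) \<longlonglongrightarrow> 0" using LIMSEQ_inverse_real_of_nat by (simp add: inverse_eq_divide)
  have "(\<lambda>k. 1 - (1 / real (Suc k))\<^sup>2 / t\<^sup>2) \<longlonglongrightarrow> 1 - 0\<^sup>2 / t\<^sup>2"
    using assms by (intro tendsto_diff tendsto_divide tendsto_power tendsto_const l) auto
  moreover have "\<forall>\<^sub>F k in sequentially. 1 / real (Suc k) < \<bar>t\<bar>"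
    using assms by (intro order_tendstoD(2)[OF l]) auto
  then have "\<forall>\<^sub>F k in sequentially. 1 - (1 / real (Suc k))\<^sup>2 / t\<^sup>2 = shrink' (1 / real (Suc k)) t"
    by (rule eventually_mono) (simp add: shrink'_def)
  ultimately show ?thesis by (simp add: Lim_transform_eventually)
qed

section \<open>Approximation of Lipschitz functions by test functions\<close>

lemma lipschitz_norm_continuous:
  fixes v :: "'a::real_normed_vector \<Rightarrow> real"
  assumes lip: "\<And>p q. \<bar>v p - v q\<bar> \<le> M * norm (p - q)"
  shows "continuous_on UNIV v"
proof (rule lipschitz_on_continuous_on[of "\<bar>M\<bar>"], rule lipschitz_onI)
  fix p q :: 'a
  have "M * norm (p - q) \<le> \<bar>M\<bar> * norm (p - q)" by (intro mult_right_mono) auto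
  then show "dist (v p) (v q) \<le> \<bar>M\<bar> * dist p q" using lip[of p q] by (simp add: dist_norm)
qed simp

lemma truncated_weak_derivative:
  fixes v :: "real ^ 'n \<Rightarrow> real"
  assumes \<Omega>: "bounded \<Omega>" and e: "\<epsilon> > 0"
    and lip: "\<And>p q. \<bar>v p - v q\<bar> \<le> M * norm (p - q)"
    and bd: "\<And>x. \<bar>v x\<bar> \<le> B" "\<And>x. \<bar>g x\<bar> \<le> M"
    and zero: "\<And>x. x \<notin> \<Omega> \<Longrightarrow> v x = 0" "\<And>x. x \<notin> \<Omega> \<Longrightarrow> g x = 0"
    and m: "v \<in> borel_measurable borel" "g \<in> borel_measurable borel"
    and der: "AE x in lborel. x \<in> \<Omega> \<longrightarrow> ((\<lambda>t. v (x + t *\<^sub>R axis i 1)) has_real_derivative g x) (at 0)"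
    and ms: "(\<lambda>x. shrink \<epsilon> (v x)) \<in> borel_measurable borel" "(\<lambda>x. shrink' \<epsilon> (v x) * g x) \<in> borel_measurable borel"
    and \<psi>: "\<psi> \<in> test_functions UNIV"
  shows "(LINT x|lborel. shrink \<epsilon> (v x) * partial_deriv i \<psi> x) = - (LINT x|lborel. (shrink' \<epsilon> (v x) * g x) * \<psi> x)"
proof -
  let ?e = "axis i (1::real) :: real ^ 'n" and ?v = "\<lambda>x. shrink \<epsilon> (v x)" and ?g = "\<lambda>x. shrink' \<epsilon> (v x) * g x"
  let ?F = "\<lambda>x. ?v x * \<psi> x" and ?F' = "\<lambda>x. ?g x * \<psi> x + partial_deriv i \<psi> x * ?v x"
  note sm = test_functions_smooth[OF \<psi>]
  obtain P where P: "P \<ge> 0" "\<And>x. \<bar>\<psi> x\<bar> \<le> P" using test_functions_bounded[OF \<psi>] by metis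
  obtain Q where Q: "\<And>x t. \<bar>\<psi> (x + t *\<^sub>R ?e) - \<psi> x\<bar> \<le> Q * \<bar>t\<bar>" using test_functions_lipschitz[OF \<psi>] by metis
  have B: "\<bar>?v x\<bar> \<le> B" for x using shrink_bounds(3)[OF e, of "v x"] bd(1)[of x] by linarith
  have B0: "B \<ge> 0" using B[of 0] by linarith
  have bm: "\<psi> \<in> borel_measurable borel" "partial_deriv i \<psi> \<in> borel_measurable borel"
    using smooth_borel[OF sm] smooth_borel[OF smooth_partial_deriv[OF sm]] by auto
  have vlip: "\<bar>?v (x + t *\<^sub>R ?e) - ?v x\<bar> \<le> M * \<bar>t\<bar>" for x t
    using order_trans[OF shrink_lipschitz[OF e, of "v (x + t *\<^sub>R ?e)" "v x"] lip[of "x + t *\<^sub>R ?e" x]] by simp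
  have lipF: "\<bar>?F (x + t *\<^sub>R ?e) - ?F x\<bar> \<le> (M * P + B * Q) * \<bar>t\<bar>" for x t
  proof -
    have "?F (x + t *\<^sub>R ?e) - ?F x = (?v (x + t *\<^sub>R ?e) - ?v x) * \<psi> (x + t *\<^sub>R ?e) + ?v x * (\<psi> (x + t *\<^sub>R ?e) - \<psi> x)"
      by (simp add: algebra_simps)
    also have "\<bar>\<dots>\<bar> \<le> \<bar>?v (x + t *\<^sub>R ?e) - ?v x\<bar> * \<bar>\<psi> (x + t *\<^sub>R ?e)\<bar> + \<bar>?v x\<bar> * \<bar>\<psi> (x + t *\<^sub>R ?e) - \<psi> x\<bar>"
      by (simp add: abs_mult[symmetric])
    also have "\<dots> \<le> (M * \<bar>t\<bar>) * P + B * (Q * \<bar>t\<bar>)"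
      by (intro add_mono mult_mono vlip P(2) B Q) (use B0 order_trans[OF abs_ge_zero vlip] in auto)
    also have "\<dots> = (M * P + B * Q) * \<bar>t\<bar>" by (simp add: algebra_simps)
    finally show ?thesis .
  qed
  have vc: "continuous_on UNIV v" by (rule lipschitz_norm_continuous[OF lip])
  have derF: "AE x in lborel. ((\<lambda>t. ?F (x + t *\<^sub>R ?e)) has_real_derivative ?F' x) (at 0)"
    using der
  proof eventually_elim
    case (elim x)
    have d2: "((\<lambda>t. \<psi> (x + t *\<^sub>R ?e)) has_real_derivative partial_deriv i \<psi> x) (at 0)"
      using partial_deriv_line[OF sm, of x i 0] by simp
    show ?case
    proof (cases "x \<in> \<Omega>")
      case True
      then have d1: "((\<lambda>t. v (x + t *\<^sub>R ?e)) has_real_derivative g x) (at 0)" using elim by blast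
      have d3: "((\<lambda>t. ?v (x + t *\<^sub>R ?e)) has_real_derivative ?g x) (at 0)"
        using DERIV_chain2[OF shrink_deriv[OF e] d1] by simp
      from DERIV_mult[OF d3 d2] show ?thesis by simp
    next
      case False
      have o: "open ((\<lambda>t. x + t *\<^sub>R ?e) -` (v -` {- \<epsilon><..<\<epsilon>}))"
        by (intro open_vimage open_greaterThanLessThan vc continuous_intros)
      have "((\<lambda>t. 0::real) has_real_derivative 0) (at (0::real))" by simp
      from has_field_derivative_transform_within_open[OF this o, of "\<lambda>t. ?F (x + t *\<^sub>R ?e)"]
      have "((\<lambda>t. ?F (x + t *\<^sub>R ?e)) has_real_derivative 0) (at 0)"
        using zero(1)[OF False] e by (auto simp: shrink_bounds(4)[OF e] abs_less_iff)
      then show ?thesis using zero[OF False] e shrink_bounds(4)[OF e, of 0] by simp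
    qed
  qed
  have z: "x \<notin> \<Omega> \<Longrightarrow> ?F x = 0" for x using zero(1)[of x] shrink_bounds(4)[OF e, of 0] e by simp
  have "(LINT x|lborel. ?F' x) = 0"
  proof (rule integral_directional_derivative_eq_0(2)[where F = ?F and L = \<Omega> and e = ?e and M = "M * P + B * Q"])
    show "?F \<in> borel_measurable borel" using bm ms by (intro borel_measurable_times)
    show "?F' \<in> borel_measurable borel"
      by (rule borel_measurable_add[OF borel_measurable_times[OF ms(2) bm(1)] borel_measurable_times[OF bm(2) ms(1)]])
  qed (use \<Omega> lipF derF z in auto)
  moreover have "integrable lborel (\<lambda>x. ?g x * \<psi> x)"
  proof -
    have "\<bar>?g x\<bar> \<le> M" for x
      using shrink'_bounds[OF e, of "v x"] mult_mono[of "shrink' \<epsilon> (v x)" 1 "\<bar>g x\<bar>" M] bd(2)[of x] by (simp add: abs_mult)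
    from integrable_mult_bounded[OF test_functions_integrable[OF \<psi>] ms(2) this]
    show ?thesis by (simp add: mult.commute)
  qed
  moreover have "integrable lborel (\<lambda>x. partial_deriv i \<psi> x * ?v x)"
    by (rule integrable_mult_bounded[OF test_functions_integrable[OF test_functions_partial_deriv[OF \<psi>]] ms(1) B])
  ultimately show ?thesis
    by (simp add: Bochner_Integration.integral_add mult.commute)
qed

lemma ennreal_quarters:
  assumes "a \<le> ennreal (e / 4)" "b \<le> ennreal (e / 4)" "e > 0"
  shows "2 * a + 2 * b \<le> ennreal e"
proof -
  have "2 * a + 2 * b \<le> 2 * ennreal (e / 4) + 2 * ennreal (e / 4)" using assms by (intro add_mono mult_left_mono) auto
  also have "2 * ennreal (e / 4) = ennreal (2 * (e / 4))" using ennreal_mult'[of 2 "e / 4"] by simp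
  also have "ennreal (2 * (e / 4)) + ennreal (2 * (e / 4)) = ennreal e"
    using assms(3) by (subst ennreal_plus[symmetric]) auto
  finally show ?thesis .
qed

lemma sqn_triangle_via:
  assumes [measurable]: "f \<in> borel_measurable borel" "g \<in> borel_measurable borel" "h \<in> borel_measurable borel"
  shows "sqn (\<lambda>x. f x - h x) \<le> 2 * sqn (\<lambda>x. f x - g x) + 2 * sqn (\<lambda>x. g x - h x)"
  using sqn_add[of "\<lambda>x. f x - g x" "\<lambda>x. g x - h x"] by simp

text \<open>A compact set keeps a positive distance from the complement of the open set. Kernels of
  smaller radius do not push the support out of \<Omega>; \<open>R\<close> converts the cube that
  supports \<open>eta\<close> into a radius.\<close>

lemma mollify_test_function:
  fixes w :: "real ^ 'n \<Rightarrow> real"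
  assumes w: "w \<in> borel_measurable borel" "integrable lborel w"
    and S: "compact S" "S \<subseteq> \<Omega>" "\<And>x. x \<notin> S \<Longrightarrow> w x = 0" and \<Omega>: "open \<Omega>"
  shows "\<exists>\<rho>>0. \<forall>r. 0 < r \<longrightarrow> r \<le> \<rho> \<longrightarrow> mollify 1 0 r w \<in> test_functions \<Omega>"
proof -
  obtain \<delta> where \<delta>: "\<delta> > 0" "(\<Union>x\<in>S. cball x \<delta>) \<subseteq> \<Omega>"
    using compact_subset_open_imp_cball_epsilon_subset[OF S(1) \<Omega> S(2)] by metis
  obtain R where R: "R > 0" "\<And>y. y \<in> cbox lower (upper :: real ^ 'n) \<Longrightarrow> norm y \<le> R"
    using bounded_cbox[of lower "upper :: real ^ 'n"] unfolding bounded_pos by blast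
  have "mollify 1 0 r w \<in> test_functions \<Omega>" if r: "0 < r" "r \<le> \<delta> / R" for r
  proof (rule test_functionsI)
    show "smooth (mollify 1 0 r w)" by (rule mollify_smooth(1)[OF w r(1)])
    show "compact {x + y | x y. x \<in> S \<and> y \<in> cball 0 \<delta>}" by (intro compact_sums S compact_cball)
    show "{x + y | x y. x \<in> S \<and> y \<in> cball 0 \<delta>} \<subseteq> \<Omega>"
    proof safe
      fix x y :: "real ^ 'n" assume "x \<in> S" "y \<in> cball 0 \<delta>"
      then have "x + y \<in> (\<Union>x\<in>S. cball x \<delta>)" by (auto intro!: bexI[of _ x] simp: dist_norm)
      then show "x + y \<in> \<Omega>" using \<delta>(2) by blast
    qed
    fix x assume x: "x \<notin> {x + y | x y. x \<in> S \<and> y \<in> cball 0 \<delta>}"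
    have "w (1 *\<^sub>R x + 0 + r *\<^sub>R y) * eta y = 0" for y
    proof (cases "y \<in> cbox lower upper")
      case True
      have "r * norm y \<le> \<delta> / R * R" using r R True by (intro mult_mono) auto
      then have "- (r *\<^sub>R y) \<in> cball 0 \<delta>" using R(1) r(1) by (simp add: dist_norm)
      moreover have "x = (x + r *\<^sub>R y) + - (r *\<^sub>R y)" by simp
      ultimately have "x + r *\<^sub>R y \<notin> S" using x by blast
      then show ?thesis using S(3) by simp
    qed (simp add: eta_outside)
    then show "mollify 1 0 r w x = 0" unfolding mollify_def by (simp only: integral_zero)
  qed
  then show ?thesis using \<delta>(1) R(1) by (intro exI[of _ "\<delta> / R"]) auto
qed

lemma sqn_finite_bounded:
  fixes f :: "'a::euclidean_space \<Rightarrow> real"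
  assumes f: "f \<in> borel_measurable borel" "\<And>x. \<bar>f x\<bar> \<le> C" "\<And>x. x \<notin> \<Omega> \<Longrightarrow> f x = 0" and \<Omega>: "bounded \<Omega>"
  shows "sqn f < \<infinity>"
  unfolding sqn_finite_iff[OF f(1)]
proof (rule integrable_bounded_support[OF _ \<Omega>])
  show "\<bar>(f x)\<^sup>2\<bar> \<le> C\<^sup>2" for x using power_mono[OF f(2)[of x] abs_ge_zero, of 2] by simp
qed (use f in auto)

text \<open>Truncation gives compact support in \<Omega> and mollification gives smoothness; each is
  allowed an error of e/4 because \<open>sqn\<close> doubles both. At zeros of \<open>v\<close> the
  truncation has derivative zero for every \<epsilon>, so the truncated derivatives converge only if
  the derivatives of \<open>v\<close> vanish there too, which is the hypothesis
  \<open>nz\<close>.\<close>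

lemma lipschitz_test_approximation:
  fixes v :: "real ^ 'n \<Rightarrow> real"
  assumes \<Omega>: "open \<Omega>" "bounded \<Omega>"
    and lip: "\<And>p q. \<bar>v p - v q\<bar> \<le> M * norm (p - q)"
    and bd: "\<And>x. \<bar>v x\<bar> \<le> B" "\<And>i x. \<bar>g i x\<bar> \<le> M"
    and zero: "\<And>x. x \<notin> \<Omega> \<Longrightarrow> v x = 0" "\<And>i x. x \<notin> \<Omega> \<Longrightarrow> g i x = 0"
    and m: "\<And>i. g i \<in> borel_measurable borel"
    and der: "\<And>i. AE x in lborel. x \<in> \<Omega> \<longrightarrow> ((\<lambda>t. v (x + t *\<^sub>R axis i 1)) has_real_derivative g i x) (at 0)"
    and nz: "AE x in lborel. v x = 0 \<longrightarrow> (\<forall>i. g i x = 0)" and e: "e > 0"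
  shows "\<exists>\<phi>\<in>test_functions \<Omega>. sqn (\<lambda>x. v x - \<phi> x) \<le> ennreal e \<and> (\<forall>i. sqn (\<lambda>x. g i x - partial_deriv i \<phi> x) \<le> ennreal e)"
proof -
  define \<epsilon> where "\<epsilon> k = 1 / real (Suc k)" for k
  have \<epsilon>: "\<epsilon> k > 0" for k by (simp add: \<epsilon>_def)
  define w where "w k x = shrink (\<epsilon> k) (v x)" for k x
  define d where "d k i x = shrink' (\<epsilon> k) (v x) * g i x" for k i x
  have vc: "continuous_on UNIV v" by (rule lipschitz_norm_continuous[OF lip])
  have mv: "v \<in> borel_measurable borel" by (rule borel_measurable_continuous_onI[OF vc])
  have sc: "shrink (\<epsilon> k) \<in> borel_measurable borel" for k
    by (intro borel_measurable_continuous_onI continuous_at_imp_continuous_on ballI DERIV_isCont[OF shrink_deriv[OF \<epsilon>]])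
  have sc': "shrink' (\<epsilon> k) \<in> borel_measurable borel" for k unfolding shrink'_def[abs_def] by measurable
  have mw: "w k \<in> borel_measurable borel" for k
    unfolding w_def[abs_def] by (rule measurable_compose[OF mv sc])
  have md: "d k i \<in> borel_measurable borel" for k i
    unfolding d_def[abs_def] by (intro borel_measurable_times m measurable_compose[OF mv sc'])
  have sv: "sqn v < \<infinity>" by (rule sqn_finite_bounded[OF mv bd(1) zero(1) \<Omega>(2)])
  have sg: "sqn (g i) < \<infinity>" for i by (rule sqn_finite_bounded[OF m bd(2) zero(2) \<Omega>(2)])
  have wB: "\<bar>w k x\<bar> \<le> B" for k x using shrink_bounds(3)[OF \<epsilon>, of k "v x"] bd(1)[of x] by (simp add: w_def)
  have dg: "\<bar>d k i x\<bar> \<le> \<bar>g i x\<bar>" for k i x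
    using shrink'_bounds[OF \<epsilon>, of k "v x"] by (simp add: d_def abs_mult mult_left_le_one_le)
  have w0: "x \<notin> \<Omega> \<Longrightarrow> w k x = 0" for k x using zero(1)[of x] shrink_bounds(4)[OF \<epsilon>, of 0 k] \<epsilon>[of k] by (simp add: w_def)
  have limv: "(\<lambda>k. sqn (\<lambda>x. v x - w k x)) \<longlonglongrightarrow> 0"
  proof (rule square_integral_dominated[OF _ mv sv])
    show "(\<lambda>x. v x - w k x) \<in> borel_measurable borel" for k using mv mw by (intro borel_measurable_diff)
    show "\<bar>v x - w k x\<bar> \<le> \<bar>v x\<bar>" for k x using shrink_bounds(1)[OF \<epsilon>] by (simp add: w_def)
    have "(\<lambda>k. v x - w k x) \<longlonglongrightarrow> v x - v x" for x
      unfolding w_def \<epsilon>_def by (intro tendsto_diff tendsto_const shrink_tendsto)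
    then show "AE x in lborel. (\<lambda>k. v x - w k x) \<longlonglongrightarrow> 0" by simp
  qed
  have limg: "(\<lambda>k. sqn (\<lambda>x. g i x - d k i x)) \<longlonglongrightarrow> 0" for i
  proof (rule square_integral_dominated[OF _ m sg])
    show "(\<lambda>x. g i x - d k i x) \<in> borel_measurable borel" for k using m md by (intro borel_measurable_diff)
    show "\<bar>g i x - d k i x\<bar> \<le> \<bar>g i x\<bar>" for k x
    proof -
      have "g i x - d k i x = (1 - shrink' (\<epsilon> k) (v x)) * g i x" by (simp add: d_def algebra_simps)
      then show ?thesis using shrink'_bounds[OF \<epsilon>, of k "v x"] by (simp add: abs_mult mult_left_le_one_le)
    qed
    show "AE x in lborel. (\<lambda>k. g i x - d k i x) \<longlonglongrightarrow> 0"
      using nz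
    proof eventually_elim
      case (elim x)
      show ?case
      proof (cases "v x = 0")
        case True
        then show ?thesis using elim by (simp add: d_def)
      next
        case False
        have "(\<lambda>k. g i x - d k i x) \<longlonglongrightarrow> g i x - 1 * g i x"
          unfolding d_def \<epsilon>_def by (intro tendsto_diff tendsto_mult tendsto_const shrink'_tendsto False)
        then show ?thesis by simp
      qed
    qed
  qed
  have e4: "0 < ennreal (e / 4)" using e by simp
  have "\<forall>\<^sub>F k in sequentially. sqn (\<lambda>x. v x - w k x) < ennreal (e / 4) \<and> (\<forall>i. sqn (\<lambda>x. g i x - d k i x) < ennreal (e / 4))"
    by (intro eventually_conj eventually_all_finite order_tendstoD(2)[OF limv e4] order_tendstoD(2)[OF limg e4])
  then obtain k where k: "sqn (\<lambda>x. v x - w k x) < ennreal (e / 4)" "\<And>i. sqn (\<lambda>x. g i x - d k i x) < ennreal (e / 4)"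
    unfolding eventually_sequentially by blast
  \<comment> \<open>Off \<Omega> the function is zero, so this closed set lies in the bounded set
    \<Omega> and is compact. The truncation vanishes outside it.\<close>
  define S where "S = {x. \<epsilon> k \<le> \<bar>v x\<bar>}"
  have S\<Omega>: "S \<subseteq> \<Omega>" unfolding S_def using zero(1) \<epsilon>[of k] by force
  have "closed S" unfolding S_def by (intro closed_Collect_le continuous_intros vc)
  then have S: "compact S" using bounded_subset[OF \<Omega>(2) S\<Omega>] by (simp add: compact_eq_bounded_closed)
  have wS: "x \<notin> S \<Longrightarrow> w k x = 0" for x using shrink_bounds(4)[OF \<epsilon>] by (simp add: w_def S_def)
  have iw: "integrable lborel (w k)" by (rule integrable_bounded_support[OF mw \<Omega>(2) w0 wB])
  have weak: "(LINT x|lborel. w k x * partial_deriv i \<psi> x) = - (LINT x|lborel. d k i x * \<psi> x)"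
    if "\<psi> \<in> test_functions UNIV" for i \<psi>
    unfolding w_def d_def
    by (rule truncated_weak_derivative[OF \<Omega>(2) \<epsilon> lip bd(1) bd(2) zero(1) zero(2) mv m der _ _ that])
      (use mw[of k] md[of k i] in \<open>simp_all add: w_def[abs_def] d_def[abs_def]\<close>)
  obtain \<rho> where \<rho>: "\<rho> > 0" "\<And>r. 0 < r \<Longrightarrow> r \<le> \<rho> \<Longrightarrow> mollify 1 0 r (w k) \<in> test_functions \<Omega>"
    using mollify_test_function[OF mw iw S S\<Omega> wS \<Omega>(1)] by blast
  define r where "r n = \<rho> / real (Suc n)" for n
  have r: "0 < r n" "r n \<le> \<rho>" for n using \<rho>(1) by (auto simp: r_def field_simps)
  have "(\<lambda>n. \<rho> * inverse (real (Suc n))) \<longlonglongrightarrow> \<rho> * 0" by (intro tendsto_mult tendsto_const LIMSEQ_inverse_real_of_nat)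
  then have rl: "r \<longlonglongrightarrow> 0" unfolding r_def[abs_def] by (simp add: divide_inverse)
  have sw: "sqn (w k) < \<infinity>" by (rule sqn_finite_bounded[OF mw wB w0 \<Omega>(2)])
  have sd: "sqn (d k i) < \<infinity>" for i using sqn_mono[of "d k i" "g i", OF dg] sg[of i] by (rule order_le_less_trans)
  have l: "(\<lambda>n. sqn (\<lambda>x. mollify 1 0 (r n) f x - f x)) \<longlonglongrightarrow> 0" if "f \<in> borel_measurable borel" "sqn f < \<infinity>" for f :: "real ^ 'n \<Rightarrow> real"
    using mollify_tendsto_L2[OF that, of "\<lambda>_. 1" "\<lambda>_. 0" r] rl r(1) by (simp add: less_imp_neq[symmetric])
  have "\<forall>\<^sub>F n in sequentially. sqn (\<lambda>x. mollify 1 0 (r n) (w k) x - w k x) < ennreal (e / 4) \<and>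
      (\<forall>i. sqn (\<lambda>x. mollify 1 0 (r n) (d k i) x - d k i x) < ennreal (e / 4))"
    by (intro eventually_conj eventually_all_finite order_tendstoD(2)[OF l[OF mw sw] e4] order_tendstoD(2)[OF l[OF md sd] e4])
  then obtain n where n: "sqn (\<lambda>x. mollify 1 0 (r n) (w k) x - w k x) < ennreal (e / 4)"
      "\<And>i. sqn (\<lambda>x. mollify 1 0 (r n) (d k i) x - d k i x) < ennreal (e / 4)"
    unfolding eventually_sequentially by blast
  define \<phi> where "\<phi> = mollify 1 0 (r n) (w k)"
  have \<phi>: "\<phi> \<in> test_functions \<Omega>" unfolding \<phi>_def by (rule \<rho>(2)[OF r])
  have pd: "partial_deriv i \<phi> = mollify 1 0 (r n) (d k i)" for i
    unfolding \<phi>_def by (rule ext, rule mollify_smooth(2)[OF mw iw r(1) md weak])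
  have "sqn (\<lambda>x. v x - \<phi> x) \<le> ennreal e"
    by (rule order_trans[OF sqn_triangle_via[OF mv mw[of k] smooth_borel[OF test_functions_smooth[OF \<phi>]]]], rule ennreal_quarters[OF _ _ e])
      (use k(1) n(1) in \<open>auto simp: \<phi>_def sqn_minus_commute[of "w k"]\<close>)
  moreover have "sqn (\<lambda>x. g i x - partial_deriv i \<phi> x) \<le> ennreal e" for i
    by (rule order_trans[OF sqn_triangle_via[OF m[of i] md[of k i] smooth_borel[OF smooth_partial_deriv[OF test_functions_smooth[OF \<phi>]]]]], rule ennreal_quarters[OF _ _ e])
      (use k(2)[of i] n(2)[of i] in \<open>auto simp: pd sqn_minus_commute[of "d k i"]\<close>)
  ultimately show ?thesis using \<phi> by blast
qed

section \<open>Interpolants of H^2 functions\<close>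

context mesh
begin

text \<open>The factor (d + 1)^2 stems from the sums over vertices and 8 d^2 2^d from the Taylor
  estimate. For gradients, 2 diam(K)/r \<le> 8\<gamma> turns the factor (2/r)^2 diam(K)^4 into 64
  \<gamma>^2 H^2. For values, diam(K)^4 is bounded by D^2 H^2: one order is given away so that both
  errors have the same rate.\<close>

lemma interpolation_exists:
  fixes v :: "real ^ 'n \<Rightarrow> real"
  assumes h: "h2_data \<Omega> v v1 v2" and d: "CARD('n) \<le> 3"
    and z: "\<And>x. x \<notin> \<Omega> \<Longrightarrow> v x = 0" "\<And>i x. x \<notin> \<Omega> \<Longrightarrow> v1 i x = 0"
    and \<gamma>: "\<gamma> > 0" "\<And>K. K \<in> \<T> \<Longrightarrow> diameter K \<le> \<gamma> * insphere_diameter K"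
    and H: "\<And>K. K \<in> \<T> \<Longrightarrow> diameter K \<le> H" "H \<le> D"
  shows "\<exists>c b u. pw_agree c b \<and>
    (\<forall>K\<in>\<T>. continuous_on K (u K) \<and> (AE x in lborel. x \<in> K \<longrightarrow> u K x = v x) \<and> (\<forall>z\<in>verts K. u K z = c K + b K \<bullet> z)) \<and>
    sqn (\<lambda>x. v x - pw c b x) \<le> ennreal ((real CARD('n) + 1)\<^sup>2 * (8 * (CARD('n))\<^sup>2 * 2 ^ CARD('n)) * (D\<^sup>2 * H\<^sup>2)) * (\<Sum>i\<in>UNIV. \<Sum>j\<in>UNIV. sqn (v2 i j)) \<and>
    (\<forall>i. sqn (\<lambda>x. v1 i x - pw_grad b i x) \<le> ennreal ((real CARD('n) + 1)\<^sup>2 * (8 * (CARD('n))\<^sup>2 * 2 ^ CARD('n)) * (64 * \<gamma>\<^sup>2 * H\<^sup>2)) * (\<Sum>i\<in>UNIV. \<Sum>j\<in>UNIV. sqn (v2 i j)))"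
proof -
  let ?N = "(real CARD('n) + 1)\<^sup>2" and ?C = "8 * (CARD('n))\<^sup>2 * 2 ^ CARD('n) :: real"
  let ?S = "\<Sum>i\<in>UNIV. \<Sum>j\<in>UNIV. sqn (v2 i j)"
  define Y where "Y K = (\<Sum>i\<in>UNIV. \<Sum>j\<in>UNIV. sqn (\<lambda>x. indicator K x * v2 i j x))" for K
  have m: "v \<in> borel_measurable borel" "\<And>i. v1 i \<in> borel_measurable borel" "\<And>i j. v2 i j \<in> borel_measurable borel"
    using h by (auto simp: h2_data_def)
  have "\<exists>u c b. continuous_on K u \<and> (AE x in lborel. x \<in> K \<longrightarrow> u x = v x) \<and>
      (\<forall>a\<in>K. sqn (\<lambda>x. indicator K x * (u a - v x + (\<Sum>i\<in>UNIV. (x - a) $ i * v1 i x))) \<le> ennreal (8 * (diameter K)^4 * (CARD('n))\<^sup>2 * 2 ^ CARD('n)) * Y K) \<and>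
      (\<forall>z\<in>verts K. u z = c + b \<bullet> z)" if K: "K \<in> \<T>" for K
  proof -
    note s = simplex_verts[OF simplices[OF K]]
    obtain u where "continuous_on K u \<and> (AE x in lborel. x \<in> K \<longrightarrow> u x = v x) \<and>
      (\<forall>a\<in>K. sqn (\<lambda>x. indicator K x * (u a - v x + (\<Sum>i\<in>UNIV. (x - a) $ i * v1 i x))) \<le> ennreal (8 * (diameter K)^4 * (CARD('n))\<^sup>2 * 2 ^ CARD('n)) * Y K)"
      using h2_local_rep[OF h d s(5-7) interior_simplex_subset[OF K]] unfolding Y_def ..
    moreover obtain c b where "\<forall>z\<in>verts K. u z = c + b \<bullet> z" using affine_interpolation[OF s(2), of u] by (elim exE)
    ultimately show ?thesis by (intro exI[of _ u] exI[of _ c] exI[of _ b]) simp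
  qed
  then have "\<forall>K\<in>\<T>. \<exists>u c b. continuous_on K u \<and> (AE x in lborel. x \<in> K \<longrightarrow> u x = v x) \<and>
      (\<forall>a\<in>K. sqn (\<lambda>x. indicator K x * (u a - v x + (\<Sum>i\<in>UNIV. (x - a) $ i * v1 i x))) \<le> ennreal (8 * (diameter K)^4 * (CARD('n))\<^sup>2 * 2 ^ CARD('n)) * Y K) \<and>
      (\<forall>z\<in>verts K. u z = c + b \<bullet> z)" by (rule ballI)
  from this[unfolded bchoice_iff] obtain u c b where ucb:
    "\<forall>K\<in>\<T>. continuous_on K (u K) \<and> (AE x in lborel. x \<in> K \<longrightarrow> u K x = v x) \<and>
      (\<forall>a\<in>K. sqn (\<lambda>x. indicator K x * (u K a - v x + (\<Sum>i\<in>UNIV. (x - a) $ i * v1 i x))) \<le> ennreal (8 * (diameter K)^4 * (CARD('n))\<^sup>2 * 2 ^ CARD('n)) * Y K) \<and>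
      (\<forall>z\<in>verts K. u K z = c K + b K \<bullet> z)" by (elim exE)
  have uc: "continuous_on K (u K)" and ua: "AE x in lborel. x \<in> K \<longrightarrow> u K x = v x"
    and up: "\<And>z. z \<in> verts K \<Longrightarrow> u K z = c K + b K \<bullet> z"
    and ue: "\<And>a. a \<in> K \<Longrightarrow> sqn (\<lambda>x. indicator K x * (u K a - v x + (\<Sum>i\<in>UNIV. (x - a) $ i * v1 i x))) \<le> ennreal (8 * (diameter K)^4 * (CARD('n))\<^sup>2 * 2 ^ CARD('n)) * Y K"
    if "K \<in> \<T>" for K using bspec[OF ucb that] by simp_all
  have ag: "pw_agree c b"
    unfolding pw_agree_def by (intro ballI impI) (rule interpolants_agree[OF h d uc ua up]; simp)
  have ds: "0 \<le> diameter K" if "K \<in> \<T>" for K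
    using simplex_verts(5)[OF simplices[OF that]] by (intro diameter_ge_0 compact_imp_bounded)
  have e1: "sqn (\<lambda>x. indicator K x * (v x - pw c b x)) \<le> ennreal (?N * ?C * (D\<^sup>2 * H\<^sup>2)) * Y K"
    and e2: "\<And>i. sqn (\<lambda>x. indicator K x * (v1 i x - pw_grad b i x)) \<le> ennreal (?N * ?C * (64 * \<gamma>\<^sup>2 * H\<^sup>2)) * Y K" if K: "K \<in> \<T>" for K
  proof -
    note s = simplex_verts[OF simplices[OF K]]
    obtain y r where r: "r > 0" "ball y r \<subseteq> K" "diameter K \<le> 4 * \<gamma> * r"
      using insphere_ball[OF s(5,7) \<gamma>(1) \<gamma>(2)[OF K]] .
    note E = simplex_interpolation_error[where c = "c K" and b = "b K", OF simplices[OF K] m(1) m(2) ue[OF K] up[OF K] r(1,2)]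
    have dH: "(diameter K)\<^sup>2 \<le> H\<^sup>2" using H(1)[OF K] ds[OF K] by (intro power_mono)
    have dD: "(diameter K)\<^sup>2 \<le> D\<^sup>2" using H(1)[OF K] H(2) ds[OF K] by (intro power_mono) linarith
    have q: "(diameter K)^4 = (diameter K)\<^sup>2 * (diameter K)\<^sup>2" by (simp add: power_add[symmetric])
    have d4: "(diameter K)^4 \<le> D\<^sup>2 * H\<^sup>2" unfolding q by (intro mult_mono dD dH) auto
    have dr: "(2 / r)\<^sup>2 * (diameter K)^4 \<le> 64 * \<gamma>\<^sup>2 * H\<^sup>2"
    proof -
      have "2 / r * diameter K \<le> 8 * \<gamma>" using r(1,3) by (simp add: field_simps)
      then have "(2 / r * diameter K)\<^sup>2 \<le> (8 * \<gamma>)\<^sup>2" using ds[OF K] r(1) by (intro power_mono) auto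
      then have "(2 / r * diameter K)\<^sup>2 * (diameter K)\<^sup>2 \<le> (8 * \<gamma>)\<^sup>2 * H\<^sup>2" by (intro mult_mono dH) auto
      moreover have "(2 / r)\<^sup>2 * (diameter K)^4 = (2 / r * diameter K)\<^sup>2 * (diameter K)\<^sup>2"
        unfolding q by (simp only: power_mult_distrib mult.assoc)
      ultimately show ?thesis by (simp add: power_mult_distrib mult.assoc)
    qed
    have "sqn (\<lambda>x. indicator K x * (v x - pw c b x)) \<le> sqn (\<lambda>x. indicator K x * (v x - (c K + b K \<bullet> x)))"
    proof (rule sqn_mono_AE)
      show "AE x in lborel. \<bar>indicator K x * (v x - pw c b x)\<bar> \<le> \<bar>indicator K x * (v x - (c K + b K \<bullet> x))\<bar>"
        using AE_interior
      proof eventually_elim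
        case (elim x)
        show ?case
        proof (cases "x \<in> K")
          case True
          then have "x \<in> \<Omega>" using elim K interior_simplex_subset[OF K] by blast
          then show ?thesis using pw_eq[OF ag K True] by simp
        qed simp
      qed
    qed
    also note E(1)
    also have "ennreal ?N * (ennreal (8 * (diameter K)^4 * (CARD('n))\<^sup>2 * 2 ^ CARD('n)) * Y K) = ennreal (?N * ?C * (diameter K)^4) * Y K"
      using ds[OF K] by (simp add: mult.assoc[symmetric] ennreal_mult[symmetric]) (simp add: ac_simps)
    also have "\<dots> \<le> ennreal (?N * ?C * (D\<^sup>2 * H\<^sup>2)) * Y K"
      by (intro mult_right_mono ennreal_leI mult_left_mono d4) auto
    finally show "sqn (\<lambda>x. indicator K x * (v x - pw c b x)) \<le> ennreal (?N * ?C * (D\<^sup>2 * H\<^sup>2)) * Y K" .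
    fix i
    have "sqn (\<lambda>x. indicator K x * (v1 i x - pw_grad b i x)) \<le> sqn (\<lambda>x. indicator K x * (v1 i x - b K $ i))"
    proof (rule sqn_mono_AE)
      show "AE x in lborel. \<bar>indicator K x * (v1 i x - pw_grad b i x)\<bar> \<le> \<bar>indicator K x * (v1 i x - b K $ i)\<bar>"
        using AE_interior
      proof eventually_elim
        case (elim x)
        show ?case
        proof (cases "x \<in> K")
          case True
          then show ?thesis using pw_grad_eq[OF K, of x b i] elim K by simp
        qed simp
      qed
    qed
    also note E(2)
    also have "ennreal ((2 / r)\<^sup>2 * ?N) * (ennreal (8 * (diameter K)^4 * (CARD('n))\<^sup>2 * 2 ^ CARD('n)) * Y K) = ennreal (?N * ?C * ((2 / r)\<^sup>2 * (diameter K)^4)) * Y K"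
      using ds[OF K] by (simp add: mult.assoc[symmetric] ennreal_mult[symmetric]) (simp add: ac_simps)
    also have "\<dots> \<le> ennreal (?N * ?C * (64 * \<gamma>\<^sup>2 * H\<^sup>2)) * Y K"
      by (intro mult_right_mono ennreal_leI mult_left_mono dr) auto
    finally show "sqn (\<lambda>x. indicator K x * (v1 i x - pw_grad b i x)) \<le> ennreal (?N * ?C * (64 * \<gamma>\<^sup>2 * H\<^sup>2)) * Y K" .
  qed
  have YS: "(\<Sum>K\<in>\<T>. Y K) \<le> ?S"
  proof -
    have "(\<Sum>K\<in>\<T>. Y K) = (\<Sum>i\<in>UNIV. \<Sum>j\<in>UNIV. \<Sum>K\<in>\<T>. sqn (\<lambda>x. indicator K x * v2 i j x))"
      unfolding Y_def by (subst sum.swap) (intro sum.cong refl sum.swap)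
    also have "\<dots> \<le> ?S" by (intro sum_mono sum_sqn_le m(3))
    finally show ?thesis .
  qed
  have tot: "sqn g \<le> ennreal C * ?S"
    if g: "g \<in> borel_measurable borel" "\<And>x. x \<notin> \<Omega> \<Longrightarrow> g x = 0" and E: "\<And>K. K \<in> \<T> \<Longrightarrow> sqn (\<lambda>x. indicator K x * g x) \<le> ennreal C * Y K" for g C
  proof -
    have "sqn g \<le> (\<Sum>K\<in>\<T>. sqn (\<lambda>x. indicator K x * g x))" by (rule sqn_le_sum[OF g])
    also have "\<dots> \<le> (\<Sum>K\<in>\<T>. ennreal C * Y K)" by (intro sum_mono E)
    also have "\<dots> = ennreal C * (\<Sum>K\<in>\<T>. Y K)" by (rule sum_distrib_left[symmetric])
    also have "\<dots> \<le> ennreal C * ?S" by (intro mult_left_mono YS) simp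
    finally show ?thesis .
  qed
  have "sqn (\<lambda>x. v x - pw c b x) \<le> ennreal (?N * ?C * (D\<^sup>2 * H\<^sup>2)) * ?S"
    by (rule tot[OF _ _ e1]) (use m(1) pw_borel[OF ag] z(1) pw_outside in \<open>auto intro!: borel_measurable_diff\<close>)
  moreover have "sqn (\<lambda>x. v1 i x - pw_grad b i x) \<le> ennreal (?N * ?C * (64 * \<gamma>\<^sup>2 * H\<^sup>2)) * ?S" for i
    by (rule tot[OF _ _ e2]) (use m(2) pw_grad_borel z(2) pw_grad_outside in \<open>auto intro!: borel_measurable_diff\<close>)
  ultimately show ?thesis using ag uc ua up
    by (intro exI[of _ c] exI[of _ b] exI[of _ u] conjI ballI allI) simp_all
qed

lemma pw_test_approximation:
  assumes ag: "pw_agree c b" and bz: "\<And>K x. K \<in> \<T> \<Longrightarrow> x \<in> K \<Longrightarrow> x \<notin> \<Omega> \<Longrightarrow> c K + b K \<bullet> x = 0" and e: "e > 0"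
  shows "\<exists>\<phi>\<in>test_functions \<Omega>. sqn (\<lambda>x. pw c b x - \<phi> x) \<le> ennreal e \<and> (\<forall>i. sqn (\<lambda>x. pw_grad b i x - partial_deriv i \<phi> x) \<le> ennreal e)"
proof -
  obtain B where B: "B \<ge> 0" "\<And>x. \<bar>pw c b x\<bar> \<le> B" using pw_bounded[OF ag] by metis
  show ?thesis
  proof (rule lipschitz_test_approximation[OF open_dom bounded_dom _ B(2) pw_grad_bound pw_outside pw_grad_outside pw_grad_borel _ _ e])
    fix p q
    show "\<bar>pw c b p - pw c b q\<bar> \<le> slope_bound b * norm (p - q)"
    proof (rule affine_pieces_lipschitz[where Z = "- \<Omega>"])
      show "pw c b x = c K + b K \<bullet> x" if "K \<in> \<T>" "x \<in> K" for K x
        using pw_eq[OF ag that] bz[OF that] pw_outside[of x c b] by (cases "x \<in> \<Omega>") auto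
      show "closed_segment p q \<subseteq> - \<Omega> \<union> \<Union>\<T>" using cover closure_subset[of \<Omega>] by blast
    qed (use open_dom pw_outside in auto)
  next
    fix i
    show "AE x in lborel. x \<in> \<Omega> \<longrightarrow> ((\<lambda>t. pw c b (x + t *\<^sub>R axis i 1)) has_real_derivative pw_grad b i x) (at 0)"
      using AE_interior
    proof eventually_elim
      case (elim x)
      show ?case
      proof
        assume "x \<in> \<Omega>"
        then obtain K where K: "K \<in> \<T>" "x \<in> K" using cover closure_subset by blast
        then show "((\<lambda>t. pw c b (x + t *\<^sub>R axis i 1)) has_real_derivative pw_grad b i x) (at 0)"
          using elim by (intro pw_line_derivative[OF ag K(1)]) auto
      qed
    qed
  next
    \<comment> \<open>A nonconstant affine function vanishes only on a hyperplane, which is null. So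
      almost every zero of the piecewise function lies where its gradient is zero as well, as
      \<open>lipschitz_test_approximation\<close> demands.\<close>
    have "AE x in lborel. b K \<noteq> 0 \<longrightarrow> c K + b K \<bullet> x \<noteq> 0" if "K \<in> \<T>" for K
    proof (cases "b K = 0")
      case False
      have "negligible {x. b K \<bullet> x = - c K}" using False by (intro negligible_hyperplane) auto
      then have "{x. b K \<bullet> x = - c K} \<in> null_sets lebesgue" by (simp add: negligible_iff_null_sets)
      then have "AE x in lebesgue. x \<notin> {x. b K \<bullet> x = - c K}" by (rule AE_not_in)
      then have "AE x in lborel. x \<notin> {x. b K \<bullet> x = - c K}" by (simp only: AE_completion_iff)
      then show ?thesis
      proof eventually_elim
        case (elim x)
        then show ?case by (simp add: eq_neg_iff_add_eq_0 add.commute)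
      qed
    qed simp
    then have "AE x in lborel. \<forall>K\<in>\<T>. b K \<noteq> 0 \<longrightarrow> c K + b K \<bullet> x \<noteq> 0" by (intro AE_finite_allI finite_mesh)
    then show "AE x in lborel. pw c b x = 0 \<longrightarrow> (\<forall>i. pw_grad b i x = 0)"
      using AE_interior
    proof eventually_elim
      case (elim x)
      show ?case
      proof (intro impI allI)
        fix i assume 0: "pw c b x = 0"
        show "pw_grad b i x = 0"
        proof (cases "x \<in> \<Omega>")
          case True
          then obtain K where K: "K \<in> \<T>" "x \<in> K" using cover closure_subset by blast
          then show ?thesis using elim 0 pw_eq[OF ag K True] pw_grad_eq[OF K(1), of x b i] by auto
        qed (simp add: pw_grad_outside)
      qed
    qed
  qed
qed

end

section \<open>Zero boundary values in pointwise form\<close>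

lemma integral_product_bound:
  fixes f g :: "'a::euclidean_space \<Rightarrow> real"
  assumes m: "f \<in> borel_measurable borel" "g \<in> borel_measurable borel" and g: "sqn g < \<infinity>"
    and f: "sqn f \<le> ennreal (e\<^sup>2)" and e: "e > 0"
  shows "\<bar>LINT x|lborel. f x * g x\<bar> \<le> e * (1 + (LINT x|lborel. (g x)\<^sup>2))"
proof -
  have sf: "sqn f < \<infinity>" using f by (rule order_le_less_trans) simp
  have i: "integrable lborel (\<lambda>x. (f x)\<^sup>2)" "integrable lborel (\<lambda>x. (g x)\<^sup>2)"
    using sf g sqn_finite_iff[OF m(1)] sqn_finite_iff[OF m(2)] by auto
  have F: "(LINT x|lborel. (f x)\<^sup>2) \<le> e\<^sup>2" using f unfolding sqn_eq_integral[OF i(1)] by simp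
  have ip: "integrable lborel (\<lambda>x. f x * g x)" by (rule integrable_mult_square_integrable[OF m sf g])
  \<comment> \<open>Young's inequality with weight \<open>e\<close>: the smallness of
    \<open>f\<close> absorbs the factor 1/e, and the resulting bound is linear in
    \<open>e\<close>.\<close>
  have pt: "\<bar>f x * g x\<bar> \<le> (1 / e) * (f x)\<^sup>2 + e * (g x)\<^sup>2" for x
  proof -
    have "0 \<le> (\<bar>f x\<bar> - e * \<bar>g x\<bar>)\<^sup>2" by simp
    then have "2 * e * (\<bar>f x\<bar> * \<bar>g x\<bar>) \<le> (f x)\<^sup>2 + e\<^sup>2 * (g x)\<^sup>2"
      by (simp add: power2_diff power_mult_distrib mult_ac)
    moreover have "0 \<le> e * (\<bar>f x\<bar> * \<bar>g x\<bar>)" using e by simp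
    ultimately have "e * (\<bar>f x\<bar> * \<bar>g x\<bar>) \<le> (f x)\<^sup>2 + e\<^sup>2 * (g x)\<^sup>2" by linarith
    also have "\<dots> = e * ((1 / e) * (f x)\<^sup>2 + e * (g x)\<^sup>2)" using e by (simp add: field_simps power2_eq_square)
    finally show ?thesis using e by (simp add: abs_mult)
  qed
  have "\<bar>LINT x|lborel. f x * g x\<bar> \<le> (LINT x|lborel. \<bar>f x * g x\<bar>)" by (rule integral_abs_bound)
  also have "\<dots> \<le> (LINT x|lborel. (1 / e) * (f x)\<^sup>2 + e * (g x)\<^sup>2)"
    by (rule integral_mono[OF integrable_abs[OF ip] _ pt])
      (intro Bochner_Integration.integrable_add integrable_mult_right i)
  also have "\<dots> = (1 / e) * (LINT x|lborel. (f x)\<^sup>2) + e * (LINT x|lborel. (g x)\<^sup>2)"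
    by (subst Bochner_Integration.integral_add) (auto intro!: integrable_mult_right i)
  also have "\<dots> \<le> (1 / e) * e\<^sup>2 + e * (LINT x|lborel. (g x)\<^sup>2)"
    using e F by (intro add_mono mult_left_mono) auto
  also have "\<dots> = e * (1 + (LINT x|lborel. (g x)\<^sup>2))" using e by (simp add: power2_eq_square algebra_simps)
  finally show ?thesis .
qed

text \<open>Approximation by test functions in \<Omega> lets the identity be tested with functions
  that do not vanish near the boundary. In this form, membership in H^1_0 says that the extension by
  zero is weakly differentiable on the whole space.\<close>

lemma weak_identity_UNIV:
  fixes v :: "real ^ 'n \<Rightarrow> real"
  assumes m: "v \<in> borel_measurable borel" "g \<in> borel_measurable borel" and fin: "sqn v < \<infinity>" "sqn g < \<infinity>"
    and app: "\<And>e. e > 0 \<Longrightarrow> \<exists>\<phi>\<in>test_functions \<Omega>. sqn (\<lambda>x. v x - \<phi> x) \<le> ennreal e \<and> sqn (\<lambda>x. g x - partial_deriv i \<phi> x) \<le> ennreal e"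
    and \<psi>: "\<psi> \<in> test_functions UNIV"
  shows "(LINT x|lborel. v x * partial_deriv i \<psi> x) = - (LINT x|lborel. g x * \<psi> x)"
proof -
  note d\<psi> = test_functions_partial_deriv[OF \<psi>, of i]
  define C where "C = (1 + (LINT x|lborel. (partial_deriv i \<psi> x)\<^sup>2)) + (1 + (LINT x|lborel. (\<psi> x)\<^sup>2))"
  have C: "C > 0" unfolding C_def by (intro add_pos_pos add_pos_nonneg integral_nonneg_AE) auto
  note b\<psi> = smooth_borel[OF test_functions_smooth[OF \<psi>]] smooth_borel[OF test_functions_smooth[OF d\<psi>]]
  note s\<psi> = sqn_test_function_finite[OF \<psi>] sqn_test_function_finite[OF d\<psi>]
  let ?X = "(LINT x|lborel. v x * partial_deriv i \<psi> x) + (LINT x|lborel. g x * \<psi> x)"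
  have "\<bar>?X\<bar> \<le> 0 + e" if e: "e > 0" for e
  proof -
    define d where "d = e / C"
    have d: "d > 0" using e C by (simp add: d_def)
    then have "\<exists>\<phi>\<in>test_functions \<Omega>. sqn (\<lambda>x. v x - \<phi> x) \<le> ennreal (d\<^sup>2) \<and> sqn (\<lambda>x. g x - partial_deriv i \<phi> x) \<le> ennreal (d\<^sup>2)" by (intro app) simp
    then obtain \<phi> where \<phi>: "\<phi> \<in> test_functions \<Omega>" "sqn (\<lambda>x. v x - \<phi> x) \<le> ennreal (d\<^sup>2)" "sqn (\<lambda>x. g x - partial_deriv i \<phi> x) \<le> ennreal (d\<^sup>2)" by (elim bexE conjE)
    note d\<phi> = test_functions_partial_deriv[OF \<phi>(1), of i]
    note b\<phi> = smooth_borel[OF test_functions_smooth[OF \<phi>(1)]] smooth_borel[OF test_functions_smooth[OF d\<phi>]]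
    note s\<phi> = sqn_test_function_finite[OF \<phi>(1)] sqn_test_function_finite[OF d\<phi>]
    have 1: "(LINT x|lborel. (v x - \<phi> x) * partial_deriv i \<psi> x) = (LINT x|lborel. v x * partial_deriv i \<psi> x) - (LINT x|lborel. \<phi> x * partial_deriv i \<psi> x)"
      unfolding left_diff_distrib
      by (intro Bochner_Integration.integral_diff integrable_mult_square_integrable m b\<psi> b\<phi> fin s\<psi> s\<phi>)
    have 2: "(LINT x|lborel. (g x - partial_deriv i \<phi> x) * \<psi> x) = (LINT x|lborel. g x * \<psi> x) - (LINT x|lborel. partial_deriv i \<phi> x * \<psi> x)"
      unfolding left_diff_distrib
      by (intro Bochner_Integration.integral_diff integrable_mult_square_integrable m b\<psi> b\<phi> fin s\<psi> s\<phi>)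
    have "?X = (LINT x|lborel. (v x - \<phi> x) * partial_deriv i \<psi> x) + (LINT x|lborel. (g x - partial_deriv i \<phi> x) * \<psi> x)"
      unfolding 1 2 using integral_by_parts[OF \<phi>(1) test_functions_smooth[OF \<psi>], of i] by linarith
    also have "\<bar>\<dots>\<bar> \<le> d * (1 + (LINT x|lborel. (partial_deriv i \<psi> x)\<^sup>2)) + d * (1 + (LINT x|lborel. (\<psi> x)\<^sup>2))"
      by (rule order_trans[OF abs_triangle_ineq], intro add_mono integral_product_bound borel_measurable_diff m b\<phi> b\<psi> s\<psi> \<phi>(2,3) d)
    also have "\<dots> = d * C" by (simp add: C_def algebra_simps)
    also have "\<dots> = e" using C by (simp add: d_def)
    finally show ?thesis by simp
  qed
  then have "\<bar>?X\<bar> \<le> 0" by (rule field_le_epsilon)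
  then show ?thesis by linarith
qed

context mesh
begin

text \<open>There is a continuous representative on each of the finitely many compact simplices, and
  outside \<Omega> the function is zero.\<close>

lemma h2_bounded_AE:
  fixes v :: "real ^ 'n \<Rightarrow> real"
  assumes h: "h2_data \<Omega> v v1 v2" and d: "CARD('n) \<le> 3" and z: "\<And>x. x \<notin> \<Omega> \<Longrightarrow> v x = 0"
  shows "\<exists>M. AE x in lborel. \<bar>v x\<bar> \<le> M"
proof -
  have "\<exists>B. AE x in lborel. x \<in> K \<longrightarrow> \<bar>v x\<bar> \<le> B" if K: "K \<in> \<T>" for K
  proof -
    note s = simplex_verts[OF simplices[OF K]]
    from h2_local_rep[OF h d s(5-7) interior_simplex_subset[OF K]]
    obtain u where u: "continuous_on K u" and ae: "AE x in lborel. x \<in> K \<longrightarrow> u x = v x" by (elim exE conjE)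
    have "bounded (u ` K)" by (rule compact_imp_bounded[OF compact_continuous_image[OF u s(5)]])
    then obtain B where B: "\<forall>y\<in>u ` K. norm y \<le> B" unfolding bounded_iff ..
    from ae have "AE x in lborel. x \<in> K \<longrightarrow> \<bar>v x\<bar> \<le> B"
    proof eventually_elim
      case (elim x)
      then show ?case using B by auto
    qed
    then show ?thesis ..
  qed
  then have "\<forall>K\<in>\<T>. \<exists>B. AE x in lborel. x \<in> K \<longrightarrow> \<bar>v x\<bar> \<le> B" by (rule ballI)
  then obtain B where B: "\<forall>K\<in>\<T>. AE x in lborel. x \<in> K \<longrightarrow> \<bar>v x\<bar> \<le> B K" unfolding bchoice_iff ..
  have "AE x in lborel. \<forall>K\<in>\<T>. x \<in> K \<longrightarrow> \<bar>v x\<bar> \<le> B K" using B by (intro AE_finite_allI finite_mesh) simp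
  then have "AE x in lborel. \<bar>v x\<bar> \<le> (\<Sum>K\<in>\<T>. \<bar>B K\<bar>)"
  proof eventually_elim
    case (elim x)
    show ?case
    proof (cases "x \<in> \<Omega>")
      case True
      then obtain K where K: "K \<in> \<T>" "x \<in> K" using cover closure_subset by blast
      then have "\<bar>v x\<bar> \<le> \<bar>B K\<bar>" using elim by fastforce
      also have "\<dots> \<le> (\<Sum>K\<in>\<T>. \<bar>B K\<bar>)" by (rule member_le_sum[OF K(1)]) (auto simp: finite_mesh)
      finally show ?thesis .
    qed (simp add: z sum_nonneg)
  qed
  then show ?thesis ..
qed

text \<open>The continuous function \<open>U\<close> on the whole space links both sides of the
  boundary: it is zero outside the closure of \<Omega> and equals \<open>u\<close> in the interior
  of \<open>K\<close>. Both facts pass to the boundary point \<open>y\<close> by continuity.\<close>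

lemma boundary_values_zero:
  fixes v :: "real ^ 'n \<Rightarrow> real"
  assumes h: "h2_data \<Omega> v v1 v2" and h1: "\<And>i. h2_data \<Omega> (v1 i) (w1 i) (w2 i)" and d: "CARD('n) \<le> 3"
    and z: "\<And>x. x \<notin> \<Omega> \<Longrightarrow> v x = 0" "\<And>i x. x \<notin> \<Omega> \<Longrightarrow> v1 i x = 0"
    and app: "\<And>e. e > 0 \<Longrightarrow> \<exists>\<phi>\<in>test_functions \<Omega>. sqn (\<lambda>x. v x - \<phi> x) \<le> ennreal e \<and> (\<forall>i. sqn (\<lambda>x. v1 i x - partial_deriv i \<phi> x) \<le> ennreal e)"
    and K: "K \<in> \<T>" and u: "continuous_on K u" "AE x in lborel. x \<in> K \<longrightarrow> u x = v x" and y: "y \<in> K" "y \<notin> \<Omega>"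
  shows "u y = 0"
proof -
  have m: "v \<in> borel_measurable borel" "\<And>i. v1 i \<in> borel_measurable borel" and fin: "sqn v < \<infinity>" "\<And>i. sqn (v1 i) < \<infinity>"
    using h by (auto simp: h2_data_def)
  have "\<forall>i. \<exists>M. AE x in lborel. \<bar>v1 i x\<bar> \<le> M" using h2_bounded_AE[OF h1 d z(2)] by (rule allI)
  then obtain M where M: "\<forall>i. AE x in lborel. \<bar>v1 i x\<bar> \<le> M i" unfolding choice_iff ..
  have M': "AE x in lborel. \<bar>v1 i x\<bar> \<le> (\<Sum>i\<in>UNIV. \<bar>M i\<bar>)" for i
    using spec[OF M, of i]
  proof eventually_elim
    case (elim x)
    have "\<bar>M i\<bar> \<le> (\<Sum>i\<in>UNIV. \<bar>M i\<bar>)" by (rule member_le_sum) auto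
    then show ?case using elim by linarith
  qed
  have cc: "compact (closure \<Omega>)" using bounded_dom by (simp add: compact_closure)
  have "(\<lambda>x. indicator (closure \<Omega>) x * v x) = v"
    using z(1) closure_subset[of \<Omega>] by (auto simp: indicator_def fun_eq_iff)
  then have iv: "integrable lborel v" using integrable_restrict_compact[OF m(1) fin(1) cc] by simp
  have w: "(LINT x|lborel. v x * partial_deriv i \<psi> x) = - (LINT x|lborel. v1 i x * \<psi> x)" if "\<psi> \<in> test_functions UNIV" for \<psi> i
  proof (rule weak_identity_UNIV[OF m fin _ that])
    fix e :: real assume "e > 0"
    from app[OF this] show "\<exists>\<phi>\<in>test_functions \<Omega>. sqn (\<lambda>x. v x - \<phi> x) \<le> ennreal e \<and> sqn (\<lambda>x. v1 i x - partial_deriv i \<phi> x) \<le> ennreal e"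
      by (elim bexE conjE) (intro bexI conjI, simp_all)
  qed
  have "\<exists>U. continuous_on UNIV U \<and> (AE x in lborel. U x = v x)"
    by (rule lipschitz_representative[OF m(1) fin(1) iv m(2) M' w])
  then obtain U where U: "continuous_on UNIV U" and UV: "AE x in lborel. U x = v x" by (elim exE conjE)
  have U0: "U x = 0" if "x \<in> - closure \<Omega>" for x
  proof (rule AE_eq_continuous_on_open[OF _ _ _ _ that])
    show "AE x in lborel. x \<in> - closure \<Omega> \<longrightarrow> U x = 0"
      using UV
    proof eventually_elim
      case (elim x)
      then show ?case using z(1)[of x] closure_subset[of \<Omega>] by auto
    qed
  qed (use continuous_on_subset[OF U] in auto)
  have Uy: "U y = 0"
  proof (rule continuous_eq_closure[OF U continuous_on_const subset_UNIV _ UNIV_I U0])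
    \<comment> \<open>As \<Omega> is the interior of its closure, every point outside \<Omega> is a
      limit of points outside the closure. A slit would violate this.\<close>
    show "y \<in> closure (- closure \<Omega>)" using y(2) regular_dom by (simp add: closure_complement)
  qed
  note s = simplex_verts[OF simplices[OF K]]
  have "u y = U y"
  proof (rule continuous_eq_closure[OF u(1) continuous_on_subset[OF U subset_UNIV] interior_subset _ y(1)])
    show "y \<in> closure (interior K)" using convex_closure_interior[OF s(6,7)] y(1) closure_subset[of K] by auto
    fix x assume x: "x \<in> interior K"
    show "u x = U x"
    proof (rule AE_eq_continuous_on_open[OF open_interior continuous_on_subset[OF u(1) interior_subset] continuous_on_subset[OF U subset_UNIV] _ x])
      show "AE x in lborel. x \<in> interior K \<longrightarrow> u x = U x"
        using u(2) UV
      proof eventually_elim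
        case (elim x)
        then show ?case using interior_subset[of K] by auto
      qed
    qed
  qed
  then show ?thesis using Uy by simp
qed

end

section \<open>Sobolev spaces and energies\<close>

text \<open>The derivative is an argument instead of the choice made by \<open>weak_deriv\<close>,
  so that differences can be formed on representatives and all estimates can be carried out with
  \<open>sqn\<close>.\<close>

definition weak_pair :: "(real ^ 'n) set \<Rightarrow> 'n::finite multiset \<Rightarrow> (real ^ 'n \<Rightarrow> real) \<Rightarrow> (real ^ 'n \<Rightarrow> real) \<Rightarrow> bool" where
  "weak_pair \<Omega> \<alpha> V W \<longleftrightarrow>
     V \<in> borel_measurable borel \<and> (\<forall>x. x \<notin> \<Omega> \<longrightarrow> V x = 0) \<and> sqn V < \<infinity> \<and>
     W \<in> borel_measurable borel \<and> (\<forall>x. x \<notin> \<Omega> \<longrightarrow> W x = 0) \<and> sqn W < \<infinity> \<and>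
     (\<forall>\<phi>\<in>test_functions \<Omega>. \<forall>is. mset is = \<alpha> \<longrightarrow>
        (LINT x|lborel. V x * foldr partial_deriv is \<phi> x) = (-1) ^ size \<alpha> * (LINT x|lborel. W x * \<phi> x))"

lemma zero_rep_add:
  assumes "zero_rep \<Omega> f g" "zero_rep \<Omega> f' g'"
  shows "zero_rep \<Omega> (\<lambda>x. f x + f' x) (\<lambda>x. g x + g' x)"
  using assms unfolding zero_rep_def by (auto intro: borel_measurable_add elim: AE_mp)

lemma zero_rep_self:
  "V \<in> borel_measurable borel \<Longrightarrow> (\<And>x. x \<notin> \<Omega> \<Longrightarrow> V x = 0) \<Longrightarrow> zero_rep \<Omega> V V"
  by (simp add: zero_rep_def)

text \<open>The norm identity holds even without finiteness: if the square is not integrable, its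
  Bochner integral is zero by convention, and \<open>enn2real\<close> sends infinity to
  zero.\<close>

lemma L2_zero_rep:
  assumes "zero_rep \<Omega> f g" "open \<Omega>"
  shows "f \<in> L2 \<Omega> \<longleftrightarrow> sqn g < \<infinity>" and "(L2_norm_on \<Omega> f)\<^sup>2 = enn2real (sqn g)"
proof -
  have b: "\<Omega> \<in> sets borel" using assms(2) by simp
  have m: "g \<in> borel_measurable borel" using assms(1) by (simp add: zero_rep_def)
  note I = zero_rep_integral[OF zero_rep_square[OF assms(1)] b]
  show "f \<in> L2 \<Omega> \<longleftrightarrow> sqn g < \<infinity>"
    unfolding L2_def sqn_finite_iff[OF m] using zero_rep_measurable(2)[OF assms(1) b] I(1) by simp
  have "0 \<le> (LINT x|lebesgue_on \<Omega>. (f x)\<^sup>2)" by (intro integral_nonneg_AE) simp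
  then have "(L2_norm_on \<Omega> f)\<^sup>2 = (LINT x|lborel. (g x)\<^sup>2)" unfolding L2_norm_on_def by (simp add: I(2))
  also have "\<dots> = enn2real (sqn g)" unfolding sqn_def using m by (intro integral_eq_nn_integral) auto
  finally show "(L2_norm_on \<Omega> f)\<^sup>2 = enn2real (sqn g)" .
qed

lemma L2_norm_vector_zero_rep:
  fixes f :: "real ^ 'n \<Rightarrow> real ^ 'n"
  assumes z: "\<And>i. zero_rep \<Omega> (\<lambda>x. f x $ i) (g i)" and fin: "\<And>i. sqn (g i) < \<infinity>" and \<Omega>: "open \<Omega>"
  shows "(L2_norm_on \<Omega> f)\<^sup>2 = (\<Sum>i\<in>UNIV. enn2real (sqn (g i)))"
proof -
  have b: "\<Omega> \<in> sets borel" using \<Omega> by simp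
  have m: "g i \<in> borel_measurable borel" for i using z[of i] by (simp add: zero_rep_def)
  have n: "(norm y)\<^sup>2 = (\<Sum>i\<in>UNIV. (y $ i)\<^sup>2)" for y :: "real ^ 'n" by (simp add: norm_vec_def L2_set_def sum_nonneg)
  have i: "integrable lborel (\<lambda>x. (g i x)\<^sup>2)" for i using fin[of i] sqn_finite_iff[OF m] by simp
  have "0 \<le> (LINT x|lebesgue_on \<Omega>. (norm (f x))\<^sup>2)" by (intro integral_nonneg_AE) simp
  then have "(L2_norm_on \<Omega> f)\<^sup>2 = (LINT x|lebesgue_on \<Omega>. (\<Sum>i\<in>UNIV. (f x $ i)\<^sup>2))" unfolding L2_norm_on_def n by simp
  also have "\<dots> = (LINT x|lborel. (\<Sum>i\<in>UNIV. (g i x)\<^sup>2))"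
    by (rule zero_rep_integral(2)[OF zero_rep_sum b]) (rule zero_rep_square[OF z], simp)
  also have "\<dots> = (\<Sum>i\<in>UNIV. (LINT x|lborel. (g i x)\<^sup>2))" by (rule Bochner_Integration.integral_sum) (rule i)
  also have "\<dots> = (\<Sum>i\<in>UNIV. enn2real (sqn (g i)))"
    unfolding sqn_def using m by (intro sum.cong refl integral_eq_nn_integral) auto
  finally show ?thesis .
qed

lemma locally_integrable_zero_rep:
  fixes v :: "real ^ 'n \<Rightarrow> real"
  assumes z: "zero_rep \<Omega> v V" and fin: "sqn V < \<infinity>"
  shows "locally_integrable \<Omega> v"
  unfolding locally_integrable_def
proof (intro allI impI)
  fix K assume K: "compact K \<and> K \<subseteq> \<Omega>"
  have b: "K \<in> sets borel" using K by (simp add: borel_compact)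
  have m: "V \<in> borel_measurable borel" and ae: "AE x in lborel. x \<in> \<Omega> \<longrightarrow> v x = V x" using z by (auto simp: zero_rep_def)
  have "zero_rep K v (\<lambda>x. indicator K x * V x)"
    unfolding zero_rep_def
  proof (intro conjI)
    show "(\<lambda>x. indicator K x * V x) \<in> borel_measurable borel" using b m by measurable
    show "AE x in lborel. x \<in> K \<longrightarrow> v x = indicator K x * V x"
      using ae by eventually_elim (use K in auto)
  qed simp
  from zero_rep_integral(1)[OF this b] show "integrable (lebesgue_on K) v"
    using integrable_restrict_compact[OF m fin] K by simp
qed

lemma weak_pair_identity:
  "weak_pair \<Omega> (mset is) V W \<Longrightarrow> \<phi> \<in> test_functions \<Omega> \<Longrightarrow>
    (LINT x|lborel. V x * foldr partial_deriv is \<phi> x) = (-1) ^ length is * (LINT x|lborel. W x * \<phi> x)"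
  by (simp add: weak_pair_def)

lemma weak_pair_has_weak_deriv:
  assumes \<Omega>: "open \<Omega>" and p: "weak_pair \<Omega> \<alpha> V W" and z: "zero_rep \<Omega> v V"
  shows "has_weak_deriv \<Omega> \<alpha> v W" "zero_rep \<Omega> (weak_deriv \<Omega> \<alpha> v) W"
proof -
  have zW: "zero_rep \<Omega> W W" using p by (intro zero_rep_self) (auto simp: weak_pair_def)
  have b: "\<Omega> \<in> sets borel" using \<Omega> by simp
  show h: "has_weak_deriv \<Omega> \<alpha> v W"
    unfolding has_weak_deriv_def
  proof (intro conjI ballI allI impI)
    show "locally_integrable \<Omega> v" "locally_integrable \<Omega> W"
      using locally_integrable_zero_rep[OF z] locally_integrable_zero_rep[OF zW] p by (auto simp: weak_pair_def)
    fix \<phi> "is" assume \<phi>: "\<phi> \<in> test_functions \<Omega>" "mset is = \<alpha>"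
    note bm = smooth_borel[OF test_functions_smooth[OF \<phi>(1)]] smooth_borel[OF test_functions_smooth[OF test_functions_foldr[OF \<phi>(1)]]]
    show "(LINT x|lebesgue_on \<Omega>. v x * foldr partial_deriv is \<phi> x) = (-1) ^ size \<alpha> * (LINT x|lebesgue_on \<Omega>. W x * \<phi> x)"
      unfolding zero_rep_integral(2)[OF zero_rep_mult[OF z bm(2)] b] zero_rep_integral(2)[OF zero_rep_mult[OF zW bm(1)] b]
      using p \<phi> by (simp add: weak_pair_def)
  qed
  have "AE x in lborel. x \<in> \<Omega> \<longrightarrow> weak_deriv \<Omega> \<alpha> v x = W x"
    using weak_deriv_AE_eq(2)[OF \<Omega> h] unfolding AE_lebesgue_on[OF b] .
  then show "zero_rep \<Omega> (weak_deriv \<Omega> \<alpha> v) W" using p by (simp add: zero_rep_def weak_pair_def)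
qed

lemma weak_pair_diff:
  assumes p: "weak_pair \<Omega> \<alpha> V W" "weak_pair \<Omega> \<alpha> V' W'"
  shows "weak_pair \<Omega> \<alpha> (\<lambda>x. V x - V' x) (\<lambda>x. W x - W' x)"
  unfolding weak_pair_def
proof (intro conjI ballI allI impI)
  have m: "V \<in> borel_measurable borel" "V' \<in> borel_measurable borel" "W \<in> borel_measurable borel" "W' \<in> borel_measurable borel"
    and s: "sqn V < \<infinity>" "sqn V' < \<infinity>" "sqn W < \<infinity>" "sqn W' < \<infinity>" using p by (auto simp: weak_pair_def)
  show "(\<lambda>x. V x - V' x) \<in> borel_measurable borel" "(\<lambda>x. W x - W' x) \<in> borel_measurable borel"
    using m by (auto intro: borel_measurable_diff)
  show "sqn (\<lambda>x. V x - V' x) < \<infinity>" "sqn (\<lambda>x. W x - W' x) < \<infinity>"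
    using s by (auto intro!: order_le_less_trans[OF sqn_diff] m simp: ennreal_mult_less_top)
  fix \<phi> "is" assume \<phi>: "\<phi> \<in> test_functions \<Omega>" "mset is = \<alpha>"
  note d\<phi> = test_functions_foldr[OF \<phi>(1), of "is"]
  note bm = smooth_borel[OF test_functions_smooth[OF \<phi>(1)]] smooth_borel[OF test_functions_smooth[OF d\<phi>]]
  note sm = sqn_test_function_finite[OF \<phi>(1)] sqn_test_function_finite[OF d\<phi>]
  have "(LINT x|lborel. (V x - V' x) * foldr partial_deriv is \<phi> x) = (LINT x|lborel. V x * foldr partial_deriv is \<phi> x) - (LINT x|lborel. V' x * foldr partial_deriv is \<phi> x)"
    unfolding left_diff_distrib by (intro Bochner_Integration.integral_diff integrable_mult_square_integrable m s bm sm)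
  moreover have "(LINT x|lborel. (W x - W' x) * \<phi> x) = (LINT x|lborel. W x * \<phi> x) - (LINT x|lborel. W' x * \<phi> x)"
    unfolding left_diff_distrib by (intro Bochner_Integration.integral_diff integrable_mult_square_integrable m s bm sm)
  ultimately show "(LINT x|lborel. (V x - V' x) * foldr partial_deriv is \<phi> x) = (-1) ^ size \<alpha> * (LINT x|lborel. (W x - W' x) * \<phi> x)"
    using p \<phi> by (simp add: weak_pair_def right_diff_distrib)
qed (use p in \<open>auto simp: weak_pair_def\<close>)

lemma weak_pair_exists:
  assumes \<Omega>: "open \<Omega>" and h: "has_weak_deriv \<Omega> \<alpha> v w" "w \<in> L2 \<Omega>" and z: "zero_rep \<Omega> v V" "v \<in> L2 \<Omega>"
  shows "\<exists>W. weak_pair \<Omega> \<alpha> V W"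
proof -
  have b: "\<Omega> \<in> sets borel" using \<Omega> by simp
  have "w \<in> borel_measurable (lebesgue_on \<Omega>)" using h(2) by (simp add: L2_def)
  then obtain W where W: "zero_rep \<Omega> w W" using zero_rep_exists b by metis
  have "weak_pair \<Omega> \<alpha> V W"
    unfolding weak_pair_def
  proof (intro conjI ballI allI impI)
    show "sqn V < \<infinity>" "sqn W < \<infinity>" using L2_zero_rep(1)[OF W \<Omega>] L2_zero_rep(1)[OF z(1) \<Omega>] h(2) z(2) by auto
    fix \<phi> "is" assume \<phi>: "\<phi> \<in> test_functions \<Omega>" "mset is = \<alpha>"
    note bm = smooth_borel[OF test_functions_smooth[OF \<phi>(1)]] smooth_borel[OF test_functions_smooth[OF test_functions_foldr[OF \<phi>(1)]]]
    show "(LINT x|lborel. V x * foldr partial_deriv is \<phi> x) = (-1) ^ size \<alpha> * (LINT x|lborel. W x * \<phi> x)"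
      using has_weak_derivD[OF h(1) \<phi>]
      unfolding zero_rep_integral(2)[OF zero_rep_mult[OF z(1) bm(2)] b] zero_rep_integral(2)[OF zero_rep_mult[OF W bm(1)] b] .
  qed (use z W in \<open>auto simp: zero_rep_def\<close>)
  then show "\<exists>W. weak_pair \<Omega> \<alpha> V W" by (intro exI[of "weak_pair \<Omega> \<alpha> V" W])
qed

lemma weak_pair_singletonI:
  fixes V :: "real ^ 'n \<Rightarrow> real"
  assumes "V \<in> borel_measurable borel" "\<And>x. x \<notin> \<Omega> \<Longrightarrow> V x = 0" "sqn V < \<infinity>"
    "W \<in> borel_measurable borel" "\<And>x. x \<notin> \<Omega> \<Longrightarrow> W x = 0" "sqn W < \<infinity>"
    and id: "\<And>\<phi>. \<phi> \<in> test_functions \<Omega> \<Longrightarrow> (LINT x|lborel. V x * partial_deriv i \<phi> x) = - (LINT x|lborel. W x * \<phi> x)"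
  shows "weak_pair \<Omega> {#i#} V W" "weak_pair \<Omega> {#} V V"
  using assms unfolding weak_pair_def by (auto simp: mset_single_iff)

lemma weak_pair_test_function:
  assumes \<phi>: "\<phi> \<in> test_functions \<Omega>"
  shows "weak_pair \<Omega> {#i#} \<phi> (partial_deriv i \<phi>)" "weak_pair \<Omega> {#} \<phi> \<phi>"
proof -
  note d\<phi> = test_functions_partial_deriv[OF \<phi>, of i]
  note bm = smooth_borel[OF test_functions_smooth[OF \<phi>]] smooth_borel[OF test_functions_smooth[OF d\<phi>]]
  have "weak_pair \<Omega> {#i#} \<phi> (partial_deriv i \<phi>) \<and> weak_pair \<Omega> {#} \<phi> \<phi>"
    by (intro conjI weak_pair_singletonI[of \<phi> \<Omega> "partial_deriv i \<phi>" i] bm sqn_test_function_finite[OF \<phi>] sqn_test_function_finite[OF d\<phi>]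
        test_functions_zero[OF \<phi>] test_functions_zero[OF d\<phi>] integral_by_parts[OF \<phi> test_functions_smooth])
  then show "weak_pair \<Omega> {#i#} \<phi> (partial_deriv i \<phi>)" "weak_pair \<Omega> {#} \<phi> \<phi>" by auto
qed

text \<open>Over an infinite index set the sum in \<open>Hk_norm\<close> would be zero by default.
  Finiteness is what lets the norm bound each single derivative.\<close>

lemma finite_multi_indices: "finite {\<alpha> :: 'n::finite multiset. size \<alpha> \<le> k}"
proof -
  have "{\<alpha> :: 'n multiset. size \<alpha> \<le> k} \<subseteq> mset ` {xs. set xs \<subseteq> UNIV \<and> length xs \<le> k}"
  proof
    fix \<alpha> :: "'n multiset" assume \<alpha>: "\<alpha> \<in> {\<alpha>. size \<alpha> \<le> k}"
    obtain xs where "mset xs = \<alpha>" using ex_mset by auto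
    then show "\<alpha> \<in> mset ` {xs. set xs \<subseteq> UNIV \<and> length xs \<le> k}" using \<alpha> by (auto intro!: image_eqI[of _ _ xs] simp: size_mset[symmetric] simp del: size_mset)
  qed
  then show ?thesis by (rule finite_subset) (rule finite_imageI[OF finite_lists_length_le[OF finite]])
qed

lemma Hk_norm_square: "(Hk_norm k \<Omega> v)\<^sup>2 = (\<Sum>\<alpha> | size \<alpha> \<le> k. (L2_norm_on \<Omega> (weak_deriv \<Omega> \<alpha> v))\<^sup>2)"
  unfolding Hk_norm_def by (simp add: sum_nonneg)

lemma Hk_norm_nonneg: "Hk_norm k \<Omega> v \<ge> 0"
  unfolding Hk_norm_def by (simp add: sum_nonneg)

lemma sqn_le_Hk_norm:
  assumes \<Omega>: "open \<Omega>" and p: "weak_pair \<Omega> \<alpha> V W" and z: "zero_rep \<Omega> v V" and \<alpha>: "size \<alpha> \<le> k"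
  shows "sqn W \<le> ennreal ((Hk_norm k \<Omega> v)\<^sup>2)"
proof -
  have fin: "sqn W < top" using p by (simp add: weak_pair_def infinity_ennreal_def)
  have "enn2real (sqn W) = (L2_norm_on \<Omega> (weak_deriv \<Omega> \<alpha> v))\<^sup>2"
    by (rule L2_zero_rep(2)[OF weak_pair_has_weak_deriv(2)[OF \<Omega> p z] \<Omega>, symmetric])
  also have "\<dots> \<le> (Hk_norm k \<Omega> v)\<^sup>2"
    unfolding Hk_norm_square using \<alpha> by (intro member_le_sum finite_multi_indices) auto
  finally have "ennreal (enn2real (sqn W)) \<le> ennreal ((Hk_norm k \<Omega> v)\<^sup>2)" by (rule ennreal_leI)
  then show ?thesis using fin by simp
qed

lemma Hk_weak_pairs:
  assumes \<Omega>: "open \<Omega>" and u: "u \<in> Hk k \<Omega>"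
  shows "\<exists>W. zero_rep \<Omega> u (W {#}) \<and> (\<forall>\<alpha>. size \<alpha> \<le> k \<longrightarrow> weak_pair \<Omega> \<alpha> (W {#}) (W \<alpha>))"
proof -
  have uL: "u \<in> L2 \<Omega>" using u by (simp add: Hk_def)
  then obtain V where V: "zero_rep \<Omega> u V" using zero_rep_exists[of u \<Omega>] \<Omega> by (auto simp: L2_def)
  have "\<exists>W. size \<alpha> \<le> k \<longrightarrow> weak_pair \<Omega> \<alpha> V W" for \<alpha>
  proof (cases "size \<alpha> \<le> k")
    case True
    then obtain w where "w \<in> L2 \<Omega>" "has_weak_deriv \<Omega> \<alpha> u w" using u by (auto simp: Hk_def)
    from weak_pair_exists[OF \<Omega> this(2,1) V uL] show ?thesis by blast
  qed simp
  then obtain W where W: "\<And>\<alpha>. size \<alpha> \<le> k \<Longrightarrow> weak_pair \<Omega> \<alpha> V (W \<alpha>)" by metis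
  \<comment> \<open>The derivative of order zero is replaced by the chosen representative of the
    function itself, so that the whole family refers to \<open>W {#}\<close>.\<close>
  define W' where "W' \<alpha> = (if \<alpha> = {#} then V else W \<alpha>)" for \<alpha>
  have "weak_pair \<Omega> {#} V (W {#})" by (rule W) simp
  then have "weak_pair \<Omega> {#} V V" by (simp add: weak_pair_def)
  then show ?thesis using V W by (intro exI[of _ W']) (auto simp: W'_def)
qed

text \<open>A derivative of a test function is a test function. Testing the pair for
  \<open>is\<close> with the \<open>js\<close>-derivative of \<phi>, and the pair for
  \<open>is @ js\<close> with \<phi> itself, shows that the derivatives of a function have the
  expected further weak derivatives. The signs cancel.\<close>

lemma h2_data_weak_pairs:
  assumes p: "\<And>\<alpha>. size \<alpha> \<le> k \<Longrightarrow> weak_pair \<Omega> \<alpha> (W {#}) (W \<alpha>)" and k: "length is + 2 \<le> k"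
  shows "h2_data \<Omega> (W (mset is)) (\<lambda>i. W (mset (is @ [i]))) (\<lambda>i j. W (mset (is @ [i, j])))"
proof -
  have m: "W \<alpha> \<in> borel_measurable borel" "sqn (W \<alpha>) < top" if "size \<alpha> \<le> k" for \<alpha>
    using p[OF that] by (simp_all add: weak_pair_def)
  have id: "(LINT x|lborel. W (mset is) x * foldr partial_deriv js \<phi> x) = (-1) ^ length js * (LINT x|lborel. W (mset (is @ js)) x * \<phi> x)"
    if \<phi>: "\<phi> \<in> test_functions \<Omega>" and js: "length js \<le> 2" for js \<phi>
  proof -
    have "(LINT x|lborel. W {#} x * foldr partial_deriv is (foldr partial_deriv js \<phi>) x) = (-1) ^ length is * (LINT x|lborel. W (mset is) x * foldr partial_deriv js \<phi> x)"
      by (rule weak_pair_identity[OF p test_functions_foldr[OF \<phi>]]) (use k in simp)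
    moreover have "(LINT x|lborel. W {#} x * foldr partial_deriv (is @ js) \<phi> x) = (-1) ^ length (is @ js) * (LINT x|lborel. W (mset (is @ js)) x * \<phi> x)"
      by (rule weak_pair_identity[OF p \<phi>]) (use k js in simp)
    ultimately have "(-1) ^ length is * (LINT x|lborel. W (mset is) x * foldr partial_deriv js \<phi> x)
        = (-1) ^ length is * ((-1) ^ length js * (LINT x|lborel. W (mset (is @ js)) x * \<phi> x))"
      by (simp add: power_add)
    then show ?thesis by simp
  qed
  show ?thesis
    unfolding h2_data_def
  proof (intro conjI allI ballI)
    fix \<phi> i j assume \<phi>: "\<phi> \<in> test_functions \<Omega>"
    show "(LINT z|lborel. W (mset is) z * partial_deriv i \<phi> z) = - (LINT z|lborel. W (mset (is @ [i])) z * \<phi> z)"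
      using id[OF \<phi>, of "[i]"] by simp
    show "(LINT z|lborel. W (mset is) z * partial_deriv i (partial_deriv j \<phi>) z) = (LINT z|lborel. W (mset (is @ [i, j])) z * \<phi> z)"
      using id[OF \<phi>, of "[i, j]"] by simp
  qed (use k in \<open>auto intro!: m\<close>)
qed

lemma H1_0_approximation:
  assumes \<Omega>: "open \<Omega>" and u: "u \<in> H1_0 \<Omega>" and z: "zero_rep \<Omega> u V" and p: "\<And>i. weak_pair \<Omega> {#i#} V (G i)" and e: "e > 0"
  shows "\<exists>\<phi>\<in>test_functions \<Omega>. sqn (\<lambda>x. V x - \<phi> x) \<le> ennreal e \<and> (\<forall>i. sqn (\<lambda>x. G i x - partial_deriv i \<phi> x) \<le> ennreal e)"
proof -
  have "sqrt e > 0" using e by simp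
  then obtain \<phi> where \<phi>: "\<phi> \<in> test_functions \<Omega>" and n: "Hk_norm 1 \<Omega> (\<lambda>x. u x - \<phi> x) < sqrt e"
    using u unfolding H1_0_def by blast
  have "(Hk_norm 1 \<Omega> (\<lambda>x. u x - \<phi> x))\<^sup>2 \<le> (sqrt e)\<^sup>2" using n Hk_norm_nonneg by (intro power_mono) auto
  then have n2: "ennreal ((Hk_norm 1 \<Omega> (\<lambda>x. u x - \<phi> x))\<^sup>2) \<le> ennreal e" using e by (intro ennreal_leI) simp
  note t = weak_pair_test_function[OF \<phi>]
  have z': "zero_rep \<Omega> (\<lambda>x. u x - \<phi> x) (\<lambda>x. V x - \<phi> x)"
    using t(2) by (intro zero_rep_diff[OF z zero_rep_self]) (auto simp: weak_pair_def)
  have V: "weak_pair \<Omega> {#} V V" using p unfolding weak_pair_def by auto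
  have "sqn (\<lambda>x. V x - \<phi> x) \<le> ennreal e"
    by (rule order_trans[OF sqn_le_Hk_norm[OF \<Omega> weak_pair_diff[OF V t(2)] z', where k = 1] n2]) simp
  moreover have "sqn (\<lambda>x. G i x - partial_deriv i \<phi> x) \<le> ennreal e" for i
    by (rule order_trans[OF sqn_le_Hk_norm[OF \<Omega> weak_pair_diff[OF p t(1)] z', where k = 1] n2]) simp
  ultimately show ?thesis using \<phi> by blast
qed

lemma size_le_1: "size \<alpha> \<le> 1 \<Longrightarrow> \<alpha> = {#} \<or> (\<exists>i. \<alpha> = {#i#})"
  by (metis One_nat_def le_Suc_eq le_zero_eq size_eq_0_iff_empty size_1_singleton_mset)

lemma Hk_1I:
  assumes \<Omega>: "open \<Omega>" and z: "zero_rep \<Omega> u V" and p: "\<And>i. weak_pair \<Omega> {#i#} V (G i)" "weak_pair \<Omega> {#} V V"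
  shows "u \<in> Hk 1 \<Omega>"
proof -
  have L: "W \<in> L2 \<Omega>" if "weak_pair \<Omega> \<alpha> V W" for \<alpha> W
    using that L2_zero_rep(1)[OF zero_rep_self \<Omega>] by (auto simp: weak_pair_def)
  have "u \<in> L2 \<Omega>" using p(2) L2_zero_rep(1)[OF z \<Omega>] by (auto simp: weak_pair_def)
  moreover have "\<exists>w\<in>L2 \<Omega>. has_weak_deriv \<Omega> \<alpha> u w" if "size \<alpha> \<le> 1" for \<alpha>
    using size_le_1[OF that] L[OF p(1)] L[OF p(2)] weak_pair_has_weak_deriv(1)[OF \<Omega> p(1) z] weak_pair_has_weak_deriv(1)[OF \<Omega> p(2) z] by auto
  ultimately show ?thesis by (simp add: Hk_def)
qed

lemma H1_0I:
  assumes \<Omega>: "open \<Omega>" and z: "zero_rep \<Omega> u V" and p: "\<And>i. weak_pair \<Omega> {#i#} V (G i)" "weak_pair \<Omega> {#} V V"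
    and app: "\<And>e. e > 0 \<Longrightarrow> \<exists>\<phi>\<in>test_functions \<Omega>. sqn (\<lambda>x. V x - \<phi> x) \<le> ennreal e \<and> (\<forall>i. sqn (\<lambda>x. G i x - partial_deriv i \<phi> x) \<le> ennreal e)"
  shows "u \<in> H1_0 \<Omega>"
  unfolding H1_0_def
proof (intro CollectI conjI allI impI)
  show "u \<in> Hk 1 \<Omega>" by (rule Hk_1I[OF \<Omega> z p])
  fix e :: real assume e: "e > 0"
  define m where "m = real (card {\<alpha> :: 'a multiset. size \<alpha> \<le> 1})"
  have "{#} \<in> {\<alpha> :: 'a multiset. size \<alpha> \<le> 1}" by simp
  then have m: "m > 0" unfolding m_def using finite_multi_indices[of 1, where 'n = 'a] by (auto simp: card_gt_0_iff intro: exI[of _ "{#}"])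
  \<comment> \<open>There are \<open>m\<close> multi-indices, each contributing at most
    \<open>d\<close>; the factor 2 leaves room for the strict inequality.\<close>
  define d where "d = e\<^sup>2 / (2 * m)"
  have d: "d > 0" using e m by (simp add: d_def)
  obtain \<phi> where \<phi>: "\<phi> \<in> test_functions \<Omega>" "sqn (\<lambda>x. V x - \<phi> x) \<le> ennreal d" "\<forall>i. sqn (\<lambda>x. G i x - partial_deriv i \<phi> x) \<le> ennreal d"
    using app[OF d] by (elim bexE conjE)
  note t = weak_pair_test_function[OF \<phi>(1)]
  have z': "zero_rep \<Omega> (\<lambda>x. u x - \<phi> x) (\<lambda>x. V x - \<phi> x)"
    using t(2) by (intro zero_rep_diff[OF z zero_rep_self]) (auto simp: weak_pair_def)
  have R: "(L2_norm_on \<Omega> (weak_deriv \<Omega> \<alpha> (\<lambda>x. u x - \<phi> x)))\<^sup>2 \<le> d" if "weak_pair \<Omega> \<alpha> (\<lambda>x. V x - \<phi> x) W" "sqn W \<le> ennreal d" for \<alpha> W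
    unfolding L2_zero_rep(2)[OF weak_pair_has_weak_deriv(2)[OF \<Omega> that(1) z'] \<Omega>]
    using enn2real_mono[OF that(2)] d by simp
  have "(L2_norm_on \<Omega> (weak_deriv \<Omega> \<alpha> (\<lambda>x. u x - \<phi> x)))\<^sup>2 \<le> d" if "size \<alpha> \<le> 1" for \<alpha>
    using size_le_1[OF that] R[OF weak_pair_diff[OF p(2) t(2)] \<phi>(2)] R[OF weak_pair_diff[OF p(1) t(1)] spec[OF \<phi>(3)]] by auto
  then have "(Hk_norm 1 \<Omega> (\<lambda>x. u x - \<phi> x))\<^sup>2 \<le> m * d" unfolding Hk_norm_square m_def by (intro sum_bounded_above) simp
  also have "m * d = e\<^sup>2 / 2" using m by (simp add: d_def)
  also have "\<dots> < e\<^sup>2" using e by simp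
  finally have "Hk_norm 1 \<Omega> (\<lambda>x. u x - \<phi> x) < e" using e by (intro power2_less_imp_less[of _ e]) auto
  then show "\<exists>\<phi>\<in>test_functions \<Omega>. Hk_norm 1 \<Omega> (\<lambda>x. u x - \<phi> x) < e" using \<phi>(1) by blast
qed

section \<open>The functional and the norm in terms of representatives\<close>

lemma zero_rep_contract:
  fixes A :: "real ^ 'n \<Rightarrow> real ^ 'n ^ 'n"
  assumes "\<And>i j. zero_rep \<Omega> (\<lambda>x. A x $ i $ j) (a i j)" "\<And>i j. zero_rep \<Omega> (\<lambda>x. B x $ i $ j) (b i j)"
  shows "zero_rep \<Omega> (\<lambda>x. A x \<Zcolon> B x) (\<lambda>x. \<Sum>i\<in>UNIV. \<Sum>j\<in>UNIV. a i j x * b i j x)"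
  unfolding contract_def by (intro zero_rep_sum zero_rep_mult2 assms finite)

lemma energy_reps:
  fixes \<tau> :: "real ^ 'n \<Rightarrow> real ^ 'n"
  assumes \<Omega>: "open \<Omega>" and a: "\<And>i j. zero_rep \<Omega> (\<lambda>x. A x $ i $ j) (a i j)" 
    and v: "zero_rep \<Omega> v V" "\<And>i. weak_pair \<Omega> {#i#} V (G i)"
    and t: "\<And>i. zero_rep \<Omega> (\<lambda>x. \<tau> x $ i) (S i)" "\<And>i j. weak_pair \<Omega> {#j#} (S i) (S' i j)"
  shows "zero_rep \<Omega> f F \<Longrightarrow> J0 \<Omega> A f v \<tau> = enn2real (sqn (\<lambda>x. F x + (\<Sum>i\<in>UNIV. \<Sum>j\<in>UNIV. a i j x * S' i j x))) + (\<Sum>i\<in>UNIV. enn2real (sqn (\<lambda>x. S i x - G i x)))"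
    and "(triple_norm0 \<Omega> A v \<tau>)\<^sup>2 = enn2real (sqn (\<lambda>x. \<Sum>i\<in>UNIV. \<Sum>j\<in>UNIV. a i j x * S' i j x)) + (\<Sum>i\<in>UNIV. enn2real (sqn (\<lambda>x. S i x - G i x)))"
proof -
  have "zero_rep \<Omega> (\<lambda>x. weak_jacobian \<Omega> \<tau> x $ i $ j) (S' i j)" for i j
    unfolding weak_jacobian_def using weak_pair_has_weak_deriv(2)[OF \<Omega> t(2) t(1)] by simp
  note C = zero_rep_contract[OF a this]
  have m: "S i \<in> borel_measurable borel" "sqn (S i) < \<infinity>" "G i \<in> borel_measurable borel" "sqn (G i) < \<infinity>" for i
    using t(2)[of undefined i] v(2)[of i] by (auto simp: weak_pair_def)
  have g: "zero_rep \<Omega> (\<lambda>x. (\<tau> x - weak_grad \<Omega> v x) $ i) (\<lambda>x. S i x - G i x)" for i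
    unfolding weak_grad_def using zero_rep_diff[OF t(1) weak_pair_has_weak_deriv(2)[OF \<Omega> v(2) v(1)]] by simp
  have fin: "sqn (\<lambda>x. S i x - G i x) < \<infinity>" for i
    using m by (auto intro!: order_le_less_trans[OF sqn_diff] simp: ennreal_mult_less_top)
  note L = L2_norm_vector_zero_rep[OF g fin \<Omega>]
  show "J0 \<Omega> A f v \<tau> = enn2real (sqn (\<lambda>x. F x + (\<Sum>i\<in>UNIV. \<Sum>j\<in>UNIV. a i j x * S' i j x))) + (\<Sum>i\<in>UNIV. enn2real (sqn (\<lambda>x. S i x - G i x)))"
    if "zero_rep \<Omega> f F" unfolding J0_def L L2_zero_rep(2)[OF zero_rep_add[OF that C] \<Omega>] ..
  show "(triple_norm0 \<Omega> A v \<tau>)\<^sup>2 = enn2real (sqn (\<lambda>x. \<Sum>i\<in>UNIV. \<Sum>j\<in>UNIV. a i j x * S' i j x)) + (\<Sum>i\<in>UNIV. enn2real (sqn (\<lambda>x. S i x - G i x)))"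
    unfolding triple_norm0_def L L2_zero_rep(2)[OF C \<Omega>] by (simp add: sum_nonneg)
qed

lemma sqn_sum_bound:
  fixes g :: "'i \<Rightarrow> 'a::euclidean_space \<Rightarrow> real"
  assumes m: "\<And>i. g i \<in> borel_measurable borel" and g: "\<And>i. sqn (g i) \<le> ennreal C" and C: "C \<ge> 0"
  shows "sqn (\<lambda>x. \<Sum>i\<in>I. g i x) \<le> ennreal ((real (card I))\<^sup>2 * C)"
proof -
  have "sqn (\<lambda>x. \<Sum>i\<in>I. g i x) \<le> (\<integral>\<^sup>+x. ennreal (real (card I)) * (\<Sum>i\<in>I. ennreal ((g i x)\<^sup>2)) \<partial>lborel)"
    unfolding sqn_def
  proof (rule nn_integral_mono)
    fix x
    have "ennreal ((\<Sum>i\<in>I. g i x)\<^sup>2) \<le> ennreal (real (card I) * (\<Sum>i\<in>I. (g i x)\<^sup>2))" by (intro ennreal_leI CS_real)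
    also have "\<dots> = ennreal (real (card I)) * (\<Sum>i\<in>I. ennreal ((g i x)\<^sup>2))" by (subst sum_ennreal) (simp_all add: ennreal_mult sum_nonneg)
    finally show "ennreal ((\<Sum>i\<in>I. g i x)\<^sup>2) \<le> ennreal (real (card I)) * (\<Sum>i\<in>I. ennreal ((g i x)\<^sup>2))" .
  qed
  also have "\<dots> = ennreal (real (card I)) * (\<Sum>i\<in>I. sqn (g i))"
    unfolding sqn_def using m by (subst nn_integral_cmult) (auto simp: nn_integral_sum simp del: sum_ennreal)
  also have "\<dots> \<le> ennreal (real (card I)) * (\<Sum>i\<in>I. ennreal C)" by (intro mult_left_mono sum_mono g) simp
  also have "(\<Sum>i\<in>I. ennreal C) = ennreal (real (card I) * C)" using C by (subst sum_ennreal) auto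
  also have "ennreal (real (card I)) * ennreal (real (card I) * C) = ennreal ((real (card I))\<^sup>2 * C)"
    using C by (subst ennreal_mult[symmetric]) (auto simp: power2_eq_square mult.assoc)
  finally show ?thesis .
qed

lemma sqn_bounded_coefficient:
  assumes "AE x in lborel. \<bar>a x\<bar> \<le> \<beta>" "g \<in> borel_measurable borel" "sqn g \<le> ennreal C" "C \<ge> 0"
  shows "sqn (\<lambda>x. a x * g x) \<le> ennreal (\<beta>\<^sup>2 * C)"
proof -
  have "AE x in lborel. \<bar>a x * g x\<bar> \<le> \<bar>\<beta> * g x\<bar>"
    using assms(1) by eventually_elim (auto simp: abs_mult intro!: mult_right_mono)
  then have "sqn (\<lambda>x. a x * g x) \<le> sqn (\<lambda>x. \<beta> * g x)" by (rule sqn_mono_AE)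
  also have "\<dots> = ennreal (\<beta>\<^sup>2) * sqn g" by (rule sqn_cmult[OF assms(2)])
  also have "\<dots> \<le> ennreal (\<beta>\<^sup>2) * ennreal C" by (intro mult_left_mono assms(3)) simp
  also have "\<dots> = ennreal (\<beta>\<^sup>2 * C)" using assms(4) by (simp add: ennreal_mult)
  finally show ?thesis .
qed

lemma sqn_triangle_bound:
  assumes "f \<in> borel_measurable borel" "g \<in> borel_measurable borel" "h \<in> borel_measurable borel"
    and "sqn (\<lambda>x. g x - f x) \<le> ennreal X" "sqn (\<lambda>x. g x - h x) \<le> ennreal Y" "X \<ge> 0" "Y \<ge> 0"
  shows "sqn (\<lambda>x. f x - h x) \<le> ennreal (2 * X + 2 * Y)"
proof -
  have "sqn (\<lambda>x. f x - h x) \<le> 2 * sqn (\<lambda>x. f x - g x) + 2 * sqn (\<lambda>x. g x - h x)" by (rule sqn_triangle_via[OF assms(1-3)])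
  also have "\<dots> \<le> 2 * ennreal X + 2 * ennreal Y"
    using assms(4,5) by (intro add_mono mult_left_mono) (auto simp: sqn_minus_commute[of f])
  also have "\<dots> = ennreal (2 * X + 2 * Y)" using assms(6,7) by (simp add: ennreal_mult)
  finally show ?thesis .
qed

section \<open>The error of the least-squares solution\<close>

context mesh
begin

lemma pw_weak_pair:
  assumes ag: "pw_agree c b"
  shows "weak_pair \<Omega> {#i#} (pw c b) (pw_grad b i)" "weak_pair \<Omega> {#} (pw c b) (pw c b)" "zero_rep \<Omega> (pw c b) (pw c b)"
proof -
  obtain B where B: "B \<ge> 0" "\<And>x. \<bar>pw c b x\<bar> \<le> B" using pw_bounded[OF ag] by metis
  have "weak_pair \<Omega> {#i#} (pw c b) (pw_grad b i) \<and> weak_pair \<Omega> {#} (pw c b) (pw c b)"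
    by (intro conjI weak_pair_singletonI[of "pw c b" \<Omega> "pw_grad b i" i] pw_borel[OF ag] pw_grad_borel pw_outside pw_grad_outside
        sqn_finite_bounded[OF pw_borel[OF ag] B(2) pw_outside bounded_dom] sqn_finite_bounded[OF pw_grad_borel pw_grad_bound pw_grad_outside bounded_dom]
        pw_weak_derivative[OF ag])
  then show "weak_pair \<Omega> {#i#} (pw c b) (pw_grad b i)" "weak_pair \<Omega> {#} (pw c b) (pw c b)" by auto
  show "zero_rep \<Omega> (pw c b) (pw c b)" by (intro zero_rep_self pw_borel[OF ag] pw_outside)
qed

lemma pw_S1:
  assumes ag: "pw_agree c b"
  shows "pw c b \<in> S1 \<Omega> \<T>"
  unfolding S1_def
proof (intro CollectI conjI ballI)
  show "pw c b \<in> Hk 1 \<Omega>" by (rule Hk_1I[OF open_dom pw_weak_pair(3,1,2)[OF ag]])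
  fix K assume K: "K \<in> \<T>"
  have "AE x in lborel. x \<in> K \<longrightarrow> pw c b x = c K + b K \<bullet> x"
    using AE_interior
  proof eventually_elim
    case (elim x)
    then show ?case using K interior_simplex_subset[OF K] pw_eq[OF ag K, of x] by blast
  qed
  then show "\<exists>c' b'. AE x in lebesgue_on K. pw c b x = c' + b' \<bullet> x"
    unfolding AE_lebesgue_on[OF simplex_borel[OF K]] by (intro exI)
qed

lemma pw_S1_0:
  assumes ag: "pw_agree c b" and bz: "\<And>K x. K \<in> \<T> \<Longrightarrow> x \<in> K \<Longrightarrow> x \<notin> \<Omega> \<Longrightarrow> c K + b K \<bullet> x = 0"
  shows "pw c b \<in> S1_0 \<Omega> \<T>"
  unfolding S1_0_def
  by (intro IntI pw_S1[OF ag] H1_0I[OF open_dom pw_weak_pair(3,1,2)[OF ag]] pw_test_approximation[OF ag bz])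

text \<open>The first summand belongs to the residual: two nested sums of n terms cost n^2 each, and
  \<beta> bounds the coefficients. The second belongs to the n components of the difference between
  the interpolant of grad u and the gradient of the interpolant of u, split at grad u into a value
  error and a gradient error. The last n^2 in \<open>e\<close> counts the second derivatives, each
  bounded by the H^3 norm of u.\<close>

definition error_const :: "real \<Rightarrow> real \<Rightarrow> real" where
  "error_const \<beta> \<gamma> =
    (let n = real CARD('n); e = (n + 1)\<^sup>2 * (8 * n\<^sup>2 * 2 ^ CARD('n)) * n\<^sup>2; e1 = e * (64 * \<gamma>\<^sup>2)
     in n\<^sup>2 * (n\<^sup>2 * (\<beta>\<^sup>2 * e1)) + n * (2 * (e * (diameter (closure \<Omega>))\<^sup>2) + 2 * e1))"

lemma mesh_size_bounds:
  shows "K \<in> \<T> \<Longrightarrow> diameter K \<le> mesh_size \<T>" "mesh_size \<T> \<le> diameter (closure \<Omega>)" "0 \<le> mesh_size \<T>"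
proof -
  have ne: "\<T> \<noteq> {}" using cover dom by (auto simp: open_polytope_def)
  have b: "bounded (closure \<Omega>)" by (rule bounded_closure[OF bounded_dom])
  show le: "diameter K \<le> mesh_size \<T>" if "K \<in> \<T>" for K
    unfolding mesh_size_def using finite_mesh that by (intro Max_ge) auto
  show "mesh_size \<T> \<le> diameter (closure \<Omega>)"
    unfolding mesh_size_def using finite_mesh ne cover by (intro Max.boundedI) (auto intro!: diameter_subset b)
  obtain K where K: "K \<in> \<T>" using ne by blast
  have "0 \<le> diameter K" using simplex_verts(5)[OF simplices[OF K]] by (intro diameter_ge_0 compact_imp_bounded)
  then show "0 \<le> mesh_size \<T>" using le[OF K] by linarith
qed

text \<open>By the equation, the residual of the discrete pair is, up to sign, the contraction of
  \<open>A\<close> with the Jacobian of the error, and grad u cancels in the second term. So the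
  energy of the error is the functional at the discrete solution. The interpolant of u is admissible
  because it vanishes at the boundary vertices.\<close>

lemma lsfem_error:
  fixes A :: "real ^ 'n \<Rightarrow> real ^ 'n ^ 'n"
  assumes d: "CARD('n) \<le> 3" and A: "A \<in> Linf_matrix \<Omega>"
    and \<beta>: "\<And>i j. AE x in lebesgue_on \<Omega>. \<bar>A x $ i $ j\<bar> \<le> \<beta>" "\<beta> \<ge> 0"
    and \<gamma>: "\<gamma> > 0" "\<And>K. K \<in> \<T> \<Longrightarrow> diameter K \<le> \<gamma> * insphere_diameter K"
    and sol: "is_solution \<Omega> A f u" and u: "u \<in> Hk 3 \<Omega>" and fem: "L2_LSFEM_solution \<Omega> A \<T> f u\<^sub>h \<sigma>\<^sub>h"
  shows "(triple_norm0 \<Omega> A (\<lambda>x. u x - u\<^sub>h x) (\<lambda>x. weak_grad \<Omega> u x - \<sigma>\<^sub>h x))\<^sup>2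
    \<le> error_const \<beta> \<gamma> * ((mesh_size \<T>)\<^sup>2 * (Hk_norm 3 \<Omega> u)\<^sup>2)"
proof -
  define H where "H = mesh_size \<T>"
  define N where "N = Hk_norm 3 \<Omega> u"
  define D where "D = diameter (closure \<Omega>)"
  define n where "n = real CARD('n)"
  define e where "e = (n + 1)\<^sup>2 * (8 * n\<^sup>2 * 2 ^ CARD('n)) * n\<^sup>2"
  define E0 where "E0 = e * D\<^sup>2 * (H\<^sup>2 * N\<^sup>2)"
  define E1 where "E1 = e * (64 * \<gamma>\<^sup>2) * (H\<^sup>2 * N\<^sup>2)"
  have e: "e \<ge> 0" by (simp add: e_def n_def)
  have E: "E0 \<ge> 0" "E1 \<ge> 0" unfolding E0_def E1_def using e by auto
  have b: "\<Omega> \<in> sets borel" using open_dom by simp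
  obtain W where W0: "zero_rep \<Omega> u (W {#})" and W': "\<forall>\<alpha>. size \<alpha> \<le> 3 \<longrightarrow> weak_pair \<Omega> \<alpha> (W {#}) (W \<alpha>)"
    using Hk_weak_pairs[OF open_dom u] by (elim exE conjE)
  have W: "weak_pair \<Omega> \<alpha> (W {#}) (W \<alpha>)" if "size \<alpha> \<le> 3" for \<alpha> using W' that by simp
  have Wm: "W \<alpha> \<in> borel_measurable borel" "sqn (W \<alpha>) < \<infinity>" "x \<notin> \<Omega> \<Longrightarrow> W \<alpha> x = 0" "sqn (W \<alpha>) \<le> ennreal (N\<^sup>2)" if "size \<alpha> \<le> 3" for \<alpha> x
    using W[OF that] sqn_le_Hk_norm[OF open_dom W[OF that] W0 that] by (simp_all add: weak_pair_def N_def)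
  have W1: "weak_pair \<Omega> {#i#} (W {#}) (W {#i#})" for i by (rule W) simp
  have h0: "h2_data \<Omega> (W {#}) (\<lambda>i. W {#i#}) (\<lambda>i j. W {#i, j#})"
    using h2_data_weak_pairs[where k = 3 and \<Omega> = \<Omega> and W = W and ?is = "[]"] W by simp
  have h1: "h2_data \<Omega> (W {#i#}) (\<lambda>j. W {#i, j#}) (\<lambda>j k. W {#i, j, k#})" for i
    using h2_data_weak_pairs[where k = 3 and \<Omega> = \<Omega> and W = W and ?is = "[i]"] W by (simp add: add_mset_commute)
  have WJ: "weak_pair \<Omega> {#j#} (W {#i#}) (W {#i, j#})" for i j
    by (rule weak_pair_singletonI(1)) (use h1[of i] Wm in \<open>auto simp: h2_data_def\<close>)
  have z0: "\<And>x. x \<notin> \<Omega> \<Longrightarrow> W {#} x = 0" and z1: "\<And>i x. x \<notin> \<Omega> \<Longrightarrow> W {#i#} x = 0" and z2: "\<And>i j x. x \<notin> \<Omega> \<Longrightarrow> W {#i, j#} x = 0"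
    by (simp_all add: Wm(3))
  have S: "ennreal ((real CARD('n) + 1)\<^sup>2 * (8 * (CARD('n))\<^sup>2 * 2 ^ CARD('n)) * X) * (\<Sum>i\<in>UNIV. \<Sum>j\<in>UNIV. sqn (g i j)) \<le> ennreal (e * X * N\<^sup>2)"
    if "\<And>i j. sqn (g i j) \<le> ennreal (N\<^sup>2)" "X \<ge> 0" for g :: "'n \<Rightarrow> 'n \<Rightarrow> real ^ 'n \<Rightarrow> real" and X
  proof -
    have "(\<Sum>i\<in>UNIV. \<Sum>j\<in>UNIV. sqn (g i j)) \<le> (\<Sum>i\<in>(UNIV :: 'n set). \<Sum>j\<in>(UNIV :: 'n set). ennreal (N\<^sup>2))"
      by (intro sum_mono that(1))
    also have "\<dots> = ennreal (\<Sum>i\<in>(UNIV :: 'n set). \<Sum>j\<in>(UNIV :: 'n set). N\<^sup>2)"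
      by (simp only: sum_ennreal sum_nonneg zero_le_power2)
    also have "\<dots> = ennreal (n\<^sup>2 * N\<^sup>2)" by (simp add: n_def power2_eq_square mult.assoc)
    finally have "ennreal ((n + 1)\<^sup>2 * (8 * n\<^sup>2 * 2 ^ CARD('n)) * X) * (\<Sum>i\<in>UNIV. \<Sum>j\<in>UNIV. sqn (g i j))
        \<le> ennreal ((n + 1)\<^sup>2 * (8 * n\<^sup>2 * 2 ^ CARD('n)) * X) * ennreal (n\<^sup>2 * N\<^sup>2)" by (intro mult_left_mono) auto
    also have "\<dots> = ennreal (((n + 1)\<^sup>2 * (8 * n\<^sup>2 * 2 ^ CARD('n)) * X) * (n\<^sup>2 * N\<^sup>2))"
      using that(2) by (intro ennreal_mult[symmetric]) (auto simp: n_def)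
    also have "((n + 1)\<^sup>2 * (8 * n\<^sup>2 * 2 ^ CARD('n)) * X) * (n\<^sup>2 * N\<^sup>2) = e * X * N\<^sup>2" by (simp add: e_def ac_simps)
    finally show ?thesis by (simp add: n_def)
  qed
  note Hb = mesh_size_bounds(1)[folded H_def] mesh_size_bounds(2)[folded H_def D_def]
  have "\<exists>c b u. pw_agree c b \<and>
    (\<forall>K\<in>\<T>. continuous_on K (u K) \<and> (AE x in lborel. x \<in> K \<longrightarrow> u K x = W {#} x) \<and> (\<forall>z\<in>verts K. u K z = c K + b K \<bullet> z)) \<and>
    sqn (\<lambda>x. W {#} x - pw c b x) \<le> ennreal ((real CARD('n) + 1)\<^sup>2 * (8 * (CARD('n))\<^sup>2 * 2 ^ CARD('n)) * (D\<^sup>2 * H\<^sup>2)) * (\<Sum>i\<in>UNIV. \<Sum>j\<in>UNIV. sqn (W {#i, j#})) \<and>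
    (\<forall>i. sqn (\<lambda>x. W {#i#} x - pw_grad b i x) \<le> ennreal ((real CARD('n) + 1)\<^sup>2 * (8 * (CARD('n))\<^sup>2 * 2 ^ CARD('n)) * (64 * \<gamma>\<^sup>2 * H\<^sup>2)) * (\<Sum>i\<in>UNIV. \<Sum>j\<in>UNIV. sqn (W {#i, j#})))"
    by (rule interpolation_exists[OF h0 d z0 z1 \<gamma> Hb])
  then obtain c b\<^sub>0 U where ag: "pw_agree c b\<^sub>0"
    and U: "\<forall>K\<in>\<T>. continuous_on K (U K) \<and> (AE x in lborel. x \<in> K \<longrightarrow> U K x = W {#} x) \<and> (\<forall>z\<in>verts K. U K z = c K + b\<^sub>0 K \<bullet> z)"
    and grad: "\<forall>i. sqn (\<lambda>x. W {#i#} x - pw_grad b\<^sub>0 i x) \<le> ennreal ((real CARD('n) + 1)\<^sup>2 * (8 * (CARD('n))\<^sup>2 * 2 ^ CARD('n)) * (64 * \<gamma>\<^sup>2 * H\<^sup>2)) * (\<Sum>i\<in>UNIV. \<Sum>j\<in>UNIV. sqn (W {#i, j#}))"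
    by (elim exE conjE)
  have gradE: "sqn (\<lambda>x. W {#i#} x - pw_grad b\<^sub>0 i x) \<le> ennreal E1" for i
    using order_trans[OF spec[OF grad, of i] S[of "\<lambda>i j. W {#i, j#}" "64 * \<gamma>\<^sup>2 * H\<^sup>2"]] Wm(4) by (simp add: E1_def ac_simps)
  have bz: "c K + b\<^sub>0 K \<bullet> x = 0" if K: "K \<in> \<T>" and x: "x \<in> K" "x \<notin> \<Omega>" for K x
  proof (rule interpolant_zero_boundary[OF K _ x])
    fix z assume z: "z \<in> verts K" "z \<notin> \<Omega>"
    note UK = bspec[OF U K]
    have zK: "z \<in> K" using z(1) by (simp add: verts_def extreme_point_of_def)
    have u0: "u \<in> H1_0 \<Omega>" using sol by (simp add: is_solution_def V_space_def)
    have "U K z = 0"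
      by (rule boundary_values_zero[OF h0 h1 d z0 z1 H1_0_approximation[OF open_dom u0 W0 W1] K conjunct1[OF UK] conjunct1[OF conjunct2[OF UK]] zK z(2)])
    then show "c K + b\<^sub>0 K \<bullet> z = 0" using UK z(1) by auto
  qed
  have "\<exists>p. pw_agree (fst p) (snd p) \<and> sqn (\<lambda>x. W {#i#} x - pw (fst p) (snd p) x) \<le> ennreal E0 \<and>
      (\<forall>j. sqn (\<lambda>x. W {#i, j#} x - pw_grad (snd p) j x) \<le> ennreal E1)" for i
  proof -
    have "\<exists>c b u. pw_agree c b \<and>
      (\<forall>K\<in>\<T>. continuous_on K (u K) \<and> (AE x in lborel. x \<in> K \<longrightarrow> u K x = W {#i#} x) \<and> (\<forall>z\<in>verts K. u K z = c K + b K \<bullet> z)) \<and>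
      sqn (\<lambda>x. W {#i#} x - pw c b x) \<le> ennreal ((real CARD('n) + 1)\<^sup>2 * (8 * (CARD('n))\<^sup>2 * 2 ^ CARD('n)) * (D\<^sup>2 * H\<^sup>2)) * (\<Sum>j\<in>UNIV. \<Sum>k\<in>UNIV. sqn (W {#i, j, k#})) \<and>
      (\<forall>j. sqn (\<lambda>x. W {#i, j#} x - pw_grad b j x) \<le> ennreal ((real CARD('n) + 1)\<^sup>2 * (8 * (CARD('n))\<^sup>2 * 2 ^ CARD('n)) * (64 * \<gamma>\<^sup>2 * H\<^sup>2)) * (\<Sum>j\<in>UNIV. \<Sum>k\<in>UNIV. sqn (W {#i, j, k#})))"
      by (rule interpolation_exists[OF h1 d z1 z2 \<gamma> Hb])
    then obtain c b where cb: "pw_agree c b"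
      "sqn (\<lambda>x. W {#i#} x - pw c b x) \<le> ennreal ((real CARD('n) + 1)\<^sup>2 * (8 * (CARD('n))\<^sup>2 * 2 ^ CARD('n)) * (D\<^sup>2 * H\<^sup>2)) * (\<Sum>j\<in>UNIV. \<Sum>k\<in>UNIV. sqn (W {#i, j, k#}))"
      "\<forall>j. sqn (\<lambda>x. W {#i, j#} x - pw_grad b j x) \<le> ennreal ((real CARD('n) + 1)\<^sup>2 * (8 * (CARD('n))\<^sup>2 * 2 ^ CARD('n)) * (64 * \<gamma>\<^sup>2 * H\<^sup>2)) * (\<Sum>j\<in>UNIV. \<Sum>k\<in>UNIV. sqn (W {#i, j, k#}))"
      by (elim exE conjE)
    have "sqn (\<lambda>x. W {#i#} x - pw c b x) \<le> ennreal E0"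
      using order_trans[OF cb(2) S[of "\<lambda>j k. W {#i, j, k#}" "D\<^sup>2 * H\<^sup>2"]] Wm(4) by (simp add: E0_def ac_simps)
    moreover have "sqn (\<lambda>x. W {#i, j#} x - pw_grad b j x) \<le> ennreal E1" for j
      using order_trans[OF spec[OF cb(3), of j] S[of "\<lambda>j k. W {#i, j, k#}" "64 * \<gamma>\<^sup>2 * H\<^sup>2"]] Wm(4) by (simp add: E1_def ac_simps)
    ultimately show ?thesis using cb(1) by (intro exI[of _ "(c, b)"]) simp
  qed
  then have "\<forall>i. \<exists>p. pw_agree (fst p) (snd p) \<and> sqn (\<lambda>x. W {#i#} x - pw (fst p) (snd p) x) \<le> ennreal E0 \<and>
      (\<forall>j. sqn (\<lambda>x. W {#i, j#} x - pw_grad (snd p) j x) \<le> ennreal E1)" by (rule allI)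
  from choice[OF this] obtain P where P: "\<forall>i. pw_agree (fst (P i)) (snd (P i)) \<and> sqn (\<lambda>x. W {#i#} x - pw (fst (P i)) (snd (P i)) x) \<le> ennreal E0 \<and>
      (\<forall>j. sqn (\<lambda>x. W {#i, j#} x - pw_grad (snd (P i)) j x) \<le> ennreal E1)" by (elim exE)
  define T where "T i = pw (fst (P i)) (snd (P i))" for i
  define T' where "T' i j = pw_grad (snd (P i)) j" for i j
  have agP: "pw_agree (fst (P i)) (snd (P i))" and TE: "sqn (\<lambda>x. W {#i#} x - T i x) \<le> ennreal E0"
    and TE': "sqn (\<lambda>x. W {#i, j#} x - T' i j x) \<le> ennreal E1" for i j
    using P by (simp_all add: T_def T'_def)
  have Tp: "weak_pair \<Omega> {#j#} (T i) (T' i j)" and Tz: "zero_rep \<Omega> (T i) (T i)" for i j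
    unfolding T_def T'_def by (rule pw_weak_pair[OF agP])+
  have Tm: "T i \<in> borel_measurable borel" "T' i j \<in> borel_measurable borel" for i j
    using Tp[of j i] by (auto simp: weak_pair_def)
  define v\<^sub>h where "v\<^sub>h = pw c b\<^sub>0"
  define \<tau>\<^sub>h where "\<tau>\<^sub>h x = (\<chi> i. T i x)" for x
  have v_S: "v\<^sub>h \<in> S1_0 \<Omega> \<T>" unfolding v\<^sub>h_def by (rule pw_S1_0[OF ag bz])
  have \<tau>_S: "\<tau>\<^sub>h \<in> S1_vec \<Omega> \<T>" unfolding S1_vec_def \<tau>\<^sub>h_def T_def using pw_S1[OF agP] by simp

  have "\<forall>i j. \<exists>a. zero_rep \<Omega> (\<lambda>x. A x $ i $ j) a"
  proof (intro allI)
    fix i j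
    have "(\<lambda>x. A x $ i $ j) \<in> borel_measurable (lebesgue_on \<Omega>)" using A by (simp add: Linf_matrix_def)
    then show "\<exists>a. zero_rep \<Omega> (\<lambda>x. A x $ i $ j) a" using zero_rep_exists b by metis
  qed
  then obtain a where a: "\<And>i j. zero_rep \<Omega> (\<lambda>x. A x $ i $ j) (a i j)" by metis
  have am: "a i j \<in> borel_measurable borel" for i j using a[of i j] by (simp add: zero_rep_def)
  have a\<beta>: "AE x in lborel. \<bar>a i j x\<bar> \<le> \<beta>" for i j
  proof -
    have "AE x in lborel. x \<in> \<Omega> \<longrightarrow> \<bar>A x $ i $ j\<bar> \<le> \<beta>" using \<beta>(1)[of i j] unfolding AE_lebesgue_on[OF b] .
    moreover have "AE x in lborel. x \<in> \<Omega> \<longrightarrow> A x $ i $ j = a i j x" using a[of i j] by (simp add: zero_rep_def)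
    ultimately show ?thesis
    proof eventually_elim
      case (elim x)
      then show ?case using a[of i j] \<beta>(2) by (cases "x \<in> \<Omega>") (auto simp: zero_rep_def)
    qed
  qed
  \<comment> \<open>The equation on the level of representatives: \<open>F\<close> expresses the
    right-hand side by second derivatives of u, ready to be combined with discrete
    Jacobians.\<close>
  define F where "F x = - (\<Sum>i\<in>UNIV. \<Sum>j\<in>UNIV. a i j x * W {#i, j#} x)" for x
  have F: "zero_rep \<Omega> f F"
  proof -
    have "zero_rep \<Omega> (\<lambda>x. weak_hessian \<Omega> u x $ i $ j) (W {#i, j#})" for i j
      unfolding weak_hessian_def using weak_pair_has_weak_deriv(2)[OF open_dom W W0, of "{#i, j#}"] by simp
    note C = zero_rep_contract[OF a this]
    then have 1: "AE x in lborel. x \<in> \<Omega> \<longrightarrow> A x \<Zcolon> weak_hessian \<Omega> u x = (\<Sum>i\<in>UNIV. \<Sum>j\<in>UNIV. a i j x * W {#i, j#} x)"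
      by (simp add: zero_rep_def)
    have 2: "AE x in lborel. x \<in> \<Omega> \<longrightarrow> - (A x \<Zcolon> weak_hessian \<Omega> u x) = f x"
      using sol unfolding is_solution_def AE_lebesgue_on[OF b] by blast
    have "AE x in lborel. x \<in> \<Omega> \<longrightarrow> f x = F x"
      using 1 2 by eventually_elim (auto simp: F_def)
    moreover have "F \<in> borel_measurable borel"
      unfolding F_def[abs_def] using C by (intro borel_measurable_uminus) (simp add: zero_rep_def)
    ultimately show ?thesis using C by (simp add: zero_rep_def F_def)
  qed

  have min: "u\<^sub>h \<in> S1_0 \<Omega> \<T>" "\<sigma>\<^sub>h \<in> S1_vec \<Omega> \<T>" "J0 \<Omega> A f u\<^sub>h \<sigma>\<^sub>h \<le> J0 \<Omega> A f v\<^sub>h \<tau>\<^sub>h"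
    using fem v_S \<tau>_S unfolding L2_LSFEM_solution_def is_arg_min_def by (auto simp: not_less)
  have "u\<^sub>h \<in> Hk 1 \<Omega>" using min(1) by (simp add: S1_0_def S1_def)
  from Hk_weak_pairs[OF open_dom this] obtain V where V0: "zero_rep \<Omega> u\<^sub>h (V {#})" and V': "\<forall>\<alpha>. size \<alpha> \<le> 1 \<longrightarrow> weak_pair \<Omega> \<alpha> (V {#}) (V \<alpha>)"
    by (elim exE conjE)
  have V1: "weak_pair \<Omega> {#i#} (V {#}) (V {#i#})" for i using V' by simp
  have "\<forall>i. \<exists>R. zero_rep \<Omega> (\<lambda>x. \<sigma>\<^sub>h x $ i) (R {#}) \<and> (\<forall>\<alpha>. size \<alpha> \<le> 1 \<longrightarrow> weak_pair \<Omega> \<alpha> (R {#}) (R \<alpha>))"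
  proof
    fix i
    have "(\<lambda>x. \<sigma>\<^sub>h x $ i) \<in> Hk 1 \<Omega>" using min(2) by (simp add: S1_vec_def S1_def)
    then show "\<exists>R. zero_rep \<Omega> (\<lambda>x. \<sigma>\<^sub>h x $ i) (R {#}) \<and> (\<forall>\<alpha>. size \<alpha> \<le> 1 \<longrightarrow> weak_pair \<Omega> \<alpha> (R {#}) (R \<alpha>))"
      by (rule Hk_weak_pairs[OF open_dom])
  qed
  from choice[OF this] obtain R where R: "\<forall>i. zero_rep \<Omega> (\<lambda>x. \<sigma>\<^sub>h x $ i) (R i {#}) \<and> (\<forall>\<alpha>. size \<alpha> \<le> 1 \<longrightarrow> weak_pair \<Omega> \<alpha> (R i {#}) (R i \<alpha>))"
    by (elim exE)
  have R0: "zero_rep \<Omega> (\<lambda>x. \<sigma>\<^sub>h x $ i) (R i {#})" and R1: "weak_pair \<Omega> {#j#} (R i {#}) (R i {#j#})" for i j using R by simp_all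

  have "(triple_norm0 \<Omega> A (\<lambda>x. u x - u\<^sub>h x) (\<lambda>x. weak_grad \<Omega> u x - \<sigma>\<^sub>h x))\<^sup>2
      = enn2real (sqn (\<lambda>x. \<Sum>i\<in>UNIV. \<Sum>j\<in>UNIV. a i j x * (W {#i, j#} x - R i {#j#} x)))
        + (\<Sum>i\<in>UNIV. enn2real (sqn (\<lambda>x. (W {#i#} x - R i {#} x) - (W {#i#} x - V {#i#} x))))"
  proof (rule energy_reps(2)[OF open_dom a zero_rep_diff[OF W0 V0] weak_pair_diff[OF W1 V1] _ weak_pair_diff[OF WJ R1]])
    show "zero_rep \<Omega> (\<lambda>x. (weak_grad \<Omega> u x - \<sigma>\<^sub>h x) $ i) (\<lambda>x. W {#i#} x - R i {#} x)" for i
      unfolding weak_grad_def using zero_rep_diff[OF weak_pair_has_weak_deriv(2)[OF open_dom W1 W0] R0] by simp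
  qed
  \<comment> \<open>Here the second derivatives of u are traded for the right-hand side, which turns
    the error into the residual of the discrete solution.\<close>
  also have "(\<lambda>x. \<Sum>i\<in>UNIV. \<Sum>j\<in>UNIV. a i j x * (W {#i, j#} x - R i {#j#} x)) = (\<lambda>x. - (F x + (\<Sum>i\<in>UNIV. \<Sum>j\<in>UNIV. a i j x * R i {#j#} x)))"
    by (simp add: F_def right_diff_distrib sum_subtractf)
  also have "sqn (\<lambda>x. - (F x + (\<Sum>i\<in>UNIV. \<Sum>j\<in>UNIV. a i j x * R i {#j#} x))) = sqn (\<lambda>x. F x + (\<Sum>i\<in>UNIV. \<Sum>j\<in>UNIV. a i j x * R i {#j#} x))"
    by (simp only: sqn_def power2_minus)
  also have "(\<lambda>i. enn2real (sqn (\<lambda>x. (W {#i#} x - R i {#} x) - (W {#i#} x - V {#i#} x)))) = (\<lambda>i. enn2real (sqn (\<lambda>x. R i {#} x - V {#i#} x)))"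
    by (simp add: sqn_minus_commute[of "R _ {#}"])
  also have "enn2real (sqn (\<lambda>x. F x + (\<Sum>i\<in>UNIV. \<Sum>j\<in>UNIV. a i j x * R i {#j#} x))) + (\<Sum>i\<in>UNIV. enn2real (sqn (\<lambda>x. R i {#} x - V {#i#} x)))
      = J0 \<Omega> A f u\<^sub>h \<sigma>\<^sub>h"
    by (rule energy_reps(1)[OF open_dom a V0 V1 R0 R1 F, symmetric])
  also note min(3)
  also have "J0 \<Omega> A f v\<^sub>h \<tau>\<^sub>h = enn2real (sqn (\<lambda>x. F x + (\<Sum>i\<in>UNIV. \<Sum>j\<in>UNIV. a i j x * T' i j x))) + (\<Sum>i\<in>UNIV. enn2real (sqn (\<lambda>x. T i x - pw_grad b\<^sub>0 i x)))"
    unfolding v\<^sub>h_def by (rule energy_reps(1)[OF open_dom a pw_weak_pair(3,1)[OF ag] _ Tp F]) (simp add: \<tau>\<^sub>h_def Tz)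
  also have "\<dots> \<le> n\<^sup>2 * (n\<^sup>2 * (\<beta>\<^sup>2 * E1)) + (\<Sum>i\<in>(UNIV :: 'n set). 2 * E0 + 2 * E1)"
  proof (intro add_mono sum_mono)
    have "(\<lambda>x. F x + (\<Sum>i\<in>UNIV. \<Sum>j\<in>UNIV. a i j x * T' i j x)) = (\<lambda>x. - (\<Sum>i\<in>UNIV. \<Sum>j\<in>UNIV. a i j x * (W {#i, j#} x - T' i j x)))"
      by (simp add: F_def right_diff_distrib sum_subtractf)
    then have "sqn (\<lambda>x. F x + (\<Sum>i\<in>UNIV. \<Sum>j\<in>UNIV. a i j x * T' i j x)) = sqn (\<lambda>x. \<Sum>i\<in>UNIV. \<Sum>j\<in>UNIV. a i j x * (W {#i, j#} x - T' i j x))"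
      by (simp only: sqn_def power2_minus)
    also have "\<dots> \<le> ennreal (n\<^sup>2 * (n\<^sup>2 * (\<beta>\<^sup>2 * E1)))"
      unfolding n_def
      by (intro sqn_sum_bound sqn_bounded_coefficient[OF a\<beta>] TE' borel_measurable_sum borel_measurable_times borel_measurable_diff am Wm(1) Tm)
        (use E in auto)
    finally show "enn2real (sqn (\<lambda>x. F x + (\<Sum>i\<in>UNIV. \<Sum>j\<in>UNIV. a i j x * T' i j x))) \<le> n\<^sup>2 * (n\<^sup>2 * (\<beta>\<^sup>2 * E1))"
      using E by (intro enn2real_leI) auto
  next
    fix i
    \<comment> \<open>Both functions approximate the same component of grad u, one as its
      interpolant, the other as a derivative of the interpolant of u. That component is inserted
      between them.\<close>
    have "sqn (\<lambda>x. T i x - pw_grad b\<^sub>0 i x) \<le> ennreal (2 * E0 + 2 * E1)"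
      by (rule sqn_triangle_bound[OF Tm(1) Wm(1) pw_grad_borel TE gradE E]) simp
    then show "enn2real (sqn (\<lambda>x. T i x - pw_grad b\<^sub>0 i x)) \<le> 2 * E0 + 2 * E1" using E by (intro enn2real_leI) auto
  qed
  also have "\<dots> = error_const \<beta> \<gamma> * ((mesh_size \<T>)\<^sup>2 * (Hk_norm 3 \<Omega> u)\<^sup>2)"
    unfolding error_const_def Let_def E0_def E1_def e_def D_def n_def H_def N_def by (simp add: algebra_simps)
  finally show ?thesis .
qed

end

theorem theorem3p4:
  fixes \<Omega> :: "(real ^ 'n) set"
    and A :: "real ^ 'n \<Rightarrow> real ^ 'n ^ 'n"
    and \<F> :: "(real ^ 'n) set set set"
  assumes dim: "CARD('n) \<in> {2, 3}"
    and domain: "open_polytope \<Omega>"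
    and coeff: "A \<in> Linf_matrix \<Omega>"
    and meshes: "\<forall>\<T>\<in>\<F>. simplicial_mesh \<Omega> \<T>"
    and regular: "shape_regular \<F>"
    and solvable: "uniquely_solvable \<Omega> A"
  shows "\<exists>C>0. \<forall>f \<in> L2 \<Omega>. \<forall>u. is_solution \<Omega> A f u \<and> u \<in> Hk 3 \<Omega> \<longrightarrow>
           (\<forall>\<T>\<in>\<F>. \<forall>u\<^sub>h \<sigma>\<^sub>h. L2_LSFEM_solution \<Omega> A \<T> f u\<^sub>h \<sigma>\<^sub>h \<longrightarrow>
              triple_norm0 \<Omega> A (\<lambda>x. u x - u\<^sub>h x) (\<lambda>x. weak_grad \<Omega> u x - \<sigma>\<^sub>h x)
                \<le> C * mesh_size \<T> * Hk_norm 3 \<Omega> u)"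
proof -
  have d: "CARD('n) \<le> 3" using dim by auto
  obtain \<gamma> where \<gamma>: "\<gamma> > 0" "\<And>\<T> K. \<T> \<in> \<F> \<Longrightarrow> K \<in> \<T> \<Longrightarrow> diameter K \<le> \<gamma> * insphere_diameter K"
    using regular unfolding shape_regular_def by blast
  have "\<forall>p. \<exists>b. AE x in lebesgue_on \<Omega>. \<bar>A x $ fst p $ snd p\<bar> \<le> b" using coeff by (simp add: Linf_matrix_def)
  from choice[OF this] obtain B where B: "\<forall>p. AE x in lebesgue_on \<Omega>. \<bar>A x $ fst p $ snd p\<bar> \<le> B p" by (elim exE)
  define \<beta> where "\<beta> = (\<Sum>p\<in>UNIV. \<bar>B p\<bar>)"
  have \<beta>0: "\<beta> \<ge> 0" by (simp add: \<beta>_def sum_nonneg)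
  have \<beta>: "AE x in lebesgue_on \<Omega>. \<bar>A x $ i $ j\<bar> \<le> \<beta>" for i j
    using spec[OF B, of "(i, j)"]
  proof eventually_elim
    case (elim x)
    have "\<bar>B (i, j)\<bar> \<le> \<beta>" unfolding \<beta>_def by (rule member_le_sum) auto
    then show ?case using elim by simp
  qed
  \<comment> \<open>\<open>error_const\<close> depends on \<Omega>, \<beta> and \<gamma> but on no
    mesh, so \<open>C\<close> is fixed before a mesh is chosen. The absolute value spares a sign
    argument, and adding one makes \<open>C\<close> positive.\<close>
  define C where "C = sqrt (\<bar>mesh.error_const \<Omega> \<beta> \<gamma>\<bar>) + 1"
  have "triple_norm0 \<Omega> A (\<lambda>x. u x - u\<^sub>h x) (\<lambda>x. weak_grad \<Omega> u x - \<sigma>\<^sub>h x) \<le> C * mesh_size \<T> * Hk_norm 3 \<Omega> u"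
    if "is_solution \<Omega> A f u" "u \<in> Hk 3 \<Omega>" "\<T> \<in> \<F>" "L2_LSFEM_solution \<Omega> A \<T> f u\<^sub>h \<sigma>\<^sub>h" for f u \<T> u\<^sub>h \<sigma>\<^sub>h
  proof -
    interpret mesh \<Omega> \<T> using domain meshes that(3) by (simp add: mesh_def)
    have HN: "0 \<le> mesh_size \<T> * Hk_norm 3 \<Omega> u" by (intro mult_nonneg_nonneg mesh_size_bounds(3) Hk_norm_nonneg)
    have "(triple_norm0 \<Omega> A (\<lambda>x. u x - u\<^sub>h x) (\<lambda>x. weak_grad \<Omega> u x - \<sigma>\<^sub>h x))\<^sup>2
        \<le> error_const \<beta> \<gamma> * ((mesh_size \<T>)\<^sup>2 * (Hk_norm 3 \<Omega> u)\<^sup>2)"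
      by (rule lsfem_error[OF d coeff \<beta> \<beta>0 \<gamma>(1) \<gamma>(2)[OF that(3)] that(1,2,4)])
    also have "\<dots> \<le> \<bar>error_const \<beta> \<gamma>\<bar> * ((mesh_size \<T>)\<^sup>2 * (Hk_norm 3 \<Omega> u)\<^sup>2)" by (intro mult_right_mono) auto
    also have "\<dots> = (sqrt \<bar>error_const \<beta> \<gamma>\<bar> * (mesh_size \<T> * Hk_norm 3 \<Omega> u))\<^sup>2" by (simp add: power_mult_distrib)
    finally have "triple_norm0 \<Omega> A (\<lambda>x. u x - u\<^sub>h x) (\<lambda>x. weak_grad \<Omega> u x - \<sigma>\<^sub>h x) \<le> sqrt \<bar>error_const \<beta> \<gamma>\<bar> * (mesh_size \<T> * Hk_norm 3 \<Omega> u)"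
      by (rule power2_le_imp_le) (use HN in simp)
    also have "\<dots> \<le> C * (mesh_size \<T> * Hk_norm 3 \<Omega> u)" unfolding C_def using HN by (intro mult_right_mono) auto
    finally show ?thesis by (simp add: mult.assoc)
  qed
  moreover have "C > 0" by (simp add: C_def add_nonneg_pos)
  ultimately show ?thesis by blast
qed

end
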